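(* Let $x_0\in(0,\infty)$ be such that $g(x_0)>0$, and let $\varepsilon_n=\sqrt{n^{-1}\log n}$. Let $\hat F_n$ be either $F_n$ (for all $n$) or $\tilde F_n$ (for all $n$). Suppose that: (a) $\sup_{t\in\mathbb R}|G_n(t)-G(t)|=O(\varepsilon_n)$; (b$'$) $\varepsilon_n^{-2}\{H_n(x_0+\varepsilon_nt)-H_n(x_0)-\hat F_n(x_0)\varepsilon_nt\}\to\frac12t^2f(x_0)$ as $n\to\infty$, uniformly on compact sets of $t\in\mathbb R$; (c$'$) for each $\varepsilon>0$, $$\left|H_n(x_0+\beta)-H_n(x_0)-\beta\hat F_n(x_0)-\tfrac12\beta^2f(x_0)\right|\le\varepsilon\beta^2+o(\beta^2)+O(\varepsilon_n^2)$$ for all large $n$, uniformly in $\beta$ varying over a neighborhood of zero (here $o(\beta^2)$ is as $\beta\to0$, uniformly in $n$, and $O(\varepsilon_n^2)$ is as $n\to\infty$, uniformly in $\beta$). Then the distribution of $$\Lambda_n=\frac{\check F_n(x_0)-\hat F_n(x_0)}{\varepsilon_n}$$ converges weakly to that of $W\stackrel{d}{=}\operatorname{GCM}_{\mathbb R}[\mathbb X]'(0)$, where $W\sim N\left(0,\frac2{\pi^2}x_0g(x_0)\right)$ and $\mathbb X(t)=tW+\frac12t^2f(x_0)$, $t\in\mathbb R$.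
   Context: Model: $\mathbf X=(X_1,X_2,X_3)$ is a random vector in $\mathbb R^3$ with a density of the form $\rho(x_1^2+x_2^2+x_3^2)$. $Y=X_1^2+X_2^2$ has distribution function $G$ with density $g(y)=\pi\int_y^\infty\frac{\rho(z)}{\sqrt{z-y}}\,dz$, and $V(y)=\int_y^\infty\frac{g(u)}{\sqrt{u-y}}\,du=\pi^2\int_y^\infty\rho(z)\,dz$. $Z=X_1^2+X_2^2+X_3^2$ has density $f(z)=2\pi\sqrt z\rho(z)$ and distribution function $F(x)=1+\frac2\pi\int_x^\infty\sqrt z\,dV(z)$. Triangular array: $G_n$, $n\ge1$, are (nonrandom) distribution functions on $[0,\infty)$; $T_1,T_2,\ldots$ are i.i.d. Uniform$(0,1)$; $Y_{n,i}=G_n^{-1}(T_i)$, $1\le i\le n$, where $G_n^{-1}(u)=\inf\{x:G_n(x)\ge u\}$ (so $Y_{n,1},\ldots,Y_{n,n}$ are i.i.d. with distribution function $G_n$). Define $$V_n(y)=\int_y^\infty\frac{dG_n(u)}{\sqrt{u-y}},\quad V_n^{\#}(y)=\frac1n\sum_{i:\,Y_{n,i}>y}\frac1{\sqrt{Y_{n,i}-y}},\quad U_n(x)=\int_0^xV_n(y)\,dy.$$ $\tilde V_n$ is the right derivative of the least concave majorant of $U_n$ on $[0,\infty)$. $F_n$, $F_n^{\#}$, $\tilde F_n$ are obtained by replacing $V$ in $1+\frac2\pi\int_x^\infty\sqrt z\,dV(z)$ by $V_n$, $V_n^{\#}$, $\tilde V_n$ respectively, the integral being understood through integration by parts: for $D\in\{V_n,V_n^{\#},\tilde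 V_n\}$, $$1+\frac2\pi\int_x^\infty\sqrt z\,dD(z):=1-\frac2\pi\sqrt x\,D(x)-\frac2\pi\int_x^\infty\frac{D(u)}{2\sqrt u}\,du.$$ Put $H_n(x)=\int_0^xF_n(z)\,dz$ and $H_n^{\#}(x)=\int_0^xF_n^{\#}(z)\,dz$. For an interval $I$ and a function $h$, $\operatorname{GCM}_I[h]$ is the greatest convex minorant of the restriction of $h$ to $I$, and $'$ applied to it denotes the right derivative. $\check F_n=\operatorname{GCM}_{[0,\infty)}[H_n^{\#}]'$ (the nondecreasing function closest to $F_n^{\#}$ in the least-squares sense).
   Formalization: The formal theorem additionally assumes f(x₀) > 0; without it the claim fails, e.g. for ρ supported in [2,3], x₀ = 1 and G_n = G, where (a), (b′), (c′) hold but Λ_n tends to 0. *)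

theory Defs
  imports "HOL-Probability.Probability" "HOL-Library.Landau_Symbols"
begin

definition right_deriv :: "(real \<Rightarrow> real) \<Rightarrow> real \<Rightarrow> real" where
  "right_deriv h x = Lim (at_right x) (\<lambda>y. (h y - h x) / (y - x))"

text \<open>
  The pointwise supremum of all convex minorants (infimum of all concave majorants) of the
  restriction of \<open>h\<close> to \<open>I\<close>.  It is the greatest one (least one) on \<open>I\<close> as soon as one exists;
  values outside \<open>I\<close> have no meaning.
\<close>

definition gcm :: "real set \<Rightarrow> (real \<Rightarrow> real) \<Rightarrow> real \<Rightarrow> real" where
  "gcm I h x = Sup {c x | c. convex_on I c \<and> (\<forall>y\<in>I. c y \<le> h y)}"

definition lcmaj :: "real set \<Rightarrow> (real \<Rightarrow> real) \<Rightarrow> real \<Rightarrow> real" where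
  "lcmaj I h x = Inf {c x | c. concave_on I c \<and> (\<forall>y\<in>I. h y \<le> c y)}"


text \<open>
  The densities of \<open>X\<^sub>1\<^sup>2 + X\<^sub>2\<^sup>2\<close> and \<open>X\<^sub>1\<^sup>2 + X\<^sub>2\<^sup>2 + X\<^sub>3\<^sup>2\<close> when \<open>(X\<^sub>1, X\<^sub>2, X\<^sub>3)\<close> has density
  \<open>\<rho> (x\<^sub>1\<^sup>2 + x\<^sub>2\<^sup>2 + x\<^sub>3\<^sup>2)\<close>.  These are the specific pointwise versions.  A divergent integral has
  the value 0 here, so positivity of \<open>proj_density \<rho> y\<close> includes its finiteness.
\<close>

definition proj_density :: "(real \<Rightarrow> real) \<Rightarrow> real \<Rightarrow> real" where
  "proj_density \<rho> y = pi * (LINT z:{y<..}|lborel. \<rho> z / sqrt (z - y))"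

definition radial_density :: "(real \<Rightarrow> real) \<Rightarrow> real \<Rightarrow> real" where
  "radial_density \<rho> z = 2 * pi * sqrt z * \<rho> z"


definition is_df_nonneg :: "(real \<Rightarrow> real) \<Rightarrow> bool" where
  "is_df_nonneg G \<longleftrightarrow>
     mono G \<and> (\<forall>x. continuous (at_right x) G) \<and> (\<forall>x<0. G x = 0) \<and> (G \<longlongrightarrow> 1) at_top"

definition quantile :: "(real \<Rightarrow> real) \<Rightarrow> real \<Rightarrow> real" where
  "quantile G u = Inf {x. u \<le> G x}"

text \<open>
  The integral over \<open>{y<..}\<close> against \<open>dG\<close>: an atom of \<open>G\<close> at \<open>y\<close> itself is left out, as in the
  empirical version \<open>V_emp\<close>.
\<close>

definition V_of :: "(real \<Rightarrow> real) \<Rightarrow> real \<Rightarrow> real" where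
  "V_of G y = (LINT u:{y<..}|interval_measure G. 1 / sqrt (u - y))"

definition U_of :: "(real \<Rightarrow> real) \<Rightarrow> real \<Rightarrow> real" where
  "U_of G x = (LINT y:{0..x}|lborel. V_of G y)"

definition V_tilde :: "(real \<Rightarrow> real) \<Rightarrow> real \<Rightarrow> real" where
  "V_tilde G = right_deriv (lcmaj {0..} (U_of G))"

definition V_emp :: "nat \<Rightarrow> (nat \<Rightarrow> real) \<Rightarrow> real \<Rightarrow> real" where
  "V_emp n Y y = (1 / real n) * (\<Sum>i | i \<in> {1..n} \<and> Y i > y. 1 / sqrt (Y i - y))"

text \<open>\<open>1 + (2/\<pi>) \<integral>\<^sub>x\<^sup>\<infinity> \<surd>z dD(z)\<close>, understood through integration by parts\<close>

definition F_functional :: "(real \<Rightarrow> real) \<Rightarrow> real \<Rightarrow> real" where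
  "F_functional D x =
     1 - 2 / pi * sqrt x * D x - 2 / pi * (LINT u:{x<..}|lborel. D u / (2 * sqrt u))"

definition F_of :: "(real \<Rightarrow> real) \<Rightarrow> real \<Rightarrow> real" where
  "F_of G = F_functional (V_of G)"

definition F_tilde :: "(real \<Rightarrow> real) \<Rightarrow> real \<Rightarrow> real" where
  "F_tilde G = F_functional (V_tilde G)"

definition F_emp :: "nat \<Rightarrow> (nat \<Rightarrow> real) \<Rightarrow> real \<Rightarrow> real" where
  "F_emp n Y = F_functional (V_emp n Y)"

definition H_of :: "(real \<Rightarrow> real) \<Rightarrow> real \<Rightarrow> real" where
  "H_of G x = (LINT z:{0..x}|lborel. F_of G z)"

definition H_emp :: "nat \<Rightarrow> (nat \<Rightarrow> real) \<Rightarrow> real \<Rightarrow> real" where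
  "H_emp n Y x = (LINT z:{0..x}|lborel. F_emp n Y z)"

definition F_check :: "nat \<Rightarrow> (nat \<Rightarrow> real) \<Rightarrow> real \<Rightarrow> real" where
  "F_check n Y = right_deriv (gcm {0..} (H_emp n Y))"

definition eps :: "nat \<Rightarrow> real" where
  "eps n = sqrt (ln (real n) / real n)"

end

theory Submission
  imports Defs "HOL-Real_Asymp.Real_Asymp"
begin

text \<open>
  Integrating \<open>F_functional\<close> over \<open>{0..x}\<close> turns it into a linear functional of the underlying law: both
  \<open>H_emp\<close> and \<open>H_of\<close> are averages of one explicit kernel \<open>ikern y x\<close>, over the sample and over \<open>dG\<^sub>n\<close>
  respectively (\<open>integral_F_functional\<close>). So \<open>H_emp - H_of\<close> is an empirical process indexed by \<open>x\<close>, and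
  the theorem is about the convex minorant of a smooth drift plus this noise.

  The size of the noise is decided by the increments \<open>ikern y (x0 + h) - ikern y x0\<close> as functions of \<open>y\<close>.
  For \<open>y\<close> slightly above \<open>x0\<close> they behave like \<open>- (2 / \<pi>) * sqrt x0 * h / sqrt (y - x0)\<close>, which just
  fails to be square integrable. Over \<open>x0 + a < y \<le> x0 + b\<close> its second moment is
  \<open>(4 / \<pi>\<^sup>2) * x0 * g x0 * h\<^sup>2 * ln (b / a)\<close>. For \<open>h\<close> of order \<open>eps n\<close>, the singular approximation is
  good between \<open>a\<close> of order \<open>1 / sqrt n\<close> and \<open>b\<close> of order 1, up to logarithmic factors; then \<open>ln (b / a)\<close>
  is asymptotic to \<open>ln n / 2\<close>. This yields the rate \<open>eps n\<close> and the variance \<open>(2 / \<pi>\<^sup>2) * x0 * g x0\<close>.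
  Since the singular part is linear in \<open>h\<close>, one variable \<open>Q n\<close>, the truncated and rescaled singular part,
  carries the noise for all \<open>h\<close> at once. It is asymptotically normal (\<open>char_Q_tendsto\<close>), and the rest of
  the increment is negligible in second moment (\<open>singular_error_second_moment\<close>).

  Locally, therefore, \<open>H_emp\<close> at \<open>x0 + eps n * t\<close>, minus its value at \<open>x0\<close> and the centring, is
  \<open>(eps n)\<^sup>2 * (t * Q n + t\<^sup>2 * f x0 / 2)\<close> up to a smaller error. Pointwise this is Chebyshev's inequality,
  and uniformity in bounded \<open>t\<close> follows by chaining with fourth moments (\<open>D_close_to_linear\<close>). The right
  derivative at 0 of the minorant of this parabola is \<open>Q n\<close>. To conclude the same for \<open>H_emp\<close>, it is enough
  that the line of slope \<open>Fhat n x0 + eps n * Q n\<close> lies globally below \<open>H_emp\<close> up to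
  \<open>o((eps n)\<^sup>2)\<close> (\<open>right_deriv_gcm_localized\<close>). At intermediate distances the quadratic drift of \<open>c'\<close>
  beats the noise on dyadic blocks (\<open>D_below_quadratic\<close>). At positive distances from \<open>x0\<close> the law of large
  numbers compares \<open>H_emp\<close> with the convex function \<open>E (max 0 (x - Z))\<close> (\<open>He_linear_growth\<close>). So the scaled
  error differs from \<open>Q n\<close> by a term that tends to zero in probability, and Levy's continuity theorem
  applies.

  The moment bounds need one fact about the law of \<open>Y\<close>, namely that \<open>G\<^sub>n\<close> gives mass at most
  \<open>C * (u + eps n)\<close> to the interval of radius \<open>u\<close> about \<open>x0\<close> (\<open>eventually_local_mass\<close>). To the right
  of \<open>x0\<close> this follows from (a) and the finiteness of \<open>g x0\<close>. To the left, where \<open>g\<close> may be infinite, it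
  comes from \<open>c'\<close>: the quadratic bound limits the second differences of \<open>E (max 0 (x - Z))\<close>, hence the
  probability that \<open>Z\<close> is close to \<open>x0\<close>, hence the mass that \<open>Y\<close> puts just below \<open>x0\<close>.
\<close>

section \<open>The kernel of the primitive\<close>

text \<open>
  \<open>V_of G t\<close> and \<open>V_emp n Y t\<close> are the averages of \<open>spike y t\<close> over \<open>y\<close>, with respect to \<open>dG\<close> and
  to the sample. The averages of \<open>tail_kern\<close>, \<open>kern\<close> and \<open>ikern\<close> are then the tail integral in
  \<open>F_functional\<close>, the value of \<open>F_functional\<close>, and its primitive.
\<close>

definition spike :: "real \<Rightarrow> real \<Rightarrow> real" where
  "spike y t = (if t < y then 1 / sqrt (y - t) else 0)"

definition tail_kern :: "real \<Rightarrow> real \<Rightarrow> real" where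
  "tail_kern y t = (if 0 \<le> t \<and> t < y then pi / 2 - arcsin (sqrt (t / y)) else 0)"

definition kern :: "real \<Rightarrow> real \<Rightarrow> real" where
  "kern y t = 1 - 2 / pi * (sqrt t * spike y t) - 2 / pi * tail_kern y t"

text \<open>
  The primitive of \<open>kern y\<close> that vanishes at 0, in closed form. The term \<open>max 0 y\<close> covers \<open>y < 0\<close>,
  where \<open>kern y\<close> is 1 on all of \<open>{0..}\<close>.
\<close>

definition ikern :: "real \<Rightarrow> real \<Rightarrow> real" where
  "ikern y x =
     (if x < y then 2 / pi * (x * arcsin (sqrt (x / y))
                      - 3/2 * (y * arcsin (sqrt (x / y)) - sqrt (x * (y - x))))
      else x - 3/2 * max 0 y)"

lemma has_integral_const_interval:
  fixes c :: real
  assumes "a \<le> b" shows "((\<lambda>_. c) has_integral (b - a) * c) {a..b}"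
  using has_integral_const_real[of c a b] assms by simp

text \<open>
  An antiderivative of \<open>spike y u / (2 * sqrt u)\<close>, the integrand of the tail integral in
  \<open>F_functional\<close> for a single observation at \<open>y\<close>. It explains the arc sine in \<open>tail_kern\<close>.
\<close>

lemma has_real_derivative_arcsin_sqrt:
  assumes "0 < t" "t < y"
  shows "((\<lambda>u. arcsin (sqrt (u / y))) has_real_derivative 1 / (2 * sqrt t * sqrt (y - t))) (at t)"
proof -
  have y: "y > 0" "t / y > 0" "t / y < 1" using assms by auto
  have s: "sqrt (t/y) < 1" "sqrt (t/y) > -1" using y
    by (auto intro: less_le_trans[of _ 0])
  have "((\<lambda>u. arcsin (sqrt (u / y))) has_real_derivative
      inverse (sqrt (1 - (sqrt (t / y))\<^sup>2)) * (inverse (sqrt (t / y)) / 2 * (1 / y))) (at t)"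
    using y s by (auto intro!: derivative_eq_intros DERIV_arcsin)
  moreover have "1 - (sqrt (t/y))\<^sup>2 = (y - t) / y" using y assms by (simp add: field_simps)
  moreover have "sqrt ((y-t)/y) * sqrt (t/y) * y = sqrt t * sqrt (y-t)"
    using y assms by (simp add: real_sqrt_divide)
  ultimately show ?thesis using y assms
    by (simp add: field_simps real_sqrt_divide)
qed

lemma kern_before:
  assumes "0 \<le> t" "t < y"
  shows "kern y t = 2 / pi * (arcsin (sqrt (t / y)) - sqrt (t / (y - t)))"
  using assms by (simp add: kern_def spike_def tail_kern_def real_sqrt_divide field_simps)

lemma kern_after: "y \<le> t \<Longrightarrow> kern y t = 1"
  by (simp add: kern_def spike_def tail_kern_def)

lemma ikern_0 [simp]: "ikern y 0 = 0"
  by (simp add: ikern_def)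

text \<open>
  A form without case distinction, from which continuity in \<open>x\<close> can be read off.
\<close>

lemma ikern_at_min:
  assumes "0 \<le> x" "0 < y"
  shows "ikern y x = 2 / pi * (min x y * arcsin (sqrt (min x y / y))
      - 3/2 * (y * arcsin (sqrt (min x y / y)) - sqrt (min x y * (y - min x y)))) + (x - min x y)"
  using assms by (auto simp: ikern_def min_def field_simps)

lemma continuous_on_arcsin_sqrt:
  assumes "continuous_on S f" "\<And>x. x \<in> S \<Longrightarrow> 0 \<le> f x \<and> f x \<le> 1"
  shows "continuous_on S (\<lambda>x. arcsin (sqrt (f x)))"
  using assms by (intro continuous_on_arcsin' continuous_intros) (auto intro: order_trans[of _ 0])

lemma continuous_on_ikern: "continuous_on {0..} (ikern y)"
proof (cases "0 < y")
  case True
  have "continuous_on {0..} (\<lambda>x. 2 / pi * (min x y * arcsin (sqrt (min x y / y))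
      - 3/2 * (y * arcsin (sqrt (min x y / y)) - sqrt (min x y * (y - min x y)))) + (x - min x y))"
    using True by (intro continuous_intros continuous_on_arcsin_sqrt) auto
  then show ?thesis using True
    by (subst continuous_on_cong[OF refl ikern_at_min]) auto
next
  case False
  then have "ikern y x = x" if "x \<in> {0..}" for x using that by (auto simp: ikern_def)
  then show ?thesis by (subst continuous_on_cong[OF refl]) auto
qed

lemma has_real_derivative_ikern:
  assumes "0 < t" "t \<noteq> y"
  shows "(ikern y has_real_derivative kern y t) (at t)"
proof (cases "t < y")
  case True
  have e: "sqrt t * sqrt t = t" "sqrt (y - t) * sqrt (y - t) = y - t" using assms True by auto
  define A where "A = (\<lambda>u. arcsin (sqrt (u / y)))"
  define S where "S = (\<lambda>u. sqrt (u * (y - u)))"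
  have A: "(A has_real_derivative 1 / (2 * sqrt t * sqrt (y - t))) (at t)"
    unfolding A_def by (rule has_real_derivative_arcsin_sqrt[OF assms(1) True])
  have S: "(S has_real_derivative inverse (sqrt (t * (y - t))) / 2 * (y - 2 * t)) (at t)"
    unfolding S_def using assms True by (auto intro!: derivative_eq_intros simp: algebra_simps)
  have "((\<lambda>x. 2 / pi * (x * A x - 3/2 * (y * A x - S x))) has_real_derivative
      2 / pi * (A t + t * (1 / (2 * sqrt t * sqrt (y - t)))
       - 3/2 * (y * (1 / (2 * sqrt t * sqrt (y - t)))
           - inverse (sqrt (t * (y - t))) / 2 * (y - 2 * t)))) (at t)"
    by (rule derivative_eq_intros A S refl)+ (simp add: algebra_simps)
  then have d: "((\<lambda>x. 2 / pi * (x * arcsin (sqrt (x / y))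
      - 3/2 * (y * arcsin (sqrt (x / y)) - sqrt (x * (y - x))))) has_real_derivative
      2 / pi * (arcsin (sqrt (t/y)) + t * (1 / (2 * sqrt t * sqrt (y - t)))
       - 3/2 * (y * (1 / (2 * sqrt t * sqrt (y - t)))
           - inverse (sqrt (t * (y - t))) / 2 * (y - 2 * t)))) (at t)"
    by (simp add: A_def S_def)
  have "2 / pi * (arcsin (sqrt (t/y)) + t * (1 / (2 * sqrt t * sqrt (y - t)))
       - 3/2 * (y * (1 / (2 * sqrt t * sqrt (y - t)))
           - inverse (sqrt (t * (y - t))) / 2 * (y - 2 * t))) =
        2 / pi * (arcsin (sqrt (t/y)) - t / (sqrt t * sqrt (y - t)))"
  proof -
    (* All three radicals are multiples of r; after that the identity is linear in r. *)
    define r where "r = 1 / (sqrt t * sqrt (y - t))"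
    have "1 / (2 * sqrt t * sqrt (y - t)) = r / 2" "inverse (sqrt (t * (y - t))) = r"
      "t / (sqrt t * sqrt (y - t)) = t * r"
      unfolding real_sqrt_mult by (simp_all add: r_def field_simps)
    then show ?thesis by (simp only:) (simp add: algebra_simps)
  qed
  also have "t / (sqrt t * sqrt (y - t)) = sqrt (t / (y - t))"
    using assms True e by (simp add: real_sqrt_divide field_simps)
  finally have "2 / pi * (arcsin (sqrt (t/y)) + t * (1 / (2 * sqrt t * sqrt (y - t)))
       - 3/2 * (y * (1 / (2 * sqrt t * sqrt (y - t)))
           - inverse (sqrt (t * (y - t))) / 2 * (y - 2 * t))) = kern y t"
    using assms True by (simp add: kern_before)
  with d have "((\<lambda>x. 2 / pi * (x * arcsin (sqrt (x / y))
      - 3/2 * (y * arcsin (sqrt (x / y)) - sqrt (x * (y - x))))) has_real_derivative kern y t) (at t)"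
    by simp
  then show ?thesis
    by (rule has_field_derivative_transform_within_open[of _ _ _ "{..<y}"])
      (use True in \<open>auto simp: ikern_def\<close>)
next
  case False
  then have "y < t" using assms by auto
  have "((\<lambda>x. x - 3/2 * max 0 y) has_real_derivative 1) (at t)"
    by (auto intro!: derivative_eq_intros)
  then have "(ikern y has_real_derivative 1) (at t)"
    by (rule has_field_derivative_transform_within_open[of _ _ _ "{y<..}"])
      (use \<open>y < t\<close> in \<open>auto simp: ikern_def\<close>)
  then show ?thesis using \<open>y < t\<close> by (simp add: kern_after)
qed

lemma has_integral_kern:
  assumes "0 \<le> a" "a \<le> b"
  shows "(kern y has_integral ikern y b - ikern y a) {a..b}"
  by (rule fundamental_theorem_of_calculus_interior_strong[of "{y}"])
    (use assms in \<open>auto intro!: has_real_derivative_ikern continuous_on_subset[OF continuous_on_ikern]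
        simp: has_real_derivative_iff_has_vector_derivative[symmetric]\<close>)

lemma arcsin_sqrt_le:
  assumes "0 \<le> t" "t < y"
  shows "arcsin (sqrt (t / y)) \<le> sqrt (t / (y - t))"
proof -
  define s where "s = sqrt (t / y)"
  have s: "0 \<le> s" "s < 1" using assms by (auto simp: s_def)
  then have r: "0 \<le> arcsin s" "arcsin s < pi/2"
    using arcsin_lt_bounded[of s] by (auto simp: arcsin_nonneg)
  have "arcsin s \<le> tan (arcsin s)"
  proof (cases "arcsin s = 0")
    case False
    then have "0 < arcsin s" using r by auto
    then show ?thesis using r abs_tan_ge[of "arcsin s"] tan_gt_zero[of "arcsin s"] by auto
  qed auto
  also have "\<dots> = s / sqrt (1 - s\<^sup>2)"
    using s by (simp add: tan_def cos_arcsin)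
  also have "\<dots> = sqrt (t / (y - t))"
    using assms by (simp add: s_def real_sqrt_divide[symmetric] field_simps)
  finally show ?thesis by (simp add: s_def)
qed

lemma kern_le_1: "0 \<le> t \<Longrightarrow> kern y t \<le> 1"
  using arcsin_sqrt_le[of t y]
  by (cases "t < y") (auto simp: kern_before kern_after mult_nonneg_nonpos intro: order_trans[of _ 0])

lemma abs_kern_before_le:
  assumes "0 \<le> t" "t < y"
  shows "\<bar>kern y t\<bar> \<le> sqrt t / sqrt (y - t)"
proof -
  have p: "2 / pi \<le> 1" using pi_gt3 by simp
  have "0 \<le> arcsin (sqrt (t/y))" using assms by (intro arcsin_nonneg) auto
  moreover note arcsin_sqrt_le[OF assms]
  ultimately have "\<bar>arcsin (sqrt (t / y)) - sqrt (t / (y - t))\<bar> \<le> sqrt (t / (y - t))" by auto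
  then have "2 / pi * \<bar>arcsin (sqrt (t / y)) - sqrt (t / (y - t))\<bar> \<le> 1 * sqrt (t / (y - t))"
    using p by (intro mult_mono) auto
  then have "\<bar>2 / pi * (arcsin (sqrt (t / y)) - sqrt (t / (y - t)))\<bar> \<le> sqrt (t / (y - t))"
    by (simp only: abs_mult) simp
  then show ?thesis using assms by (simp only: kern_before real_sqrt_divide)
qed

text \<open>
  \<open>kern\<close> is not bounded below, so its primitive is not monotone. It is bounded above by 1,
  however, and this one-sided Lipschitz bound is enough to pass from a grid to all \<open>x\<close> in the law
  of large numbers far away from \<open>x0\<close>.
\<close>

lemma ikern_minus_id_antimono:
  assumes "0 \<le> a" "a \<le> b"
  shows "ikern y b - b \<le> ikern y a - a"
proof -
  have "ikern y b - ikern y a \<le> (b - a)"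
    using has_integral_le[OF has_integral_kern[OF assms] has_integral_const_interval[OF assms(2), of 1]]
      assms kern_le_1 by auto
  then show ?thesis by simp
qed

text \<open>
  Half the integral of \<open>spike y\<close> over \<open>{a..b}\<close>. All bounds on increments of \<open>ikern\<close> are expressed
  by it: it is at most \<open>sqrt (b - a)\<close>, which is sharp for \<open>y\<close> near \<open>b\<close>, and at most
  \<open>(b - a) / sqrt (y - a)\<close>, which is better for \<open>y\<close> far to the right.
\<close>

definition sqrt_gap :: "real \<Rightarrow> real \<Rightarrow> real \<Rightarrow> real" where
  "sqrt_gap a b y = sqrt (max 0 (y - a)) - sqrt (max 0 (y - b))"

lemma has_integral_spike:
  assumes "a \<le> b"
  shows "(spike y has_integral 2 * sqrt_gap a b y) {a..b}"
proof -
  have "(spike y has_integral (- 2 * sqrt (max 0 (y - b))) - (- 2 * sqrt (max 0 (y - a)))) {a..b}"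
  proof (rule fundamental_theorem_of_calculus_interior_strong[of "{y}"])
    show "((\<lambda>b. - 2 * sqrt (max 0 (y - b))) has_vector_derivative spike y x) (at x)"
      if "x \<in> {a<..<b} - {y}" for x
    proof (cases "x < y")
      case True
      have "((\<lambda>b. - 2 * sqrt (y - b)) has_real_derivative spike y x) (at x)"
        using True by (auto intro!: derivative_eq_intros simp: spike_def field_simps)
      then show ?thesis unfolding has_real_derivative_iff_has_vector_derivative[symmetric]
        by (rule has_field_derivative_transform_within_open[of _ _ _ "{..<y}"]) (use True in auto)
    next
      case False
      then have "y < x" using that by auto
      have "((\<lambda>b. 0) has_real_derivative spike y x) (at x)"
        using False by (auto simp: spike_def)
      then show ?thesis unfolding has_real_derivative_iff_has_vector_derivative[symmetric]
        by (rule has_field_derivative_transform_within_open[of _ _ _ "{y<..}"]) (use \<open>y < x\<close> in auto)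
    qed
  qed (use assms in \<open>auto intro!: continuous_intros\<close>)
  then show ?thesis by (simp add: sqrt_gap_def)
qed

lemma sqrt_gap_nonneg: "a \<le> b \<Longrightarrow> 0 \<le> sqrt_gap a b y"
  by (auto simp: sqrt_gap_def)

lemma sqrt_gap_le_sqrt:
  assumes "a \<le> b" shows "sqrt_gap a b y \<le> sqrt (b - a)"
proof -
  have "sqrt (max 0 (y - a)) \<le> sqrt (max 0 (y - b) + (b - a))" using assms by auto
  also have "\<dots> \<le> sqrt (max 0 (y - b)) + sqrt (b - a)" using assms by (intro sqrt_add_le_add_sqrt) auto
  finally show ?thesis by (simp add: sqrt_gap_def)
qed

lemma sqrt_gap_le_divide:
  assumes "a \<le> b" "a < y" shows "sqrt_gap a b y \<le> (b - a) / sqrt (y - a)"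
proof -
  have s: "sqrt (y - a) > 0" using assms by auto
  have "sqrt (y - a) * sqrt_gap a b y = (y - a) - sqrt (y - a) * sqrt (max 0 (y - b))"
    using assms s by (simp add: sqrt_gap_def algebra_simps max_def)
  also have "\<dots> \<le> (y - a) - max 0 (y - b)"
    using assms mult_right_mono[of "sqrt (max 0 (y-b))" "sqrt (y-a)" "sqrt (max 0 (y-b))"] by auto
  also have "\<dots> \<le> b - a" by auto
  finally show ?thesis using s by (simp add: field_simps)
qed

lemma sqrt_gap_eq_0: "y \<le> a \<Longrightarrow> a \<le> b \<Longrightarrow> sqrt_gap a b y = 0"
  by (simp add: sqrt_gap_def)

lemma abs_ikern_diff_le:
  assumes "0 \<le> a" "a \<le> b" "b \<le> B"
  shows "\<bar>ikern y b - ikern y a\<bar> \<le> (b - a) + 2 * sqrt B * sqrt_gap a b y"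
proof -
  have i: "((\<lambda>t. 1 + sqrt B * spike y t) has_integral (b - a) + sqrt B * (2 * sqrt_gap a b y)) {a..b}"
    using has_integral_add[OF has_integral_const_interval[OF assms(2), of 1]
      has_integral_mult_right[OF has_integral_spike[OF assms(2)]]] by simp
  have B: "\<bar>kern y t\<bar> \<le> 1 + sqrt B * spike y t" if "t \<in> {a..b}" for t
  proof (cases "t < y")
    case True
    have "sqrt t / sqrt (y - t) \<le> sqrt B / sqrt (y - t)" using that assms True
      by (intro divide_right_mono) auto
    then show ?thesis using abs_kern_before_le[of t y] that assms True by (auto simp: spike_def)
  qed (auto simp: kern_after spike_def)
  have "norm (ikern y b - ikern y a) \<le> (b - a) + sqrt B * (2 * sqrt_gap a b y)"
    using has_integral_kern[OF assms(1,2)] i B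
    by (metis (no_types, lifting) has_integral_integrable integral_norm_bound_integral integral_unique
        real_norm_def)
  then show ?thesis by (simp add: algebra_simps)
qed

lemma abs_ikern_le: "0 \<le> x \<Longrightarrow> \<bar>ikern y x\<bar> \<le> 3 * x"
proof -
  assume x: "0 \<le> x"
  have "\<bar>ikern y x - ikern y 0\<bar> \<le> (x - 0) + 2 * sqrt x * sqrt_gap 0 x y"
    by (rule abs_ikern_diff_le) (use x in auto)
  also have "\<dots> \<le> x + 2 * sqrt x * sqrt x" using sqrt_gap_le_sqrt[of 0 x y] x
    by (intro add_mono mult_left_mono) auto
  also have "2 * sqrt x * sqrt x = 2 * x" using x by (simp add: mult.assoc)
  finally show ?thesis by simp
qed

lemma ikern_le: "0 \<le> x \<Longrightarrow> ikern y x \<le> x"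
  using ikern_minus_id_antimono[of 0 x y] by simp

lemma ikern_ge: "y \<le> B \<Longrightarrow> 0 \<le> B \<Longrightarrow> B \<le> x \<Longrightarrow> x - 3/2 * B \<le> ikern y x"
  by (auto simp: ikern_def)

lemma ikern_linear_approx:
  assumes "0 \<le> a" "a \<le> b" "\<And>t. t \<in> {a..b} \<Longrightarrow> \<bar>kern y t - c\<bar> \<le> B" "B \<ge> 0"
  shows "\<bar>ikern y b - ikern y a - (b - a) * c\<bar> \<le> B * (b - a)"
proof -
  have "((\<lambda>t. kern y t - c) has_integral (ikern y b - ikern y a) - (b - a) * c) {a..b}"
    by (intro has_integral_diff has_integral_kern has_integral_const_interval assms)
  from has_integral_bound[of B _ _ a b, unfolded box_real, OF assms(4) this]
  show ?thesis using assms by auto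
qed

text \<open>
  The counterpart of \<open>ikern_at_min\<close> for continuity in \<open>y\<close>.
\<close>

lemma ikern_at_max:
  assumes "0 < x"
  shows "ikern y x = 2 / pi * (x * arcsin (sqrt (x / max x y))
      - 3/2 * (max x y * arcsin (sqrt (x / max x y)) - sqrt (x * (max x y - x))))
      + 3/2 * (x - min x (max 0 y))"
  using assms by (auto simp: ikern_def max_def min_def field_simps)

lemma isCont_ikern_fst:
  assumes "0 \<le> x" shows "isCont (\<lambda>y. ikern y x) y"
proof (cases "x = 0")
  case False
  then have x: "0 < x" using assms by auto
  have "continuous_on UNIV (\<lambda>y. ikern y x)"
    unfolding ikern_at_max[OF x] using x
    by (intro continuous_intros continuous_on_arcsin_sqrt) (auto simp: max_def)
  then show ?thesis by (simp add: continuous_on_eq_continuous_at)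
qed auto

lemma borel_measurable_ikern: "0 \<le> x \<Longrightarrow> (\<lambda>y. ikern y x) \<in> borel_measurable borel"
  by (intro borel_measurable_continuous_onI continuous_at_imp_continuous_on) (auto intro: isCont_ikern_fst)

lemma measurable_spike [measurable]: "(\<lambda>p. spike (fst p) (snd p)) \<in> borel_measurable (borel \<Otimes>\<^sub>M borel)"
  unfolding spike_def by measurable

lemma measurable_tail_kern [measurable]:
  "(\<lambda>p. tail_kern (fst p) (snd p)) \<in> borel_measurable (borel \<Otimes>\<^sub>M borel)"
proof -
  have [measurable]: "(\<lambda>s::real. arcsin (max (-1) (min 1 s))) \<in> borel_measurable borel"
    by (intro borel_measurable_continuous_onI continuous_on_arcsin' continuous_intros) auto
  have "tail_kern y t = (if 0 \<le> t \<and> t < y then pi/2 - arcsin (max (-1) (min 1 (sqrt (t / y)))) else 0)" for y t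
  proof (cases "0 \<le> t \<and> t < y")
    case True
    then have "0 \<le> sqrt (t / y)" "sqrt (t / y) \<le> 1" by auto
    then have "max (-1) (min 1 (sqrt (t / y))) = sqrt (t / y)" by linarith
    then show ?thesis by (simp only: tail_kern_def)
  qed (simp only: tail_kern_def if_False)
  then show ?thesis by (simp only:) measurable
qed

lemma spike_nonneg [simp]: "0 \<le> spike y t" by (simp add: spike_def)

lemma tail_kern_bounds: "0 \<le> tail_kern y t" "tail_kern y t \<le> pi / 2"
proof -
  have "0 \<le> arcsin (sqrt (t/y)) \<and> arcsin (sqrt (t/y)) \<le> pi/2" if "0 \<le> t" "t < y"
  proof -
    have "0 \<le> sqrt (t / y)" "sqrt (t / y) \<le> 1" using that by auto
    then show ?thesis using arcsin_ubound[of "sqrt (t/y)"] arcsin_nonneg[of "sqrt (t/y)"]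
      by (metis atLeastAtMost_iff neg_le_0_iff_le order_trans zero_le_one)
  qed
  then show "0 \<le> tail_kern y t" "tail_kern y t \<le> pi / 2" by (auto simp: tail_kern_def)
qed

text \<open>
  For nonnegative integrands the fundamental theorem of calculus for the gauge integral yields
  Lebesgue integrability, also when the integrand is unbounded as \<open>spike\<close> is.
\<close>

lemma has_bochner_integral_of_nonneg_has_integral:
  fixes f :: "real \<Rightarrow> real"
  assumes [measurable]: "f \<in> borel_measurable borel" "S \<in> sets borel"
    and nonneg: "\<And>x. x \<in> S \<Longrightarrow> 0 \<le> f x" and I: "(f has_integral I) S"
  shows "has_bochner_integral lborel (\<lambda>x. indicator S x * f x) I"
proof (rule has_bochner_integral_nn_integral)
  have "((\<lambda>x. indicator S x * f x) has_integral I) UNIV"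
  proof -
    have "(\<lambda>x. indicator S x * f x) = (\<lambda>x. if x \<in> S then f x else 0)" by (auto simp: indicator_def)
    then show ?thesis using I has_integral_restrict_UNIV[of S f I] by simp
  qed
  then show "(\<integral>\<^sup>+x. ennreal (indicator S x * f x) \<partial>lborel) = ennreal I"
    by (intro nn_integral_has_integral_lborel) (use nonneg in \<open>auto simp: indicator_def\<close>)
  show "0 \<le> I" using has_integral_nonneg[OF I nonneg] .
qed (use nonneg in \<open>auto simp: indicator_def\<close>)

lemma has_bochner_integral_spike_over_sqrt:
  assumes "0 \<le> t"
  shows "has_bochner_integral lborel (\<lambda>u. indicator {t<..} u * (spike y u / (2 * sqrt u))) (tail_kern y t)"
proof (cases "t < y")
  case True
  have m [measurable]: "spike y \<in> borel_measurable borel" unfolding spike_def by measurable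
  have "((\<lambda>u. spike y u / (2 * sqrt u)) has_integral arcsin (sqrt (y / y)) - arcsin (sqrt (t / y))) {t..y}"
    by (rule fundamental_theorem_of_calculus_interior)
      (use True assms has_real_derivative_arcsin_sqrt in \<open>auto intro!: continuous_intros
          continuous_on_arcsin_sqrt
        simp: has_real_derivative_iff_has_vector_derivative[symmetric] spike_def field_simps\<close>)
  then have "((\<lambda>u. spike y u / (2 * sqrt u)) has_integral tail_kern y t) {t..y}"
    using True assms by (simp add: tail_kern_def)
  from has_bochner_integral_of_nonneg_has_integral[OF _ _ _ this]
  have "has_bochner_integral lborel (\<lambda>u. indicator {t..y} u * (spike y u / (2 * sqrt u))) (tail_kern y t)"
    using assms by auto
  moreover have "AE u in lborel. indicator {t..y} u * (spike y u / (2 * sqrt u)) =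
      indicator {t<..} u * (spike y u / (2 * sqrt u))"
    using AE_lborel_singleton[of t] by eventually_elim (auto simp: indicator_def spike_def)
  ultimately show ?thesis by (subst (asm) has_bochner_integral_cong_AE) auto
next
  case False
  then have "indicator {t<..} u * (spike y u / (2 * sqrt u)) = 0" for u
    by (auto simp: indicator_def spike_def)
  then show ?thesis using False has_bochner_integral_zero[of lborel]
    by (simp only: tail_kern_def) (simp del: times_divide_eq_right)
qed

lemma has_bochner_integral_spike:
  assumes "a \<le> b"
  shows "has_bochner_integral lborel (\<lambda>u. indicator {a..b} u * spike y u) (2 * sqrt_gap a b y)"
  by (rule has_bochner_integral_of_nonneg_has_integral[OF _ _ _ has_integral_spike[OF assms]])
    (auto simp: spike_def[abs_def])

lemma integrable_pair_of_nonneg: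
  fixes f :: "'a \<times> real \<Rightarrow> real"
  assumes "prob_space \<mu>" and [measurable]: "f \<in> borel_measurable (\<mu> \<Otimes>\<^sub>M lborel)"
    and nonneg: "\<And>p. 0 \<le> f p" and I: "\<And>y. has_bochner_integral lborel (\<lambda>t. f (y, t)) (I y)"
    and C: "\<And>y. I y \<le> C"
  shows "integrable (\<mu> \<Otimes>\<^sub>M lborel) f"
proof -
  interpret prob_space \<mu> by fact
  interpret pair_sigma_finite \<mu> lborel ..
  have I': "integral\<^sup>L lborel (\<lambda>t. f (y, t)) = I y" for y
    using I has_bochner_integral_integral_eq by blast
  have I0: "0 \<le> I y" for y unfolding I'[symmetric] using nonneg by simp
  have [measurable]: "I \<in> borel_measurable \<mu>"
    unfolding I'[symmetric, abs_def] by measurable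
  show ?thesis
  proof (rule Fubini_integrable)
    have "integrable \<mu> I" using I0 C by (intro integrable_const_bound[of _ C]) auto
    then show "integrable \<mu> (\<lambda>x. \<integral>y. norm (f (x, y)) \<partial>lborel)"
      using nonneg I' by simp
    show "AE x in \<mu>. integrable lborel (\<lambda>y. f (x, y))"
      using I by (auto simp: has_bochner_integral_iff)
  qed fact
qed

text \<open>
  \<open>F_functional\<close> is affine in \<open>V\<close>, and \<open>V\<close> is an average of spikes. Two applications of Fubini's
  theorem, one for the tail integral and one for the primitive, move the average over \<open>y\<close> to the
  outside; what remains inside is \<open>ikern\<close>. The bounds \<open>sqrt_gap 0 x y \<le> sqrt x\<close> and
  \<open>tail_kern \<le> \<pi> / 2\<close>, uniform in \<open>y\<close>, provide the integrability.
\<close>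

theorem integral_F_functional:
  assumes "prob_space \<mu>" and sets_mu [measurable_cong]: "sets \<mu> = sets borel"
    and V: "\<And>u. 0 \<le> u \<Longrightarrow> V u = (\<integral>y. spike y u \<partial>\<mu>)" and x: "0 \<le> x"
  shows "(LINT t:{0..x}|lborel. F_functional V t) = (\<integral>y. ikern y x \<partial>\<mu>)"
proof -
  interpret prob_space \<mu> by fact
  interpret pair_sigma_finite \<mu> lborel ..
  define f where "f = (\<lambda>y t. indicator {0..x} t * (sqrt t * spike y t))"
  define k where "k = (\<lambda>y t. indicator {0..x} t * tail_kern y t)"
  have bi: "integrable (\<mu> \<Otimes>\<^sub>M lborel) (\<lambda>p. indicator {0..x} (snd p) * spike (fst p) (snd p))"
  proof (rule integrable_pair_of_nonneg[OF \<open>prob_space \<mu>\<close>, where C = "2 * sqrt x"])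
    show "has_bochner_integral lborel (\<lambda>t. indicat_real {0..x} (snd (y, t)) * spike (fst (y, t)) (snd (y, t)))
      (2 * sqrt_gap 0 x y)" for y using has_bochner_integral_spike[OF x, of y] by simp
    show "2 * sqrt_gap 0 x y \<le> 2 * sqrt x" for y using sqrt_gap_le_sqrt[OF x, of y] by simp
  qed auto
  have fi: "integrable (\<mu> \<Otimes>\<^sub>M lborel) (case_prod f)"
  proof (rule Bochner_Integration.integrable_bound[OF integrable_mult_right[OF bi, of "sqrt x"]])
    show "AE p in \<mu> \<Otimes>\<^sub>M lborel. norm (case_prod f p)
      \<le> norm (sqrt x * (indicat_real {0..x} (snd p) * spike (fst p) (snd p)))"
      by (auto simp: f_def indicator_def abs_mult split: prod.splits intro!: mult_right_mono)
  qed (auto simp: f_def split_beta')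
  have ki: "integrable (\<mu> \<Otimes>\<^sub>M lborel) (case_prod k)"
  proof (rule integrableI_bounded_set[where A = "UNIV \<times> {0..x}" and B = "pi/2"])
    have "UNIV \<times> {0..x} = space \<mu> \<times> {0..x}" using sets_eq_imp_space_eq[OF sets_mu] by simp
    then show "emeasure (\<mu> \<Otimes>\<^sub>M lborel) (UNIV \<times> {0..x}) < \<infinity>"
      using x by (simp add: lborel.emeasure_pair_measure_Times emeasure_space_1)
    have "UNIV \<times> {0..x} \<in> sets (borel \<Otimes>\<^sub>M borel)" by simp
    then show "UNIV \<times> {0..x} \<in> sets (\<mu> \<Otimes>\<^sub>M lborel)" by (simp add: sets_mu cong: sets_pair_measure_cong)
    have "norm (case_prod k p) \<le> pi / 2" for p
      using tail_kern_bounds[of "fst p" "snd p"] by (auto simp: k_def split_beta' indicator_def)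
    then show "AE p in \<mu> \<Otimes>\<^sub>M lborel. p \<in> UNIV \<times> {0..x} \<longrightarrow> norm (case_prod k p) \<le> pi / 2" by simp
  qed (auto simp: k_def tail_kern_bounds split_beta' indicator_def)
  have hi: "integrable (\<mu> \<Otimes>\<^sub>M lborel) (\<lambda>(y, u). indicator {t<..} u * (spike y u / (2 * sqrt u)))"
    if "0 \<le> t" for t
  proof (rule integrable_pair_of_nonneg[OF \<open>prob_space \<mu>\<close>, where C = "pi/2"])
    show "has_bochner_integral lborel (\<lambda>u. case (y, u) of (y, u) \<Rightarrow>
         indicat_real {t<..} u * (spike y u / (2 * sqrt u))) (tail_kern y t)" for y
      using has_bochner_integral_spike_over_sqrt[OF that] by simp
    show "0 \<le> (case p of (y, u) \<Rightarrow> indicat_real {t<..} u * (spike y u / (2 * sqrt u)))" for p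
      using that by (auto simp: indicator_def split: prod.split)
    show "tail_kern y t \<le> pi / 2" for y by (rule tail_kern_bounds)
  qed (auto simp: split_beta')
  have tail: "(LINT u:{t<..}|lborel. V u / (2 * sqrt u)) = (\<integral>y. tail_kern y t \<partial>\<mu>)" if "0 \<le> t" for t
  proof -
    have "(LINT u:{t<..}|lborel. V u / (2 * sqrt u)) =
      (\<integral>u. (\<integral>y. indicator {t<..} u * (spike y u / (2 * sqrt u)) \<partial>\<mu>) \<partial>lborel)"
      unfolding set_lebesgue_integral_def using V that
      by (intro Bochner_Integration.integral_cong refl) (auto simp: indicator_def)
    also have "\<dots> = (\<integral>y. (\<integral>u. indicator {t<..} u * (spike y u / (2 * sqrt u)) \<partial>lborel) \<partial>\<mu>)"
      by (rule Fubini_integral[OF hi[OF that]])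
    also have "\<dots> = (\<integral>y. tail_kern y t \<partial>\<mu>)"
      using has_bochner_integral_spike_over_sqrt[OF that]
      by (intro Bochner_Integration.integral_cong refl) (auto dest: has_bochner_integral_integral_eq)
    finally show ?thesis .
  qed
  have F: "indicator {0..x} t *\<^sub>R F_functional V t = indicator {0..x} t - 2 / pi * (\<integral>y. f y t \<partial>\<mu>)
      - 2 / pi * (\<integral>y. k y t \<partial>\<mu>)" for t
    unfolding F_functional_def f_def k_def using tail[of t] V[of t]
    by (auto simp: indicator_def)
  have if1: "integrable lborel (\<lambda>t. \<integral>y. f y t \<partial>\<mu>)" using integrable_snd[OF fi] .
  have ik1: "integrable lborel (\<lambda>t. \<integral>y. k y t \<partial>\<mu>)" using integrable_snd[OF ki] .
  have "(LINT t:{0..x}|lborel. F_functional V t) = x - 2 / pi * (\<integral>t. (\<integral>y. f y t \<partial>\<mu>) \<partial>lborel)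
      - 2 / pi * (\<integral>t. (\<integral>y. k y t \<partial>\<mu>) \<partial>lborel)"
    unfolding set_lebesgue_integral_def F using if1 ik1 x by simp
  also have "\<dots> = x - 2 / pi * (\<integral>y. (\<integral>t. f y t \<partial>lborel) \<partial>\<mu>) - 2 / pi * (\<integral>y. (\<integral>t. k y t \<partial>lborel) \<partial>\<mu>)"
    using Fubini_integral[OF fi] Fubini_integral[OF ki] by simp
  also have "\<dots> = (\<integral>y. x - 2 / pi * (\<integral>t. f y t \<partial>lborel) - 2 / pi * (\<integral>t. k y t \<partial>lborel) \<partial>\<mu>)"
    using integrable_fst[OF fi] integrable_fst[OF ki] by (simp add: prob_space)
  also have "\<dots> = (\<integral>y. ikern y x \<partial>\<mu>)"
  proof (rule Bochner_Integration.integral_cong[OF refl])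
    fix y
    have f1: "integrable lborel (f y)"
    proof (rule Bochner_Integration.integrable_bound)
      show "integrable lborel (\<lambda>t. sqrt x * (indicat_real {0..x} t * spike y t))"
        using has_bochner_integral_spike[OF x, of y] by (auto simp: has_bochner_integral_iff)
    qed (auto simp: f_def indicator_def abs_mult spike_def intro!: divide_right_mono)
    have [measurable]: "(\<lambda>t. tail_kern y t) \<in> borel_measurable borel"
      using measurable_compose[OF _ measurable_tail_kern, of "\<lambda>t. (y, t)" borel] by simp
    have kb: "norm (k y t) \<le> pi / 2" for t
      using tail_kern_bounds[of y t] by (auto simp: k_def indicator_def)
    have k1: "integrable lborel (k y)"
    proof (rule integrableI_bounded_set[where A = "{0..x}" and B = "pi/2"])
      show "AE t in lborel. t \<in> {0..x} \<longrightarrow> norm (k y t) \<le> pi / 2" using kb by blast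
    qed (use x in \<open>auto simp: k_def\<close>)
    have "(\<lambda>t. indicator {0..x} t * (1 - kern y t)) = (\<lambda>t. 2 / pi * f y t + 2 / pi * k y t)"
      by (auto simp: kern_def f_def k_def indicator_def)
    moreover have "has_bochner_integral lborel (\<lambda>t. indicator {0..x} t * (1 - kern y t)) (x - ikern y x)"
    proof (rule has_bochner_integral_of_nonneg_has_integral)
      show "(\<lambda>t. 1 - kern y t) \<in> borel_measurable borel"
        unfolding kern_def spike_def by measurable
      show "((\<lambda>t. 1 - kern y t) has_integral x - ikern y x) {0..x}"
        using has_integral_diff[OF has_integral_const_interval[OF x, of 1] has_integral_kern[OF order_refl x,
            of y]] by simp
    qed (use kern_le_1 in auto)
    ultimately have "x - ikern y x = 2 / pi * (\<integral>t. f y t \<partial>lborel) + 2 / pi * (\<integral>t. k y t \<partial>lborel)"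
      using f1 k1 by (auto simp: has_bochner_integral_iff)
    then show "x - 2 / pi * (\<integral>t. f y t \<partial>lborel) - 2 / pi * (\<integral>t. k y t \<partial>lborel) = ikern y x" by simp
  qed
  finally show ?thesis .
qed

lemma df_nonneg_at_bot:
  assumes "is_df_nonneg G" shows "(G \<longlongrightarrow> 0) at_bot"
proof -
  have "\<forall>\<^sub>F x in at_bot. G x = 0"
    using assms eventually_at_bot_dense unfolding is_df_nonneg_def by (metis (mono_tags))
  then show ?thesis by (simp add: tendsto_eventually)
qed

lemma real_distribution_interval_measure_df:
  assumes "is_df_nonneg G" shows "real_distribution (interval_measure G)"
  using assms df_nonneg_at_bot[OF assms] unfolding is_df_nonneg_def
  by (intro real_distribution_interval_measure) (auto simp: mono_def)

lemma cdf_interval_measure_df: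
  assumes "is_df_nonneg G" shows "cdf (interval_measure G) = G"
  using assms df_nonneg_at_bot[OF assms] unfolding is_df_nonneg_def
  by (intro cdf_interval_measure) (auto simp: mono_def)

lemma H_of_eq:
  assumes "is_df_nonneg G" "0 \<le> x"
  shows "H_of G x = (\<integral>y. ikern y x \<partial>interval_measure G)"
proof -
  interpret real_distribution "interval_measure G" by (rule real_distribution_interval_measure_df[OF assms(1)])
  have "V_of G u = (\<integral>y. spike y u \<partial>interval_measure G)" for u
    unfolding V_of_def set_lebesgue_integral_def
    by (intro Bochner_Integration.integral_cong) (auto simp: spike_def indicator_def)
  then show ?thesis unfolding H_of_def F_of_def using assms prob_space_axioms
    by (intro integral_F_functional) auto
qed

text \<open>
  The sample enters as its empirical law, the image of the uniform distribution on the indices.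
\<close>

lemma H_emp_eq:
  assumes "n \<ge> 1" "0 \<le> x"
  shows "H_emp n Y x = (\<Sum>i\<in>{1..n}. ikern (Y i) x) / n"
proof -
  define \<mu> where "\<mu> = distr (measure_pmf (pmf_of_set {1..n})) borel Y"
  have e: "(\<integral>y. h y \<partial>\<mu>) = (\<Sum>i\<in>{1..n}. h (Y i)) / n" if [measurable]: "h \<in> borel_measurable borel" for h ::
      "real \<Rightarrow> real"
    unfolding \<mu>_def using assms by (simp add: integral_distr integral_pmf_of_set)
  have "prob_space \<mu>" unfolding \<mu>_def by (intro prob_space.prob_space_distr prob_space_measure_pmf) simp
  moreover have "V_emp n Y u = (\<integral>y. spike y u \<partial>\<mu>)" for u
  proof -
    have "{i. i \<in> {1..n} \<and> u < Y i} = {i\<in>{1..n}. u < Y i}" by auto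
    then have "(\<Sum>i\<in>{1..n}. spike (Y i) u) = (\<Sum>i | i \<in> {1..n} \<and> Y i > u. 1 / sqrt (Y i - u))"
      unfolding spike_def by (subst \<open>{i. _} = _\<close>, subst sum.inter_filter) auto
    then show ?thesis unfolding V_emp_def by (subst e) (auto simp: spike_def[abs_def])
  qed
  ultimately have "H_emp n Y x = (\<integral>y. ikern y x \<partial>\<mu>)"
    unfolding H_emp_def F_emp_def using assms
    by (intro integral_F_functional) (auto simp: \<mu>_def)
  then show ?thesis using e borel_measurable_ikern assms by simp
qed

section \<open>The joint law of the squared projection and the squared radius\<close>

text \<open>
  Meant for the images of Lebesgue measure under sums of squares: these are infinite, but finite
  on every half line.
\<close>

lemma measure_eqI_atMost:
  fixes M N :: "real measure"
  assumes "sets M = sets borel" "sets N = sets borel"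
    and eq: "\<And>r. emeasure M {..r} = emeasure N {..r}" and fin: "\<And>r. emeasure M {..r} < \<infinity>"
  shows "M = N"
proof (rule measure_eqI_generator_eq[where E = "range atMost" and \<Omega> = UNIV and A = "\<lambda>i. {..real i}"])
  show "Int_stable (range (atMost :: real \<Rightarrow> _))"
    by (auto simp: Int_stable_def)
  show "sets M = sigma_sets UNIV (range atMost)" "sets N = sigma_sets UNIV (range atMost)"
    using assms borel_eq_atMost by (auto simp: borel_eq_atMost sets_measure_of)
  show "(\<Union>i. {..real i}) = UNIV" using real_arch_simple by auto
qed (use eq fin in \<open>auto simp: less_top[symmetric]\<close>)

lemma distr_power2_lborel:
  "distr lborel borel (\<lambda>x. x\<^sup>2) = density lborel (\<lambda>s. ennreal (indicator {0<..} s / sqrt s))"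
proof (rule measure_eqI_atMost)
  fix r :: real
  have d: "emeasure (distr lborel borel (\<lambda>x. x\<^sup>2)) {..r} = ennreal (2 * sqrt (max 0 r))"
  proof (cases "0 \<le> r")
    case True
    then have "(\<lambda>x::real. x\<^sup>2) -` {..r} = {- sqrt r..sqrt r}"
    proof -
      have "x\<^sup>2 \<le> r \<longleftrightarrow> - sqrt r \<le> x \<and> x \<le> sqrt r" for x :: real
        using real_sqrt_le_iff[of "x\<^sup>2" r] by (simp only: real_sqrt_abs abs_le_iff) auto
      then show ?thesis by auto
    qed
    then show ?thesis using True by (simp add: emeasure_distr)
  next
    case False
    then have "(\<lambda>x::real. x\<^sup>2) -` {..r} = {}" by (auto simp: not_le) (smt (verit) zero_le_power2)
    then show ?thesis using False by (simp add: emeasure_distr)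
  qed
  have e: "emeasure (density lborel (\<lambda>s. ennreal (indicator {0<..} s / sqrt s))) {..r} =
      ennreal (2 * sqrt (max 0 r))"
  proof (cases "0 \<le> r")
    case True
    have "((\<lambda>s. 1 / sqrt s) has_integral 2 * sqrt r - 2 * sqrt 0) {0..r}"
      by (rule fundamental_theorem_of_calculus_interior)
        (use True in \<open>auto intro!: derivative_eq_intros continuous_intros
          simp: has_real_derivative_iff_has_vector_derivative[symmetric] field_simps\<close>)
    then have "has_bochner_integral lborel (\<lambda>s. indicator {0..r} s * (1 / sqrt s)) (2 * sqrt r)"
      by (intro has_bochner_integral_of_nonneg_has_integral) auto
    then have "(\<integral>\<^sup>+s. ennreal (indicator {0..r} s * (1 / sqrt s)) \<partial>lborel) = ennreal (2 * sqrt r)"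
      by (subst nn_integral_eq_integral) (auto simp: has_bochner_integral_iff indicator_def)
    moreover have "ennreal (indicator {0<..} s / sqrt s) * indicator {..r} s =
        ennreal (indicator {0..r} s * (1 / sqrt s))" for s
      by (auto simp: indicator_def)
    ultimately show ?thesis using True by (simp add: emeasure_density)
  next
    case False
    then have z: "ennreal (indicator {0<..} s / sqrt s) * indicator {..r} s = 0" for s
      by (auto simp: indicator_def)
    have "emeasure (density lborel (\<lambda>s. ennreal (indicator {0<..} s / sqrt s))) {..r} =
        (\<integral>\<^sup>+(s::real). 0 \<partial>lborel)"
      by (subst emeasure_density) (simp, simp, simp only: z)
    then show ?thesis using False by simp
  qed
  show "emeasure (distr lborel borel (\<lambda>x. x\<^sup>2)) {..r}
      = emeasure (density lborel (\<lambda>s. ennreal (indicator {0<..} s / sqrt s))) {..r}"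
    using d e by simp
  show "emeasure (distr lborel borel (\<lambda>x. x\<^sup>2)) {..r} < \<infinity>" using d by simp
qed simp_all

lemma distr_disk_lborel:
  "distr (lborel \<Otimes>\<^sub>M lborel) borel (\<lambda>p. (fst p)\<^sup>2 + (snd p)\<^sup>2) =
      density lborel (\<lambda>r::real. ennreal (pi * indicator {0<..} r))"
proof (rule measure_eqI_atMost)
  fix r :: real
  have d: "emeasure (distr (lborel \<Otimes>\<^sub>M lborel) borel (\<lambda>p. (fst p)\<^sup>2 + (snd p)\<^sup>2)) {..r} =
      ennreal (pi * max 0 r)"
  proof (cases "0 \<le> r")
    case True
    then have v: "(\<lambda>p::real\<times>real. (fst p)\<^sup>2 + (snd p)\<^sup>2) -` {..r} = cball 0 (sqrt r)"
      by (auto simp: norm_Pair dist_norm)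
    have [simp]: "(\<lambda>p::real\<times>real. (fst p)\<^sup>2 + (snd p)\<^sup>2) \<in> borel_measurable borel"
      by (intro borel_measurable_continuous_onI continuous_intros)
    have "emeasure (distr (lborel \<Otimes>\<^sub>M lborel) borel (\<lambda>p. (fst p)\<^sup>2 + (snd p)\<^sup>2)) {..r}
      = emeasure lborel ((\<lambda>p::real\<times>real. (fst p)\<^sup>2 + (snd p)\<^sup>2) -` {..r})"
      unfolding lborel_prod by (subst emeasure_distr) simp_all
    also have "\<dots> = ennreal (pi * max 0 r)"
      unfolding v using True by (subst emeasure_cball) (auto simp: unit_ball_vol_2)
    finally show ?thesis .
  next
    case False
    then have "(\<lambda>p::real\<times>real. (fst p)\<^sup>2 + (snd p)\<^sup>2) -` {..r} = {}"
      by (auto simp: not_le) (smt (verit) zero_le_power2)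
    then show ?thesis using False by (simp add: emeasure_distr)
  qed
  have i: "ennreal (pi * indicator {0<..} s) * indicator {..r} s =
      ennreal pi * indicator {0<..r} s" for s :: real
    by (auto simp: indicator_def)
  have "emeasure (density lborel (\<lambda>s. ennreal (pi * indicator {0<..} s))) {..r} =
      ennreal pi * emeasure lborel {0<..r}"
    by (subst emeasure_density) (simp, simp, simp only: i, subst nn_integral_cmult_indicator, simp_all)
  also have "\<dots> = ennreal (pi * max 0 r)"
    by (cases "0 \<le> r") (simp_all add: ennreal_mult')
  finally have e: "emeasure (density lborel (\<lambda>s. ennreal (pi * indicator {0<..} s))) {..r} =
      ennreal (pi * max 0 r)" .
  show "emeasure (distr (lborel \<Otimes>\<^sub>M lborel) borel (\<lambda>p. (fst p)\<^sup>2 + (snd p)\<^sup>2)) {..r}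
      = emeasure (density lborel (\<lambda>r. ennreal (pi * indicator {0<..} r))) {..r}"
    using d e by simp
  show "emeasure (distr (lborel \<Otimes>\<^sub>M lborel) borel (\<lambda>p. (fst p)\<^sup>2 + (snd p)\<^sup>2)) {..r} < \<infinity>" using d by simp
qed simp_all

definition vec3 :: "real \<Rightarrow> real \<Rightarrow> real \<Rightarrow> real ^ 3" where
  "vec3 a b c = a *\<^sub>R axis 1 1 + b *\<^sub>R axis 2 1 + c *\<^sub>R axis 3 1"

lemma vec3_nth [simp]: "vec3 a b c $ 1 = a" "vec3 a b c $ 2 = b" "vec3 a b c $ 3 = c"
  by (simp_all add: vec3_def axis_def)

lemma lborel_vec3:
  "distr ((lborel \<Otimes>\<^sub>M lborel) \<Otimes>\<^sub>M lborel) borel (\<lambda>p. vec3 (fst (fst p)) (snd (fst p)) (snd p)) = lborel"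
    (is "?D = _")
proof (rule lborel_eqI[symmetric])
  fix l u :: "real ^ 3"
  assume lu: "\<And>b. b \<in> Basis \<Longrightarrow> l \<bullet> b \<le> u \<bullet> b"
  have le: "l $ i \<le> u $ i" for i using lu[of "axis i 1"] by (simp add: inner_axis axis_in_Basis_iff)
  have m [measurable]: "(\<lambda>p. vec3 (fst (fst p)) (snd (fst p)) (snd p)) \<in> borel_measurable ((lborel \<Otimes>\<^sub>M lborel)
      \<Otimes>\<^sub>M lborel)"
    unfolding vec3_def by measurable
  have v: "(\<lambda>p. vec3 (fst (fst p)) (snd (fst p)) (snd p)) -` box l u =
    ({l$1<..<u$1} \<times> {l$2<..<u$2}) \<times> {l$3<..<u$3}"
    by (auto simp: mem_box_cart forall_3)
  have "emeasure ?D (box l u) =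
      emeasure ((lborel \<Otimes>\<^sub>M lborel) \<Otimes>\<^sub>M lborel) (({l$1<..<u$1} \<times> {l$2<..<u$2}) \<times> {l$3<..<u$3})"
    by (subst emeasure_distr) (simp_all add: v space_pair_measure del: lborel_prod)
  also have "\<dots> = ennreal (u$1 - l$1) * ennreal (u$2 - l$2) * ennreal (u$3 - l$3)"
    using le by (simp add: lborel.emeasure_pair_measure_Times del: lborel_prod)
  also have "\<dots> = ennreal (\<Prod>b\<in>Basis. (u - l) \<bullet> b)"
  proof -
    have B: "(Basis :: (real^3) set) = range (\<lambda>i. axis i 1)" by (auto simp: Basis_vec_def)
    have "(\<Prod>b\<in>Basis. (u - l) \<bullet> b) = (\<Prod>i\<in>UNIV. u $ i - l $ i)"
      unfolding B by (subst prod.reindex) (auto simp: inj_on_def axis_eq_axis inner_axis)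
    then show ?thesis using le by (simp only: UNIV_3) (simp add: ennreal_mult mult.assoc)
  qed
  finally show "emeasure ?D (box l u) = ennreal (\<Prod>b\<in>Basis. (u - l) \<bullet> b)" .
qed (simp only: sets_distr)

text \<open>
  Polar coordinates in a form adapted to \<open>(Y, Z)\<close>. Under Lebesgue measure on the plane the squared
  radius has constant density \<open>\<pi>\<close>, and on the line the square has density \<open>1 / sqrt s\<close>. At
  \<open>s = z - y\<close> the latter is \<open>spike z y\<close>.
\<close>

lemma nn_integral_vec3:
  fixes h :: "real \<Rightarrow> real \<Rightarrow> ennreal"
  assumes [measurable]: "(\<lambda>p. h (fst p) (snd p)) \<in> borel_measurable (borel \<Otimes>\<^sub>M borel)"
  shows "(\<integral>\<^sup>+x. h ((x$1)\<^sup>2 + (x$2)\<^sup>2) ((x$1)\<^sup>2 + (x$2)\<^sup>2 + (x$3)\<^sup>2) \<partial>(lborel :: (real^3) measure))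
     = (\<integral>\<^sup>+z. \<integral>\<^sup>+y. ennreal (pi * indicator {0<..} y * spike z y) * h y z \<partial>lborel \<partial>lborel)"
proof -
  have [measurable]: "(\<lambda>p. vec3 (fst (fst p)) (snd (fst p)) (snd p)) \<in> borel_measurable ((lborel \<Otimes>\<^sub>M lborel)
      \<Otimes>\<^sub>M lborel)"
    unfolding vec3_def by measurable
  define J where "J r = (\<integral>\<^sup>+c. h r (r + c\<^sup>2) \<partial>lborel)" for r
  have hm [measurable]: "(\<lambda>x. h (f x) (g x)) \<in> borel_measurable A" if "f \<in> borel_measurable A" "g \<in>
      borel_measurable A"
    for f g and A :: "'b measure"
    using measurable_compose[OF measurable_Pair[OF that] assms] by simp
  have Jm [measurable]: "J \<in> borel_measurable borel" unfolding J_def by measurable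
  have J: "J r = (\<integral>\<^sup>+z. ennreal (spike z r) * h r z \<partial>lborel)" for r
  proof -
    have "J r = (\<integral>\<^sup>+s. h r (r + s) \<partial>(distr lborel borel (\<lambda>x. x\<^sup>2)))"
      unfolding J_def by (subst nn_integral_distr) auto
    also have "\<dots> = (\<integral>\<^sup>+s. ennreal (indicator {0<..} s / sqrt s) * h r (r + s) \<partial>lborel)"
      unfolding distr_power2_lborel by (subst nn_integral_density) auto
    also have "\<dots> = (\<integral>\<^sup>+s. ennreal (spike (r + 1 * s) r) * h r (r + 1 * s) \<partial>lborel)"
      by (intro nn_integral_cong) (auto simp: spike_def indicator_def)
    also have "\<dots> = (\<integral>\<^sup>+z. ennreal (spike z r) * h r z \<partial>lborel)"
      by (subst nn_integral_real_affine[of "\<lambda>z. ennreal (spike z r) * h r z" 1 r]) (auto simp: spike_def)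
    finally show ?thesis .
  qed
  have "(\<integral>\<^sup>+x. h ((x$1)\<^sup>2 + (x$2)\<^sup>2) ((x$1)\<^sup>2 + (x$2)\<^sup>2 + (x$3)\<^sup>2) \<partial>(lborel :: (real^3) measure)) =
     (\<integral>\<^sup>+p. h ((fst (fst p))\<^sup>2 + (snd (fst p))\<^sup>2) ((fst (fst p))\<^sup>2 + (snd (fst p))\<^sup>2 + (snd p)\<^sup>2)
        \<partial>((lborel \<Otimes>\<^sub>M lborel) \<Otimes>\<^sub>M lborel))"
    unfolding lborel_vec3[symmetric] by (subst nn_integral_distr) auto
  also have "\<dots> = (\<integral>\<^sup>+q. J ((fst q)\<^sup>2 + (snd q)\<^sup>2) \<partial>(lborel \<Otimes>\<^sub>M lborel))"
    unfolding J_def by (subst lborel.nn_integral_fst[symmetric]) auto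
  also have "\<dots> = (\<integral>\<^sup>+r. J r \<partial>(distr (lborel \<Otimes>\<^sub>M lborel) borel (\<lambda>p. (fst p)\<^sup>2 + (snd p)\<^sup>2)))"
    by (subst nn_integral_distr) auto
  also have "\<dots> = (\<integral>\<^sup>+r. ennreal (pi * indicator {0<..} r) * J r \<partial>lborel)"
    unfolding distr_disk_lborel by (subst nn_integral_density) auto
  also have "\<dots> = (\<integral>\<^sup>+y. \<integral>\<^sup>+z. ennreal (pi * indicator {0<..} y * spike z y) * h y z \<partial>lborel \<partial>lborel)"
    unfolding J by (subst nn_integral_cmult[symmetric])
      (auto simp: spike_def ennreal_mult mult.assoc)
  also have "\<dots> = (\<integral>\<^sup>+z. \<integral>\<^sup>+y. ennreal (pi * indicator {0<..} y * spike z y) * h y z \<partial>lborel \<partial>lborel)"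
    by (rule lborel_pair.Fubini') (simp add: spike_def split_beta')
  finally show ?thesis .
qed

lemma nn_integral_spike_interval:
  assumes "a \<le> b"
  shows "(\<integral>\<^sup>+y. ennreal (indicator {a<..b} y * spike z y) \<partial>lborel) = ennreal (2 * sqrt_gap a b z)"
proof -
  have "(\<integral>\<^sup>+y. ennreal (indicator {a<..b} y * spike z y) \<partial>lborel) =
      (\<integral>\<^sup>+y. ennreal (indicator {a..b} y * spike z y) \<partial>lborel)"
    using AE_lborel_singleton[of a] by (intro nn_integral_cong_AE) (auto elim!: eventually_mono simp:
        indicator_def)
  also have "\<dots> = ennreal (2 * sqrt_gap a b z)"
    using has_bochner_integral_spike[OF assms, of z]
    by (subst nn_integral_eq_integral) (auto simp: has_bochner_integral_iff)
  finally show ?thesis .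
qed

lemma nn_integral_spike_pos:
  assumes "0 \<le> z" shows "(\<integral>\<^sup>+y. ennreal (indicator {0<..} y * spike z y) \<partial>lborel) = ennreal (2 * sqrt z)"
proof -
  have e: "indicat_real {0<..} y * spike z y = indicat_real {0<..z} y * spike z y" for y
    by (auto simp: indicator_def spike_def)
  show ?thesis unfolding e nn_integral_spike_interval[OF assms] using assms by (simp add: sqrt_gap_def)
qed

text \<open>
  The beta integral \<open>B(1/2, 1/2) = \<pi>\<close> on the interval from \<open>u\<close> to \<open>z\<close>.
\<close>

lemma has_bochner_integral_spike_spike:
  assumes "0 \<le> u"
  shows "has_bochner_integral lborel (\<lambda>y. indicator {0<..} y * spike z y * spike y u) (if u < z then pi else 0)"
proof -
  have "has_bochner_integral lborel (\<lambda>v. 2 * (indicator {0<..} v * (spike (z - u) v / (2 * sqrt v)))) (2 *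
      tail_kern (z - u) 0)"
    by (rule has_bochner_integral_mult_right[OF has_bochner_integral_spike_over_sqrt]) simp
  moreover have "2 * (indicator {0<..} v * (spike (z - u) v / (2 * sqrt v)))
      = indicator {0<..} (u + 1 * v) * spike z (u + 1 * v) * spike (u + 1 * v) u" for v
    using assms by (auto simp: indicator_def spike_def diff_diff_eq)
  moreover have "2 * tail_kern (z - u) 0 = (if u < z then pi else 0)" by (simp add: tail_kern_def)
  ultimately show ?thesis
    using lborel_has_bochner_integral_real_affine_iff[of 1 "\<lambda>y. indicator {0<..} y * spike z y * spike y u" _
        u] by simp
qed

text \<open>
  The inversion formula behind the estimator, for a fixed value \<open>z\<close> of \<open>Z\<close>. Given \<open>Z = z\<close>, the
  variable \<open>Y\<close> has density \<open>spike z y / (2 * sqrt z)\<close> on \<open>{0<..<z}\<close>. For this law \<open>V\<close> is constant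
  to the left of \<open>z\<close> and zero to the right, so \<open>F_functional V\<close> is the distribution function of
  the point mass at \<open>z\<close>, with primitive \<open>max 0 (x - z) = x - min x z\<close>.
\<close>

lemma nn_integral_spike_ikern:
  assumes z: "0 < z" and x: "0 \<le> x"
  shows "(\<integral>\<^sup>+y. ennreal (indicator {0<..} y * spike z y) * ennreal (x - ikern y x) \<partial>lborel) =
      ennreal (2 * sqrt z * min x z)"
proof -
  define d where "d y = indicator {0<..} y * spike z y / (2 * sqrt z)" for y
  have d0: "0 \<le> d y" for y using z by (simp add: d_def)
  have sm [measurable]: "spike z \<in> borel_measurable borel" unfolding spike_def by measurable
  have dm [measurable]: "d \<in> borel_measurable borel" unfolding d_def by measurable
  have sp [measurable]: "(\<lambda>y. spike y u) \<in> borel_measurable borel" for u unfolding spike_def by measurable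
  define \<mu> where "\<mu> = density lborel (\<lambda>y. ennreal (d y))"
  have split: "ennreal (indicator {0<..} y * spike z y) = ennreal (2 * sqrt z) * ennreal (d y)" for y
    using z by (simp add: d_def ennreal_mult[symmetric])
  have "ennreal (2 * sqrt z) * (\<integral>\<^sup>+y. ennreal (d y) \<partial>lborel) = ennreal (2 * sqrt z)"
    using nn_integral_spike_pos[of z] z by (subst nn_integral_cmult[symmetric]) (auto simp: split)
  then have "(\<integral>\<^sup>+y. ennreal (d y) \<partial>lborel) = 1"
    using z ennreal_mult_cancel_left[of "ennreal (2 * sqrt z)" "\<integral>\<^sup>+y. ennreal (d y) \<partial>lborel" 1] by simp
  then have ps: "prob_space \<mu>" by (intro prob_spaceI) (simp add: \<mu>_def emeasure_density)
  interpret prob_space \<mu> by fact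
  define V where "V u = (if u < z then pi / (2 * sqrt z) else 0)" for u
  have V: "V u = (\<integral>y. spike y u \<partial>\<mu>)" if u: "0 \<le> u" for u
  proof -
    have "(\<integral>y. spike y u \<partial>\<mu>) = (\<integral>y. d y * spike y u \<partial>lborel)"
      unfolding \<mu>_def by (subst integral_density) (use d0 in auto)
    also have "\<dots> = (\<integral>y. (indicator {0<..} y * spike z y * spike y u) / (2 * sqrt z) \<partial>lborel)"
      by (simp add: d_def)
    also have "\<dots> = V u"
      using has_bochner_integral_spike_spike[OF u, of z] by (auto simp: has_bochner_integral_iff V_def)
    finally show ?thesis by simp
  qed
  have tail: "(LINT u:{t<..}|lborel. V u / (2 * sqrt u)) = pi / (2 * sqrt z) * max 0 (sqrt z - sqrt t)" if t:
      "0 \<le> t" for t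
  proof (cases "t < z")
    case True
    have "((\<lambda>u. 1 / (2 * sqrt u)) has_integral sqrt z - sqrt t) {t..z}"
      by (rule fundamental_theorem_of_calculus_interior)
        (use True t in \<open>auto intro!: derivative_eq_intros continuous_intros
          simp: has_real_derivative_iff_has_vector_derivative[symmetric] field_simps\<close>)
    then have "has_bochner_integral lborel (\<lambda>u. indicator {t..z} u * (1 / (2 * sqrt u))) (sqrt z - sqrt t)"
      by (intro has_bochner_integral_of_nonneg_has_integral) (use t in auto)
    from has_bochner_integral_mult_right[OF this, of "pi / (2 * sqrt z)"]
    have "(\<integral>u. pi / (2 * sqrt z) * (indicator {t..z} u * (1 / (2 * sqrt u))) \<partial>lborel) =
        pi / (2 * sqrt z) * (sqrt z - sqrt t)"
      by (simp add: has_bochner_integral_iff)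
    moreover have "(LINT u:{t<..}|lborel. V u / (2 * sqrt u)) =
        (\<integral>u. pi / (2 * sqrt z) * (indicator {t..z} u * (1 / (2 * sqrt u))) \<partial>lborel)"
      unfolding set_lebesgue_integral_def
    proof (rule integral_cong_AE)
      show "AE u in lborel. indicat_real {t<..} u *\<^sub>R (V u / (2 * sqrt u)) =
          pi / (2 * sqrt z) * (indicat_real {t..z} u * (1 / (2 * sqrt u)))"
        using AE_lborel_singleton[of t] AE_lborel_singleton[of z]
            by eventually_elim (auto simp: V_def indicator_def)
    qed (auto simp: V_def)
    ultimately show ?thesis using True by simp
  next
    case False
    then have e: "indicat_real {t<..} u *\<^sub>R (V u / (2 * sqrt u)) = 0" for u by (auto simp: V_def indicator_def)
    show ?thesis using False z t unfolding set_lebesgue_integral_def e by simp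
  qed
  have F: "F_functional V t = indicator {z..} t" if t: "0 \<le> t" for t
    unfolding F_functional_def tail[OF t] using z t by (auto simp: V_def indicator_def field_simps)
  have "(\<integral>y. ikern y x \<partial>\<mu>) = (LINT t:{0..x}|lborel. F_functional V t)"
    by (rule integral_F_functional[symmetric]) (use ps V x in \<open>auto simp: \<mu>_def\<close>)
  also have "\<dots> = (\<integral>t. indicator {z..x} t \<partial>lborel)"
    unfolding set_lebesgue_integral_def using F z by (intro Bochner_Integration.integral_cong) (auto simp:
        indicator_def)
  also have "\<dots> = max 0 (x - z)" by simp
  finally have I: "(\<integral>y. ikern y x \<partial>\<mu>) = max 0 (x - z)" .
  have ii: "integrable \<mu> (\<lambda>y. ikern y x)"
    by (rule integrable_const_bound[of _ "3 * x"]) (use abs_ikern_le[OF x] borel_measurable_ikern[OF x] in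
        \<open>auto simp: \<mu>_def\<close>)
  have "(\<integral>\<^sup>+y. ennreal (x - ikern y x) \<partial>\<mu>) = ennreal (\<integral>y. x - ikern y x \<partial>\<mu>)"
    by (rule nn_integral_eq_integral) (use ii ikern_le[OF x] in auto)
  also have "(\<integral>y. x - ikern y x \<partial>\<mu>) = min x z" using ii I by (simp add: prob_space)
  finally have "(\<integral>\<^sup>+y. ennreal (d y) * ennreal (x - ikern y x) \<partial>lborel) = ennreal (min x z)"
    unfolding \<mu>_def using borel_measurable_ikern[OF x] by (subst (asm) nn_integral_density) auto
  then have "ennreal (2 * sqrt z) * (\<integral>\<^sup>+y. ennreal (d y) * ennreal (x - ikern y x) \<partial>lborel) =
      ennreal (2 * sqrt z) * ennreal (min x z)"
    by simp
  then show ?thesis unfolding split using z x borel_measurable_ikern[OF x]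
    by (subst (asm) nn_integral_cmult[symmetric]) (auto simp: ennreal_mult[symmetric] mult.assoc)
qed

locale spherical =
  fixes P :: "'p measure" and X :: "'p \<Rightarrow> real ^ 3" and \<rho> :: "real \<Rightarrow> real"
  assumes prob_P: "prob_space P"
    and rho_nonneg: "\<And>z. z \<ge> 0 \<Longrightarrow> \<rho> z \<ge> 0"
    and X: "distributed P lborel X (\<lambda>x. ennreal (\<rho> ((x $ 1)\<^sup>2 + (x $ 2)\<^sup>2 + (x $ 3)\<^sup>2)))"
begin

sublocale prob_space P by (rule prob_P)

text \<open>
  The density of \<open>X\<close> is composed of \<open>\<rho>\<close> and a nonnegative function, so it determines \<open>\<rho>\<close> on the
  nonnegative half line. Extension by zero makes this a measurable function on the whole line.
\<close>

definition "radial z = (if 0 \<le> z then \<rho> z else 0)"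
definition "Y2 \<omega> = (X \<omega> $ 1)\<^sup>2 + (X \<omega> $ 2)\<^sup>2"
definition "Z2 \<omega> = (X \<omega> $ 1)\<^sup>2 + (X \<omega> $ 2)\<^sup>2 + (X \<omega> $ 3)\<^sup>2"

lemma radial_nonneg: "0 \<le> radial z" using rho_nonneg by (simp add: radial_def)

lemma X_measurable [measurable]: "X \<in> borel_measurable P"
  using distributed_measurable[OF X] by simp

lemma YZ_measurable [measurable]: "Y2 \<in> borel_measurable P" "Z2 \<in> borel_measurable P"
proof -
  have [measurable]: "(\<lambda>x::real^3. x $ i) \<in> borel_measurable borel" for i
    by (intro borel_measurable_continuous_onI continuous_intros)
  show "Y2 \<in> borel_measurable P" "Z2 \<in> borel_measurable P" unfolding Y2_def Z2_def by measurable
qed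

lemma YZ_nonneg: "0 \<le> Y2 \<omega>" "0 \<le> Z2 \<omega>" by (simp_all add: Y2_def Z2_def)

lemma radial_measurable [measurable]: "radial \<in> borel_measurable borel"
proof -
  have "(\<lambda>z. vec3 (sqrt z) 0 0) \<in> borel_measurable borel" unfolding vec3_def by measurable
  moreover have "(\<lambda>x::real^3. ennreal (\<rho> ((x $ 1)\<^sup>2 + (x $ 2)\<^sup>2 + (x $ 3)\<^sup>2))) \<in> borel_measurable borel"
    using distributed_borel_measurable[OF X] by simp
  ultimately have m: "(\<lambda>z. ennreal (\<rho> ((sqrt z)\<^sup>2 + 0\<^sup>2 + 0\<^sup>2))) \<in> borel_measurable borel"
    by (simp add: measurable_compose[of "\<lambda>z. vec3 (sqrt z) 0 0" borel borel "\<lambda>x. ennreal (\<rho> ((x $ 1)\<^sup>2 +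
        (x $ 2)\<^sup>2 + (x $ 3)\<^sup>2))" borel, simplified])
  have "radial = (\<lambda>z. if 0 \<le> z then enn2real (ennreal (\<rho> ((sqrt z)\<^sup>2 + 0\<^sup>2 + 0\<^sup>2))) else 0)"
    using rho_nonneg by (auto simp: radial_def fun_eq_iff)
  also have "\<dots> \<in> borel_measurable borel" using m by measurable
  finally show ?thesis .
qed

lemma joint_law:
  assumes [measurable]: "(\<lambda>p. h (fst p) (snd p)) \<in> borel_measurable (borel \<Otimes>\<^sub>M borel)"
  shows "(\<integral>\<^sup>+\<omega>. h (Y2 \<omega>) (Z2 \<omega>) \<partial>P)
    = (\<integral>\<^sup>+z. ennreal (pi * radial z) * (\<integral>\<^sup>+y. ennreal (indicator {0<..} y * spike z y) * h y z \<partial>lborel)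
        \<partial>lborel)"
proof -
  have hm [measurable]: "(\<lambda>x. h (f x) (g x)) \<in> borel_measurable A" if "f \<in> borel_measurable A" "g \<in>
      borel_measurable A"
    for f g and A :: "'b measure"
    using measurable_compose[OF measurable_Pair[OF that] assms] by simp
  have "(\<integral>\<^sup>+\<omega>. h (Y2 \<omega>) (Z2 \<omega>) \<partial>P) =
     (\<integral>\<^sup>+x. ennreal (\<rho> ((x $ 1)\<^sup>2 + (x $ 2)\<^sup>2 + (x $ 3)\<^sup>2)) * h ((x $ 1)\<^sup>2 + (x $ 2)\<^sup>2) ((x $ 1)\<^sup>2 +
         (x $ 2)\<^sup>2 + (x $ 3)\<^sup>2) \<partial>(lborel :: (real^3) measure))"
  proof -
    have [measurable]: "(\<lambda>x::real^3. x $ i) \<in> borel_measurable lborel" for i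
      unfolding measurable_lborel2 by (intro borel_measurable_continuous_onI continuous_intros)
    show ?thesis unfolding Y2_def Z2_def by (subst distributed_nn_integral[OF X]) measurable
  qed
  also have "\<dots> = (\<integral>\<^sup>+x. ennreal (radial ((x $ 1)\<^sup>2 + (x $ 2)\<^sup>2 + (x $ 3)\<^sup>2)) * h ((x $ 1)\<^sup>2 +
      (x $ 2)\<^sup>2) ((x $ 1)\<^sup>2 + (x $ 2)\<^sup>2 + (x $ 3)\<^sup>2) \<partial>(lborel :: (real^3) measure))"
    by (simp add: radial_def)
  also have "\<dots> = (\<integral>\<^sup>+z. \<integral>\<^sup>+y. ennreal (pi * indicator {0<..} y * spike z y) * (ennreal (radial z) * h y z)
      \<partial>lborel \<partial>lborel)"
    by (rule nn_integral_vec3) measurable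
  also have "\<dots> = (\<integral>\<^sup>+z. ennreal (pi * radial z) * (\<integral>\<^sup>+y. ennreal (indicator {0<..} y * spike z y) * h y z
      \<partial>lborel) \<partial>lborel)"
  proof (rule nn_integral_cong)
    fix z
    have [measurable]: "spike z \<in> borel_measurable borel" unfolding spike_def by measurable
    show "(\<integral>\<^sup>+y. ennreal (pi * indicator {0<..} y * spike z y) * (ennreal (radial z) * h y z) \<partial>lborel) =
      ennreal (pi * radial z) * (\<integral>\<^sup>+y. ennreal (indicator {0<..} y * spike z y) * h y z \<partial>lborel)"
      by (subst nn_integral_cmult[symmetric])
        (use radial_nonneg[of z] in \<open>auto simp: ennreal_mult ac_simps intro!: nn_integral_cong\<close>)
  qed
  finally show ?thesis .
qed

lemma law_Z:
  assumes [measurable]: "k \<in> borel_measurable borel"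
  shows "(\<integral>\<^sup>+\<omega>. k (Z2 \<omega>) \<partial>P) = (\<integral>\<^sup>+z. ennreal (radial_density radial z) * k z \<partial>lborel)"
proof -
  have "(\<integral>\<^sup>+\<omega>. k (Z2 \<omega>) \<partial>P) = (\<integral>\<^sup>+z. ennreal (pi * radial z) * (\<integral>\<^sup>+y. ennreal (indicator {0<..} y * spike z y)
      * k z \<partial>lborel) \<partial>lborel)"
    by (rule joint_law) simp
  also have "\<dots> = (\<integral>\<^sup>+z. ennreal (radial_density radial z) * k z \<partial>lborel)"
  proof (rule nn_integral_cong)
    fix z
    have [measurable]: "spike z \<in> borel_measurable borel" unfolding spike_def by measurable
    show "ennreal (pi * radial z) * (\<integral>\<^sup>+y. ennreal (indicator {0<..} y * spike z y) * k z \<partial>lborel) =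
        ennreal (radial_density radial z) * k z"
    proof (cases "0 \<le> z")
      case True
      have "(\<integral>\<^sup>+y. ennreal (indicator {0<..} y * spike z y) * k z \<partial>lborel) = ennreal (2 * sqrt z) * k z"
        by (subst nn_integral_multc) (simp_all add: nn_integral_spike_pos[OF True])
      moreover have "ennreal (pi * radial z) * ennreal (2 * sqrt z) = ennreal (radial_density radial z)"
        using radial_nonneg[of z] True by (simp add: radial_density_def ennreal_mult[symmetric] mult_ac)
      ultimately show ?thesis by (metis mult.assoc)
    qed (simp add: radial_def radial_density_def)
  qed
  finally show ?thesis .
qed

text \<open>
  The primitive of the distribution function of \<open>Z\<close>, in the form that shows its convexity at once.
  It is the limit of the primitives \<open>H_of (Gn n)\<close>.
\<close>

definition "Hinf x = expectation (\<lambda>\<omega>. max 0 (x - Z2 \<omega>))"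

lemma integrable_pos_part: "integrable P (\<lambda>\<omega>. max 0 (x - Z2 \<omega>))"
proof (rule integrable_const_bound[of _ "\<bar>x\<bar>"])
  have "norm (max 0 (x - Z2 \<omega>)) \<le> \<bar>x\<bar>" for \<omega> using YZ_nonneg(2)[of \<omega>] by (auto simp: max_def)
  then show "AE \<omega> in P. norm (max 0 (x - Z2 \<omega>)) \<le> \<bar>x\<bar>" by simp
qed measurable

lemma expectation_ikern:
  assumes x: "0 \<le> x"
  shows "expectation (\<lambda>\<omega>. ikern (Y2 \<omega>) x) = Hinf x"
proof -
  have [measurable]: "(\<lambda>y. ikern y x) \<in> borel_measurable borel" using x by (rule borel_measurable_ikern)
  have ii: "integrable P (\<lambda>\<omega>. ikern (Y2 \<omega>) x)"
    by (rule integrable_const_bound[of _ "3 * x"]) (use abs_ikern_le[OF x] in auto)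
  have im: "integrable P (\<lambda>\<omega>. min x (Z2 \<omega>))"
    by (rule integrable_const_bound[of _ x]) (use x YZ_nonneg in \<open>auto simp: min_def\<close>)
  have "(\<integral>\<^sup>+\<omega>. ennreal (x - ikern (Y2 \<omega>) x) \<partial>P) = (\<integral>\<^sup>+z. ennreal (pi * radial z) *
      (\<integral>\<^sup>+y. ennreal (indicator {0<..} y * spike z y) * ennreal (x - ikern y x) \<partial>lborel) \<partial>lborel)"
    by (rule joint_law[of "\<lambda>y z. ennreal (x - ikern y x)"]) simp
  also have "\<dots> = (\<integral>\<^sup>+z. ennreal (radial_density radial z) * ennreal (min x z) \<partial>lborel)"
  proof (rule nn_integral_cong_AE)
    show "AE z in lborel. ennreal (pi * radial z) * (\<integral>\<^sup>+y. ennreal (indicator {0<..} y * spike z y) * ennreal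
        (x - ikern y x) \<partial>lborel) =
      ennreal (radial_density radial z) * ennreal (min x z)"
      using AE_lborel_singleton[of 0]
    proof eventually_elim
      case (elim z)
      show ?case
      proof (cases "0 < z")
        case True
        then show ?thesis using radial_nonneg[of z] x
          by (simp only: nn_integral_spike_ikern[OF True x]) (simp add: radial_density_def
              ennreal_mult[symmetric] ac_simps)
      next
        case False
        then show ?thesis using elim by (simp add: radial_def radial_density_def)
      qed
    qed
  qed
  also have "\<dots> = (\<integral>\<^sup>+\<omega>. ennreal (min x (Z2 \<omega>)) \<partial>P)" by (rule law_Z[symmetric]) simp
  finally have "ennreal (expectation (\<lambda>\<omega>. x - ikern (Y2 \<omega>) x)) = ennreal (expectation (\<lambda>\<omega>. min x (Z2 \<omega>)))"
    by (subst (asm) (1 2) nn_integral_eq_integral) (use ii im ikern_le[OF x] x YZ_nonneg in auto)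
  then have "expectation (\<lambda>\<omega>. x - ikern (Y2 \<omega>) x) = expectation (\<lambda>\<omega>. min x (Z2 \<omega>))"
    using ikern_le[OF x] x YZ_nonneg by (subst (asm) ennreal_inj) (auto intro!: integral_nonneg_AE)
  then have "expectation (\<lambda>\<omega>. ikern (Y2 \<omega>) x) = expectation (\<lambda>\<omega>. x - min x (Z2 \<omega>))"
    using ii im by (simp add: prob_space)
  also have "\<dots> = Hinf x" unfolding Hinf_def by (intro Bochner_Integration.integral_cong) auto
  finally show ?thesis .
qed

lemma prob_Y_interval:
  assumes "0 \<le> a" "a \<le> b"
  shows "has_bochner_integral lborel (\<lambda>z. 2 * pi * radial z * sqrt_gap a b z) (prob {\<omega> \<in> space P. a < Y2 \<omega> \<and> Y2
      \<omega> \<le> b})"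
proof (rule has_bochner_integral_nn_integral)
  have "(\<integral>\<^sup>+\<omega>. indicator {a<..b} (Y2 \<omega>) \<partial>P) = (\<integral>\<^sup>+z. ennreal (pi * radial z) *
      (\<integral>\<^sup>+y. ennreal (indicator {0<..} y * spike z y) * indicator {a<..b} y \<partial>lborel) \<partial>lborel)"
    by (rule joint_law[of "\<lambda>y z. indicator {a<..b} y"]) simp
  also have "\<dots> = (\<integral>\<^sup>+z. ennreal (2 * pi * radial z * sqrt_gap a b z) \<partial>lborel)"
  proof (rule nn_integral_cong)
    fix z
    have "(\<integral>\<^sup>+y. ennreal (indicator {0<..} y * spike z y) * indicator {a<..b} y \<partial>lborel) =
        (\<integral>\<^sup>+y. ennreal (indicator {a<..b} y * spike z y) \<partial>lborel)"
      using assms by (intro nn_integral_cong) (auto simp: indicator_def)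
    also have "\<dots> = ennreal (2 * sqrt_gap a b z)" by (rule nn_integral_spike_interval[OF assms(2)])
    finally show "ennreal (pi * radial z) * (\<integral>\<^sup>+y. ennreal (indicator {0<..} y * spike z y) * indicator {a<..b}
        y \<partial>lborel)
      = ennreal (2 * pi * radial z * sqrt_gap a b z)"
      using radial_nonneg[of z] sqrt_gap_nonneg[OF assms(2), of z]
      by (simp only:) (simp add: ennreal_mult[symmetric] mult_ac)
  qed
  also have "(\<integral>\<^sup>+\<omega>. indicator {a<..b} (Y2 \<omega>) \<partial>P) = emeasure P {\<omega> \<in> space P. a < Y2 \<omega> \<and> Y2 \<omega> \<le> b}"
  proof -
    have "{\<omega> \<in> space P. a < Y2 \<omega> \<and> Y2 \<omega> \<le> b} \<in> sets P" by measurable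
    moreover have "(\<integral>\<^sup>+\<omega>. indicator {a<..b} (Y2 \<omega>) \<partial>P) =
        (\<integral>\<^sup>+\<omega>. indicator {\<omega> \<in> space P. a < Y2 \<omega> \<and> Y2 \<omega> \<le> b} \<omega> \<partial>P)"
      by (intro nn_integral_cong) (simp add: indicator_def)
    ultimately show ?thesis by simp
  qed
  finally show "(\<integral>\<^sup>+z. ennreal (2 * pi * radial z * sqrt_gap a b z) \<partial>lborel) =
      ennreal (prob {\<omega> \<in> space P. a < Y2 \<omega> \<and> Y2 \<omega> \<le> b})"
    by (simp add: emeasure_eq_measure)
  show "(\<lambda>z. 2 * pi * radial z * sqrt_gap a b z) \<in> borel_measurable lborel" unfolding sqrt_gap_def by measurable
qed (use radial_nonneg sqrt_gap_nonneg[OF assms(2)] in auto)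

end

section \<open>The law of the squared projection near a point\<close>

context spherical begin

definition "GY = cdf (distr P borel Y2)"

sublocale Y: real_distribution "distr P borel Y2" by (rule real_distribution_distr) measurable

lemma GY_diff:
  assumes "a \<le> b" shows "GY b - GY a = prob {\<omega> \<in> space P. a < Y2 \<omega> \<and> Y2 \<omega> \<le> b}"
proof (cases "a = b")
  case False
  then have "GY b - GY a = measure (distr P borel Y2) {a<..b}"
    unfolding GY_def using assms by (intro Y.cdf_diff_eq) auto
  also have "\<dots> = prob (Y2 -` {a<..b} \<inter> space P)" by (subst measure_distr) auto
  also have "Y2 -` {a<..b} \<inter> space P = {\<omega> \<in> space P. a < Y2 \<omega> \<and> Y2 \<omega> \<le> b}" by auto
  finally show ?thesis .
next
  case True
  then have "{\<omega> \<in> space P. a < Y2 \<omega> \<and> Y2 \<omega> \<le> b} = {}" by auto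
  then show ?thesis using True by (simp only: measure_empty diff_self)
qed

lemma proj_density_integral:
  assumes x0: "0 < x0" and pos: "0 < proj_density \<rho> x0"
  shows "has_bochner_integral lborel (\<lambda>z. pi * radial z * spike z x0) (proj_density \<rho> x0)"
proof -
  have e: "indicator {x0<..} z *\<^sub>R (\<rho> z / sqrt (z - x0)) = radial z * spike z x0" for z
    using x0 by (auto simp: indicator_def radial_def spike_def)
  have pd: "proj_density \<rho> x0 = pi * (\<integral>z. radial z * spike z x0 \<partial>lborel)"
    unfolding proj_density_def set_lebesgue_integral_def e ..
  then have "integrable lborel (\<lambda>z. radial z * spike z x0)"
    using pos not_integrable_integral_eq by fastforce
  from has_bochner_integral_mult_right[OF has_bochner_integral_integrable[OF this], of pi]
  show ?thesis by (simp add: pd mult.assoc)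
qed

lemma sqrt_gap_le_spike: "0 \<le> s \<Longrightarrow> sqrt_gap x0 (x0 + s) z \<le> s * spike z x0"
  using sqrt_gap_le_divide[of x0 "x0 + s" z] sqrt_gap_eq_0[of z x0 "x0 + s"] by (auto simp: spike_def)

text \<open>
  To the right of \<open>x0\<close> the increments of \<open>G\<close> are dominated through
  \<open>sqrt_gap x0 (x0 + s) z \<le> s * spike z x0\<close>, whose average over \<open>z\<close> is finite because \<open>g x0\<close> is.
\<close>

lemma GY_right_le:
  assumes x0: "0 < x0" and pos: "0 < proj_density \<rho> x0" and s: "0 \<le> s"
  shows "GY (x0 + s) - GY x0 \<le> 2 * proj_density \<rho> x0 * s"
proof -
  note B = prob_Y_interval[of x0 "x0 + s"] proj_density_integral[OF x0 pos]
  have "GY (x0 + s) - GY x0 = (\<integral>z. 2 * pi * radial z * sqrt_gap x0 (x0 + s) z \<partial>lborel)"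
    using B(1) GY_diff[of x0 "x0 + s"] s x0 by (simp add: has_bochner_integral_iff)
  also have "\<dots> \<le> (\<integral>z. 2 * s * (pi * radial z * spike z x0) \<partial>lborel)"
  proof (rule integral_mono)
    show "2 * pi * radial z * sqrt_gap x0 (x0 + s) z \<le> 2 * s * (pi * radial z * spike z x0)" for z
      using mult_left_mono[OF sqrt_gap_le_spike[OF s, of x0 z], of "2 * pi * radial z"] radial_nonneg[of z]
      by (simp add: mult_ac)
  qed (use B s x0 in \<open>auto simp: has_bochner_integral_iff\<close>)
  also have "\<dots> = 2 * s * proj_density \<rho> x0" using B(2) by (simp add: has_bochner_integral_iff)
  finally show ?thesis by (simp add: mult_ac)
qed

text \<open>
  The domination of \<open>GY_right_le\<close> also permits passing to the limit in the difference quotient.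
\<close>

lemma GY_right_derivative:
  assumes x0: "0 < x0" and pos: "0 < proj_density \<rho> x0"
  shows "((\<lambda>s. (GY (x0 + s) - GY x0) / s) \<longlongrightarrow> proj_density \<rho> x0) (at_right 0)"
  unfolding tendsto_at_iff_sequentially
proof safe
  fix S :: "nat \<Rightarrow> real" assume S: "\<forall>i. S i \<in> {0<..} - {0}" "S \<longlonglongrightarrow> 0"
  have S0: "0 < S i" for i using S(1) by auto
  note B = proj_density_integral[OF x0 pos]
  have q: "(GY (x0 + S i) - GY x0) / S i = (\<integral>z. 2 * pi * radial z * (sqrt_gap x0 (x0 +
      S i) z / S i) \<partial>lborel)" for i
    using prob_Y_interval[of x0 "x0 + S i"] GY_diff[of x0 "x0 + S i"] S0[of i] x0
        by (simp add: has_bochner_integral_iff)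
  have lim: "(\<lambda>i. \<integral>z. 2 * pi * radial z * (sqrt_gap x0 (x0 + S i) z / S i) \<partial>lborel) \<longlonglongrightarrow> (\<integral>z. pi * radial z *
      spike z x0 \<partial>lborel)"
  proof (rule integral_dominated_convergence[where w = "\<lambda>z. 2 * (pi * radial z * spike z x0)"])
    show "AE z in lborel. (\<lambda>i. 2 * pi * radial z * (sqrt_gap x0 (x0 +
        S i) z / S i)) \<longlonglongrightarrow> pi * radial z * spike z x0"
    proof (rule AE_I2)
      fix z
      have "(\<lambda>i. sqrt_gap x0 (x0 + S i) z / S i) \<longlonglongrightarrow> spike z x0 / 2"
      proof (cases "x0 < z")
        case True
        have "((\<lambda>b. - sqrt (z - b)) has_real_derivative 1 / (2 * sqrt (z - x0))) (at x0)"
          using True by (auto intro!: derivative_eq_intros simp: field_simps)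
        then have "((\<lambda>h. (- sqrt (z - (x0 + h)) - - sqrt (z - x0)) / h) \<longlongrightarrow> 1 / (2 * sqrt (z - x0))) (at 0)"
          by (simp add: DERIV_def)
        moreover have "filterlim S (at 0) sequentially"
          unfolding filterlim_at using S(2) S0 by (auto simp: less_imp_neq[symmetric])
        ultimately have "(\<lambda>i. (- sqrt (z - (x0 + S i)) - - sqrt (z - x0)) / S i) \<longlonglongrightarrow> 1 / (2 * sqrt (z - x0))"
          by (rule filterlim_compose)
        moreover have "\<forall>\<^sub>F i in sequentially. S i < z - x0"
            using order_tendstoD(2)[OF S(2), of "z - x0"] True by simp
        then have "\<forall>\<^sub>F i in sequentially. (- sqrt (z - (x0 + S i)) - - sqrt (z - x0)) / S i =
            sqrt_gap x0 (x0 + S i) z / S i"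
          by eventually_elim (use True in \<open>auto simp: sqrt_gap_def max_def\<close>)
        ultimately have "(\<lambda>i. sqrt_gap x0 (x0 + S i) z / S i) \<longlonglongrightarrow> 1 / (2 * sqrt (z - x0))"
          by (rule Lim_transform_eventually)
        then show ?thesis using True by (simp add: spike_def mult.commute)
      next
        case False
        then have "sqrt_gap x0 (x0 + S i) z = 0" for i using S0[of i] by (intro sqrt_gap_eq_0) auto
        then show ?thesis using False by (simp add: spike_def)
      qed
      from tendsto_mult_left[OF this, of "2 * pi * radial z"]
      show "(\<lambda>i. 2 * pi * radial z * (sqrt_gap x0 (x0 + S i) z / S i)) \<longlonglongrightarrow> pi * radial z * spike z x0"
          by (simp add: mult.assoc)
    qed
    show "AE z in lborel. norm (2 * pi * radial z * (sqrt_gap x0 (x0 + S i) z / S i)) \<le>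
        2 * (pi * radial z * spike z x0)" for i
    proof (rule AE_I2)
      fix z
      have "sqrt_gap x0 (x0 + S i) z / S i \<le> spike z x0"
        using sqrt_gap_le_spike[of "S i" x0 z] S0[of i] by (simp add: pos_divide_le_eq mult.commute)
      moreover have "0 \<le> sqrt_gap x0 (x0 + S i) z" using S0[of i] by (intro sqrt_gap_nonneg) auto
      ultimately show "norm (2 * pi * radial z * (sqrt_gap x0 (x0 + S i) z / S i)) \<le>
          2 * (pi * radial z * spike z x0)"
        using radial_nonneg[of z] S0[of i] mult_left_mono[of "sqrt_gap x0 (x0 +
            S i) z / S i" "spike z x0" "2 * pi * radial z"]
        by (auto simp: abs_mult mult.assoc)
    qed
    show "(\<lambda>z. 2 * pi * radial z * (sqrt_gap x0 (x0 + S i) z / S i)) \<in> borel_measurable lborel" for i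
      unfolding sqrt_gap_def by measurable
  qed (use B in \<open>auto simp: has_bochner_integral_iff\<close>)
  then show "((\<lambda>s. (GY (x0 + s) - GY x0) / s) \<circ> S) \<longlonglongrightarrow> proj_density \<rho> x0"
    unfolding comp_def q using B by (simp add: has_bochner_integral_iff)
qed

text \<open>
  To the left of \<open>x0\<close> finiteness of \<open>g x0\<close> gives no bound: values of \<open>Z\<close> just below \<open>x0\<close>
  contribute as well, and \<open>g\<close> may be infinite there since \<open>\<rho>\<close> is an arbitrary density. Their
  contribution is at most of order \<open>sqrt u\<close> times the probability that \<open>Z\<close> is within \<open>u\<close> of \<open>x0\<close>.
\<close>

lemma GY_left_le:
  assumes x0: "0 < x0" and pos: "0 < proj_density \<rho> x0" and u: "0 < u" "u \<le> x0 / 2"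
  shows "GY x0 - GY (x0 - u) \<le> 2 * proj_density \<rho> x0 * u + sqrt u / sqrt (x0 / 2) * prob {\<omega> \<in> space P. \<bar>Z2 \<omega> -
      x0\<bar> \<le> u}"
proof -
  have zz: "has_bochner_integral lborel (\<lambda>z. radial_density radial z * indicator {x0 - u..x0 + u} z)
    (prob {\<omega> \<in> space P. \<bar>Z2 \<omega> - x0\<bar> \<le> u})"
  proof (rule has_bochner_integral_nn_integral)
    have "{\<omega> \<in> space P. \<bar>Z2 \<omega> - x0\<bar> \<le> u} \<in> sets P" by measurable
    then have "ennreal (prob {\<omega> \<in> space P. \<bar>Z2 \<omega> - x0\<bar> \<le> u}) =
        (\<integral>\<^sup>+\<omega>. indicator {\<omega> \<in> space P. \<bar>Z2 \<omega> - x0\<bar> \<le> u} \<omega> \<partial>P)"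
      by (simp add: emeasure_eq_measure)
    also have "\<dots> = (\<integral>\<^sup>+\<omega>. indicator {x0 - u..x0 + u} (Z2 \<omega>) \<partial>P)"
      by (intro nn_integral_cong) (auto simp: indicator_def)
    also have "\<dots> = (\<integral>\<^sup>+z. ennreal (radial_density radial z) * indicator {x0 - u..x0 + u} z \<partial>lborel)"
      by (rule law_Z) simp
    also have "\<dots> = (\<integral>\<^sup>+z. ennreal (radial_density radial z * indicator {x0 - u..x0 + u} z) \<partial>lborel)"
      by (intro nn_integral_cong) (auto simp: indicator_def)
    finally show "(\<integral>\<^sup>+z. ennreal (radial_density radial z * indicator {x0 - u..x0 + u} z) \<partial>lborel)
        = ennreal (prob {\<omega> \<in> space P. \<bar>Z2 \<omega> - x0\<bar> \<le> u})" by simp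
    show "(\<lambda>z. radial_density radial z * indicator {x0 - u..x0 + u} z) \<in> borel_measurable lborel"
      unfolding radial_density_def by measurable
    show "AE z in lborel. 0 \<le> radial_density radial z * indicator {x0 - u..x0 + u} z"
    proof (rule AE_I2)
      fix z show "0 \<le> radial_density radial z * indicator {x0 - u..x0 + u} z"
        using radial_nonneg[of z] u x0 by (auto simp: radial_density_def indicator_def)
    qed
  qed simp
  note B = prob_Y_interval[of "x0 - u" x0] proj_density_integral[OF x0 pos] zz
  let ?k = "sqrt u / sqrt (x0 / 2)"
  have "GY x0 - GY (x0 - u) = (\<integral>z. 2 * pi * radial z * sqrt_gap (x0 - u) x0 z \<partial>lborel)"
    using B(1) GY_diff[of "x0 - u" x0] u x0 by (simp add: has_bochner_integral_iff)
  also have "\<dots> \<le> (\<integral>z. 2 * u * (pi * radial z * spike z x0) + ?k * (radial_density radial z * indicator {x0 -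
      u..x0 + u} z) \<partial>lborel)"
  proof (rule integral_mono)
    fix z
    have g: "0 \<le> sqrt_gap (x0 - u) x0 z" using u by (intro sqrt_gap_nonneg) auto
    have k0: "0 \<le> ?k * (radial_density radial z * indicator {x0 - u..x0 + u} z)"
      using radial_nonneg[of z] u x0 by (auto simp: radial_density_def indicator_def)
    have s0: "0 \<le> 2 * u * (pi * radial z * spike z x0)" using radial_nonneg[of z] u by simp
    consider "z \<le> x0 - u" | "x0 - u < z" "z \<le> x0" | "x0 < z" by linarith
    then show "2 * pi * radial z * sqrt_gap (x0 - u) x0 z \<le>
      2 * u * (pi * radial z * spike z x0) + ?k * (radial_density radial z * indicator {x0 - u..x0 + u} z)"
    proof cases
      case 1
      then have "sqrt_gap (x0 - u) x0 z = 0" using u by (intro sqrt_gap_eq_0) auto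
      then show ?thesis using k0 s0 by (simp only: mult_zero_right)
    next
      case 2
      have "sqrt (x0 / 2) \<le> sqrt z" using 2 u by auto
      then have "1 \<le> sqrt z / sqrt (x0 / 2)" using x0 by simp
      then have "sqrt u * 1 \<le> sqrt u * (sqrt z / sqrt (x0 / 2))" using u by (intro mult_left_mono) auto
      then have "sqrt u \<le> ?k * sqrt z" by simp
      moreover have "sqrt_gap (x0 - u) x0 z \<le> sqrt u" using sqrt_gap_le_sqrt[of "x0 - u" x0 z] u by simp
      ultimately have "2 * pi * radial z * sqrt_gap (x0 - u) x0 z \<le> 2 * pi * radial z * (?k * sqrt z)"
        using radial_nonneg[of z] by (intro mult_left_mono) auto
      also have "\<dots> = ?k * (radial_density radial z * indicator {x0 - u..x0 + u} z)"
        using 2 u by (simp add: radial_density_def indicator_def mult_ac)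
      finally show ?thesis using s0 by linarith
    next
      case 3
      have "sqrt_gap (x0 - u) x0 z \<le> u / sqrt (z - (x0 - u))"
        using sqrt_gap_le_divide[of "x0 - u" x0 z] 3 u by simp
      also have "\<dots> \<le> u * spike z x0" using 3 u by (auto simp: spike_def intro!: divide_left_mono)
      finally have "2 * pi * radial z * sqrt_gap (x0 - u) x0 z \<le> 2 * pi * radial z * (u * spike z x0)"
        using radial_nonneg[of z] by (intro mult_left_mono) auto
      also have "\<dots> = 2 * u * (pi * radial z * spike z x0)" by (simp add: mult_ac)
      finally show ?thesis using k0 by linarith
    qed
  qed (use B u in \<open>auto simp: has_bochner_integral_iff\<close>)
  also have "\<dots> = 2 * u * proj_density \<rho> x0 + ?k * prob {\<omega> \<in> space P. \<bar>Z2 \<omega> - x0\<bar> \<le> u}"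
    using B(2,3) by (simp only: has_bochner_integral_iff Bochner_Integration.integral_add integrable_mult_right
        integral_mult_right_zero)
  finally show ?thesis by (simp add: mult_ac)
qed

text \<open>
  The second difference of \<open>\<lambda>x. max 0 (x - z)\<close> at \<open>x0\<close> with step \<open>2 * u\<close> is nonnegative, and at
  least \<open>u\<close> when \<open>z\<close> is within \<open>u\<close> of \<open>x0\<close>. So smoothness of \<open>Hinf\<close> at \<open>x0\<close> controls the
  probability in \<open>GY_left_le\<close>.
\<close>

lemma Hinf_second_difference:
  assumes u: "0 \<le> u"
  shows "u * prob {\<omega> \<in> space P. \<bar>Z2 \<omega> - x0\<bar> \<le> u} \<le> Hinf (x0 + 2 * u) + Hinf (x0 - 2 * u) - 2 * Hinf x0"
proof -
  have m: "{\<omega> \<in> space P. \<bar>Z2 \<omega> - x0\<bar> \<le> u} \<in> sets P" by measurable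
  have "u * prob {\<omega> \<in> space P. \<bar>Z2 \<omega> - x0\<bar> \<le> u} = expectation (\<lambda>\<omega>. u * indicator {\<omega> \<in> space P. \<bar>Z2 \<omega> - x0\<bar> \<le> u}
      \<omega>)"
    using m by simp
  also have "\<dots> \<le> expectation (\<lambda>\<omega>. max 0 (x0 + 2 * u - Z2 \<omega>) + max 0 (x0 - 2 * u - Z2 \<omega>) - 2 * max 0 (x0 - Z2
      \<omega>))"
  proof (rule integral_mono)
    show "integrable P (\<lambda>\<omega>. u * indicator {\<omega> \<in> space P. \<bar>Z2 \<omega> - x0\<bar> \<le> u} \<omega>)"
      using m by (intro integrable_mult_right integrable_real_indicator) (auto simp: less_top[symmetric])
  qed (use u integrable_pos_part in \<open>auto simp: indicator_def max_def\<close>)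
  also have "\<dots> = Hinf (x0 + 2 * u) + Hinf (x0 - 2 * u) - 2 * Hinf x0"
    unfolding Hinf_def using integrable_pos_part by simp
  finally show ?thesis .
qed

lemma Hinf_mono: "x \<le> y \<Longrightarrow> Hinf x \<le> Hinf y"
  unfolding Hinf_def by (intro integral_mono integrable_pos_part) auto

lemma Hinf_lipschitz:
  assumes "x \<le> y" shows "Hinf y \<le> Hinf x + (y - x)"
proof -
  have "Hinf y \<le> expectation (\<lambda>\<omega>. max 0 (x - Z2 \<omega>) + (y - x))"
    unfolding Hinf_def using assms integrable_pos_part by (intro integral_mono) auto
  also have "\<dots> = Hinf x + (y - x)" unfolding Hinf_def using integrable_pos_part by (simp add: prob_space)
  finally show ?thesis .
qed

lemma Hinf_convex: "convex_on UNIV Hinf"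
proof (rule convex_onI)
  fix t x y :: real assume t: "0 < t" "t < 1"
  have "Hinf ((1 - t) *\<^sub>R x + t *\<^sub>R y) \<le> expectation (\<lambda>\<omega>. (1 - t) * max 0 (x - Z2 \<omega>) + t * max 0 (y - Z2 \<omega>))"
    unfolding Hinf_def
  proof (rule integral_mono)
    fix \<omega>
    have "(1 - t) * x + t * y - Z2 \<omega> = (1 - t) * (x - Z2 \<omega>) + t * (y - Z2 \<omega>)" by (simp add: algebra_simps)
    also have "\<dots> \<le> (1 - t) * max 0 (x - Z2 \<omega>) + t * max 0 (y - Z2 \<omega>)"
      using t by (intro add_mono mult_left_mono) auto
    finally show "max 0 ((1 - t) *\<^sub>R x + t *\<^sub>R y - Z2 \<omega>) \<le> (1 - t) * max 0 (x - Z2 \<omega>) + t * max 0 (y - Z2 \<omega>)"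
      using t by (auto simp: max_def)
  qed (use integrable_pos_part in auto)
  also have "\<dots> = (1 - t) * Hinf x + t * Hinf y" unfolding Hinf_def using integrable_pos_part by simp
  finally show "Hinf ((1 - t) *\<^sub>R x + t *\<^sub>R y) \<le> (1 - t) * Hinf x + t * Hinf y" .
qed simp

lemma H_of_tendsto_Hinf:
  assumes df: "\<And>n. n \<ge> 1 \<Longrightarrow> is_df_nonneg (Gn n)" and conv: "\<And>t. (\<lambda>n. Gn n t) \<longlonglongrightarrow> GY t" and x: "0 \<le> x"
  shows "(\<lambda>n. H_of (Gn n) x) \<longlonglongrightarrow> Hinf x"
proof -
  have "(\<lambda>n. integral\<^sup>L (interval_measure (Gn (Suc n))) (\<lambda>y. ikern y x)) \<longlonglongrightarrow> integral\<^sup>L (distr P borel Y2) (\<lambda>y.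
      ikern y x)"
  proof (rule weak_conv_imp_integral_bdd_continuous_conv)
    show "real_distribution (interval_measure (Gn (Suc n)))" for n
      by (rule real_distribution_interval_measure_df[OF df]) simp
    show "weak_conv_m (\<lambda>n. interval_measure (Gn (Suc n))) (distr P borel Y2)"
      unfolding weak_conv_m_def weak_conv_def
      using conv LIMSEQ_Suc[OF conv] cdf_interval_measure_df[OF df] by (auto simp: GY_def)
    show "isCont (\<lambda>y. ikern y x) y" for y by (rule isCont_ikern_fst[OF x])
    show "norm (ikern y x) \<le> 3 * x" for y using abs_ikern_le[OF x, of y] by simp
  qed (rule Y.real_distribution_axioms)
  also have "integral\<^sup>L (distr P borel Y2) (\<lambda>y. ikern y x) = Hinf x"
    using expectation_ikern[OF x] borel_measurable_ikern[OF x] by (simp add: integral_distr)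
  finally have "(\<lambda>n. H_of (Gn (Suc n)) x) \<longlonglongrightarrow> Hinf x" using H_of_eq[OF df x] by simp
  then show ?thesis by (rule LIMSEQ_imp_Suc)
qed

end

section \<open>Moments, characteristic functions and chaining\<close>

context prob_space begin

text \<open>
  The exceptional set is only required to contain the failures of \<open>S\<close>. So \<open>S\<close> may quantify over
  uncountably many points without a measurability proof.
\<close>

abbreviation holds_up_to :: "real \<Rightarrow> ('a \<Rightarrow> bool) \<Rightarrow> bool" where
  "holds_up_to p S \<equiv> \<exists>E\<in>events. prob E \<le> p \<and> (\<forall>\<omega>\<in>space M - E. S \<omega>)"

lemma holds_up_to_finite_ball:
  assumes "finite J" "\<And>j. j \<in> J \<Longrightarrow> holds_up_to (p j) (S j)"
  shows "holds_up_to (\<Sum>j\<in>J. p j) (\<lambda>\<omega>. \<forall>j\<in>J. S j \<omega>)"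
proof -
  obtain E where E: "\<And>j. j \<in> J \<Longrightarrow> E j \<in> events" "\<And>j. j \<in> J \<Longrightarrow> prob (E j) \<le> p j"
    "\<And>j \<omega>. j \<in> J \<Longrightarrow> \<omega> \<in> space M - E j \<Longrightarrow> S j \<omega>" using assms(2) by metis
  have "prob (\<Union>j\<in>J. E j) \<le> (\<Sum>j\<in>J. prob (E j))" using assms(1) E(1)
      by (intro finite_measure_subadditive_finite) auto
  also have "\<dots> \<le> (\<Sum>j\<in>J. p j)" by (rule sum_mono) (rule E(2))
  finally show ?thesis using E(1,3) assms(1) by (intro bexI[of _ "\<Union>j\<in>J. E j"]) auto
qed

lemma holds_up_to_conj:
  assumes "holds_up_to p S" "holds_up_to q S'"
  shows "holds_up_to (p + q) (\<lambda>\<omega>. S \<omega> \<and> S' \<omega>)"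
proof -
  obtain E F where E: "E \<in> events" "prob E \<le> p" "\<forall>\<omega>\<in>space M - E. S \<omega>" "F \<in> events" "prob F \<le>
      q" "\<forall>\<omega>\<in>space M - F. S' \<omega>"
    using assms by blast
  have "prob (E \<union> F) \<le> p + q" using measure_Un_le[OF E(1,4)] E(2,5) by linarith
  then show ?thesis using E by (intro bexI[of _ "E \<union> F"]) auto
qed

lemma expectation_power_mult_indep:
  fixes U V :: "'a \<Rightarrow> real"
  assumes "indep_var borel U borel V" and bU: "\<And>\<omega>. \<bar>U \<omega>\<bar> \<le> bu" and bV: "\<And>\<omega>. \<bar>V \<omega>\<bar> \<le> bv"
  shows "expectation (\<lambda>\<omega>. U \<omega> ^ i * V \<omega> ^ j) = expectation (\<lambda>\<omega>. U \<omega> ^ i) * expectation (\<lambda>\<omega>. V \<omega> ^ j)"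
    and "integrable M (\<lambda>\<omega>. U \<omega> ^ i * V \<omega> ^ j)"
proof -
  have [measurable]: "U \<in> borel_measurable M" "V \<in> borel_measurable M"
    using indep_var_rv1[OF assms(1)] indep_var_rv2[OF assms(1)] by auto
  have ind: "indep_var borel (\<lambda>\<omega>. U \<omega> ^ i) borel (\<lambda>\<omega>. V \<omega> ^ j)"
    using indep_var_compose[OF assms(1), of "\<lambda>x. x ^ i" borel "\<lambda>x. x ^ j" borel] by (simp add: comp_def)
  have i1: "integrable M (\<lambda>\<omega>. U \<omega> ^ i)"
    by (rule integrable_const_bound[of _ "bu ^ i"]) (auto simp: power_abs intro!: power_mono bU)
  have i2: "integrable M (\<lambda>\<omega>. V \<omega> ^ j)"
    by (rule integrable_const_bound[of _ "bv ^ j"]) (auto simp: power_abs intro!: power_mono bV)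
  show "expectation (\<lambda>\<omega>. U \<omega> ^ i * V \<omega> ^ j) = expectation (\<lambda>\<omega>. U \<omega> ^ i) * expectation (\<lambda>\<omega>. V \<omega> ^ j)"
    by (rule indep_var_lebesgue_integral[OF ind i1 i2])
  show "integrable M (\<lambda>\<omega>. U \<omega> ^ i * V \<omega> ^ j)"
    by (rule indep_var_integrable[OF ind i1 i2])
qed

text \<open>
  Induction on the number of summands. Terms in which the new summand or the old sum occurs to the
  first power vanish by independence and centring, which leaves
  \<open>E (X + S) ^ 4 = E X ^ 4 + 6 * E X\<^sup>2 * E S\<^sup>2 + E S ^ 4\<close>.
\<close>

lemma iid_sum_moments:
  fixes \<xi> :: "nat \<Rightarrow> 'a \<Rightarrow> real"
  assumes indep: "indep_vars (\<lambda>_. borel) \<xi> {1..n}"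
    and bdd: "\<And>i \<omega>. \<bar>\<xi> i \<omega>\<bar> \<le> b"
    and mean: "\<And>i. i \<in> {1..n} \<Longrightarrow> expectation (\<xi> i) = 0"
    and var: "\<And>i. i \<in> {1..n} \<Longrightarrow> expectation (\<lambda>\<omega>. (\<xi> i \<omega>)\<^sup>2) = v"
  shows "expectation (\<lambda>\<omega>. (\<Sum>i\<in>{1..n}. \<xi> i \<omega>)\<^sup>2) = n * v"
    and "expectation (\<lambda>\<omega>. (\<Sum>i\<in>{1..n}. \<xi> i \<omega>) ^ 4) \<le> n * (b\<^sup>2 * v) + 3 * (real n * v)\<^sup>2"
proof -
  have "k \<le> n \<Longrightarrow> expectation (\<lambda>\<omega>. (\<Sum>i\<in>{1..k}. \<xi> i \<omega>)) = 0 \<and>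
     expectation (\<lambda>\<omega>. (\<Sum>i\<in>{1..k}. \<xi> i \<omega>)\<^sup>2) = k * v \<and>
     expectation (\<lambda>\<omega>. (\<Sum>i\<in>{1..k}. \<xi> i \<omega>) ^ 4) \<le> k * (b\<^sup>2 * v) + 3 * (real k * v)\<^sup>2" for k
  proof (induction k)
    case 0
    show ?case by simp
  next
    case (Suc k)
    define S where "S = (\<lambda>\<omega>. \<Sum>i\<in>{1..k}. \<xi> i \<omega>)"
    define X where "X = \<xi> (Suc k)"
    have IH: "expectation S = 0" "expectation (\<lambda>\<omega>. (S \<omega>)\<^sup>2) = k * v"
      "expectation (\<lambda>\<omega>. S \<omega> ^ 4) \<le> k * (b\<^sup>2 * v) + 3 * (real k * v)\<^sup>2"
      using Suc by (auto simp: S_def)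
    have k: "Suc k \<in> {1..n}" using Suc.prems by auto
    have ins: "{1..Suc k} = insert (Suc k) {1..k}" by auto
    have "indep_vars (\<lambda>_. borel) \<xi> (insert (Suc k) {1..k})"
      using Suc.prems by (intro indep_vars_subset[OF indep]) auto
    then have ind: "indep_var borel X borel S"
      unfolding X_def S_def by (intro indep_vars_sum) auto
    have bS: "\<bar>S \<omega>\<bar> \<le> k * b" for \<omega>
      unfolding S_def using sum_norm_bound[of "{1..k}" "\<lambda>i. \<xi> i \<omega>" b] bdd by auto
    have bX: "\<bar>X \<omega>\<bar> \<le> b" for \<omega> using bdd by (simp add: X_def)
    note m = expectation_power_mult_indep[OF ind bX bS]
    have X: "expectation X = 0" "expectation (\<lambda>\<omega>. (X \<omega>)\<^sup>2) = v" using mean var k by (auto simp: X_def)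
    have sum: "(\<Sum>i\<in>{1..Suc k}. \<xi> i \<omega>) = X \<omega> + S \<omega>" for \<omega> unfolding ins S_def X_def by (subst sum.insert) auto
    have i: "integrable M (\<lambda>\<omega>. X \<omega> ^ i)" "integrable M (\<lambda>\<omega>. S \<omega> ^ i)" for i
      using m(2)[of i 0] m(2)[of 0 i] by simp_all
    have i1: "integrable M X" "integrable M S" using i[of 1] by simp_all
    have A: "expectation (\<lambda>\<omega>. X \<omega> + S \<omega>) = 0" using i1 X IH by simp
    have sq: "(X \<omega> + S \<omega>)\<^sup>2 = X \<omega> ^ 2 * S \<omega> ^ 0 + 2 * (X \<omega> ^ 1 * S \<omega> ^ 1) + X \<omega> ^ 0 * S \<omega> ^ 2" for \<omega>
      by (simp add: power2_sum)
    have B: "expectation (\<lambda>\<omega>. (X \<omega> + S \<omega>)\<^sup>2) = v + k * v"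
      unfolding sq using m(2)[of 2 0] m(2)[of 1 1] m(2)[of 0 2] m(1)[of 1 1] X IH
          by (simp del: power_0 power_one_right)
         (simp add: X IH)
    have q: "(X \<omega> + S \<omega>) ^ 4 = X \<omega> ^ 4 * S \<omega> ^ 0 + 4 * (X \<omega> ^ 3 * S \<omega> ^ 1) + 6 * (X \<omega> ^ 2 * S \<omega> ^ 2)
       + 4 * (X \<omega> ^ 1 * S \<omega> ^ 3) + X \<omega> ^ 0 * S \<omega> ^ 4" for \<omega>
      by (simp add: power4_eq_xxxx power2_eq_square power3_eq_cube algebra_simps)
    have "expectation (\<lambda>\<omega>. (X \<omega> + S \<omega>) ^ 4) = expectation (\<lambda>\<omega>. X \<omega> ^ 4 * S \<omega> ^ 0)
        + 4 * expectation (\<lambda>\<omega>. X \<omega> ^ 3 * S \<omega> ^ 1) + 6 * expectation (\<lambda>\<omega>. X \<omega> ^ 2 * S \<omega> ^ 2)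
        + 4 * expectation (\<lambda>\<omega>. X \<omega> ^ 1 * S \<omega> ^ 3) + expectation (\<lambda>\<omega>. X \<omega> ^ 0 * S \<omega> ^ 4)"
      unfolding q using m(2)[of 4 0] m(2)[of 3 1] m(2)[of 2 2] m(2)[of 1 3] m(2)[of 0 4]
      by (simp del: power_0 power_one_right)
    also have "\<dots> = expectation (\<lambda>\<omega>. X \<omega> ^ 4) + 6 * (v * (k * v)) + expectation (\<lambda>\<omega>. S \<omega> ^ 4)"
      unfolding m(1) using X IH by (simp add: prob_space)
    also have "expectation (\<lambda>\<omega>. X \<omega> ^ 4) \<le> expectation (\<lambda>\<omega>. b\<^sup>2 * (X \<omega>)\<^sup>2)"
    proof (rule integral_mono)
      show "X \<omega> ^ 4 \<le> b\<^sup>2 * (X \<omega>)\<^sup>2" for \<omega>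
        using bX[of \<omega>] mult_right_mono[of "(X \<omega>)\<^sup>2" "b\<^sup>2" "(X \<omega>)\<^sup>2"] abs_le_square_iff[of "X \<omega>" b]
        by (auto simp: power4_eq_xxxx power2_eq_square mult.assoc)
    qed (use i in auto)
    also have "\<dots> = b\<^sup>2 * v" using X by simp
    also note IH(3)
    finally have C: "expectation (\<lambda>\<omega>. (X \<omega> + S \<omega>) ^ 4) \<le> b\<^sup>2 * v + 6 * (v * (k * v)) + (k * (b\<^sup>2 * v) +
        3 * (real k * v)\<^sup>2)"
      by simp
    also have "\<dots> \<le> Suc k * (b\<^sup>2 * v) + 3 * (real (Suc k) * v)\<^sup>2"
      by (simp add: power2_eq_square algebra_simps)
    finally show ?case unfolding sum using A B by (simp add: algebra_simps)
  qed
  from this[of n] show "expectation (\<lambda>\<omega>. (\<Sum>i\<in>{1..n}. \<xi> i \<omega>)\<^sup>2) = n * v"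
    and "expectation (\<lambda>\<omega>. (\<Sum>i\<in>{1..n}. \<xi> i \<omega>) ^ 4) \<le> n * (b\<^sup>2 * v) + 3 * (real n * v)\<^sup>2" by auto
qed

end

lemma one_minus_approx_exp: "0 \<le> y \<Longrightarrow> \<bar>(1 - y) - exp (- y)\<bar> \<le> (y::real)\<^sup>2"
proof -
  assume y: "0 \<le> y"
  have "exp (-y) \<ge> 1 - y" using exp_ge_add_one_self[of "-y"] by simp
  moreover have "exp (-y) \<le> 1 / (1 + y)"
    using exp_ge_add_one_self[of y] y by (simp add: exp_minus field_simps)
  moreover have "1 / (1 + y) - (1 - y) = y\<^sup>2 / (1 + y)" using y by (simp add: field_simps power2_eq_square)
  moreover have "y\<^sup>2 / (1 + y) \<le> y\<^sup>2" using y by (simp add: field_simps)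
  ultimately show ?thesis by linarith
qed

text \<open>
  Lindeberg's argument for summands that are uniformly small: each characteristic function agrees
  with \<open>exp (- t\<^sup>2 * v / 2)\<close> up to \<open>b * v\<close> and \<open>v\<^sup>2\<close>, and the errors add up in the product. The
  hypothesis that \<open>n * v n\<close> converges makes their sum vanish.
\<close>

lemma (in prob_space) char_triangular_array_tendsto:
  fixes \<xi> :: "nat \<Rightarrow> nat \<Rightarrow> 'a \<Rightarrow> real" and b v :: "nat \<Rightarrow> real"
  assumes indep: "\<And>n. indep_vars (\<lambda>_. borel) (\<xi> n) {1..n}"
    and bdd: "\<And>n i \<omega>. \<bar>\<xi> n i \<omega>\<bar> \<le> b n" and b: "b \<longlonglongrightarrow> 0"
    and mean: "\<And>n i. i \<in> {1..n} \<Longrightarrow> expectation (\<xi> n i) = 0"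
    and var: "\<And>n i. i \<in> {1..n} \<Longrightarrow> expectation (\<lambda>\<omega>. (\<xi> n i \<omega>)\<^sup>2) = v n"
    and nv: "(\<lambda>n. n * v n) \<longlonglongrightarrow> s" and v0: "\<And>n. 0 \<le> v n"
  shows "(\<lambda>n. char (distr M borel (\<lambda>\<omega>. \<Sum>i\<in>{1..n}. \<xi> n i \<omega>)) t) \<longlonglongrightarrow> complex_of_real (exp (- (t\<^sup>2 * s / 2)))"
proof -
  define y where "y n = t\<^sup>2 * v n / 2" for n
  have y0: "0 \<le> y n" for n using v0 by (simp add: y_def)
  have b0: "0 \<le> b n" for n using bdd[of n 0 undefined] by linarith
  have rv: "random_variable borel (\<xi> n i)" if "i \<in> {1..n}" for n i
    using indep[of n] that unfolding indep_vars_def2 by auto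
  have c: "cmod (char (distr M borel (\<xi> n i)) t - complex_of_real (exp (- y n))) \<le>
      \<bar>t\<bar>^3 / 6 * (b n * v n) + (y n)\<^sup>2"
    if i: "i \<in> {1..n}" for n i
  proof -
    note [measurable] = rv[OF i]
    have i1: "integrable M (\<xi> n i)"
      by (rule integrable_const_bound[of _ "b n"]) (use bdd in auto)
    have i2: "integrable M (\<lambda>\<omega>. (\<xi> n i \<omega>)\<^sup>2)"
    proof (rule integrable_const_bound[of _ "(b n)\<^sup>2"])
      have "(\<xi> n i \<omega>)\<^sup>2 \<le> (b n)\<^sup>2" for \<omega> using bdd[of n i \<omega>] b0[of n]
          by (simp add: abs_le_square_iff[symmetric])
      then show "AE \<omega> in M. norm ((\<xi> n i \<omega>)\<^sup>2) \<le> (b n)\<^sup>2" by simp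
    qed simp
    interpret D: real_distribution "distr M borel (\<xi> n i)" by (rule real_distribution_distr) simp
    have "cmod (char (distr M borel (\<xi> n i)) t - (1 - t^2 * v n / 2)) \<le> t\<^sup>2 / 6 *
        D.expectation (\<lambda>x. min (6 * x\<^sup>2) (\<bar>t\<bar> * \<bar>x\<bar> ^ 3))"
      by (rule D.char_approx3) (use i1 i2 mean[OF i] var[OF i] in \<open>auto simp: integrable_distr_eq
          integral_distr\<close>)
    also have "D.expectation (\<lambda>x. min (6 * x\<^sup>2) (\<bar>t\<bar> * \<bar>x\<bar> ^ 3)) =
        expectation (\<lambda>\<omega>. min (6 * (\<xi> n i \<omega>)\<^sup>2) (\<bar>t\<bar> * \<bar>\<xi> n i \<omega>\<bar> ^ 3))"
      by (subst integral_distr) auto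
    also have "\<dots> \<le> expectation (\<lambda>\<omega>. \<bar>t\<bar> * b n * (\<xi> n i \<omega>)\<^sup>2)"
    proof (rule integral_mono)
      show "integrable M (\<lambda>\<omega>. min (6 * (\<xi> n i \<omega>)\<^sup>2) (\<bar>t\<bar> * \<bar>\<xi> n i \<omega>\<bar> ^ 3))"
        by (rule Bochner_Integration.integrable_bound[OF integrable_mult_right[OF i2, of 6]]) auto
      show "min (6 * (\<xi> n i \<omega>)\<^sup>2) (\<bar>t\<bar> * \<bar>\<xi> n i \<omega>\<bar> ^ 3) \<le> \<bar>t\<bar> * b n * (\<xi> n i \<omega>)\<^sup>2" for \<omega>
      proof -
        have "\<bar>\<xi> n i \<omega>\<bar> ^ 3 \<le> b n * (\<xi> n i \<omega>)\<^sup>2"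
          using mult_right_mono[OF bdd[of n i \<omega>], of "(\<xi> n i \<omega>)\<^sup>2"]
              by (simp add: power3_eq_cube power2_eq_square)
        then have "\<bar>t\<bar> * \<bar>\<xi> n i \<omega>\<bar> ^ 3 \<le> \<bar>t\<bar> * (b n * (\<xi> n i \<omega>)\<^sup>2)" by (intro mult_left_mono) auto
        then show ?thesis by (simp add: mult.assoc)
      qed
    qed (use i2 in auto)
    also have "\<dots> = \<bar>t\<bar> * b n * v n" using var[OF i] by simp
    finally have A: "cmod (char (distr M borel (\<xi> n i)) t - (1 - t^2 * v n / 2)) \<le> t\<^sup>2 / 6 * (\<bar>t\<bar> * b n * v n)"
      by (simp add: mult_left_mono)
    have "cmod (complex_of_real (1 - y n) - complex_of_real (exp (- y n))) \<le> (y n)\<^sup>2"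
      unfolding of_real_diff[symmetric] norm_of_real using one_minus_approx_exp[OF y0] by simp
    moreover have "cmod (char (distr M borel (\<xi> n i)) t - complex_of_real (1 - y n)) \<le>
        t\<^sup>2 / 6 * (\<bar>t\<bar> * b n * v n)"
      using A by (simp add: y_def)
    ultimately have "cmod (char (distr M borel (\<xi> n i)) t - complex_of_real (exp (- y n))) \<le>
        t\<^sup>2 / 6 * (\<bar>t\<bar> * b n * v n) + (y n)\<^sup>2"
      using norm_triangle_ineq[of "char (distr M borel (\<xi> n i)) t - complex_of_real (1 - y n)"
        "complex_of_real (1 - y n) - complex_of_real (exp (- y n))"] by (simp only: diff_add_cancel add_diff_eq)
    then show ?thesis by (simp add: power3_eq_cube power2_eq_square algebra_simps)
  qed
  define r where "r n = n * (\<bar>t\<bar>^3 / 6 * (b n * v n) + (y n)\<^sup>2)" for n :: nat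
  have B: "cmod (char (distr M borel (\<lambda>\<omega>. \<Sum>i\<in>{1..n}. \<xi> n i \<omega>)) t - complex_of_real (exp (- (n * y n)))) \<le>
      r n" for n
  proof -
    have "char (distr M borel (\<lambda>\<omega>. \<Sum>i\<in>{1..n}. \<xi> n i \<omega>)) t = (\<Prod>i\<in>{1..n}. char (distr M borel (\<xi> n i)) t)"
      by (rule char_distr_sum[OF indep])
    moreover have "complex_of_real (exp (- (n * y n))) = (\<Prod>i\<in>{1..n}. complex_of_real (exp (- y n)))"
      using exp_of_nat_mult[of n "- y n"] by (simp add: of_real_power[symmetric] del: of_real_power)
    moreover have "norm ((\<Prod>i\<in>{1..n}. char (distr M borel (\<xi> n i)) t) - (\<Prod>i\<in>{1..n}. complex_of_real (exp (- y
        n))))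
      \<le> (\<Sum>i\<in>{1..n}. norm (char (distr M borel (\<xi> n i)) t - complex_of_real (exp (- y n))))"
    proof (rule norm_prod_diff)
      fix i assume "i \<in> {1..n}"
      then interpret D: real_distribution "distr M borel (\<xi> n i)" using rv
          by (intro real_distribution_distr) simp
      show "norm (char (distr M borel (\<xi> n i)) t) \<le> 1" by (rule D.cmod_char_le_1)
      show "norm (complex_of_real (exp (- y n))) \<le> 1" using y0 by simp
    qed
    moreover have "(\<Sum>i\<in>{1..n}. norm (char (distr M borel (\<xi> n i)) t - complex_of_real (exp (- y n)))) \<le>
       (\<Sum>i\<in>{1..n}. \<bar>t\<bar>^3 / 6 * (b n * v n) + (y n)\<^sup>2)" by (rule sum_mono) (rule c)
    ultimately show ?thesis by (simp add: r_def)
  qed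
  have ny: "(\<lambda>n. n * y n) \<longlonglongrightarrow> t\<^sup>2 * s / 2"
    using tendsto_mult_left[OF nv, of "t\<^sup>2 / 2"] by (simp add: y_def algebra_simps)
  have "(\<lambda>n. y n) \<longlonglongrightarrow> 0"
  proof (rule Lim_transform_eventually)
    show "(\<lambda>n. (n * y n) * (1 / real n)) \<longlonglongrightarrow> 0" using tendsto_mult[OF ny lim_1_over_n] by simp
    show "\<forall>\<^sub>F n in sequentially. n * y n * (1 / real n) = y n"
      using eventually_gt_at_top[of 0] by eventually_elim auto
  qed
  then have "(\<lambda>n. \<bar>t\<bar>^3 / 6 * (b n * (n * v n)) + (n * y n) * y n) \<longlonglongrightarrow> \<bar>t\<bar>^3 / 6 * (0 * s) + t\<^sup>2 * s / 2 * 0"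
    by (intro tendsto_intros b nv ny)
  then have "r \<longlonglongrightarrow> 0" unfolding r_def by (simp add: power2_eq_square algebra_simps)
  then have "(\<lambda>n. char (distr M borel (\<lambda>\<omega>. \<Sum>i\<in>{1..n}. \<xi> n i \<omega>)) t - complex_of_real (exp (- (n * y n)))) \<longlonglongrightarrow> 0"
    using B by (intro Lim_null_comparison[OF _ \<open>r \<longlonglongrightarrow> 0\<close>]) auto
  from tendsto_add[OF this tendsto_of_real[OF tendsto_exp[OF tendsto_minus[OF ny]]]]
  show ?thesis by (simp del: of_real_exp)
qed

lemma char_normal_distribution:
  assumes "prob_space N" "distributed N lborel W (\<lambda>w. ennreal (normal_density 0 \<sigma> w))" "0 < \<sigma>"
  shows "char (distr N borel W) t = complex_of_real (exp (- (t\<^sup>2 * \<sigma>\<^sup>2 / 2)))"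
proof -
  interpret prob_space N by fact
  have [measurable]: "W \<in> borel_measurable N" using distributed_measurable[OF assms(2)] by simp
  have d: "distributed N lborel (\<lambda>x. 0 + (1 / \<sigma>) * W x) (\<lambda>x. ennreal (normal_density (0 +
      1/\<sigma> * 0) (\<bar>1/\<sigma>\<bar> * \<sigma>) x))"
    using normal_density_affine[OF assms(2,3), of "1/\<sigma>" 0] assms(3) by simp
  then have "distr N lborel (\<lambda>x. W x / \<sigma>) = std_normal_distribution"
    using assms(3) by (simp add: distributed_def)
  then have S: "distr N borel (\<lambda>x. W x / \<sigma>) = std_normal_distribution"
    by (simp cong: distr_cong)
  have "char (distr N borel W) t = char (distr N borel (\<lambda>x. W x / \<sigma>)) (\<sigma> * t)"
    using assms(3) by (simp add: char_def integral_distr)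
  then show ?thesis unfolding S char_std_normal_distribution by (simp add: power_mult_distrib mult.commute)
qed

text \<open>
  Slutsky's lemma in terms of characteristic functions.
\<close>

lemma (in prob_space) char_diff_tendsto_0:
  fixes A B :: "nat \<Rightarrow> 'a \<Rightarrow> real"
  assumes A [measurable]: "\<And>n. A n \<in> borel_measurable M" and B [measurable]: "\<And>n. B n \<in> borel_measurable M"
    and close: "\<And>d. 0 < d \<Longrightarrow> (\<lambda>n. prob {\<omega> \<in> space M. \<bar>A n \<omega> - B n \<omega>\<bar> > d}) \<longlonglongrightarrow> 0"
  shows "(\<lambda>n. char (distr M borel (A n)) t - char (distr M borel (B n)) t) \<longlonglongrightarrow> 0"
proof (rule LIMSEQ_I)
  fix e :: real assume e: "0 < e"
  define d where "d = e / (4 * (\<bar>t\<bar> + 1))"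
  have d: "0 < d" "\<bar>t\<bar> * d \<le> e / 4" using e by (auto simp: d_def field_simps)
  have "\<forall>\<^sub>F n in sequentially. prob {\<omega> \<in> space M. \<bar>A n \<omega> - B n \<omega>\<bar> > d} < e / 4"
    using order_tendstoD(2)[OF close[OF d(1)], of "e/4"] e by simp
  then obtain n0 where n0: "\<And>n. n \<ge> n0 \<Longrightarrow> prob {\<omega> \<in> space M. \<bar>A n \<omega> - B n \<omega>\<bar> > d} < e / 4"
    by (auto simp: eventually_sequentially)
  show "\<exists>n0. \<forall>n\<ge>n0. norm (char (distr M borel (A n)) t - char (distr M borel (B n)) t - 0) < e"
  proof (intro exI allI impI)
    fix n assume n: "n \<ge> n0"
    let ?E = "{\<omega> \<in> space M. \<bar>A n \<omega> - B n \<omega>\<bar> > d}"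
    have Em: "?E \<in> events" by measurable
    have pt: "norm (iexp (t * A n \<omega>) - iexp (t * B n \<omega>)) \<le> e / 4 + 2 * indicator ?E \<omega>" if "\<omega> \<in> space M" for \<omega>
    proof (cases "\<omega> \<in> ?E")
      case True
      then show ?thesis using norm_triangle_ineq4[of "iexp (t * A n \<omega>)" "iexp (t * B n \<omega>)"] e by simp
    next
      case False
      have "iexp (t * A n \<omega>) - iexp (t * B n \<omega>) = iexp (t * B n \<omega>) * (iexp (t * (A n \<omega> - B n \<omega>)) - 1)"
        by (simp add: algebra_simps flip: exp_add)
      also have "norm \<dots> = norm (iexp (t * (A n \<omega> - B n \<omega>)) - 1)" by (simp add: norm_mult)
      also have "\<dots> \<le> \<bar>t * (A n \<omega> - B n \<omega>)\<bar>" using iexp_approx1[of "t * (A n \<omega> - B n \<omega>)" 0] by simp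
      also have "\<dots> \<le> \<bar>t\<bar> * d" using False that by (auto simp: abs_mult intro!: mult_left_mono)
      finally show ?thesis using d False by simp
    qed
    have "char (distr M borel (A n)) t - char (distr M borel (B n)) t =
       (CLINT \<omega>|M. iexp (t * A n \<omega>) - iexp (t * B n \<omega>))"
      unfolding char_def by (subst Bochner_Integration.integral_diff) (auto simp: integral_distr intro!:
          integrable_iexp)
    also have "norm \<dots> \<le> (\<integral>\<omega>. norm (iexp (t * A n \<omega>) - iexp (t * B n \<omega>)) \<partial>M)"
      by (rule integral_norm_bound)
    also have "\<dots> \<le> (\<integral>\<omega>. e / 4 + 2 * indicator ?E \<omega> \<partial>M)"
    proof (rule integral_mono)
      show "integrable M (\<lambda>\<omega>. norm (iexp (t * A n \<omega>) - iexp (t * B n \<omega>)))"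
        by (intro integrable_norm Bochner_Integration.integrable_diff integrable_iexp) auto
      show "integrable M (\<lambda>\<omega>. e / 4 + 2 * indicat_real ?E \<omega>)"
        by (intro Bochner_Integration.integrable_add integrable_const integrable_mult_right
            integrable_real_indicator)
          (use Em in \<open>auto simp: less_top[symmetric]\<close>)
    qed (use pt in auto)
    also have "\<dots> = e / 4 + 2 * prob ?E"
    proof -
      have "integrable M (indicat_real ?E)" using Em
          by (intro integrable_real_indicator) (auto simp: less_top[symmetric])
      then show ?thesis by (subst Bochner_Integration.integral_add) (use Em in \<open>auto simp: prob_space\<close>)
    qed
    also have "\<dots> < e" using n0[OF n] e by linarith
    finally show "norm (char (distr M borel (A n)) t - char (distr M borel (B n)) t - 0) < e" by simp
  qed
qed

text \<open>
  Dyadic chaining. Level \<open>k\<close> is allowed the deviation \<open>u / 10 * (9 / 10) ^ k\<close>; these sum to \<open>u\<close>.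
  The fourth moments of the \<open>2 ^ k\<close> increments of level \<open>k\<close> are of order \<open>4 ^ - k\<close>, so that the
  union bound is a geometric series with ratio \<open>1 / (2 * (9 / 10) ^ 4) < 1\<close>. Continuity extends
  the bound from dyadic points to all points.
\<close>

lemma (in prob_space) chaining_maximal_inequality:
  fixes X :: "real \<Rightarrow> 'a \<Rightarrow> real"
  assumes L: "0 < L" and B: "0 \<le> B" and lam: "0 < u"
    and meas [measurable]: "\<And>t. t \<in> {a..a+L} \<Longrightarrow> X t \<in> borel_measurable M"
    and cont: "\<And>\<omega>. \<omega> \<in> space M \<Longrightarrow> continuous_on {a..a+L} (\<lambda>t. X t \<omega>)"
    and int: "\<And>s t. s \<in> {a..a+L} \<Longrightarrow> t \<in> {a..a+L} \<Longrightarrow> integrable M (\<lambda>\<omega>. (X t \<omega> - X s \<omega>) ^ 4)"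
    and mom: "\<And>s t. s \<in> {a..a+L} \<Longrightarrow> t \<in> {a..a+L} \<Longrightarrow> expectation (\<lambda>\<omega>. (X t \<omega> - X s \<omega>) ^ 4) \<le> B * (t - s)\<^sup>2"
  shows "holds_up_to (10 ^ 5 * B * L\<^sup>2 / u ^ 4) (\<lambda>\<omega>. \<forall>t\<in>{a..a+L}. \<bar>X t \<omega> - X a \<omega>\<bar> \<le> u)"
proof -
  define q :: real where "q = 9 / 10"
  define p where "p k j = a + L * real j / 2 ^ k" for k j :: nat
  define e where "e k j = {\<omega> \<in> space M. u * q ^ k / 10 < \<bar>X (p k (Suc j)) \<omega> - X (p k j) \<omega>\<bar>}" for k j
  define E where "E k = (\<Union>j<2^k. e k j)" for k
  have p_in: "p k j \<in> {a..a+L}" if "j \<le> 2 ^ k" for k j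
  proof -
    have "real j \<le> real (2 ^ k)" using that by (simp only: of_nat_le_iff)
    then have "real j \<le> 2 ^ k" by simp
    then have "L * (real j / 2 ^ k) \<le> L * 1" using L by (intro mult_left_mono) auto
    then show ?thesis using L by (simp add: p_def)
  qed
  have e_sets: "e k j \<in> events" if "j < 2 ^ k" for k j
  proof -
    have [measurable]: "X (p k (Suc j)) \<in> borel_measurable M" "X (p k j) \<in> borel_measurable M"
      using meas[OF p_in[of "Suc j" k]] meas[OF p_in[of j k]] that by auto
    show ?thesis unfolding e_def by measurable
  qed
  have E_sets: "E k \<in> events" for k unfolding E_def using e_sets by auto
  have e_prob: "prob (e k j) \<le> 10 ^ 4 * B * L\<^sup>2 / u ^ 4 * (1 / (4 * q ^ 4)) ^ k" if j: "j < 2 ^ k" for k j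
  proof -
    let ?c = "(u * q ^ k / 10) ^ 4"
    have c: "0 < ?c" using lam by (simp add: q_def)
    have [measurable]: "X (p k (Suc j)) \<in> borel_measurable M" "X (p k j) \<in> borel_measurable M"
      using meas[OF p_in[of "Suc j" k]] meas[OF p_in[of j k]] that by auto
    have pp: "p k j \<in> {a..a+L}" "p k (Suc j) \<in> {a..a+L}"
      using p_in[of "Suc j" k] p_in[of j k] that by auto
    have "prob (e k j) \<le> prob {\<omega>\<in>space M. ?c \<le> (X (p k (Suc j)) \<omega> - X (p k j) \<omega>) ^ 4}"
    proof (rule finite_measure_mono)
      show "e k j \<subseteq> {\<omega>\<in>space M. ?c \<le> (X (p k (Suc j)) \<omega> - X (p k j) \<omega>) ^ 4}"
      proof
        fix \<omega> assume "\<omega> \<in> e k j"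
        then have w: "\<omega> \<in> space M" "u * q ^ k / 10 \<le> \<bar>X (p k (Suc j)) \<omega> - X (p k j) \<omega>\<bar>" by (auto simp: e_def)
        have "?c \<le> \<bar>X (p k (Suc j)) \<omega> - X (p k j) \<omega>\<bar> ^ 4" using w lam by (intro power_mono) (auto simp: q_def)
        then show "\<omega> \<in> {\<omega>\<in>space M. ?c \<le> (X (p k (Suc j)) \<omega> - X (p k j) \<omega>) ^ 4}"
          using w by (simp add: power_even_abs)
      qed
    qed simp
    also have "\<dots> \<le> expectation (\<lambda>\<omega>. (X (p k (Suc j)) \<omega> - X (p k j) \<omega>) ^ 4) / ?c"
      by (rule integral_Markov_inequality_measure[OF int[OF pp] _ _ c]) auto
    also have "\<dots> \<le> B * (p k (Suc j) - p k j)\<^sup>2 / ?c"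
      using c mom[OF pp] by (intro divide_right_mono) auto
    also have "p k (Suc j) - p k j = L / 2 ^ k" by (simp add: p_def field_simps)
    also have "B * (L / 2 ^ k)\<^sup>2 / ?c = 10 ^ 4 * B * L\<^sup>2 / u ^ 4 * (1 / (4 * q ^ 4)) ^ k"
    proof -
      have "(2 ^ k)\<^sup>2 = (4 :: real) ^ k" by (simp add: power2_eq_square power_mult_distrib[symmetric])
      moreover have "(q ^ k) ^ 4 = (q ^ 4) ^ k" by (simp add: power_mult[symmetric] mult.commute)
      ultimately show ?thesis using lam by (simp add: power_divide power_mult_distrib field_simps)
    qed
    finally show ?thesis .
  qed
  define K where "K = 10 ^ 4 * B * L\<^sup>2 / u ^ 4"
  define r :: real where "r = 1 / (2 * q ^ 4)"
  have r: "0 \<le> r" "r < 1" "1 / (1 - r) \<le> 10" by (auto simp: r_def q_def power_numeral_reduce)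
  have K: "0 \<le> K" using B lam by (simp add: K_def)
  have E_prob: "prob (E k) \<le> K * r ^ k" for k
  proof -
    have "prob (E k) \<le> (\<Sum>j<2^k. prob (e k j))"
      unfolding E_def using e_sets by (intro finite_measure_subadditive_finite) auto
    also have "\<dots> \<le> (\<Sum>j<(2::nat)^k. K * (1 / (4 * q ^ 4)) ^ k)"
      unfolding K_def by (intro sum_mono e_prob) auto
    also have "\<dots> = K * (2 ^ k * (1 / (4 * q ^ 4)) ^ k)" by simp
    also have "2 ^ k * (1 / (4 * q ^ 4)) ^ k = r ^ k"
      unfolding power_mult_distrib[symmetric] by (simp add: r_def)
    finally show ?thesis .
  qed
  have "summable (\<lambda>k. K * r ^ k)" using r by (intro summable_mult summable_geometric) auto
  then have sm: "summable (\<lambda>k. prob (E k))"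
    by (rule summable_comparison_test'[of _ 0]) (use E_prob in auto)
  have "prob (\<Union>k. E k) \<le> (\<Sum>k. prob (E k))"
    using E_sets sm by (intro finite_measure_subadditive_countably) auto
  also have "\<dots> \<le> (\<Sum>k. K * r ^ k)" using E_prob sm \<open>summable (\<lambda>k. K * r ^ k)\<close> by (intro suminf_le) auto
  also have "\<dots> = K * (1 / (1 - r))" using r by (subst suminf_mult) (auto simp: suminf_geometric
      summable_geometric)
  also have "\<dots> \<le> K * 10" using r K by (intro mult_left_mono) auto
  finally have prob: "prob (\<Union>k. E k) \<le> 10 ^ 5 * B * L\<^sup>2 / u ^ 4" by (simp add: K_def)
  have "\<bar>X t \<omega> - X a \<omega>\<bar> \<le> u" if w: "\<omega> \<in> space M - (\<Union>k. E k)" and t: "t \<in> {a..a+L}" for \<omega> t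
  proof -
    have ws: "\<omega> \<in> space M" using w by auto
    have inc: "\<bar>X (p k (Suc j)) \<omega> - X (p k j) \<omega>\<bar> \<le> u / 10 * q ^ k" if "j < 2 ^ k" for k j
    proof -
      have "\<omega> \<notin> e k j" using w that unfolding E_def by blast
      then show ?thesis using ws by (simp add: e_def)
    qed
    have level: "j \<le> 2 ^ k \<Longrightarrow> \<bar>X (p k j) \<omega> - X a \<omega>\<bar> \<le> u / 10 * (\<Sum>i\<le>k. q ^ i)" for k j
    proof (induction k arbitrary: j)
      case 0
      have "p 0 0 = a" by (simp add: p_def)
      then show ?case using inc[of 0 0] 0 lam by (cases j) auto
    next
      case (Suc k)
      have pe: "p (Suc k) (2 * m) = p k m" for m by (simp add: p_def)
      have up: "u / 10 * (\<Sum>i\<le>Suc k. q ^ i) = u / 10 * (\<Sum>i\<le>k. q ^ i) + u / 10 * q ^ Suc k"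
        by (simp add: algebra_simps)
      have pos: "0 \<le> u / 10 * q ^ Suc k" using lam by (simp add: q_def)
      show ?case
      proof (cases "even j")
        case True
        then obtain m where m: "j = 2 * m" by (elim evenE)
        then have "m \<le> 2 ^ k" using Suc.prems by simp
        from Suc.IH[OF this] show ?thesis unfolding m pe up using pos by linarith
      next
        case False
        then obtain m where m: "j = Suc (2 * m)" by (elim oddE) auto
        then have "m \<le> 2 ^ k" "2 * m < 2 ^ Suc k" using Suc.prems by simp_all
        from Suc.IH[OF this(1)] inc[OF this(2)] show ?thesis unfolding m pe up by linarith
      qed
    qed
    have "(\<Sum>i\<le>k. q ^ i) \<le> 10" for k
    proof -
      have "(\<Sum>i\<le>k. q ^ i) = (1 - q ^ Suc k) / (1 - q)"
        using sum_gp0[of q k] by (simp add: q_def)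
      also have "\<dots> \<le> 10" by (simp add: q_def)
      finally show ?thesis .
    qed
    then have ten: "u / 10 * (\<Sum>i\<le>k. q ^ i) \<le> u / 10 * 10" for k using lam by (intro mult_left_mono) auto
    then have lev: "j \<le> 2 ^ k \<Longrightarrow> \<bar>X (p k j) \<omega> - X a \<omega>\<bar> \<le> u" for j k
        using order_trans[OF level[of j k] ten[of k]] by simp
    define m where "m k = nat \<lfloor>(t - a) / L * 2 ^ k\<rfloor>" for k :: nat
    have t0: "0 \<le> (t - a) / L" "(t - a) / L \<le> 1" using t L by (auto simp: field_simps)
    have m1: "real (m k) \<le> (t - a) / L * 2 ^ k" "(t - a) / L * 2 ^ k - 1 \<le> real (m k)" for k
    proof -
      have "0 \<le> (t - a) / L * 2 ^ k" by (intro mult_nonneg_nonneg t0) simp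
      then have "real (m k) = of_int \<lfloor>(t - a) / L * 2 ^ k\<rfloor>" unfolding m_def by simp
      then show "real (m k) \<le> (t - a) / L * 2 ^ k" "(t - a) / L * 2 ^ k - 1 \<le> real (m k)" by linarith+
    qed
    have m2: "m k \<le> 2 ^ k" for k
    proof -
      have "real (m k) \<le> 1 * 2 ^ k" using m1(1)[of k] t0
          by (meson mult_right_mono order_trans zero_le_numeral zero_le_power)
      then have "real (m k) \<le> real (2 ^ k)" by simp
      then show ?thesis by (simp only: of_nat_le_iff)
    qed
    have "(\<lambda>k. p k (m k)) \<longlonglongrightarrow> t"
    proof (rule real_tendsto_sandwich)
      show "\<forall>\<^sub>F k in sequentially. t - L * (1/2) ^ k \<le> p k (m k)"
      proof (rule always_eventually, rule allI)
        fix k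
        have "L * (((t - a) / L * 2 ^ k - 1) / 2 ^ k) \<le> L * (real (m k) / 2 ^ k)"
          using m1(2)[of k] L by (intro mult_left_mono divide_right_mono) auto
        moreover have "L * (((t - a) / L * 2 ^ k - 1) / 2 ^ k) = t - a - L * (1/2) ^ k"
          using L by (simp add: diff_divide_distrib right_diff_distrib power_one_over)
        ultimately show "t - L * (1/2) ^ k \<le> p k (m k)" by (simp add: p_def)
      qed
      show "\<forall>\<^sub>F k in sequentially. p k (m k) \<le> t"
      proof (rule always_eventually, rule allI)
        fix k
        have "L * (real (m k) / 2 ^ k) \<le> L * (((t - a) / L * 2 ^ k) / 2 ^ k)"
          using m1(1)[of k] L by (intro mult_left_mono divide_right_mono) auto
        then show "p k (m k) \<le> t" using L by (simp add: p_def)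
      qed
      have "(\<lambda>k. t - L * (1/2) ^ k) \<longlonglongrightarrow> t - L * 0"
        by (intro tendsto_intros LIMSEQ_realpow_zero) auto
      then show "(\<lambda>k. t - L * (1/2) ^ k) \<longlonglongrightarrow> t" by simp
    qed simp
    then have "(\<lambda>k. X (p k (m k)) \<omega>) \<longlonglongrightarrow> X t \<omega>"
      using cont[OF ws] t p_in m2 by (auto simp: continuous_on_sequentially comp_def)
    then have "(\<lambda>k. \<bar>X (p k (m k)) \<omega> - X a \<omega>\<bar>) \<longlonglongrightarrow> \<bar>X t \<omega> - X a \<omega>\<bar>" by (intro tendsto_intros)
    then show ?thesis by (rule LIMSEQ_le_const2) (use lev m2 in auto)
  qed
  with prob E_sets show ?thesis by (intro bexI[of _ "\<Union>k. E k"]) auto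
qed

section \<open>Greatest convex minorants\<close>

lemma convex_on_affine_real: "convex_on S (\<lambda>y::real. v + s * (y - x))" if "convex S"
  using that by (intro convex_onI) (auto simp: algebra_simps)

text \<open>
  A single convex minorant makes the supremum in \<open>gcm\<close> one of a nonempty set.
\<close>

context
  fixes I :: "real set" and h :: "real \<Rightarrow> real" and c0 :: "real \<Rightarrow> real"
  assumes minorant: "convex_on I c0" "\<And>y. y \<in> I \<Longrightarrow> c0 y \<le> h y"
begin

lemma gcm_bdd_above: "x \<in> I \<Longrightarrow> bdd_above {c x | c. convex_on I c \<and> (\<forall>y\<in>I. c y \<le> h y)}"
  by (auto intro!: bdd_aboveI[of _ "h x"])

lemma gcm_ge: "convex_on I c \<Longrightarrow> (\<And>y. y \<in> I \<Longrightarrow> c y \<le> h y) \<Longrightarrow> x \<in> I \<Longrightarrow> c x \<le> gcm I h x"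
  unfolding gcm_def by (rule cSup_upper[OF _ gcm_bdd_above]) auto

lemma gcm_least: "(\<And>c. convex_on I c \<Longrightarrow> (\<And>y. y \<in> I \<Longrightarrow> c y \<le> h y) \<Longrightarrow> c x \<le> u) \<Longrightarrow> gcm I h x \<le> u"
  unfolding gcm_def using minorant by (intro cSup_least) auto

lemma gcm_le: "x \<in> I \<Longrightarrow> gcm I h x \<le> h x"
  by (rule gcm_least) auto

lemma convex_on_gcm: "convex_on I (gcm I h)"
proof (rule convex_onI)
  show "convex I" using minorant(1) by (rule convex_on_imp_convex)
  fix t x y assume t: "(0::real) < t" "t < 1" and xy: "x \<in> I" "y \<in> I"
  show "gcm I h ((1 - t) *\<^sub>R x + t *\<^sub>R y) \<le> (1 - t) * gcm I h x + t * gcm I h y"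
  proof (rule gcm_least)
    fix c assume c: "convex_on I c" "\<And>y. y \<in> I \<Longrightarrow> c y \<le> h y"
    have "c ((1 - t) *\<^sub>R x + t *\<^sub>R y) \<le> (1 - t) * c x + t * c y"
      using convex_onD[OF c(1), of t x y] t xy by auto
    also have "\<dots> \<le> (1 - t) * gcm I h x + t * gcm I h y"
      using gcm_ge[OF c] xy t by (intro add_mono mult_left_mono) auto
    finally show "c ((1 - t) *\<^sub>R x + t *\<^sub>R y) \<le> (1 - t) * gcm I h x + t * gcm I h y" .
  qed
qed

end

lemma gcm_eq_self: "convex_on I h \<Longrightarrow> x \<in> I \<Longrightarrow> gcm I h x = h x"
  using gcm_ge[of I h h h x] gcm_le[of I h h x] by force

text \<open>
  Difference quotients of a convex function increase, so the right derivative is the infimum of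
  the slopes to the right, and an upper bound of the slopes to the left.
\<close>

lemma right_deriv_convex:
  assumes f: "convex_on {0..} f" and x: "(0::real) < x"
  shows "((\<lambda>y. (f y - f x) / (y - x)) \<longlongrightarrow> right_deriv f x) (at_right x)"
    and "\<And>y. x < y \<Longrightarrow> right_deriv f x \<le> (f y - f x) / (y - x)"
    and "\<And>y. 0 \<le> y \<Longrightarrow> y < x \<Longrightarrow> (f x - f y) / (x - y) \<le> right_deriv f x"
proof -
  define s where "s y = (f y - f x) / (y - x)" for y
  have mono: "s y \<le> s z" if "x < y" "y < z" for y z
    using convex_on_slope_le(1)[OF f, of x z y] that x
    by (simp add: s_def) (metis minus_diff_eq minus_divide_divide)
  have left: "s y \<le> s z" if "0 \<le> y" "y < x" "x < z" for y z
    using convex_on_slope_le[OF f, of y z x] that x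
    by (simp add: s_def) (metis (no_types, lifting) minus_diff_eq minus_divide_divide order_trans)
  define D where "D = Inf (s ` {x<..})"
  have bdd: "bdd_below (s ` {x<..})"
    using left[of 0] x by (intro bdd_belowI[of _ "s 0"]) auto
  have D_le: "D \<le> s y" if "x < y" for y unfolding D_def using that by (intro cInf_lower bdd) auto
  have ge_D: "s y \<le> D" if "0 \<le> y" "y < x" for y
    unfolding D_def using that left[of y] by (intro cInf_greatest) (auto simp: greaterThan_non_empty)
  have "(s \<longlongrightarrow> D) (at_right x)"
  proof (rule order_tendstoI)
    fix a assume "a < D"
    then show "\<forall>\<^sub>F y in at_right x. a < s y"
      using D_le eventually_at_right_less[of x] by (auto elim!: eventually_mono intro: less_le_trans)
  next
    fix a assume "D < a"
    then obtain z where z: "x < z" "s z < a"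
      using cInf_lessD[of "s ` {x<..}" a] by (auto simp: D_def greaterThan_non_empty)
    have "\<forall>\<^sub>F y in at_right x. y < z" using z(1) by (simp add: eventually_at_right_field exI[of _ z])
    then show "\<forall>\<^sub>F y in at_right x. s y < a"
      using eventually_at_right_less[of x] by eventually_elim (use mono z in \<open>force intro: le_less_trans\<close>)
  qed
  moreover have rd: "right_deriv f x = D"
    unfolding right_deriv_def using calculation unfolding s_def by (intro tendsto_Lim) auto
  ultimately show "((\<lambda>y. (f y - f x) / (y - x)) \<longlongrightarrow> right_deriv f x) (at_right x)"
    by (simp add: s_def[abs_def])
  show "right_deriv f x \<le> (f y - f x) / (y - x)" if "x < y" for y using D_le[OF that] rd by (simp add: s_def)
  show "(f x - f y) / (x - y) \<le> right_deriv f x" if "0 \<le> y" "y < x" for y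
    using ge_D[OF that] rd by (simp add: s_def) (metis minus_diff_eq minus_divide_divide)
qed

lemma right_deriv_gcm_quadratic:
  assumes "0 \<le> a"
  shows "right_deriv (gcm UNIV (\<lambda>t. t * w + 1/2 * t\<^sup>2 * a)) 0 = w"
proof -
  have "convex_on UNIV (\<lambda>t::real. t * w + 1/2 * t\<^sup>2 * a)"
  proof (rule f''_ge0_imp_convex)
    show "((\<lambda>t. t * w + 1/2 * t\<^sup>2 * a) has_real_derivative w + t * a) (at t)" for t
      by (auto intro!: derivative_eq_intros)
    show "((\<lambda>t. w + t * a) has_real_derivative a) (at t)" for t
      by (auto intro!: derivative_eq_intros)
  qed (use assms in auto)
  then have e: "gcm UNIV (\<lambda>t. t * w + 1/2 * t\<^sup>2 * a) = (\<lambda>t. t * w + 1/2 * t\<^sup>2 * a)"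
    by (auto intro!: gcm_eq_self)
  have "((\<lambda>y. w + 1/2 * y * a) \<longlongrightarrow> w + 1/2 * 0 * a) (at_right 0)" by (intro tendsto_intros)
  moreover have "\<forall>\<^sub>F y in at_right 0. w + 1/2 * y * a = (y * w + 1/2 * y\<^sup>2 * a - (0 * w +
      1/2 * 0\<^sup>2 * a)) / (y - 0)"
    using eventually_at_right_less[of "0::real"] by eventually_elim (simp add: field_simps power2_eq_square)
  ultimately show ?thesis unfolding e right_deriv_def
    by (intro tendsto_Lim) (auto intro: Lim_transform_eventually)
qed

text \<open>
  A description of the minorant by countably many conditions on \<open>h\<close>, for measurability. If the
  minorant exceeds \<open>r\<close> at \<open>x\<close>, its supporting line there can be lowered a little and tilted to a
  rational slope; because \<open>x > 0\<close>, the lowering compensates the tilting on the bounded part of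
  \<open>{0..}\<close> on the left of \<open>x\<close>, and decreasing the slope does no harm on the right.
\<close>

lemma gcm_greater_iff:
  assumes x: "(0::real) < x" and cont: "continuous_on {0..} h"
    and minor: "\<And>y. 0 \<le> y \<Longrightarrow> c * y \<le> h y"
  shows "r < gcm {0..} h x \<longleftrightarrow> (\<exists>s\<in>\<rat>. \<exists>v\<in>\<rat>. r < v \<and> (\<forall>y\<in>\<rat>. 0 \<le> y \<longrightarrow> v + s * (y - x) \<le> h y))"
proof
  have c0: "convex_on {0..} (\<lambda>y. c * y)" using convex_on_affine_real[of "{0..}" 0 c 0] by simp
  note g = convex_on_gcm[OF c0] gcm_le[OF c0] gcm_ge[OF c0]
  {
    assume r: "r < gcm {0..} h x"
    define g where "g = gcm {0..} h"
    have gc: "convex_on {0..} g" unfolding g_def using minor by (intro g(1)) auto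
    have gh: "g y \<le> h y" if "0 \<le> y" for y unfolding g_def using minor that by (intro g(2)) auto
    define D where "D = right_deriv g x"
    note rd = right_deriv_convex[OF gc x, folded D_def]
    have supp: "g x + D * (y - x) \<le> g y" if "0 \<le> y" for y
    proof -
      consider "y < x" | "y = x" | "x < y" by linarith
      then show ?thesis
      proof cases
        case 1
        then have "g x - g y \<le> D * (x - y)" using rd(3)[OF that 1] by (simp add: pos_divide_le_eq)
        then show ?thesis by (simp add: algebra_simps)
      next
        case 3
        then show ?thesis using rd(2)[OF 3] by (simp add: pos_le_divide_eq)
      qed auto
    qed
    obtain v where v: "v \<in> \<rat>" "r < v" "v < g x" using Rats_dense_in_real r by (metis g_def)
    (* Decreasing the slope by less than \<eta> costs at most g x - v on {0..x}. *)
    define \<eta> where "\<eta> = (g x - v) / x"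
    have "\<eta> > 0" using v x by (simp add: \<eta>_def)
    then obtain s where s: "s \<in> \<rat>" "D - \<eta> < s" "s < D" using Rats_dense_in_real[of "D - \<eta>" D] by auto
    have "v + s * (y - x) \<le> h y" if "0 \<le> y" for y
    proof -
      have "v + s * (y - x) \<le> g x + D * (y - x)"
      proof (cases "x \<le> y")
        case True
        then show ?thesis using v s mult_right_mono[of s D "y - x"] by linarith
      next
        case False
        have "(D - s) * (x - y) \<le> \<eta> * x" using False s x that \<open>\<eta> > 0\<close> by (intro mult_mono) auto
        also have "\<dots> = g x - v" using x by (simp add: \<eta>_def)
        finally show ?thesis by (simp add: algebra_simps)
      qed
      with supp[OF that] gh[OF that] show ?thesis by linarith
    qed
    with s v show "\<exists>s\<in>\<rat>. \<exists>v\<in>\<rat>. r < v \<and> (\<forall>y\<in>\<rat>. 0 \<le> y \<longrightarrow> v + s * (y - x) \<le> h y)" by blast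
  }
  {
    assume "\<exists>s\<in>\<rat>. \<exists>v\<in>\<rat>. r < v \<and> (\<forall>y\<in>\<rat>. 0 \<le> y \<longrightarrow> v + s * (y - x) \<le> h y)"
    then obtain s v where v: "r < v" and sv: "\<And>y. y \<in> \<rat> \<Longrightarrow> 0 \<le> y \<Longrightarrow> v + s * (y - x) \<le> h y" by blast
    have all: "v + s * (y - x) \<le> h y" if y: "0 \<le> y" for y
    proof -
      have "\<exists>q\<in>\<rat>. y < q \<and> q < y + 1 / real (Suc n)" for n
          using Rats_dense_in_real[of y "y + 1 / real (Suc n)"] by auto
      then obtain q where q: "\<And>n. q n \<in> \<rat>" "\<And>n. y < q n" "\<And>n. q n < y + 1 / real (Suc n)" by metis
      have "q \<longlonglongrightarrow> y"
      proof (rule real_tendsto_sandwich[where f = "\<lambda>_. y" and h = "\<lambda>n. y + 1 / real (Suc n)"])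
        show "(\<lambda>n. y + 1 / real (Suc n)) \<longlonglongrightarrow> y" using tendsto_add[OF tendsto_const LIMSEQ_inverse_real_of_nat, of
            y]
          by (simp add: inverse_eq_divide)
        show "\<forall>\<^sub>F n in sequentially. y \<le> q n" "\<forall>\<^sub>F n in sequentially. q n \<le> y + 1 / real (Suc n)"
          using q by (auto intro!: always_eventually less_imp_le simp del: of_nat_Suc)
      qed (rule tendsto_const)
      have q0: "0 \<le> q n" for n using q(2)[of n] y by linarith
      have hq: "(\<lambda>n. h (q n)) \<longlonglongrightarrow> h y"
        by (rule continuous_on_tendsto_compose[OF cont \<open>q \<longlonglongrightarrow> y\<close>]) (simp_all add: y q0)
      have L: "(\<lambda>n. v + s * (q n - x)) \<longlonglongrightarrow> v + s * (y - x)"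
        by (intro tendsto_intros \<open>q \<longlonglongrightarrow> y\<close>)
      show ?thesis
        by (rule LIMSEQ_le[OF L hq]) (intro exI[of _ 0] allI impI sv q(1) q0)
    qed
    have "v + s * (x - x) \<le> gcm {0..} h x"
      by (rule g(3)[OF _ convex_on_affine_real[of "{0..}" v s x]]) (use minor all x in auto)
    with v show "r < gcm {0..} h x" by simp
  }
qed

lemma sets_Collect_countable_Bex_Rats:
  fixes Q :: "real \<Rightarrow> 'a \<Rightarrow> bool"
  assumes "\<And>q. q \<in> \<rat> \<inter> A \<Longrightarrow> {\<omega> \<in> space M. Q q \<omega>} \<in> sets M"
  shows "{\<omega> \<in> space M. \<exists>q\<in>\<rat> \<inter> A. Q q \<omega>} \<in> sets M" "{\<omega> \<in> space M. \<forall>q\<in>\<rat> \<inter> A. Q q \<omega>} \<in> sets M"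
proof -
  have c: "countable (\<rat> \<inter> A)" using countable_rat by (rule countable_Int1)
  have "{\<omega> \<in> space M. \<exists>q\<in>\<rat> \<inter> A. Q q \<omega>} = (\<Union>q\<in>\<rat> \<inter> A. {\<omega> \<in> space M. Q q \<omega>})" by auto
  also have "\<dots> \<in> sets M" using assms by (intro sets.countable_UN'[OF c]) auto
  finally show "{\<omega> \<in> space M. \<exists>q\<in>\<rat> \<inter> A. Q q \<omega>} \<in> sets M" .
  have "{\<omega> \<in> space M. \<forall>q\<in>\<rat> \<inter> A. Q q \<omega>} = space M - (\<Union>q\<in>\<rat> \<inter> A. space M - {\<omega> \<in> space M. Q q \<omega>})" by auto
  also have "\<dots> \<in> sets M" using assms by (intro sets.Diff sets.top sets.countable_UN'[OF c]) auto
  finally show "{\<omega> \<in> space M. \<forall>q\<in>\<rat> \<inter> A. Q q \<omega>} \<in> sets M" .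
qed

lemma measurable_right_deriv_gcm:
  assumes x: "(0::real) < x" and cont: "\<And>\<omega>. \<omega> \<in> space M \<Longrightarrow> continuous_on {0..} (h \<omega>)"
    and minor: "\<And>\<omega> y. \<omega> \<in> space M \<Longrightarrow> 0 \<le> y \<Longrightarrow> c * y \<le> h \<omega> y"
    and meas [measurable]: "\<And>y. 0 \<le> y \<Longrightarrow> (\<lambda>\<omega>. h \<omega> y) \<in> borel_measurable M"
  shows "(\<lambda>\<omega>. right_deriv (gcm {0..} (h \<omega>)) x) \<in> borel_measurable M"
proof -
  have g: "(\<lambda>\<omega>. gcm {0..} (h \<omega>) y) \<in> borel_measurable M" if y: "0 < y" for y
  proof (rule borel_measurableI_greater)
    fix r
    have "{\<omega> \<in> space M. r < gcm {0..} (h \<omega>) y} =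
      {\<omega> \<in> space M. \<exists>s\<in>\<rat>. \<exists>v\<in>\<rat>. r < v \<and> (\<forall>z\<in>\<rat>. 0 \<le> z \<longrightarrow> v + s * (z - y) \<le> h \<omega> z)}"
      using gcm_greater_iff[OF y cont minor] by blast
    also have "\<dots> = {\<omega> \<in> space M. \<exists>s\<in>\<rat> \<inter> UNIV. \<exists>v\<in>\<rat> \<inter> {r<..}. \<forall>z\<in>\<rat> \<inter> {0..}. v + s * (z - y) \<le> h \<omega> z}" by auto
    also have "\<dots> \<in> sets M"
      by (intro sets_Collect_countable_Bex_Rats borel_measurable_le borel_measurable_const meas) auto
    finally show "{\<omega> \<in> space M. r < gcm {0..} (h \<omega>) y} \<in> sets M" .
  qed
  show ?thesis
  proof (rule borel_measurable_LIMSEQ_real)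
    show "(\<lambda>\<omega>. (gcm {0..} (h \<omega>) (x + 1 / real (Suc n)) - gcm {0..} (h \<omega>) x) / (x + 1 / real (Suc n) - x))
      \<in> borel_measurable M" for n
      using g[of "x + 1 / real (Suc n)"] g[of x] x
          by (intro borel_measurable_divide borel_measurable_diff) (auto simp: add_pos_pos)
    fix \<omega> assume w: "\<omega> \<in> space M"
    have "convex_on {0..} (\<lambda>y. c * y)" using convex_on_affine_real[of "{0..}" 0 c 0] by simp
    then have "convex_on {0..} (gcm {0..} (h \<omega>))" using minor[OF w] by (intro convex_on_gcm) auto
    note t = right_deriv_convex(1)[OF this x]
    have "filterlim (\<lambda>n. x + 1 / real (Suc n)) (at_right x) sequentially"
      unfolding filterlim_at using tendsto_add[OF tendsto_const LIMSEQ_inverse_real_of_nat, of x]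
          by (auto simp: inverse_eq_divide)
    from filterlim_compose[OF t this]
    show "(\<lambda>n. (gcm {0..} (h \<omega>) (x + 1 / real (Suc n)) - gcm {0..} (h \<omega>) x) / (x + 1 / real (Suc n) - x))
      \<longlonglongrightarrow> right_deriv (gcm {0..} (h \<omega>)) x" .
  qed
qed

text \<open>
  The localization principle. A line of slope \<open>s\<close> that lies below \<open>h\<close> everywhere and misses \<open>h x\<close>
  by at most \<open>\<eta>\<close> bounds the minorant at \<open>x\<close> from below; two points at distance \<open>d\<close> where \<open>h\<close> is
  hardly above the line bound it from above. Convexity does the rest.
\<close>

lemma right_deriv_gcm_localized:
  assumes x: "(0::real) < x" and d: "0 < d" "d \<le> x"
    and supp: "\<And>y. 0 \<le> y \<Longrightarrow> h x - \<eta> + s * (y - x) \<le> h y"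
    and up: "h (x + d) \<le> h x + s * d + \<eta>" and dn: "h (x - d) \<le> h x - s * d + \<eta>"
  shows "\<bar>right_deriv (gcm {0..} h) x - s\<bar> \<le> 2 * \<eta> / d"
proof -
  have c0: "convex_on {0..} (\<lambda>y. h x - \<eta> + s * (y - x))" by (intro convex_on_affine_real) auto
  define g where "g = gcm {0..} h"
  have gc: "convex_on {0..} g" unfolding g_def by (intro convex_on_gcm[OF c0]) (use supp in auto)
  have gh: "g y \<le> h y" if "0 \<le> y" for y unfolding g_def by (intro gcm_le[OF c0]) (use supp that in auto)
  have gx: "h x - \<eta> \<le> g x"
    using gcm_ge[OF c0 _ c0, of h x] supp x by (auto simp: g_def)
  note rd = right_deriv_convex[OF gc x]
  have "right_deriv g x \<le> (g (x + d) - g x) / d" using rd(2)[of "x + d"] d by simp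
  also have "\<dots> \<le> (s * d + 2 * \<eta>) / d" using gh[of "x + d"] gx up d x by (intro divide_right_mono) auto
  also have "\<dots> = s + 2 * \<eta> / d" using d by (simp add: field_simps)
  finally have 1: "right_deriv g x \<le> s + 2 * \<eta> / d" .
  have "s - 2 * \<eta> / d = (s * d - 2 * \<eta>) / d" using d by (simp add: field_simps)
  also have "\<dots> \<le> (g x - g (x - d)) / d" using gh[of "x - d"] gx dn d x by (intro divide_right_mono) auto
  also have "\<dots> \<le> right_deriv g x" using rd(3)[of "x - d"] d by simp
  finally show ?thesis using 1 by (simp add: g_def abs_le_iff)
qed

section \<open>Second moments of kernel increments under a local mass bound\<close>

text \<open>
  Since \<open>1 / (y - x) - 1 / b\<close> is the integral of \<open>1 / s\<^sup>2\<close> over \<open>{y - x..b}\<close>, Fubini's theorem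
  expresses the integral by the masses of \<open>{x + a<..x + s}\<close>. If these are \<open>c * s\<close> up to errors,
  the main term is \<open>c * ln (b / a)\<close>: the source of the logarithm in \<open>eps\<close>. Taking \<open>c = 0\<close> gives
  upper bounds.
\<close>

lemma reciprocal_integral:
  fixes \<mu> :: "real measure"
  assumes "real_distribution \<mu>" and ab: "0 < a" "a \<le> b" and cde: "0 \<le> c" "0 \<le> d" "0 \<le> e"
    and mass: "\<And>s. s \<in> {a..b} \<Longrightarrow> \<bar>measure \<mu> {x + a<..x + s} - c * s\<bar> \<le> d * s + e"
  shows "\<bar>(\<integral>y. indicator {x + a<..x + b} y / (y - x) \<partial>\<mu>) - c * ln (b / a)\<bar> \<le> d * ln (b / a) + c + d + e / a"
proof -
  interpret real_distribution \<mu> by fact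
  interpret pair_sigma_finite \<mu> lborel ..
  define m where "m s = measure \<mu> {x + a<..x + s}" for s
  have I: "has_bochner_integral lborel (\<lambda>s. indicator {u..b} s * (1 / s\<^sup>2)) (1 / u - 1 / b)" if "0 < u" "u \<le> b"
      for u
  proof (rule has_bochner_integral_of_nonneg_has_integral)
    have "((\<lambda>s. 1 / s\<^sup>2) has_integral (- 1 / b) - (- 1 / u)) {u..b}"
      by (rule fundamental_theorem_of_calculus)
        (use that in \<open>auto intro!: derivative_eq_intros
          simp: has_real_derivative_iff_has_vector_derivative[symmetric] power2_eq_square\<close>)
    then show "((\<lambda>s. 1 / s\<^sup>2) has_integral 1 / u - 1 / b) {u..b}" by simp
  qed auto
  have J: "has_bochner_integral lborel (\<lambda>s. indicator {a..b} s * (1 / s)) (ln (b / a))"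
  proof (rule has_bochner_integral_of_nonneg_has_integral)
    have "((\<lambda>s. 1 / s) has_integral ln b - ln a) {a..b}"
      by (rule fundamental_theorem_of_calculus)
        (use ab in \<open>auto intro!: derivative_eq_intros
          simp: has_real_derivative_iff_has_vector_derivative[symmetric]\<close>)
    then show "((\<lambda>s. 1 / s) has_integral ln (b / a)) {a..b}" using ab by (simp add: ln_div)
  qed (use ab in auto)
  define f where "f = (\<lambda>y s. if x + a < y \<and> y \<le> x + s \<and> a \<le> s \<and> s \<le> b then 1 / s\<^sup>2 else (0::real))"
  have [measurable]: "case_prod f \<in> borel_measurable (\<mu> \<Otimes>\<^sub>M lborel)" unfolding f_def split_beta' by measurable
  have fi: "integrable (\<mu> \<Otimes>\<^sub>M lborel) (case_prod f)"
  proof (rule integrableI_bounded_set[where A = "UNIV \<times> {a..b}" and B = "1 / a\<^sup>2"])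
    show "emeasure (\<mu> \<Otimes>\<^sub>M lborel) (UNIV \<times> {a..b}) < \<infinity>"
      using ab emeasure_space_1 by (simp add: lborel.emeasure_pair_measure_Times)
    have "UNIV \<times> {a..b} \<in> sets (borel \<Otimes>\<^sub>M borel)" by simp
    then show "UNIV \<times> {a..b} \<in> sets (\<mu> \<Otimes>\<^sub>M lborel)" by (simp cong: sets_pair_measure_cong)
    have "norm (case_prod f p) \<le> 1 / a\<^sup>2" for p
      using ab by (auto simp: f_def split: prod.split intro!: divide_left_mono power_mono)
    then show "AE p in \<mu> \<Otimes>\<^sub>M lborel. p \<in> UNIV \<times> {a..b} \<longrightarrow> norm (case_prod f p) \<le> 1 / a\<^sup>2" by simp
  qed (use ab in \<open>auto simp: f_def split: prod.splits\<close>)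
  have inner_s: "(\<integral>s. f y s \<partial>lborel) = indicator {x + a<..x + b} y * (1 / (y - x) - 1 / b)" for y
  proof (cases "y \<in> {x + a<..x + b}")
    case True
    have "f y s = indicator {y - x..b} s * (1 / s\<^sup>2)" for s using True by (auto simp: f_def indicator_def)
    then show ?thesis using I[of "y - x"] True ab by (simp add: has_bochner_integral_iff)
  next
    case False
    then have "f y s = 0" for s by (auto simp: f_def)
    then show ?thesis using False by simp
  qed
  have inner_y: "(\<integral>y. f y s \<partial>\<mu>) = indicator {a..b} s * (1 / s\<^sup>2) * m s" for s
  proof -
    have "f y s = (indicator {a..b} s * (1 / s\<^sup>2)) * indicator {x + a<..x + s} y" for y
      by (auto simp: f_def indicator_def)
    then show ?thesis by (simp add: m_def)
  qed
  have ir: "integrable \<mu> (\<lambda>y. indicator {x + a<..x + b} y / (y - x))"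
    by (rule integrable_const_bound[of _ "1 / a"]) (use ab in \<open>auto simp: indicator_def intro!:
        divide_left_mono\<close>)
  have "(\<integral>s. indicator {a..b} s * (1 / s\<^sup>2) * m s \<partial>lborel) = (\<integral>y. indicator {x + a<..x +
      b} y * (1 / (y - x) - 1 / b) \<partial>\<mu>)"
    using Fubini_integral[OF fi] by (simp add: inner_s inner_y)
  also have "\<dots> = (\<integral>y. indicator {x + a<..x + b} y / (y - x) - (1 / b) * indicator {x + a<..x + b} y \<partial>\<mu>)"
    by (simp add: right_diff_distrib)
  also have "\<dots> = (\<integral>y. indicator {x + a<..x + b} y / (y - x) \<partial>\<mu>) - m b / b"
    using ir by (subst Bochner_Integration.integral_diff) (auto simp: m_def less_top[symmetric])
  finally have key: "(\<integral>y. indicator {x + a<..x + b} y / (y - x) \<partial>\<mu>) =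
      (\<integral>s. indicator {a..b} s * (1 / s\<^sup>2) * m s \<partial>lborel) + m b / b"
    by simp
  have mi: "integrable lborel (\<lambda>s. indicator {a..b} s * (1 / s\<^sup>2) * m s)"
    using integrable_snd[OF fi] by (simp add: inner_y)
  have Ja: "integrable lborel (\<lambda>s. indicator {a..b} s * (1 / s))" and Ia: "integrable lborel (\<lambda>s. indicator
      {a..b} s * (1 / s\<^sup>2))"
    using J I[of a] ab by (auto simp: has_bochner_integral_iff)
  have "\<bar>(\<integral>s. indicator {a..b} s * (1 / s\<^sup>2) * m s \<partial>lborel) - c * ln (b / a)\<bar>
      = \<bar>\<integral>s. indicator {a..b} s * (1 / s\<^sup>2) * m s - c * (indicator {a..b} s * (1 / s)) \<partial>lborel\<bar>"
    by (simp only: Bochner_Integration.integral_diff[OF mi integrable_mult_right[OF Ja]]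
        integral_mult_right_zero has_bochner_integral_integral_eq[OF J])
  also have "\<dots> \<le> (\<integral>s. d * (indicator {a..b} s * (1 / s)) + e * (indicator {a..b} s * (1 / s\<^sup>2)) \<partial>lborel)"
  proof (rule integral_abs_bound[THEN order_trans], rule integral_mono)
    fix s
    show "\<bar>indicator {a..b} s * (1 / s\<^sup>2) * m s - c * (indicator {a..b} s * (1 / s))\<bar> \<le>
         d * (indicator {a..b} s * (1 / s)) + e * (indicator {a..b} s * (1 / s\<^sup>2))"
    proof (cases "s \<in> {a..b}")
      case True
      then have s: "0 < s" using ab by auto
      have "\<bar>1 / s\<^sup>2 * m s - c * (1 / s)\<bar> = 1 / s\<^sup>2 * \<bar>m s - c * s\<bar>"
        using s by (simp add: abs_mult_pos' field_simps power2_eq_square flip: abs_mult_pos)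
      also have "\<dots> \<le> 1 / s\<^sup>2 * (d * s + e)" using mass[OF True] by (intro mult_left_mono) (auto simp: m_def)
      also have "\<dots> = d * (1 / s) + e * (1 / s\<^sup>2)" using s by (simp add: field_simps power2_eq_square)
      finally show ?thesis using True by simp
    qed simp
    show "integrable lborel (\<lambda>s. \<bar>indicator {a..b} s * (1 / s\<^sup>2) * m s - c * (indicator {a..b} s * (1 / s))\<bar>)"
      by (intro integrable_abs Bochner_Integration.integrable_diff mi integrable_mult_right Ja)
    show "integrable lborel (\<lambda>s. d * (indicator {a..b} s * (1 / s)) + e * (indicator {a..b} s * (1 / s\<^sup>2)))"
      by (intro Bochner_Integration.integrable_add integrable_mult_right Ja Ia)
  qed
  also have "\<dots> = d * ln (b / a) + e * (1 / a - 1 / b)"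
    by (simp only: Bochner_Integration.integral_add[OF integrable_mult_right[OF Ja] integrable_mult_right[OF
        Ia]]
        integral_mult_right_zero has_bochner_integral_integral_eq[OF J] has_bochner_integral_integral_eq[OF
            I[OF ab]])
  finally have A: "\<bar>(\<integral>s. indicator {a..b} s * (1 / s\<^sup>2) * m s \<partial>lborel) - c * ln (b / a)\<bar> \<le>
      d * ln (b / a) + e * (1 / a - 1 / b)" .
  have "m b \<le> c * b + d * b + e" using mass[of b] ab by (auto simp: m_def)
  then have "m b / b \<le> c + d + e / b" using ab by (simp add: field_simps)
  moreover have "0 \<le> m b / b" using ab by (simp add: m_def)
  moreover have "e * (1 / a - 1 / b) + e / b = e / a" by (simp add: algebra_simps)
  ultimately show ?thesis unfolding key using A cde by linarith
qed

text \<open>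
  All upper bounds for second moments of kernel increments near \<open>x0\<close> come from this mass bound. It
  carries no information below the scale \<open>\<epsilon>\<close>, the precision to which the law is known.
\<close>

locale local_mass = real_distribution \<mu> for \<mu> :: "real measure" +
  fixes x0 C \<epsilon> :: real
  assumes x0: "0 < x0" and C1: "1 \<le> C" and eps: "0 < \<epsilon>" "\<epsilon> < 1"
    and mass: "\<And>u. 0 \<le> u \<Longrightarrow> measure \<mu> {x0 - u<..x0 + u} \<le> C * (u + \<epsilon>)"
begin

lemma mass_interval:
  assumes "\<bar>x - x0\<bar> \<le> A" "\<epsilon> \<le> A" "0 \<le> r" "0 \<le> s"
  shows "measure \<mu> {x - r<..x + s} \<le> C * (r + s + 2 * A)"
proof -
  have "measure \<mu> {x - r<..x + s} \<le> measure \<mu> {x0 - (r + s + A)<..x0 + (r + s + A)}"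
    by (rule finite_measure_mono) (use assms in auto)
  also have "\<dots> \<le> C * ((r + s + A) + \<epsilon>)" using mass assms eps by simp
  also have "\<dots> \<le> C * (r + s + 2 * A)" using C1 assms by (intro mult_left_mono) auto
  finally show ?thesis .
qed

text \<open>
  With \<open>h = b - a\<close>, the square of \<open>sqrt_gap a b y\<close> is at most \<open>h\<close> on an interval of length \<open>h\<close>, at
  most \<open>h\<^sup>2 / (y - a)\<close> up to distance 1, and at most \<open>h\<^sup>2\<close> beyond. The middle range costs the
  logarithm, by \<open>reciprocal_integral\<close>.
\<close>

lemma sqrt_gap_second_moment:
  assumes a: "\<bar>a - x0\<bar> \<le> A" and b: "\<bar>b - x0\<bar> \<le> A" and ab: "a < b" and A: "\<epsilon> \<le> A" "2 * A \<le> 1"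
  shows "(\<integral>y. (sqrt_gap a b y)\<^sup>2 \<partial>\<mu>) \<le> 20 * C * A * (b - a) * (1 + ln (1 / \<epsilon>))"
proof -
  define h where "h = b - a"
  have h: "0 < h" "h \<le> 2 * A" "h \<le> 1" using a b ab A by (auto simp: h_def abs_if split: if_splits)
  have A0: "0 < A" using A eps by auto
  define q where "q = (\<lambda>y. h * indicator {a<..a + h} y + (h\<^sup>2 * (indicator {a + h<..a + 1} y / (y - a)) + h\<^sup>2))"
  have [measurable]: "(\<lambda>y. (sqrt_gap a b y)\<^sup>2) \<in> borel_measurable borel" unfolding sqrt_gap_def by measurable
  have g0: "0 \<le> sqrt_gap a b y" for y using ab by (intro sqrt_gap_nonneg) auto
  have le: "(sqrt_gap a b y)\<^sup>2 \<le> q y" for y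
  proof -
    have far: "(sqrt_gap a b y)\<^sup>2 \<le> h\<^sup>2 / (y - a)" if "a < y"
    proof -
      have "(sqrt_gap a b y)\<^sup>2 \<le> (h / sqrt (y - a))\<^sup>2"
        using sqrt_gap_le_divide[of a b y] g0 that ab by (intro power_mono) (auto simp: h_def)
      then show ?thesis using that by (simp add: power_divide)
    qed
    consider "y \<le> a" | "a < y" "y \<le> a + h" | "a + h < y" "y \<le> a + 1" | "a + 1 < y" by linarith
    then show ?thesis
    proof cases
      case 1
      then show ?thesis using ab h by (auto simp: sqrt_gap_eq_0 q_def indicator_def)
    next
      case 2
      have "(sqrt_gap a b y)\<^sup>2 \<le> (sqrt h)\<^sup>2" using sqrt_gap_le_sqrt[of a b y] ab g0
        by (intro power_mono) (auto simp: h_def)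
      then show ?thesis using 2 h by (simp add: q_def indicator_def add_increasing2)
    next
      case 3
      then show ?thesis using far h by (simp add: q_def indicator_def add_increasing2)
    next
      case 4
      have "h\<^sup>2 / (y - a) \<le> h\<^sup>2 / 1" using 4 by (intro divide_left_mono) auto
      then show ?thesis using far 4 h by (simp add: q_def indicator_def)
    qed
  qed
  have ir: "integrable \<mu> (\<lambda>y. indicator {a + h<..a + 1} y / (y - a))"
    by (rule integrable_const_bound[of _ "1 / h"]) (use h in \<open>auto simp: indicator_def intro!:
        divide_left_mono\<close>)
  have gi: "integrable \<mu> (\<lambda>y. (sqrt_gap a b y)\<^sup>2)"
  proof (rule integrable_const_bound[of _ "h"])
    have "(sqrt_gap a b y)\<^sup>2 \<le> (sqrt h)\<^sup>2" for y using sqrt_gap_le_sqrt[of a b y] ab g0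
        by (intro power_mono) (auto simp: h_def)
    then show "AE y in \<mu>. norm ((sqrt_gap a b y)\<^sup>2) \<le> h" using h by simp
  qed simp
  have i1: "integrable \<mu> (\<lambda>y. h * indicator {a<..a + h} y)"
    by (intro integrable_mult_right integrable_real_indicator) (auto simp: less_top[symmetric])
  have i2: "integrable \<mu> (\<lambda>y. h\<^sup>2 * (indicator {a + h<..a + 1} y / (y - a)))"
      by (rule integrable_mult_right[OF ir])
  have i3: "integrable \<mu> (\<lambda>y. h\<^sup>2)" by simp
  have "(\<integral>y. (sqrt_gap a b y)\<^sup>2 \<partial>\<mu>) \<le> (\<integral>y. q y \<partial>\<mu>)"
    by (rule integral_mono[OF gi _ le])
      (unfold q_def, intro Bochner_Integration.integrable_add i1 i2 i3)
  also have "\<dots> = (\<integral>y. h * indicator {a<..a + h} y \<partial>\<mu>) + ((\<integral>y. h\<^sup>2 * (indicator {a + h<..a +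
      1} y / (y - a)) \<partial>\<mu>) + (\<integral>y. h\<^sup>2 \<partial>\<mu>))"
    unfolding q_def by (simp only: Bochner_Integration.integral_add[OF i1 Bochner_Integration.integrable_add[OF
        i2 i3]]
      Bochner_Integration.integral_add[OF i2 i3])
  also have "\<dots> = h * measure \<mu> {a<..a + h} + (h\<^sup>2 * (\<integral>y. indicator {a + h<..a + 1} y / (y - a) \<partial>\<mu>) + h\<^sup>2)"
    using prob_space by (simp only: integral_mult_right_zero) simp
  finally have 1: "(\<integral>y. (sqrt_gap a b y)\<^sup>2 \<partial>\<mu>) \<le> h * measure \<mu> {a<..a + h} + (h\<^sup>2 * (\<integral>y. indicator {a +
      h<..a + 1} y / (y - a) \<partial>\<mu>) + h\<^sup>2)" .
  have m1: "measure \<mu> {a<..a + h} \<le> 4 * C * A"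
  proof -
    have "measure \<mu> {a<..a + h} \<le> C * (h + 2 * A)" using mass_interval[OF a A(1), of 0 h] h by simp
    also have "\<dots> \<le> C * (4 * A)" using h C1 by (intro mult_left_mono) auto
    finally show ?thesis by simp
  qed
  have "\<bar>(\<integral>y. indicator {a + h<..a + 1} y / (y - a) \<partial>\<mu>) - 0 * ln (1 / h)\<bar> \<le>
      C * ln (1 / h) + 0 + C + (2 * C * A) / h"
  proof (rule reciprocal_integral)
    fix s assume s: "s \<in> {h..1}"
    have "measure \<mu> {a + h<..a + s} \<le> measure \<mu> {a - 0<..a + s}" by (rule finite_measure_mono) (use h in auto)
    also have "\<dots> \<le> C * (s + 2 * A)" using mass_interval[OF a A(1), of 0 s] s h by simp
    finally show "\<bar>measure \<mu> {a + h<..a + s} - 0 * s\<bar> \<le> C * s + 2 * C * A" by (simp add: algebra_simps)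
  qed (use h C1 A0 real_distribution_axioms in auto)
  then have m2: "(\<integral>y. indicator {a + h<..a + 1} y / (y - a) \<partial>\<mu>) \<le> C * ln (1 / h) + C + 2 * C * A / h" by simp
  have L: "0 \<le> ln (1 / \<epsilon>)" using eps by simp
  have hl: "h * ln (1 / h) \<le> 2 * A * ln (1 / \<epsilon>) + A"
  proof -
    (* h may be much smaller than \<epsilon>; the factor h absorbs the excess of the logarithm. *)
    have "ln (1 / h) = ln (1 / \<epsilon>) + ln (\<epsilon> / h)" using h eps by (simp add: ln_div)
    also have "\<dots> \<le> ln (1 / \<epsilon>) + \<epsilon> / h" using ln_le_minus_one[of "\<epsilon> / h"] h eps by simp
    finally have "h * ln (1 / h) \<le> h * (ln (1 / \<epsilon>) + \<epsilon> / h)" using h by (intro mult_left_mono) auto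
    also have "\<dots> = h * ln (1 / \<epsilon>) + \<epsilon>" using h by (simp add: distrib_left)
    also have "\<dots> \<le> 2 * A * ln (1 / \<epsilon>) + A" using h L A by (intro add_mono mult_right_mono) auto
    finally show ?thesis .
  qed
  have "h\<^sup>2 * (\<integral>y. indicator {a + h<..a + 1} y / (y - a) \<partial>\<mu>) \<le> h\<^sup>2 * (C * ln (1 / h) + C + 2 * C * A / h)"
    using m2 by (intro mult_left_mono) auto
  also have "\<dots> = h * C * (h * ln (1 / h)) + h * C * h + h * C * (2 * A)"
    using h by (simp add: power2_eq_square field_simps)
  also have "\<dots> \<le> h * C * (2 * A * ln (1 / \<epsilon>) + A) + h * C * (2 * A) + h * C * (2 * A)"
    using h C1 hl by (intro add_mono mult_left_mono) auto
  finally have 2: "h\<^sup>2 * (\<integral>y. indicator {a + h<..a + 1} y / (y - a) \<partial>\<mu>) \<le> h * C * A * (2 * ln (1 / \<epsilon>) + 5)"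
    by (simp add: algebra_simps)
  have 3: "h * measure \<mu> {a<..a + h} \<le> h * C * A * 4" using mult_left_mono[OF m1, of h] h by (simp add: mult_ac)
  have "h * h \<le> h * (2 * A)" using h by (intro mult_left_mono) auto
  also have "\<dots> \<le> h * (C * (2 * A))" using h C1 A0 by (intro mult_left_mono) auto
  finally have 4: "h\<^sup>2 \<le> h * C * A * 2" by (simp add: power2_eq_square mult_ac)
  have "h * C * A * (2 * ln (1 / \<epsilon>) + 11) \<le> h * C * A * (20 * (1 + ln (1 / \<epsilon>)))"
    using h C1 A0 L by (intro mult_left_mono) auto
  then show ?thesis using 1 2 3 4 by (simp add: h_def algebra_simps)
qed

lemma ikern_increment_second_moment:
  assumes a: "\<bar>a - x0\<bar> \<le> A" and b: "\<bar>b - x0\<bar> \<le> A" and ab: "a < b" and A: "\<epsilon> \<le> A" "2 * A \<le> 1" "2 * A \<le> x0"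
  shows "(\<integral>y. (ikern y b - ikern y a)\<^sup>2 \<partial>\<mu>) \<le> 400 * (1 + x0) * C * A * (b - a) * (1 + ln (1 / \<epsilon>))"
proof -
  define h where "h = b - a"
  have A0: "0 < A" using A eps by auto
  have h: "0 < h" "h \<le> 2 * A" using a b ab A by (auto simp: h_def abs_if split: if_splits)
  have bb: "0 \<le> a" "b \<le> 2 * x0" using a b A A0 by (auto simp: abs_if split: if_splits)
  have [measurable]: "sqrt_gap a b \<in> borel_measurable borel" unfolding sqrt_gap_def[abs_def] by measurable
  have [measurable]: "(\<lambda>y. ikern y a) \<in> borel_measurable borel" "(\<lambda>y. ikern y b) \<in> borel_measurable borel"
    using bb ab by (auto intro!: borel_measurable_ikern)
  have g0: "0 \<le> sqrt_gap a b y" for y using ab by (intro sqrt_gap_nonneg) auto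
  have gs: "sqrt_gap a b y \<le> sqrt h" for y using sqrt_gap_le_sqrt[of a b y] ab by (simp add: h_def)
  have pt: "(ikern y b - ikern y a)\<^sup>2 \<le> 2 * h\<^sup>2 + 16 * x0 * (sqrt_gap a b y)\<^sup>2" for y
  proof -
    have "\<bar>ikern y b - ikern y a\<bar> \<le> h + 2 * sqrt (2 * x0) * sqrt_gap a b y"
      using abs_ikern_diff_le[of a b "2 * x0" y] bb ab by (simp add: h_def)
    then have "(ikern y b - ikern y a)\<^sup>2 \<le> (h + 2 * sqrt (2 * x0) * sqrt_gap a b y)\<^sup>2"
      by (metis abs_ge_zero power2_abs power_mono)
    also have "\<dots> \<le> 2 * h\<^sup>2 + 2 * (2 * sqrt (2 * x0) * sqrt_gap a b y)\<^sup>2"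
      using sum_squares_bound[of h "2 * sqrt (2 * x0) * sqrt_gap a b y"] by (simp add: power2_sum)
    also have "(2 * sqrt (2 * x0) * sqrt_gap a b y)\<^sup>2 = 8 * x0 * (sqrt_gap a b y)\<^sup>2"
      using x0 by (simp add: power_mult_distrib)
    finally show ?thesis by simp
  qed
  have gi: "integrable \<mu> (\<lambda>y. (sqrt_gap a b y)\<^sup>2)"
  proof (rule integrable_const_bound[of _ "(sqrt h)\<^sup>2"])
    have "(sqrt_gap a b y)\<^sup>2 \<le> (sqrt h)\<^sup>2" for y using gs g0 by (intro power_mono) auto
    then show "AE y in \<mu>. norm ((sqrt_gap a b y)\<^sup>2) \<le> (sqrt h)\<^sup>2" by simp
  qed simp
  have "(\<integral>y. (ikern y b - ikern y a)\<^sup>2 \<partial>\<mu>) \<le> (\<integral>y. 2 * h\<^sup>2 + 16 * x0 * (sqrt_gap a b y)\<^sup>2 \<partial>\<mu>)"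
  proof (rule integral_mono)
    show i: "integrable \<mu> (\<lambda>y. 2 * h\<^sup>2 + 16 * x0 * (sqrt_gap a b y)\<^sup>2)" using gi by simp
    show "integrable \<mu> (\<lambda>y. (ikern y b - ikern y a)\<^sup>2)"
      by (rule Bochner_Integration.integrable_bound[OF i]) (use pt x0 in \<open>auto intro!: AE_I2 order_trans[OF
          pt]\<close>)
  qed (rule pt)
  also have "\<dots> = 2 * h\<^sup>2 + 16 * x0 * (\<integral>y. (sqrt_gap a b y)\<^sup>2 \<partial>\<mu>)" using gi prob_space by simp
  also have "\<dots> \<le> 2 * h\<^sup>2 + 16 * x0 * (20 * C * A * h * (1 + ln (1 / \<epsilon>)))"
    using sqrt_gap_second_moment[OF a b ab A(1,2)] x0 by (intro add_left_mono mult_left_mono) (auto simp: h_def)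
  also have "2 * h\<^sup>2 \<le> 4 * C * A * h * (1 + ln (1 / \<epsilon>))"
  proof -
    have "h * h \<le> h * (2 * A)" using h by (intro mult_left_mono) auto
    also have "\<dots> \<le> h * (2 * A) * (C * (1 + ln (1 / \<epsilon>)))"
    proof -
      have "1 * 1 \<le> C * (1 + ln (1 / \<epsilon>))" using C1 eps by (intro mult_mono) auto
      then show ?thesis using h A0 mult_left_mono[of 1 "C * (1 + ln (1 / \<epsilon>))" "h * (2 * A)"] by simp
    qed
    finally have hh: "h * h \<le> h * (2 * A) * (C * (1 + ln (1 / \<epsilon>)))" .
    have "2 * h\<^sup>2 \<le> 2 * (h * (2 * A) * (C * (1 + ln (1 / \<epsilon>))))"
      unfolding power2_eq_square by (rule mult_left_mono[OF hh]) simp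
    also have "\<dots> = 4 * C * A * h * (1 + ln (1 / \<epsilon>))" by (simp add: algebra_simps)
    finally show ?thesis .
  qed
  also have "4 * C * A * h * (1 + ln (1 / \<epsilon>)) + 16 * x0 * (20 * C * A * h * (1 + ln (1 / \<epsilon>)))
      \<le> 400 * (1 + x0) * C * A * h * (1 + ln (1 / \<epsilon>))"
  proof -
    have "0 \<le> C * A * h * (1 + ln (1 / \<epsilon>))" using C1 A0 h eps by (intro mult_nonneg_nonneg) auto
    then have "(4 + 320 * x0) * (C * A * h * (1 + ln (1 / \<epsilon>))) \<le>
        (400 * (1 + x0)) * (C * A * h * (1 + ln (1 / \<epsilon>)))"
      using x0 by (intro mult_right_mono) auto
    then show ?thesis by (simp add: algebra_simps)
  qed
  finally show ?thesis by (simp add: h_def)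
qed

end

text \<open>
  The leading term of \<open>(ikern y (x0 + h) - ikern y x0) / h\<close> for \<open>y\<close> slightly above \<open>x0\<close>. It is cut
  off below, where \<open>y - x0\<close> is not large compared with \<open>h\<close> and the approximation fails, and above,
  where the term is no longer dominant.
\<close>

definition singular_part :: "real \<Rightarrow> real \<Rightarrow> real \<Rightarrow> real \<Rightarrow> real" where
  "singular_part x0 a b y = - (2 / pi * sqrt x0) * (indicator {x0 + a<..x0 + b} y / sqrt (y - x0))"

lemma measurable_singular_part [measurable]: "singular_part x0 a b \<in> borel_measurable borel"
  unfolding singular_part_def[abs_def] by measurable

text \<open>
  The singular term of \<open>kern y z\<close> is \<open>- (2 / \<pi>) * sqrt (z / (y - z))\<close>. It is compared with its
  value at \<open>z = x0\<close> through \<open>\<bar>sqrt u - sqrt v\<bar> \<le> \<bar>u - v\<bar> / sqrt v\<close>; the arc sine contributes at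
  most 1.
\<close>

lemma kern_approx_singular:
  assumes x0: "0 < x0" and w: "x0 < y" "y \<le> x0 + 1" and z: "\<bar>z - x0\<bar> \<le> h" "2 * h \<le> y - x0" "0 \<le> z"
  shows "\<bar>kern y z - - (2 / pi * sqrt x0) * (1 / sqrt (y - x0))\<bar>
    \<le> 1 + 2 * (x0 + 1) * h / (sqrt x0 * ((y - x0) * sqrt (y - x0)))"
proof -
  define W where "W = y - x0"
  have W: "0 < W" using w by (simp add: W_def)
  have h0: "0 \<le> h" using z(1) by linarith
  have yz: "W / 2 \<le> y - z" using z by (simp add: W_def abs_le_iff)
  then have zy: "z < y" using W by linarith
  define u where "u = z / (y - z)"
  define u0 where "u0 = x0 / W"
  have u0: "0 < u0" using x0 W by (simp add: u0_def)
  have u: "0 \<le> u" using z zy by (simp add: u_def)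
  have "u - u0 = y * (z - x0) / ((y - z) * W)" using zy W by (simp add: u_def u0_def W_def field_simps)
  then have "\<bar>u - u0\<bar> = y * \<bar>z - x0\<bar> / ((y - z) * W)" using zy W w x0 by (simp add: abs_mult abs_divide)
  also have "\<dots> \<le> (x0 + 1) * h / (W / 2 * W)"
    using yz W w x0 z h0 by (intro frac_le mult_mono) auto
  finally have d: "\<bar>u - u0\<bar> \<le> 2 * (x0 + 1) * h / (W * W)" by (simp add: field_simps)
  have "\<bar>sqrt u - sqrt u0\<bar> * sqrt u0 \<le> \<bar>sqrt u - sqrt u0\<bar> * (sqrt u + sqrt u0)"
    using u by (intro mult_left_mono) auto
  also have "\<dots> = \<bar>(sqrt u - sqrt u0) * (sqrt u + sqrt u0)\<bar>" using u u0 by (simp add: abs_mult)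
  also have "(sqrt u - sqrt u0) * (sqrt u + sqrt u0) = u - u0" using u u0 by (simp add: algebra_simps)
  finally have "\<bar>sqrt u - sqrt u0\<bar> \<le> \<bar>u - u0\<bar> / sqrt u0" using u0 by (simp add: pos_le_divide_eq)
  also have "\<dots> \<le> 2 * (x0 + 1) * h / (W * W) / sqrt u0" using d u0 by (intro divide_right_mono) auto
  also have "\<dots> = 2 * (x0 + 1) * h / (sqrt x0 * (W * sqrt W))"
  proof -
    have key: "c / ((r * r) * (r * r)) / (k / r) = c / (k * ((r * r) * r))" if "0 < r" "0 < k" for c r k :: real
      using that by (simp add: field_simps)
    show ?thesis using key[of "sqrt W" "sqrt x0" "2 * (x0 + 1) * h"] x0 W unfolding u0_def real_sqrt_divide
        by simp
  qed
  finally have s: "\<bar>sqrt u - sqrt u0\<bar> \<le> 2 * (x0 + 1) * h / (sqrt x0 * (W * sqrt W))" .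
  have ac: "\<bar>2 / pi * arcsin (sqrt (z / y))\<bar> \<le> 1"
  proof -
    have "0 \<le> sqrt (z / y)" "sqrt (z / y) \<le> 1" using z zy by auto
    then have "0 \<le> arcsin (sqrt (z / y))" "arcsin (sqrt (z / y)) \<le> pi / 2"
      using arcsin_ubound[of "sqrt (z/y)"] arcsin_nonneg[of "sqrt (z/y)"] by (auto simp del: real_sqrt_ge_0_iff)
    then show ?thesis by (simp add: abs_mult field_simps)
  qed
  have "kern y z - - (2 / pi * sqrt x0) * (1 / sqrt W) = 2 / pi * arcsin (sqrt (z / y)) - 2 / pi * (sqrt u -
      sqrt u0)"
    unfolding kern_before[OF z(3) zy] u_def[symmetric] by (simp add: u0_def real_sqrt_divide algebra_simps)
  also have "\<bar>\<dots>\<bar> \<le> 1 + 2 / pi * \<bar>sqrt u - sqrt u0\<bar>"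
  proof -
    have "\<bar>2 / pi * (sqrt u - sqrt u0)\<bar> = 2 / pi * \<bar>sqrt u - sqrt u0\<bar>" by (simp only: abs_mult) simp
    then show ?thesis
      using ac abs_triangle_ineq4[of "2 / pi * arcsin (sqrt (z / y))" "2 / pi * (sqrt u - sqrt u0)"] by linarith
  qed
  also have "\<dots> \<le> 1 + 1 * \<bar>sqrt u - sqrt u0\<bar>" using pi_gt3 by (intro add_left_mono mult_right_mono) auto
  finally show ?thesis using s by (simp add: W_def)
qed

lemma ikern_increment_abs_le:
  assumes x0: "0 < x0" and t: "\<bar>\<tau>\<bar> = h" "h \<le> x0"
  shows "\<bar>ikern y (x0 + \<tau>) - ikern y x0\<bar> \<le> h + 2 * sqrt (2 * x0) * sqrt_gap (min x0 (x0 + \<tau>)) (max x0 (x0 +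
      \<tau>)) y"
proof (cases "0 \<le> \<tau>")
  case True
  then show ?thesis using abs_ikern_diff_le[of x0 "x0 + \<tau>" "2 * x0" y] x0 t by (simp add: min_def max_def)
next
  case False
  then show ?thesis using abs_ikern_diff_le[of "x0 + \<tau>" x0 "2 * x0" y] x0 t
    by (simp add: min_def max_def abs_minus_commute)
qed

text \<open>
  Four ranges of \<open>y\<close>. To the left of both end points only the length \<open>h\<close> matters. Up to the lower
  cut the increment is of order \<open>sqrt h\<close>, which gives the term with \<open>{x0 - h<..x0 + a}\<close>. Between
  the cuts \<open>kern_approx_singular\<close> applies and gives the last term. Beyond the upper cut \<open>sqrt_gap\<close>
  is at most \<open>h / sqrt b\<close>.
\<close>

lemma ikern_singular_error:
  assumes x0: "0 < x0" and t: "\<bar>\<tau>\<bar> = h" "0 < h" "h \<le> x0" and ab: "2 * h \<le> a" "a \<le> b" "b \<le> 1"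
  shows "(ikern y (x0 + \<tau>) - ikern y x0 - \<tau> * singular_part x0 a b y)\<^sup>2 \<le>
    2 * h\<^sup>2 + 16 * x0 * h\<^sup>2 / b + (16 * x0 * h * indicator {x0 - h<..x0 + a} y
     + 8 * (x0 + 1)\<^sup>2 / x0 * h\<^sup>2 * (h / a)\<^sup>2 * (indicator {x0 + a<..x0 + b} y / (y - x0)))"
proof -
  define gap where "gap = sqrt_gap (min x0 (x0 + \<tau>)) (max x0 (x0 + \<tau>)) y"
  have b0: "0 < b" "0 < a" using ab t by auto
  have g0: "0 \<le> gap" unfolding gap_def by (intro sqrt_gap_nonneg) auto
  have mm: "max x0 (x0 + \<tau>) - min x0 (x0 + \<tau>) = h" using t by (auto simp: max_def min_def)
  have sq: "(ikern y (x0 + \<tau>) - ikern y x0)\<^sup>2 \<le> 2 * h\<^sup>2 + 16 * x0 * gap\<^sup>2"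
  proof -
    have "(ikern y (x0 + \<tau>) - ikern y x0)\<^sup>2 \<le> (h + 2 * sqrt (2 * x0) * gap)\<^sup>2"
      using ikern_increment_abs_le[OF x0 t(1,3), of y] unfolding gap_def[symmetric]
      by (metis abs_ge_zero power2_abs power_mono)
    also have "\<dots> \<le> 2 * h\<^sup>2 + 2 * (2 * sqrt (2 * x0) * gap)\<^sup>2"
      using sum_squares_bound[of h "2 * sqrt (2 * x0) * gap"] by (simp add: power2_sum)
    also have "(2 * sqrt (2 * x0) * gap)\<^sup>2 = 8 * x0 * gap\<^sup>2" using x0 by (simp add: power_mult_distrib)
    finally show ?thesis by simp
  qed
  have B0: "0 \<le> 16 * x0 * h\<^sup>2 / b" using x0 b0 by simp
  have I0: "0 \<le> 16 * x0 * h * indicator {x0 - h<..x0 + a} y" using x0 t by simp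
  have S0: "0 \<le> 8 * (x0 + 1)\<^sup>2 / x0 * h\<^sup>2 * (h / a)\<^sup>2 * (indicator {x0 + a<..x0 + b} y / (y - x0))"
    using x0 b0 by (auto simp: indicator_def)
  consider "y \<le> x0 - h" | "x0 - h < y" "y \<le> x0 + a" | "x0 + a < y" "y \<le> x0 + b" | "x0 + b < y" by linarith
  then show ?thesis
  proof cases
    case 1
    then have "gap = 0" unfolding gap_def using t by (intro sqrt_gap_eq_0) (auto simp: min_def max_def)
    then have "(ikern y (x0 + \<tau>) - ikern y x0)\<^sup>2 \<le> 2 * h\<^sup>2" using sq by simp
    moreover have sp: "singular_part x0 a b y = 0" using 1 t b0 by (simp add: singular_part_def)
    ultimately show ?thesis using B0 I0 S0 unfolding sp mult_zero_right diff_zero by linarith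
  next
    case 2
    have "gap \<le> sqrt h" using sqrt_gap_le_sqrt[of "min x0 (x0 + \<tau>)" "max x0 (x0 + \<tau>)" y] mm
        by (simp add: gap_def)
    then have "gap\<^sup>2 \<le> (sqrt h)\<^sup>2" using g0 by (intro power_mono)
    then have "16 * x0 * gap\<^sup>2 \<le> 16 * x0 * h" using t x0 by (intro mult_left_mono) auto
    moreover have sp: "singular_part x0 a b y = 0" using 2 by (simp add: singular_part_def)
    moreover have "16 * x0 * h \<le> 16 * x0 * h * indicator {x0 - h<..x0 + a} y" using 2 by simp
    ultimately show ?thesis using B0 S0 sq unfolding sp mult_zero_right diff_zero by linarith
  next
    case 3
    define W where "W = y - x0"
    have W: "a < W" "0 < W" "W \<le> 1" using 3 b0 ab by (auto simp: W_def)
    define E where "E = 1 + 2 * (x0 + 1) * h / (sqrt x0 * (W * sqrt W))"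
    define c where "c = - (2 / pi * sqrt x0) * (1 / sqrt W)"
    have E0: "0 \<le> E" using x0 t W by (simp add: E_def)
    have k: "\<bar>kern y z - c\<bar> \<le> E" if "\<bar>z - x0\<bar> \<le> h" for z
      unfolding E_def c_def W_def by (rule kern_approx_singular[OF x0]) (use that W ab t in \<open>auto simp: W_def\<close>)
    have sp: "singular_part x0 a b y = c" using 3 by (simp add: singular_part_def c_def W_def)
    have "\<bar>ikern y (x0 + \<tau>) - ikern y x0 - \<tau> * c\<bar> \<le> E * h"
    proof (cases "0 \<le> \<tau>")
      case True
      have "\<bar>ikern y (x0 + \<tau>) - ikern y x0 - (x0 + \<tau> - x0) * c\<bar> \<le> E * (x0 + \<tau> - x0)"
        by (rule ikern_linear_approx[OF _ _ k E0]) (use True x0 t in auto)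
      then show ?thesis using True t by simp
    next
      case False
      have "\<bar>ikern y x0 - ikern y (x0 + \<tau>) - (x0 - (x0 + \<tau>)) * c\<bar> \<le> E * (x0 - (x0 + \<tau>))"
        by (rule ikern_linear_approx[OF _ _ k E0]) (use False x0 t in auto)
      moreover have "ikern y x0 - ikern y (x0 + \<tau>) - (x0 - (x0 + \<tau>)) * c =
          - (ikern y (x0 + \<tau>) - ikern y x0 - \<tau> * c)"
        by (simp add: algebra_simps)
      moreover have "x0 - (x0 + \<tau>) = h" using False t by simp
      ultimately show ?thesis by (simp only: abs_minus_cancel)
    qed
    then have "(ikern y (x0 + \<tau>) - ikern y x0 - \<tau> * c)\<^sup>2 \<le> (E * h)\<^sup>2"
        by (metis abs_ge_zero power2_abs power_mono)
    also have "\<dots> \<le> (2 + 8 * (x0 + 1)\<^sup>2 / x0 * (h / a)\<^sup>2 * (1 / W)) * h\<^sup>2"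
    proof -
      define F where "F = 2 * (x0 + 1) * h / (sqrt x0 * (W * sqrt W))"
      have "E = 1 + F" unfolding E_def F_def ..
      then have "E\<^sup>2 \<le> 2 + 2 * F\<^sup>2" using sum_squares_bound[of 1 F] by (simp add: power2_sum)
      also have "F\<^sup>2 = 4 * (x0 + 1)\<^sup>2 * h\<^sup>2 / (x0 * (W\<^sup>2 * W))"
      proof -
        have "(2 * (x0 + 1) * h)\<^sup>2 = 4 * (x0 + 1)\<^sup>2 * h\<^sup>2" by (simp add: power2_eq_square algebra_simps)
        moreover have "(sqrt x0 * (W * sqrt W))\<^sup>2 = x0 * (W\<^sup>2 * W)" using x0 W by (simp add: power_mult_distrib)
        ultimately show ?thesis unfolding F_def power_divide by (simp only:)
      qed
      also have "\<dots> \<le> 4 * (x0 + 1)\<^sup>2 * h\<^sup>2 / (x0 * (a\<^sup>2 * W))"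
        using x0 W b0 by (intro divide_left_mono mult_left_mono mult_right_mono power_mono mult_pos_pos) auto
      also have "2 + 2 * \<dots> = 2 + 8 * (x0 + 1)\<^sup>2 / x0 * (h / a)\<^sup>2 * (1 / W)"
        by (simp add: power_divide field_simps)
      finally show ?thesis unfolding power_mult_distrib by (intro mult_right_mono) auto
    qed
    also have "\<dots> = 2 * h\<^sup>2 + 8 * (x0 + 1)\<^sup>2 / x0 * h\<^sup>2 * (h / a)\<^sup>2 * (1 / W)" by (simp add: algebra_simps)
    also have "1 / W = indicator {x0 + a<..x0 + b} y / (y - x0)" using 3 by (simp add: W_def)
    finally show ?thesis unfolding sp using B0 I0 by linarith
  next
    case 4
    have "gap \<le> h / sqrt (y - min x0 (x0 + \<tau>))"
      using sqrt_gap_le_divide[of "min x0 (x0 + \<tau>)" "max x0 (x0 + \<tau>)" y] mm 4 b0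
          by (simp add: gap_def min_def max_def)
    also have "\<dots> \<le> h / sqrt b" using 4 b0 t by (intro divide_left_mono) auto
    finally have "gap\<^sup>2 \<le> (h / sqrt b)\<^sup>2" using g0 by (intro power_mono)
    then have "16 * x0 * gap\<^sup>2 \<le> 16 * x0 * (h\<^sup>2 / b)" using x0 b0
        by (intro mult_left_mono) (auto simp: power_divide)
    moreover have sp: "singular_part x0 a b y = 0" using 4 b0 ab by (simp add: singular_part_def)
    moreover have "16 * x0 * (h\<^sup>2 / b) = 16 * x0 * h\<^sup>2 / b" by simp
    ultimately show ?thesis using sq I0 S0 unfolding sp mult_zero_right diff_zero by linarith
  qed
qed

lemma abs_singular_part_le:
  assumes x0: "0 < x0" and "0 < a" shows "\<bar>singular_part x0 a b y\<bar> \<le> sqrt x0 / sqrt a"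
proof (cases "y \<in> {x0 + a<..x0 + b}")
  case True
  have "2 / pi * sqrt x0 * (1 / sqrt (y - x0)) \<le> 1 * sqrt x0 * (1 / sqrt a)"
    using True assms pi_gt3 x0 by (intro mult_mono divide_left_mono) auto
  moreover have "\<bar>sqrt (y - x0)\<bar> = sqrt (y - x0)" using True assms by auto
  ultimately show ?thesis using True x0 by (simp add: singular_part_def abs_mult)
qed (use x0 assms in \<open>simp add: singular_part_def\<close>)

context local_mass begin

lemma reciprocal_le:
  assumes "\<epsilon> \<le> a" "a \<le> b"
  shows "(\<integral>y. indicator {x0 + a<..x0 + b} y / (y - x0) \<partial>\<mu>) \<le> C * (ln (b / a) + 2)"
proof -
  have a: "0 < a" using assms eps by auto
  have "\<bar>(\<integral>y. indicator {x0 + a<..x0 + b} y / (y - x0) \<partial>\<mu>) - 0 * ln (b / a)\<bar> \<le>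
      C * ln (b / a) + 0 + C + (C * \<epsilon>) / a"
  proof (rule reciprocal_integral)
    fix s assume s: "s \<in> {a..b}"
    have "measure \<mu> {x0 + a<..x0 + s} \<le> measure \<mu> {x0 - s<..x0 + s}"
      by (rule finite_measure_mono) (use a s in auto)
    also have "\<dots> \<le> C * (s + \<epsilon>)" using mass s a by simp
    finally show "\<bar>measure \<mu> {x0 + a<..x0 + s} - 0 * s\<bar> \<le> C * s + C * \<epsilon>" by (simp add: algebra_simps)
  qed (use a assms C1 eps real_distribution_axioms in auto)
  moreover have "(C * \<epsilon>) / a \<le> C" using assms a C1 by (simp add: pos_divide_le_eq)
  ultimately show ?thesis by (simp add: algebra_simps)
qed

lemma singular_error_second_moment:
  assumes t: "\<bar>\<tau>\<bar> = h" "0 < h" "h \<le> x0" and ab: "2 * h \<le> a" "a \<le> b" "b \<le> 1" "\<epsilon> \<le> a"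
  shows "(\<integral>y. (ikern y (x0 + \<tau>) - ikern y x0 - \<tau> * singular_part x0 a b y)\<^sup>2 \<partial>\<mu>) \<le>
    2 * h\<^sup>2 + 16 * x0 * h\<^sup>2 / b + 32 * x0 * C * h * a + 8 * (x0 +
        1)\<^sup>2 / x0 * C * h\<^sup>2 * (h / a)\<^sup>2 * (ln (b / a) + 2)"
proof -
  have a0: "0 < a" "0 < b" using ab t by auto
  define k1 where "k1 = 2 * h\<^sup>2 + 16 * x0 * h\<^sup>2 / b"
  define k2 where "k2 = 16 * x0 * h"
  define k3 where "k3 = 8 * (x0 + 1)\<^sup>2 / x0 * h\<^sup>2 * (h / a)\<^sup>2"
  have ir: "integrable \<mu> (\<lambda>y. indicator {x0 + a<..x0 + b} y / (y - x0))"
    by (rule integrable_const_bound[of _ "1 / a"]) (use a0 in \<open>auto simp: indicator_def intro!: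
        divide_left_mono\<close>)
  have i1: "integrable \<mu> (\<lambda>y. k1)" by simp
  have i2: "integrable \<mu> (\<lambda>y. k2 * indicator {x0 - h<..x0 + a} y)"
    by (intro integrable_mult_right integrable_real_indicator) (auto simp: less_top[symmetric])
  have i3: "integrable \<mu> (\<lambda>y. k3 * (indicator {x0 + a<..x0 + b} y / (y - x0)))"
      by (rule integrable_mult_right[OF ir])
  have pt: "(ikern y (x0 + \<tau>) - ikern y x0 - \<tau> * singular_part x0 a b y)\<^sup>2 \<le>
    k1 + (k2 * indicator {x0 - h<..x0 + a} y + k3 * (indicator {x0 + a<..x0 + b} y / (y - x0)))" for y
    unfolding k1_def k2_def k3_def by (rule ikern_singular_error[OF x0 t ab(1,2,3)])
  have i: "integrable \<mu> (\<lambda>y. k1 + (k2 * indicator {x0 - h<..x0 + a} y + k3 * (indicator {x0 + a<..x0 +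
      b} y / (y - x0))))"
    by (intro Bochner_Integration.integrable_add i1 i2 i3)
  have [measurable]: "(\<lambda>y. ikern y (x0 + \<tau>)) \<in> borel_measurable borel" "(\<lambda>y. ikern y x0) \<in> borel_measurable
      borel"
    using x0 t by (auto intro!: borel_measurable_ikern)
  have [measurable]: "singular_part x0 a b \<in> borel_measurable borel" unfolding singular_part_def[abs_def]
      by measurable
  have "(\<integral>y. (ikern y (x0 + \<tau>) - ikern y x0 - \<tau> * singular_part x0 a b y)\<^sup>2 \<partial>\<mu>) \<le>
    (\<integral>y. k1 + (k2 * indicator {x0 - h<..x0 + a} y + k3 * (indicator {x0 + a<..x0 + b} y / (y - x0))) \<partial>\<mu>)"
  proof (rule integral_mono[OF _ i pt])
    show "integrable \<mu> (\<lambda>y. (ikern y (x0 + \<tau>) - ikern y x0 - \<tau> * singular_part x0 a b y)\<^sup>2)"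
    proof (rule Bochner_Integration.integrable_bound[OF i _ AE_I2])
      fix y
      have "norm ((ikern y (x0 + \<tau>) - ikern y x0 - \<tau> * singular_part x0 a b y)\<^sup>2) =
        (ikern y (x0 + \<tau>) - ikern y x0 - \<tau> * singular_part x0 a b y)\<^sup>2" by simp
      also note pt[of y]
      finally show "norm ((ikern y (x0 + \<tau>) - ikern y x0 - \<tau> * singular_part x0 a b y)\<^sup>2) \<le>
        norm (k1 + (k2 * indicator {x0 - h<..x0 + a} y + k3 * (indicator {x0 + a<..x0 + b} y / (y - x0))))"
        by (rule order_trans) (simp only: real_norm_def abs_ge_self)
    qed simp
  qed
  also have "\<dots> = (\<integral>y. k1 \<partial>\<mu>) + ((\<integral>y. k2 * indicator {x0 - h<..x0 + a} y \<partial>\<mu>) + (\<integral>y. k3 * (indicator {x0 +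
      a<..x0 + b} y / (y - x0)) \<partial>\<mu>))"
    by (simp only: Bochner_Integration.integral_add[OF i1 Bochner_Integration.integrable_add[OF i2 i3]]
      Bochner_Integration.integral_add[OF i2 i3])
  also have "\<dots> = k1 + (k2 * measure \<mu> {x0 - h<..x0 + a} + k3 * (\<integral>y. indicator {x0 + a<..x0 +
      b} y / (y - x0) \<partial>\<mu>))"
    using prob_space by (simp only: integral_mult_right_zero) simp
  also have "\<dots> \<le> k1 + (k2 * (2 * C * a) + k3 * (C * (ln (b / a) + 2)))"
  proof (intro add_left_mono add_mono mult_left_mono)
    have "measure \<mu> {x0 - h<..x0 + a} \<le> measure \<mu> {x0 - a<..x0 + a}"
      by (rule finite_measure_mono) (use ab t in auto)
    also have "\<dots> \<le> C * (a + \<epsilon>)" using mass a0 by simp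
    also have "\<dots> \<le> C * (a + a)" using C1 ab by (intro mult_left_mono) auto
    finally show "measure \<mu> {x0 - h<..x0 + a} \<le> 2 * C * a" by simp
    show "(\<integral>y. indicator {x0 + a<..x0 + b} y / (y - x0) \<partial>\<mu>) \<le> C * (ln (b / a) + 2)"
      by (rule reciprocal_le) (use ab in auto)
  qed (use x0 t in \<open>auto simp: k2_def k3_def\<close>)
  finally show ?thesis by (simp add: k1_def k2_def k3_def mult_ac)
qed

lemma singular_part_square:
  assumes "0 < a"
  shows "(\<integral>y. (singular_part x0 a b y)\<^sup>2 \<partial>\<mu>) = 4 / pi\<^sup>2 * x0 * (\<integral>y. indicator {x0 + a<..x0 +
      b} y / (y - x0) \<partial>\<mu>)"
proof -
  have "(singular_part x0 a b y)\<^sup>2 = 4 / pi\<^sup>2 * x0 * (indicator {x0 + a<..x0 + b} y / (y - x0))" for y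
    using x0 assms by (auto simp: singular_part_def indicator_def power_mult_distrib power_divide)
  then show ?thesis by (simp only: integral_mult_right_zero)
qed

text \<open>
  Cauchy-Schwarz with the indicator of the interval that carries the singular part. The mass of
  that interval is small, so the squared mean is negligible against the second moment and the
  variance of the singular part is asymptotically its second moment.
\<close>

lemma singular_part_mean_square:
  assumes a: "0 < a" "a \<le> b"
  shows "(\<integral>y. singular_part x0 a b y \<partial>\<mu>)\<^sup>2 \<le> (\<integral>y. (singular_part x0 a b y)\<^sup>2 \<partial>\<mu>) * (C * (b + \<epsilon>))"
proof -
  define q where "q = singular_part x0 a b"
  define B where "B = {x0 - b<..x0 + b}"
  have [measurable]: "q \<in> borel_measurable borel" unfolding q_def singular_part_def[abs_def] by measurable
  have qi: "integrable \<mu> q"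
    by (rule integrable_const_bound[of _ "sqrt x0 / sqrt a"]) (use abs_singular_part_le[OF x0 a(1)] in \<open>auto
        simp: q_def\<close>)
  have q2: "integrable \<mu> (\<lambda>y. (q y)\<^sup>2)"
  proof (rule integrable_const_bound[of _ "(sqrt x0 / sqrt a)\<^sup>2"])
    have "(q y)\<^sup>2 \<le> (sqrt x0 / sqrt a)\<^sup>2" for y
      using abs_singular_part_le[OF x0 a(1), of b y] unfolding q_def
          by (metis abs_ge_zero power2_abs power_mono)
    then show "AE y in \<mu>. norm ((q y)\<^sup>2) \<le> (sqrt x0 / sqrt a)\<^sup>2" by simp
  qed simp
  define I where "I = (\<integral>y. q y \<partial>\<mu>)"
  define A where "A = (\<integral>y. (q y)\<^sup>2 \<partial>\<mu>)"
  define m where "m = measure \<mu> B"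
  define m' where "m' = C * (b + \<epsilon>)"
  have m': "0 < m'" "m \<le> m'" using C1 a eps mass[of b] by (auto simp: m'_def m_def B_def)
  define s where "s = I / m'"
  have Bi: "integrable \<mu> (indicat_real B)" by (intro integrable_real_indicator) (auto simp: B_def
      less_top[symmetric])
  have qB: "(q y - s * indicator B y)\<^sup>2 = (q y)\<^sup>2 - (2 * s) * q y + s\<^sup>2 * indicator B y" for y
  proof (cases "y \<in> B")
    case False
    then have "y \<notin> {x0 + a<..x0 + b}" using a by (auto simp: B_def)
    then show ?thesis using False by (simp add: q_def singular_part_def)
  qed (simp add: power2_diff algebra_simps)
  (* Cauchy-Schwarz by expanding a square; s is nearly the optimal multiple of the indicator. *)
  have "0 \<le> (\<integral>y. (q y - s * indicator B y)\<^sup>2 \<partial>\<mu>)" by simp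
  also have "\<dots> = A - 2 * s * I + s\<^sup>2 * m"
    unfolding qB using qi q2 Bi by (simp add: A_def I_def m_def B_def)
  also have "\<dots> \<le> A - 2 * s * I + s\<^sup>2 * m'" using m' by (intro add_left_mono mult_left_mono) auto
  also have "\<dots> = A - I\<^sup>2 / m'" using m' by (simp add: s_def field_simps power2_eq_square)
  finally have "I\<^sup>2 \<le> A * m'" using m' by (simp add: pos_divide_le_eq)
  then show ?thesis by (simp add: A_def I_def q_def m'_def)
qed

end

section \<open>The empirical process of a row of the array\<close>

text \<open>
  Outside the open unit interval the set in \<open>quantile\<close> is everything or nothing, except at 1.
  There the function takes the default values \<open>Inf UNIV\<close> and \<open>Inf {}\<close>, so that measurability on
  the interval suffices.
\<close>

lemma borel_measurable_quantile:
  assumes "is_df_nonneg G" shows "quantile G \<in> borel_measurable borel"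
proof -
  interpret D: real_distribution "interval_measure G" by (rule real_distribution_interval_measure_df[OF assms])
  interpret C: cdf_distribution "interval_measure G" by unfold_locales
  have c: "cdf (interval_measure G) = G" by (rule cdf_interval_measure_df[OF assms])
  have G1: "G x \<le> 1" "0 \<le> G x" for x using D.cdf_bounded_prob[of x] D.cdf_nonneg[of x] by (simp_all add: c)
  have low: "{x. u \<le> G x} = UNIV" if "u \<le> 0" for u using G1(2) that order_trans by blast
  have high: "{x. u \<le> G x} = {}" if "1 < u" for u using G1(1) that by (auto simp: not_le intro: le_less_trans)
  have "quantile G \<in> borel_measurable (restrict_space borel {0<..<1})"
    using C.measurable_CI unfolding quantile_def[abs_def] c by simp
  then have [measurable]: "(\<lambda>u. indicator {0<..<1} u *\<^sub>R quantile G u) \<in> borel_measurable borel"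
    by (subst (asm) borel_measurable_restrict_space_iff) auto
  have "quantile G u = (if u \<le> 0 then Inf UNIV else if u < 1 then indicator {0<..<1} u *\<^sub>R quantile G u
      else if u = 1 then quantile G 1 else Inf {})" for u
    using low[of u] high[of u] by (auto simp: quantile_def)
  then have "quantile G = (\<lambda>u. if u \<le> 0 then Inf UNIV else if u < 1 then indicator {0<..<1} u *\<^sub>R quantile G u
      else if u = 1 then quantile G 1 else Inf {})" by auto
  also have "\<dots> \<in> borel_measurable borel" by measurable
  finally show ?thesis .
qed

lemma distr_quantile:
  assumes "is_df_nonneg G"
  shows "distr (uniform_measure lborel {0<..<1}) borel (quantile G) = interval_measure G"
proof -
  interpret D: real_distribution "interval_measure G" by (rule real_distribution_interval_measure_df[OF assms])
  interpret C: cdf_distribution "interval_measure G" by unfold_locales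
  have c: "cdf (interval_measure G) = G" by (rule cdf_interval_measure_df[OF assms])
  note m [measurable] = borel_measurable_quantile[OF assms]
  have q: "quantile G = (\<lambda>u. Inf {x. u \<le> cdf (interval_measure G) x})" by (simp add: quantile_def[abs_def] c)
  have "distr (uniform_measure lborel {0<..<1}) borel (quantile G) =
      distr (restrict_space lborel {0<..<1}) borel (quantile G)"
  proof (rule measure_eqI)
    fix A assume "A \<in> sets (distr (uniform_measure lborel {0<..<1::real}) borel (quantile G))"
    then have A [measurable]: "A \<in> sets borel" by simp
    have "quantile G -` A \<in> sets borel" using measurable_sets[OF m A] by simp
    moreover have "quantile G \<in> borel_measurable (restrict_space lborel {0<..<1})"
      by (rule measurable_restrict_space1) simp
    moreover have "quantile G \<in> borel_measurable (uniform_measure lborel {0<..<1})" by simp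
    ultimately show "emeasure (distr (uniform_measure lborel {0<..<1}) borel (quantile G)) A =
        emeasure (distr (restrict_space lborel {0<..<1}) borel (quantile G)) A"
      by (simp add: emeasure_distr emeasure_uniform_measure emeasure_restrict_space space_restrict_space
          Int_commute divide_ennreal_def)
  qed simp
  also have "\<dots> = interval_measure G" unfolding q by (rule C.distr_I_eq_M)
  finally show ?thesis .
qed

locale uniform_array = prob_space M for M :: "'m measure" +
  fixes T :: "nat \<Rightarrow> 'm \<Rightarrow> real" and Gn :: "nat \<Rightarrow> real \<Rightarrow> real"
  assumes Gn: "\<And>n. n \<ge> 1 \<Longrightarrow> is_df_nonneg (Gn n)"
    and T_indep: "indep_vars (\<lambda>_. borel) T {1..}"
    and T_unif: "\<And>i. i \<ge> 1 \<Longrightarrow> distr M borel (T i) = uniform_measure lborel {0<..<1}"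
begin

definition "obs n \<omega> i = quantile (Gn n) (T i \<omega>)"
definition "mu n = interval_measure (Gn n)"
definition "emp n h \<omega> = (\<Sum>i\<in>{1..n}. h (obs n \<omega> i)) / n - (\<integral>y. h y \<partial>mu n)"

lemma sets_mu [simp, measurable_cong]: "sets (mu n) = sets borel" by (simp add: mu_def)

lemma real_distribution_mu: "n \<ge> 1 \<Longrightarrow> real_distribution (mu n)"
  unfolding mu_def by (rule real_distribution_interval_measure_df[OF Gn])

lemma T_measurable: "i \<ge> 1 \<Longrightarrow> T i \<in> borel_measurable M"
  using T_indep by (auto simp: indep_vars_def2)

lemma obs_measurable: "n \<ge> 1 \<Longrightarrow> i \<ge> 1 \<Longrightarrow> (\<lambda>\<omega>. obs n \<omega> i) \<in> borel_measurable M"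
  unfolding obs_def by (rule measurable_compose[OF T_measurable borel_measurable_quantile[OF Gn]])

lemma distr_obs:
  assumes "n \<ge> 1" "i \<ge> 1" shows "distr M borel (\<lambda>\<omega>. obs n \<omega> i) = mu n"
proof -
  have "distr M borel (\<lambda>\<omega>. obs n \<omega> i) = distr (distr M borel (T i)) borel (quantile (Gn n))"
    unfolding obs_def using T_measurable[OF assms(2)] borel_measurable_quantile[OF Gn[OF assms(1)]]
    by (subst distr_distr) (auto simp: comp_def)
  then show ?thesis unfolding T_unif[OF assms(2)] using distr_quantile[OF Gn[OF assms(1)]] by (simp add: mu_def)
qed

lemma expectation_obs:
  fixes h :: "real \<Rightarrow> real"
  assumes "n \<ge> 1" "i \<ge> 1" "h \<in> borel_measurable borel"
  shows "expectation (\<lambda>\<omega>. h (obs n \<omega> i)) = (\<integral>y. h y \<partial>mu n)"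
  unfolding distr_obs[OF assms(1,2), symmetric] using obs_measurable[OF assms(1,2)] assms(3)
      by (simp add: integral_distr)

lemma indep_obs:
  assumes "n \<ge> 1" "\<And>n. h n \<in> borel_measurable borel"
  shows "indep_vars (\<lambda>_. borel) (\<lambda>i \<omega>. (h n (obs n \<omega> i) :: real)) {1..n}"
proof -
  have "indep_vars (\<lambda>_. borel) (\<lambda>i \<omega>. h n (quantile (Gn n) (T i \<omega>))) {1..n}"
    by (rule indep_vars_compose2[OF indep_vars_subset[OF T_indep]])
      (use measurable_compose[OF borel_measurable_quantile[OF Gn[OF assms(1)]] assms(2)] in auto)
  then show ?thesis by (simp add: obs_def)
qed

lemma emp_measurable:
  assumes "n \<ge> 1" "h \<in> borel_measurable borel" shows "emp n h \<in> borel_measurable M"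
  unfolding emp_def using measurable_compose[OF obs_measurable[OF assms(1)] assms(2)]
  by (intro borel_measurable_diff borel_measurable_divide borel_measurable_sum) auto

lemma abs_emp_le:
  assumes "n \<ge> 1" "\<And>y. \<bar>h y\<bar> \<le> b"
  shows "\<bar>emp n h \<omega>\<bar> \<le> 2 * b"
proof -
  interpret D: real_distribution "mu n" by (rule real_distribution_mu[OF assms(1)])
  have "\<bar>\<Sum>i\<in>{1..n}. h (obs n \<omega> i)\<bar> \<le> n * b" using sum_norm_bound[of "{1..n}" "\<lambda>i. h (obs n \<omega> i)" b] assms
      by auto
  then have "\<bar>(\<Sum>i\<in>{1..n}. h (obs n \<omega> i)) / n\<bar> \<le> b" using assms(1) by (simp add: abs_divide field_simps)
  moreover have "\<bar>\<integral>y. h y \<partial>mu n\<bar> \<le> (\<integral>y. b \<partial>mu n)"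
  proof (cases "integrable (mu n) h")
    case True
    then show ?thesis by (intro integral_abs_bound[THEN order_trans] integral_mono) (use assms in auto)
  next
    case False
    then show ?thesis using assms(2)[of 0] D.prob_space by (simp add: not_integrable_integral_eq)
  qed
  then have "\<bar>\<integral>y. h y \<partial>mu n\<bar> \<le> b" using D.prob_space by simp
  ultimately show ?thesis unfolding emp_def by linarith
qed

lemma integrable_mu:
  assumes "n \<ge> 1" "h \<in> borel_measurable borel" "\<And>y. \<bar>h y\<bar> \<le> (b::real)"
  shows "integrable (mu n) h"
proof -
  interpret D: real_distribution "mu n" by (rule real_distribution_mu[OF assms(1)])
  show ?thesis by (rule D.integrable_const_bound[of _ b]) (use assms in auto)
qed

lemma emp_moments:
  assumes n: "n \<ge> 1" and h [measurable]: "h \<in> borel_measurable borel" and b: "\<And>y. \<bar>h y\<bar> \<le> b"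
  shows "integrable M (\<lambda>\<omega>. emp n h \<omega> ^ k)"
    and "expectation (\<lambda>\<omega>. (emp n h \<omega>)\<^sup>2) \<le> (\<integral>y. (h y)\<^sup>2 \<partial>mu n) / n"
    and "expectation (\<lambda>\<omega>. emp n h \<omega> ^ 4) \<le> 4 * b\<^sup>2 * (\<integral>y. (h y)\<^sup>2 \<partial>mu n) / n ^ 3 +
        3 * (\<integral>y. (h y)\<^sup>2 \<partial>mu n)\<^sup>2 / n\<^sup>2"
proof -
  interpret D: real_distribution "mu n" by (rule real_distribution_mu[OF n])
  have [measurable]: "emp n h \<in> borel_measurable M" by (rule emp_measurable[OF n h])
  show "integrable M (\<lambda>\<omega>. emp n h \<omega> ^ k)"
  proof (rule integrable_const_bound[of _ "(2 * b) ^ k"])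
    have "norm (emp n h \<omega> ^ k) \<le> (2 * b) ^ k" for \<omega>
      by (simp only: real_norm_def power_abs) (rule power_mono[OF abs_emp_le[OF n b] abs_ge_zero])
    then show "AE \<omega> in M. norm (emp n h \<omega> ^ k) \<le> (2 * b) ^ k" by simp
  qed simp
  define m where "m = (\<integral>y. h y \<partial>mu n)"
  define v where "v = (\<integral>y. (h y - m)\<^sup>2 \<partial>mu n)"
  define w where "w = (\<integral>y. (h y)\<^sup>2 \<partial>mu n)"
  have b0: "0 \<le> b" using b[of 0] by linarith
  have mb: "\<bar>m\<bar> \<le> b"
  proof -
    have "\<bar>m\<bar> \<le> (\<integral>y. b \<partial>mu n)" unfolding m_def
      by (intro integral_abs_bound[THEN order_trans] integral_mono) (use b integrable_mu[OF n h b] in auto)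
    then show ?thesis using D.prob_space by simp
  qed
  have i1: "integrable (mu n) h" by (rule integrable_mu[OF n h b])
  have i2: "integrable (mu n) (\<lambda>y. (h y)\<^sup>2)"
    by (rule integrable_mu[OF n, of _ "b\<^sup>2"]) (use b b0 in \<open>auto simp: abs_le_square_iff[symmetric]\<close>)
  have "v = (\<integral>y. (h y)\<^sup>2 - 2 * m * h y + m\<^sup>2 \<partial>mu n)" unfolding v_def by (simp add: power2_diff algebra_simps)
  also have "\<dots> = w - m\<^sup>2" using i1 i2 D.prob_space by (simp add: w_def m_def[symmetric] power2_eq_square)
  finally have vw: "v \<le> w" by simp
  have v0: "0 \<le> v" unfolding v_def by simp
  define \<xi> where "\<xi> i \<omega> = h (obs n \<omega> i) - m" for i \<omega>
  have ind: "indep_vars (\<lambda>_. borel) \<xi> {1..n}"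
    unfolding \<xi>_def using indep_obs[OF n, of "\<lambda>_ y. h y - m"] by simp
  have bd: "\<bar>\<xi> i \<omega>\<bar> \<le> 2 * b" for i \<omega> unfolding \<xi>_def using b[of "obs n \<omega> i"] mb by linarith
  have mean: "expectation (\<xi> i) = 0" if "i \<in> {1..n}" for i
    unfolding \<xi>_def using expectation_obs[OF n, of i "\<lambda>y. h y - m"] that i1 D.prob_space by (simp add: m_def)
  have var: "expectation (\<lambda>\<omega>. (\<xi> i \<omega>)\<^sup>2) = v" if "i \<in> {1..n}" for i
    unfolding \<xi>_def v_def using expectation_obs[OF n, of i "\<lambda>y. (h y - m)\<^sup>2"] that by simp
  have e: "emp n h \<omega> = (\<Sum>i\<in>{1..n}. \<xi> i \<omega>) / n" for \<omega>
    unfolding emp_def \<xi>_def m_def[symmetric] using n by (simp add: sum_subtractf field_simps)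
  note mom = iid_sum_moments[OF ind bd mean var]
  have "expectation (\<lambda>\<omega>. (emp n h \<omega>)\<^sup>2) = real n * v / n\<^sup>2" unfolding e using mom(1) by (simp add: power_divide)
  also have "\<dots> = v / n" using n by (simp add: power2_eq_square)
  also have "\<dots> \<le> w / n" using vw by (intro divide_right_mono) auto
  finally show "expectation (\<lambda>\<omega>. (emp n h \<omega>)\<^sup>2) \<le> (\<integral>y. (h y)\<^sup>2 \<partial>mu n) / n" by (simp add: w_def)
  have "expectation (\<lambda>\<omega>. emp n h \<omega> ^ 4) \<le> (n * ((2 * b)\<^sup>2 * v) + 3 * (real n * v)\<^sup>2) / n ^ 4"
    unfolding e using mom(2) by (simp add: power_divide divide_right_mono)
  also have "\<dots> = 4 * b\<^sup>2 * v / n ^ 3 + 3 * v\<^sup>2 / n\<^sup>2"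
    using n by (simp add: field_simps power2_eq_square power3_eq_cube power4_eq_xxxx)
  also have "\<dots> \<le> 4 * b\<^sup>2 * w / n ^ 3 + 3 * w\<^sup>2 / n\<^sup>2"
    using vw v0 by (intro add_mono divide_right_mono mult_left_mono power_mono) auto
  finally show "expectation (\<lambda>\<omega>. emp n h \<omega> ^ 4) \<le> 4 * b\<^sup>2 * (\<integral>y. (h y)\<^sup>2 \<partial>mu n) / n ^ 3 +
      3 * (\<integral>y. (h y)\<^sup>2 \<partial>mu n)\<^sup>2 / n\<^sup>2"
    by (simp add: w_def)
qed

lemma emp_diff:
  assumes "n \<ge> 1" "integrable (mu n) h" "integrable (mu n) k"
  shows "emp n (\<lambda>y. h y - k y) \<omega> = emp n h \<omega> - emp n k \<omega>"
  unfolding emp_def using assms by (simp add: sum_subtractf diff_divide_distrib)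

lemma emp_cmult: "emp n (\<lambda>y. c * h y) \<omega> = c * emp n h \<omega>"
  unfolding emp_def by (simp add: sum_distrib_left[symmetric] algebra_simps)

lemma emp_chebyshev:
  assumes n: "n \<ge> 1" and h [measurable]: "h \<in> borel_measurable borel" and b: "\<And>y. \<bar>h y\<bar> \<le> b" and c: "0 < c"
  shows "{\<omega> \<in> space M. \<bar>emp n h \<omega>\<bar> \<ge> c} \<in> events"
    "prob {\<omega> \<in> space M. \<bar>emp n h \<omega>\<bar> \<ge> c} \<le> (\<integral>y. (h y)\<^sup>2 \<partial>mu n) / (n * c\<^sup>2)"
proof -
  have [measurable]: "emp n h \<in> borel_measurable M" by (rule emp_measurable[OF n h])
  show "{\<omega> \<in> space M. \<bar>emp n h \<omega>\<bar> \<ge> c} \<in> events" by measurable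
  have e: "c \<le> \<bar>x\<bar> \<longleftrightarrow> c\<^sup>2 \<le> x\<^sup>2" for x using c abs_le_square_iff[of c x] by simp
  have "prob {\<omega> \<in> space M. \<bar>emp n h \<omega>\<bar> \<ge> c} \<le> expectation (\<lambda>\<omega>. (emp n h \<omega>)\<^sup>2) / c\<^sup>2"
    unfolding e using c by (intro integral_Markov_inequality_measure emp_moments(1)[OF n h b]) auto
  also have "\<dots> \<le> (\<integral>y. (h y)\<^sup>2 \<partial>mu n) / n / c\<^sup>2" by (intro divide_right_mono emp_moments(2)[OF n h b]) auto
  finally show "prob {\<omega> \<in> space M. \<bar>emp n h \<omega>\<bar> \<ge> c} \<le> (\<integral>y. (h y)\<^sup>2 \<partial>mu n) / (n * c\<^sup>2)" by simp
qed

text \<open>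
  The norming \<open>c n\<close> multiplies an average; for a sum of \<open>n\<close> terms it amounts to \<open>c n / n\<close>.
\<close>

lemma char_emp_tendsto:
  assumes h: "\<And>n. h n \<in> borel_measurable borel" and b: "\<And>n y. \<bar>h n y\<bar> \<le> b n"
    and cb: "(\<lambda>n. c n * b n / n) \<longlonglongrightarrow> 0" and c: "\<And>n. 0 \<le> c n"
    and var: "(\<lambda>n. (c n)\<^sup>2 / n * ((\<integral>y. (h n y)\<^sup>2 \<partial>mu n) - (\<integral>y. h n y \<partial>mu n)\<^sup>2)) \<longlonglongrightarrow> s"
  shows "(\<lambda>n. char (distr M borel (\<lambda>\<omega>. c n * emp n (h n) \<omega>)) t) \<longlonglongrightarrow> complex_of_real (exp (- (t\<^sup>2 * s / 2)))"
proof -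
  define m where "m n = (\<integral>y. h n y \<partial>mu n)" for n
  define v where "v n = (c n / n)\<^sup>2 * (\<integral>y. (h n y - m n)\<^sup>2 \<partial>mu n)" for n
  define \<xi> where "\<xi> n i \<omega> = c n / n * (h n (obs n \<omega> i) - m n)" for n i \<omega>
  have b0: "0 \<le> b n" for n using b[of n 0] by linarith
  have mb: "\<bar>m n\<bar> \<le> b n" if n: "n \<ge> 1" for n
  proof -
    interpret D: real_distribution "mu n" by (rule real_distribution_mu[OF n])
    have "\<bar>m n\<bar> \<le> (\<integral>y. b n \<partial>mu n)" unfolding m_def
      by (intro integral_abs_bound[THEN order_trans] integral_mono) (use b integrable_mu[OF n h b] in auto)
    then show ?thesis using D.prob_space by simp
  qed
  have "(\<lambda>n. char (distr M borel (\<lambda>\<omega>. \<Sum>i\<in>{1..n}. \<xi> n i \<omega>)) t) \<longlonglongrightarrow> complex_of_real (exp (- (t\<^sup>2 * s / 2)))"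
  proof (rule char_triangular_array_tendsto[where b = "\<lambda>n. 2 * (c n * b n / n)" and v = v])
    show "indep_vars (\<lambda>_. borel) (\<xi> n) {1..n}" for n
    proof (cases "n \<ge> 1")
      case True
      then show ?thesis
        unfolding \<xi>_def using indep_obs[OF True, of "\<lambda>n y. c n / n * (h n y - m n)"] h by simp
    next
      case False
      then show ?thesis by (simp add: indep_vars_def2 indep_sets_def)
    qed
    show "\<bar>\<xi> n i \<omega>\<bar> \<le> 2 * (c n * b n / n)" for n i \<omega>
    proof (cases "n \<ge> 1")
      case True
      have "\<bar>h n (obs n \<omega> i) - m n\<bar> \<le> 2 * b n" using b[of n "obs n \<omega> i"] mb[OF True] by linarith
      then have "c n / n * \<bar>h n (obs n \<omega> i) - m n\<bar> \<le> c n / n * (2 * b n)" using c by (intro mult_left_mono) auto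
      then show ?thesis unfolding \<xi>_def abs_mult using c[of n] by (simp add: mult_ac)
    qed (auto simp: \<xi>_def not_le)
    show "(\<lambda>n. 2 * (c n * b n / n)) \<longlonglongrightarrow> 0" using tendsto_mult_left[OF cb, of 2] by simp
    show "expectation (\<xi> n i) = 0" if "i \<in> {1..n}" for n i
    proof -
      have n: "n \<ge> 1" using that by auto
      interpret D: real_distribution "mu n" by (rule real_distribution_mu[OF n])
      show ?thesis
        unfolding \<xi>_def using expectation_obs[OF n, of i "\<lambda>y. c n / n * (h n y - m n)"] that h integrable_mu[OF
            n h b] D.prob_space
        by (simp add: m_def)
    qed
    show "expectation (\<lambda>\<omega>. (\<xi> n i \<omega>)\<^sup>2) = v n" if "i \<in> {1..n}" for n i
    proof -
      have n: "n \<ge> 1" using that by auto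
      show ?thesis unfolding \<xi>_def v_def power_mult_distrib
        using expectation_obs[OF n, of i "\<lambda>y. (c n / n)\<^sup>2 * (h n y - m n)\<^sup>2"] that h by simp
    qed
    have nv: "n * v n = (c n)\<^sup>2 / n * ((\<integral>y. (h n y)\<^sup>2 \<partial>mu n) - (\<integral>y. h n y \<partial>mu n)\<^sup>2)" for n
    proof (cases "n \<ge> 1")
      case True
      interpret D: real_distribution "mu n" by (rule real_distribution_mu[OF True])
      have i1: "integrable (mu n) (h n)" by (rule integrable_mu[OF True h b])
      have i2: "integrable (mu n) (\<lambda>y. (h n y)\<^sup>2)"
        by (rule integrable_mu[OF True, of _ "(b n)\<^sup>2"]) (use h b b0 in \<open>auto simp:
            abs_le_square_iff[symmetric]\<close>)
      have "(\<integral>y. (h n y - m n)\<^sup>2 \<partial>mu n) = (\<integral>y. (h n y)\<^sup>2 - 2 * m n * h n y + (m n)\<^sup>2 \<partial>mu n)"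
        by (simp add: power2_diff algebra_simps)
      also have "\<dots> = (\<integral>y. (h n y)\<^sup>2 \<partial>mu n) - (m n)\<^sup>2" using i1 i2 D.prob_space
          by (simp add: m_def[symmetric] power2_eq_square)
      finally show ?thesis using True by (simp add: v_def m_def power_divide power2_eq_square)
    qed (auto simp: v_def not_le)
    show "(\<lambda>n. n * v n) \<longlonglongrightarrow> s" unfolding nv by (rule var)
    show "0 \<le> v n" for n by (simp add: v_def)
  qed
  moreover have "(\<Sum>i\<in>{1..n}. \<xi> n i \<omega>) = c n * emp n (h n) \<omega>" if "n \<ge> 1" for n \<omega>
  proof -
    have "(\<Sum>i\<in>{1..n}. \<xi> n i \<omega>) = c n / n * (\<Sum>i\<in>{1..n}. h n (obs n \<omega> i) - m n)"
      unfolding \<xi>_def by (rule sum_distrib_left[symmetric])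
    also have "\<dots> = c n / n * ((\<Sum>i\<in>{1..n}. h n (obs n \<omega> i)) - n * m n)" by (simp add: sum_subtractf)
    also have "\<dots> = c n * emp n (h n) \<omega>" using that by (simp add: emp_def m_def field_simps)
    finally show ?thesis .
  qed
  then have "\<forall>\<^sub>F n in sequentially. char (distr M borel (\<lambda>\<omega>. \<Sum>i\<in>{1..n}. \<xi> n i \<omega>)) t
      = char (distr M borel (\<lambda>\<omega>. c n * emp n (h n) \<omega>)) t"
    by (intro eventually_sequentiallyI[of 1]) simp
  ultimately show ?thesis by (rule Lim_transform_eventually)
qed

end

section \<open>Scales\<close>

lemma eps_pos: "n \<ge> 2 \<Longrightarrow> 0 < eps n" by (simp add: eps_def)

lemma eps_nonneg: "0 \<le> eps n" by (cases "n = 0") (simp_all add: eps_def)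

lemma eps_less_1: "n \<ge> 1 \<Longrightarrow> eps n < 1"
  using ln_le_minus_one[of "real n"] by (simp add: eps_def)

lemma eps_tendsto_0: "eps \<longlonglongrightarrow> 0" unfolding eps_def[abs_def] by real_asymp

lemma n_eps_sq: "n \<ge> 1 \<Longrightarrow> n * (eps n)\<^sup>2 = ln n"
  by (simp add: eps_def)

lemma ln_ge_1: "n \<ge> 3 \<Longrightarrow> 1 \<le> ln (real n)"
proof -
  assume "n \<ge> 3"
  then have "exp 1 \<le> real n" using e_less_272 by linarith
  then show ?thesis using ln_ge_iff[of "real n" 1] \<open>n \<ge> 3\<close> by auto
qed

lemma ln_inverse_eps_le:
  assumes "n \<ge> 3" shows "1 + ln (1 / eps n) \<le> 2 * ln n"
proof -
  note e = eps_pos[of n] ln_ge_1[OF assms]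
  have "1 / n \<le> eps n"
  proof -
    have "1 * 1 \<le> real n * ln n" using e assms by (intro mult_mono) auto
    then have "(1 / n)\<^sup>2 \<le> ln n / n" using assms by (simp add: power2_eq_square field_simps)
    then show ?thesis unfolding eps_def by (intro real_le_rsqrt)
  qed
  then have "1 / eps n \<le> n" using e assms by (simp add: field_simps)
  then have "ln (1 / eps n) \<le> ln n" using e assms by (subst ln_le_cancel_iff) auto
  then show ?thesis using e by simp
qed

text \<open>
  Cuts for the singular part, relative to increments of order \<open>eps n\<close>. The lower cut has to be of
  larger order than \<open>eps n\<close>, but of smaller order than \<open>eps n * ln n\<close>; the upper cut has to tend
  to zero more slowly than \<open>1 / ln n\<close>; and \<open>ln (upper_cut n / lower_cut n)\<close> has to be asymptotic
  to \<open>ln n / 2\<close>. For \<open>n < 3\<close> the value 1 keeps both cuts positive and the upper one at most 1.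
\<close>

definition lower_cut :: "nat \<Rightarrow> real" where "lower_cut n = (if n \<ge> 3 then ln n / sqrt n else 1)"
definition upper_cut :: "nat \<Rightarrow> real" where "upper_cut n = (if n \<ge> 3 then 1 / sqrt (ln n) else 1)"

lemma lower_cut_pos: "0 < lower_cut n" using ln_ge_1[of n] by (auto simp: lower_cut_def)
lemma upper_cut_le_1: "upper_cut n \<le> 1" using ln_ge_1[of n] by (auto simp: upper_cut_def)

lemma eventually_ge3: "\<forall>\<^sub>F n in sequentially. (3::nat) \<le> n" by (rule eventually_ge_at_top)

lemma cut_limit:
  assumes "(\<lambda>n. f (ln (real n) / sqrt n) (1 / sqrt (ln n)) n) \<longlonglongrightarrow> l"
  shows "(\<lambda>n. f (lower_cut n) (upper_cut n) n) \<longlonglongrightarrow> l"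
  by (rule Lim_transform_eventually[OF assms])
    (use eventually_ge3 in eventually_elim, simp add: lower_cut_def upper_cut_def)

lemma upper_cut_tendsto_0: "upper_cut \<longlonglongrightarrow> 0"
  by (rule cut_limit[of "\<lambda>a b n. b" 0]) real_asymp

lemma cut_order: "\<forall>\<^sub>F n in sequentially. lower_cut n \<le> upper_cut n"
proof -
  have "\<forall>\<^sub>F n in sequentially. ln (real n) / sqrt n \<le> 1 / sqrt (ln n)" by real_asymp
  then show ?thesis using eventually_ge3 by eventually_elim (simp add: lower_cut_def upper_cut_def)
qed

lemma eps_le_lower_cut: "\<forall>\<^sub>F n in sequentially. K * eps n \<le> lower_cut n"
proof -
  have "(\<lambda>n. K * sqrt (ln (real n) / n) / (ln n / sqrt n)) \<longlonglongrightarrow> 0" by real_asymp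
  then have "\<forall>\<^sub>F n in sequentially. K * sqrt (ln (real n) / n) / (ln n / sqrt n) < 1"
      by (rule order_tendstoD) simp
  then show ?thesis using eventually_ge3
  proof eventually_elim
    case (elim n)
    then have "0 < ln (real n) / sqrt n" using ln_ge_1[of n] by simp
    then have "K * sqrt (ln (real n) / n) < 1 * (ln n / sqrt n)"
      using elim(1) by (subst (asm) pos_divide_less_eq) auto
    then show ?case using elim by (simp only: lower_cut_def eps_def if_True)
  qed
qed

section \<open>Consequences of the hypotheses on the array\<close>

text \<open>
  \<open>cen n\<close> is the centring \<open>Fhat n x0\<close>. The hypotheses speak of \<open>Fhat n\<close> only through this number,
  so both choices of the centring function are covered at once.
\<close>

locale centred_array = sp: spherical P X \<rho> + uniform_array M T Gn
  for P :: "'p measure" and X :: "'p \<Rightarrow> real ^ 3" and \<rho> :: "real \<Rightarrow> real"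
    and M :: "'m measure" and T :: "nat \<Rightarrow> 'm \<Rightarrow> real" and Gn :: "nat \<Rightarrow> real \<Rightarrow> real" +
  fixes x0 :: real and cen :: "nat \<Rightarrow> real"
  assumes x0: "0 < x0" and g_pos: "0 < proj_density \<rho> x0" and f_pos: "0 < radial_density \<rho> x0"
    and a: "(\<lambda>n. SUP t. \<bar>Gn n t - sp.GY t\<bar>) \<in> O(eps)"
    and b': "\<And>K. compact K \<Longrightarrow>
      uniform_limit K
        (\<lambda>n t. (H_of (Gn n) (x0 + eps n * t) - H_of (Gn n) x0 - cen n * eps n * t) / (eps n)\<^sup>2)
        (\<lambda>t. 1/2 * t\<^sup>2 * radial_density \<rho> x0) sequentially"
    and c': "\<And>e. e > 0 \<Longrightarrow>
      \<exists>\<delta>>0. \<exists>r \<in> o[at 0](\<lambda>\<beta>::real. \<beta>\<^sup>2). \<exists>s \<in> O(\<lambda>n. (eps n)\<^sup>2).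
        \<forall>\<^sub>F n in sequentially. \<forall>\<beta>. \<bar>\<beta>\<bar> < \<delta> \<longrightarrow>
          \<bar>H_of (Gn n) (x0 + \<beta>) - H_of (Gn n) x0 - \<beta> * cen n - 1/2 * \<beta>\<^sup>2 * radial_density \<rho> x0\<bar>
            \<le> e * \<beta>\<^sup>2 + r \<beta> + s n"
begin

abbreviation "fx \<equiv> radial_density \<rho> x0"
abbreviation "gx \<equiv> proj_density \<rho> x0"
abbreviation "H n \<equiv> H_of (Gn n)"

lemma cdf_close: "\<exists>C0>0. \<forall>\<^sub>F n in sequentially. \<forall>t. \<bar>Gn n t - sp.GY t\<bar> \<le> C0 * eps n"
proof -
  obtain C0 where C0: "C0 > 0" "\<forall>\<^sub>F n in sequentially. norm (SUP t. \<bar>Gn n t - sp.GY t\<bar>) \<le> C0 * norm (eps n)"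
    using landau_o.bigE[OF a] by blast
  have "\<forall>\<^sub>F n in sequentially. \<forall>t. \<bar>Gn n t - sp.GY t\<bar> \<le> C0 * eps n"
    using C0(2) eventually_ge_at_top[of 1]
  proof eventually_elim
    case (elim n)
    have G: "0 \<le> Gn n t \<and> Gn n t \<le> 1" for t
    proof -
      interpret D: real_distribution "mu n" by (rule real_distribution_mu[OF elim(2)])
      show ?thesis using D.cdf_bounded_prob[of t] D.cdf_nonneg[of t] cdf_interval_measure_df[OF Gn[OF elim(2)]]
        by (simp add: mu_def)
    qed
    have Y: "0 \<le> sp.GY t \<and> sp.GY t \<le> 1" for t
      using sp.Y.cdf_bounded_prob[of t] sp.Y.cdf_nonneg[of t] by (simp add: sp.GY_def)
    have "\<bar>Gn n t - sp.GY t\<bar> \<le> 1" for t using G[of t] Y[of t] by linarith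
    then have "bdd_above (range (\<lambda>t. \<bar>Gn n t - sp.GY t\<bar>))" by (intro bdd_aboveI[of _ 1]) auto
    then have "\<bar>Gn n t - sp.GY t\<bar> \<le> (SUP t. \<bar>Gn n t - sp.GY t\<bar>)" for t by (rule cSUP_upper[OF UNIV_I])
    moreover have "(SUP t. \<bar>Gn n t - sp.GY t\<bar>) \<le> C0 * eps n"
      using elim(1) eps_nonneg[of n] by (simp add: abs_le_iff)
    ultimately show ?case by (blast intro: order_trans)
  qed
  with C0 show ?thesis by blast
qed

lemma cdf_tendsto: "(\<lambda>n. Gn n t) \<longlonglongrightarrow> sp.GY t"
proof -
  obtain C0 where C0: "C0 > 0" "\<forall>\<^sub>F n in sequentially. \<forall>t. \<bar>Gn n t - sp.GY t\<bar> \<le> C0 * eps n" using cdf_close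
      by blast
  have "(\<lambda>n. C0 * eps n) \<longlonglongrightarrow> 0" using tendsto_mult_left[OF eps_tendsto_0, of C0] by simp
  then have "(\<lambda>n. Gn n t - sp.GY t) \<longlonglongrightarrow> 0"
    by (rule Lim_null_comparison[rotated]) (use C0(2) in \<open>auto elim!: eventually_mono\<close>)
  then show ?thesis by (simp add: LIM_zero_iff)
qed

lemma H_tendsto: "0 \<le> x \<Longrightarrow> (\<lambda>n. H n x) \<longlonglongrightarrow> sp.Hinf x"
  by (rule sp.H_of_tendsto_Hinf[OF Gn cdf_tendsto])

text \<open>
  Hypothesis \<open>c'\<close> with the two Landau terms made explicit.
\<close>

lemma quadratic_bound:
  assumes e: "0 < e"
  shows "\<exists>\<delta>>0. \<exists>C\<ge>0. \<forall>\<^sub>F n in sequentially. \<forall>\<beta>. \<bar>\<beta>\<bar> < \<delta> \<longrightarrow>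
    \<bar>H n (x0 + \<beta>) - H n x0 - \<beta> * cen n - 1/2 * \<beta>\<^sup>2 * fx\<bar> \<le> e * \<beta>\<^sup>2 + C * (eps n)\<^sup>2"
proof -
  obtain \<delta> r s where d: "\<delta> > 0" and r: "r \<in> o[at 0](\<lambda>\<beta>::real. \<beta>\<^sup>2)" and s: "s \<in> O(\<lambda>n. (eps n)\<^sup>2)" and
    ev: "\<forall>\<^sub>F n in sequentially. \<forall>\<beta>. \<bar>\<beta>\<bar> < \<delta> \<longrightarrow>
          \<bar>H n (x0 + \<beta>) - H n x0 - \<beta> * cen n - 1/2 * \<beta>\<^sup>2 * fx\<bar> \<le> (e/2) * \<beta>\<^sup>2 + r \<beta> + s n"
    using c'[of "e/2"] e by auto
  have "\<forall>\<^sub>F \<beta> in at 0. norm (r \<beta>) \<le> (e/2) * norm (\<beta>\<^sup>2)" using landau_o.smallD[OF r, of "e/2"] e by simp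
  then obtain d1 where d1: "d1 > 0" "\<And>\<beta>. \<beta> \<noteq> 0 \<Longrightarrow> \<bar>\<beta>\<bar> < d1 \<Longrightarrow> r \<beta> \<le> (e/2) * \<beta>\<^sup>2"
    by (force simp: eventually_at dist_real_def)
  obtain C where C: "C > 0" "\<forall>\<^sub>F n in sequentially. norm (s n) \<le> C * norm ((eps n)\<^sup>2)"
    using landau_o.bigE[OF s] by blast
  have "\<forall>\<^sub>F n in sequentially. \<forall>\<beta>. \<bar>\<beta>\<bar> < min \<delta> d1 \<longrightarrow>
    \<bar>H n (x0 + \<beta>) - H n x0 - \<beta> * cen n - 1/2 * \<beta>\<^sup>2 * fx\<bar> \<le> e * \<beta>\<^sup>2 + C * (eps n)\<^sup>2"
    using ev C(2)
  proof eventually_elim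
    case (elim n)
    show ?case
    proof (intro allI impI)
      fix \<beta> assume b: "\<bar>\<beta>\<bar> < min \<delta> d1"
      show "\<bar>H n (x0 + \<beta>) - H n x0 - \<beta> * cen n - 1/2 * \<beta>\<^sup>2 * fx\<bar> \<le> e * \<beta>\<^sup>2 + C * (eps n)\<^sup>2"
      proof (cases "\<beta> = 0")
        case True
        then show ?thesis using C by simp
      next
        case False
        have "r \<beta> \<le> (e/2) * \<beta>\<^sup>2" using d1(2)[OF False] b by simp
        moreover have "s n \<le> C * (eps n)\<^sup>2" using elim(2) by simp
        moreover have "\<bar>H n (x0 + \<beta>) - H n x0 - \<beta> * cen n - 1/2 * \<beta>\<^sup>2 * fx\<bar> \<le> (e/2) * \<beta>\<^sup>2 + r \<beta> + s n"
          using elim(1) b by simp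
        moreover have "(e/2) * \<beta>\<^sup>2 + (e/2) * \<beta>\<^sup>2 = e * \<beta>\<^sup>2" by simp
        ultimately show ?thesis by linarith
      qed
    qed
  qed
  then show ?thesis using d d1 C by (intro exI[of _ "min \<delta> d1"] conjI exI[of _ C]) auto
qed

text \<open>
  Adding the bounds of \<open>quadratic_bound\<close> for \<open>\<beta>\<close> and \<open>- \<beta>\<close> removes the centring, and the rest
  passes to the limit in \<open>n\<close>. So the hypotheses on the array give a smoothness property of the law
  of \<open>Z\<close>.
\<close>

lemma Hinf_second_difference_le: "\<exists>\<delta>>0. \<forall>\<beta>. 0 < \<beta> \<and> \<beta> < \<delta> \<longrightarrow>
  sp.Hinf (x0 + \<beta>) + sp.Hinf (x0 - \<beta>) - 2 * sp.Hinf x0 \<le> (fx + 2) * \<beta>\<^sup>2"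
proof -
  obtain \<delta> C where d: "\<delta> > 0" "C \<ge> 0" and ev: "\<forall>\<^sub>F n in sequentially. \<forall>\<beta>. \<bar>\<beta>\<bar> < \<delta> \<longrightarrow>
    \<bar>H n (x0 + \<beta>) - H n x0 - \<beta> * cen n - 1/2 * \<beta>\<^sup>2 * fx\<bar> \<le> 1 * \<beta>\<^sup>2 + C * (eps n)\<^sup>2"
    using quadratic_bound[of 1] by auto
  have "sp.Hinf (x0 + \<beta>) + sp.Hinf (x0 - \<beta>) - 2 * sp.Hinf x0 \<le>
      (fx + 2) * \<beta>\<^sup>2" if b: "0 < \<beta>" "\<beta> < min \<delta> x0" for \<beta>
  proof (rule tendsto_le[OF sequentially_bot])
    show "(\<lambda>n. H n (x0 + \<beta>) + H n (x0 - \<beta>) - 2 * H n x0) \<longlonglongrightarrow> sp.Hinf (x0 + \<beta>) + sp.Hinf (x0 - \<beta>) - 2 * sp.Hinf x0"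
      using b x0 by (intro tendsto_intros H_tendsto) auto
    have "(\<lambda>n. (fx + 2) * \<beta>\<^sup>2 + 2 * C * (eps n)\<^sup>2) \<longlonglongrightarrow> (fx + 2) * \<beta>\<^sup>2 + 2 * C * 0\<^sup>2"
      by (intro tendsto_intros eps_tendsto_0)
    then show "(\<lambda>n. (fx + 2) * \<beta>\<^sup>2 + 2 * C * (eps n)\<^sup>2) \<longlonglongrightarrow> (fx + 2) * \<beta>\<^sup>2" by simp
    show "\<forall>\<^sub>F n in sequentially. H n (x0 + \<beta>) + H n (x0 - \<beta>) - 2 * H n x0 \<le> (fx + 2) * \<beta>\<^sup>2 + 2 * C * (eps n)\<^sup>2"
      using ev
    proof eventually_elim
      case (elim n)
      have "\<bar>H n (x0 + \<beta>) - H n x0 - \<beta> * cen n - 1/2 * \<beta>\<^sup>2 * fx\<bar> \<le> 1 * \<beta>\<^sup>2 + C * (eps n)\<^sup>2"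
        using elim b by auto
      moreover have "\<bar>H n (x0 - \<beta>) - H n x0 - (- \<beta>) * cen n - 1/2 * \<beta>\<^sup>2 * fx\<bar> \<le> 1 * \<beta>\<^sup>2 + C * (eps n)\<^sup>2"
        using elim[rule_format, of "- \<beta>"] b by auto
      ultimately show ?case by (simp add: abs_le_iff algebra_simps)
    qed
  qed
  then show ?thesis using d x0 by (intro exI[of _ "min \<delta> x0"]) auto
qed

text \<open>
  To the right by \<open>GY_right_le\<close>. To the left the second difference of \<open>Hinf\<close> bounds the
  probability that \<open>Z\<close> is within \<open>u\<close> of \<open>x0\<close> by a multiple of \<open>u\<close>, and \<open>GY_left_le\<close> applies.
\<close>

lemma GY_lipschitz_at: "\<exists>C. \<forall>u\<ge>0. sp.GY (x0 + u) - sp.GY (x0 - u) \<le> C * u"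
proof -
  obtain \<delta> where d: "\<delta> > 0" and sd: "\<And>\<beta>. 0 < \<beta> \<Longrightarrow> \<beta> < \<delta> \<Longrightarrow>
     sp.Hinf (x0 + \<beta>) + sp.Hinf (x0 - \<beta>) - 2 * sp.Hinf x0 \<le> (fx + 2) * \<beta>\<^sup>2"
    using Hinf_second_difference_le by blast
  define u0 where "u0 = min (min (\<delta> / 3) (x0 / 2)) 1"
  have u0: "0 < u0" "2 * u0 < \<delta>" "u0 \<le> x0 / 2" "u0 \<le> 1" using d x0 by (auto simp: u0_def)
  define K where "K = 4 * (fx + 2)"
  define C1 where "C1 = 4 * gx + K / sqrt (x0 / 2)"
  have K: "0 \<le> K" using f_pos by (simp add: K_def)
  have C1: "0 \<le> C1" using g_pos K x0 by (simp add: C1_def)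
  have small: "sp.GY (x0 + u) - sp.GY (x0 - u) \<le> C1 * u" if u: "0 < u" "u \<le> u0" for u
  proof -
    define p where "p = sp.prob {\<omega> \<in> space P. \<bar>sp.Z2 \<omega> - x0\<bar> \<le> u}"
    have "u * p \<le> (fx + 2) * (2 * u)\<^sup>2"
      using sp.Hinf_second_difference[of u x0] sd[of "2 * u"] u u0 by (simp add: p_def)
    also have "\<dots> = u * (K * u)" by (simp add: K_def power2_eq_square algebra_simps)
    finally have p: "p \<le> K * u" using u by simp
    have "sqrt u * p \<le> 1 * (K * u)" using p u u0 K by (intro mult_mono) (auto simp: p_def)
    then have "sqrt u / sqrt (x0 / 2) * p \<le> K / sqrt (x0 / 2) * u"
      using x0 by (simp add: divide_right_mono)
    moreover have "sp.GY x0 - sp.GY (x0 - u) \<le> 2 * gx * u + sqrt u / sqrt (x0 / 2) * p"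
      unfolding p_def by (rule sp.GY_left_le[OF x0 g_pos]) (use u u0 in auto)
    moreover have "sp.GY (x0 + u) - sp.GY x0 \<le> 2 * gx * u" by (rule sp.GY_right_le[OF x0 g_pos]) (use u in auto)
    ultimately show ?thesis unfolding C1_def distrib_right by linarith
  qed
  have "sp.GY (x0 + u) - sp.GY (x0 - u) \<le> (C1 + 1 / u0) * u" if u: "0 \<le> u" for u
  proof -
    consider "u = 0" | "0 < u" "u \<le> u0" | "u0 < u" using u by linarith
    then show ?thesis
    proof cases
      case 2
      have "C1 * u \<le> (C1 + 1 / u0) * u" using 2 u0 by (intro mult_right_mono) auto
      with small[OF 2] show ?thesis by linarith
    next
      case 3
      have "sp.GY (x0 + u) \<le> 1" "0 \<le> sp.GY (x0 - u)"
        using sp.Y.cdf_bounded_prob sp.Y.cdf_nonneg by (simp_all add: sp.GY_def)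
      moreover have "1 \<le> 1 / u0 * u" using 3 u0 by simp
      moreover have "0 \<le> C1 * u" using C1 u by simp
      ultimately show ?thesis unfolding distrib_right by linarith
    qed simp
  qed
  then show ?thesis by blast
qed

lemma mu_interval:
  assumes "n \<ge> 1" "s \<le> t" shows "measure (mu n) {s<..t} = Gn n t - Gn n s"
proof (cases "s = t")
  case False
  interpret D: real_distribution "mu n" by (rule real_distribution_mu[OF assms(1)])
  have "cdf (mu n) = Gn n" unfolding mu_def by (rule cdf_interval_measure_df[OF Gn[OF assms(1)]])
  then show ?thesis using D.cdf_diff_eq[of s t] False assms by simp
qed simp

lemma eventually_local_mass: "\<exists>C\<ge>1. \<forall>\<^sub>F n in sequentially. local_mass (mu n) x0 C (eps n)"
proof -
  obtain C0 where C0: "C0 > 0" "\<forall>\<^sub>F n in sequentially. \<forall>t. \<bar>Gn n t - sp.GY t\<bar> \<le> C0 * eps n" using cdf_close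
      by blast
  obtain C1 where C1: "\<And>u. u \<ge> 0 \<Longrightarrow> sp.GY (x0 + u) - sp.GY (x0 - u) \<le> C1 * u" using GY_lipschitz_at by blast
  define C where "C = max 1 (max C1 (2 * C0))"
  have "\<forall>\<^sub>F n in sequentially. local_mass (mu n) x0 C (eps n)"
    using C0(2) eventually_ge_at_top[of 2]
  proof eventually_elim
    case (elim n)
    interpret D: real_distribution "mu n" by (rule real_distribution_mu) (use elim in simp)
    show ?case
    proof
      fix u :: real assume u: "0 \<le> u"
      have "measure (mu n) {x0 - u<..x0 + u} = Gn n (x0 + u) - Gn n (x0 - u)"
        using elim u by (intro mu_interval) auto
      also have "\<dots> \<le> (sp.GY (x0 + u) - sp.GY (x0 - u)) + 2 * C0 * eps n"
        using elim(1)[rule_format, of "x0 + u"] elim(1)[rule_format, of "x0 - u"] by linarith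
      also have "\<dots> \<le> C * u + C * eps n"
      proof (intro add_mono)
        have "C1 * u \<le> C * u" using u by (intro mult_right_mono) (auto simp: C_def)
        with C1[OF u] show "sp.GY (x0 + u) - sp.GY (x0 - u) \<le> C * u" by linarith
        show "2 * C0 * eps n \<le> C * eps n" using eps_nonneg by (intro mult_right_mono) (auto simp: C_def)
      qed
      finally show "measure (mu n) {x0 - u<..x0 + u} \<le> C * (u + eps n)" by (simp add: algebra_simps)
    qed (use x0 elim eps_pos[of n] eps_less_1[of n] in \<open>auto simp: C_def\<close>)
  qed
  then show ?thesis by (intro exI[of _ C]) (auto simp: C_def)
qed

definition "recip n = (\<integral>y. indicator {x0 + lower_cut n<..x0 + upper_cut n} y / (y - x0) \<partial>mu n)"

lemma ln_ratio_tendsto: "(\<lambda>n. ln (upper_cut n / lower_cut n) / ln n) \<longlonglongrightarrow> 1 / 2"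
  by (rule cut_limit[of "\<lambda>a b n. ln (b / a) / ln n"]) real_asymp

text \<open>
  By \<open>GY_right_derivative\<close> and the uniform closeness of \<open>Gn n\<close> to \<open>G\<close>, the masses of
  \<open>{x0 + lower_cut n<..x0 + s}\<close> are \<open>gx * s\<close> up to a small multiple of \<open>s\<close> and a term of order
  \<open>lower_cut n\<close>. In \<open>reciprocal_integral\<close> only the main term, of order \<open>ln n\<close>, survives.
\<close>

lemma recip_tendsto: "(\<lambda>n. recip n / ln n) \<longlonglongrightarrow> gx / 2"
proof (rule LIMSEQ_I)
  fix e0 :: real assume e0: "0 < e0"
  define \<eta> where "\<eta> = e0 / 2"
  have eta: "0 < \<eta>" "\<eta> * (1/2) < e0" using e0 by (auto simp: \<eta>_def)
  define L where "L n = ln (upper_cut n / lower_cut n)" for n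
  obtain C0 where C0: "C0 > 0" "\<forall>\<^sub>F n in sequentially. \<forall>t. \<bar>Gn n t - sp.GY t\<bar> \<le> C0 * eps n" using cdf_close
      by blast
  have "\<forall>\<^sub>F s in at_right 0. dist ((sp.GY (x0 + s) - sp.GY x0) / s) gx < \<eta>"
    using tendstoD[OF sp.GY_right_derivative[OF x0 g_pos] eta(1)] .
  then obtain s0 where s0: "s0 > 0" "\<And>s. 0 < s \<Longrightarrow> s < s0 \<Longrightarrow> \<bar>(sp.GY (x0 + s) - sp.GY x0) / s - gx\<bar> < \<eta>"
    by (auto simp: eventually_at_right_field dist_real_def)
  define K where "K = gx + \<eta> + 2 * gx + 2 * C0"
  have bound: "\<forall>\<^sub>F n in sequentially. \<bar>recip n - gx * L n\<bar> \<le> \<eta> * L n + K"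
    using C0(2) eventually_ge3 cut_order eps_le_lower_cut[of 1] order_tendstoD(2)[OF upper_cut_tendsto_0 s0(1)]
  proof eventually_elim
    case (elim n)
    note lp = lower_cut_pos[of n]
    have m: "\<bar>measure (mu n) {x0 + lower_cut n<..x0 + s} - gx * s\<bar> \<le>
        \<eta> * s + (2 * gx * lower_cut n + 2 * C0 * eps n)"
      if s: "s \<in> {lower_cut n..upper_cut n}" for s
    proof -
      have sp: "0 < s" "s < s0" using s lp elim by auto
      have "\<bar>sp.GY (x0 + s) - sp.GY x0 - gx * s\<bar> = s * \<bar>(sp.GY (x0 + s) - sp.GY x0) / s - gx\<bar>"
      proof -
        have "s * ((sp.GY (x0 + s) - sp.GY x0) / s - gx) = sp.GY (x0 + s) - sp.GY x0 - gx * s"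
          using sp by (simp add: field_simps)
        then show ?thesis using abs_mult[of s "(sp.GY (x0 + s) - sp.GY x0) / s - gx"] sp by simp
      qed
      also have "\<dots> \<le> s * \<eta>" using s0(2)[OF sp] sp by (intro mult_left_mono) auto
      finally have A: "\<bar>sp.GY (x0 + s) - sp.GY x0 - gx * s\<bar> \<le> \<eta> * s" by (simp add: mult.commute)
      have B: "sp.GY (x0 + lower_cut n) - sp.GY x0 \<le> 2 * gx * lower_cut n"
        by (rule sp.GY_right_le[OF x0 g_pos]) (use lp in auto)
      have B': "0 \<le> sp.GY (x0 + lower_cut n) - sp.GY x0"
        using sp.Y.cdf_nondecreasing[of x0 "x0 + lower_cut n"] lp by (simp add: sp.GY_def)
      have "measure (mu n) {x0 + lower_cut n<..x0 + s} = Gn n (x0 + s) - Gn n (x0 + lower_cut n)"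
        using elim s by (intro mu_interval) auto
      then show ?thesis
        using A B B' elim(1)[rule_format, of "x0 + s"] elim(1)[rule_format, of "x0 + lower_cut n"] by linarith
    qed
    have "\<bar>recip n - gx * L n\<bar> \<le> \<eta> * L n + gx + \<eta> + (2 * gx * lower_cut n + 2 * C0 * eps n) / lower_cut n"
      unfolding recip_def L_def
      by (rule reciprocal_integral[OF real_distribution_mu _ _ _ _ _ m])
        (use elim lp eta g_pos C0 eps_nonneg[of n] in auto)
    also have "(2 * gx * lower_cut n + 2 * C0 * eps n) / lower_cut n \<le> 2 * gx + 2 * C0"
    proof -
      have "2 * C0 * eps n \<le> 2 * C0 * lower_cut n" using elim C0 by (intro mult_left_mono) auto
      then show ?thesis using lp by (simp add: pos_divide_le_eq algebra_simps)
    qed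
    finally show ?case by (simp add: K_def)
  qed
  have lim: "(\<lambda>n. \<bar>gx * (L n / ln n - 1/2)\<bar> + (\<eta> * (L n / ln n) + K * (1 / ln n))) \<longlonglongrightarrow> \<bar>gx * (1/2 - 1/2)\<bar> +
      (\<eta> * (1/2) + K * 0)"
  proof -
    define ra where "ra n = L n / ln (real n)" for n :: nat
    define rb where "rb n = 1 / ln (real n)" for n :: nat
    have "ra \<longlonglongrightarrow> 1/2" using ln_ratio_tendsto unfolding ra_def[abs_def] L_def .
    moreover have "rb \<longlonglongrightarrow> 0" unfolding rb_def[abs_def] by real_asymp
    ultimately have "(\<lambda>n. \<bar>gx * (ra n - 1/2)\<bar> + (\<eta> * ra n + K * rb n)) \<longlonglongrightarrow> \<bar>gx * (1/2 - 1/2)\<bar> + (\<eta> * (1/2) +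
        K * 0)"
      by (intro tendsto_intros)
    then show ?thesis by (simp add: ra_def rb_def)
  qed
  have "\<forall>\<^sub>F n in sequentially. \<bar>gx * (L n / ln n - 1/2)\<bar> + (\<eta> * (L n / ln n) + K * (1 / ln n)) < e0"
    using order_tendstoD(2)[OF lim, of e0] eta by simp
  then have "\<forall>\<^sub>F n in sequentially. norm (recip n / ln n - gx / 2) < e0"
    using bound eventually_ge3
  proof eventually_elim
    case (elim n)
    have ln: "0 < ln (real n)" using ln_ge_1[OF elim(3)] by simp
    have "recip n / ln n - gx / 2 = (recip n - gx * L n) / ln n + gx * (L n / ln n - 1/2)"
      by (simp add: diff_divide_distrib right_diff_distrib)
    also have "\<bar>\<dots>\<bar> \<le> \<bar>(recip n - gx * L n) / ln n\<bar> + \<bar>gx * (L n / ln n - 1/2)\<bar>" by (rule abs_triangle_ineq)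
    also have "\<bar>(recip n - gx * L n) / ln n\<bar> \<le> (\<eta> * L n + K) / ln n"
      using elim(2) ln by (simp add: abs_divide divide_right_mono)
    also have "(\<eta> * L n + K) / ln n = \<eta> * (L n / ln n) + K * (1 / ln n)" by (simp add: add_divide_distrib)
    finally show ?case using elim(1) by simp
  qed
  then show "\<exists>no. \<forall>n\<ge>no. norm (recip n / ln n - gx / 2) < e0" by (simp add: eventually_sequentially)
qed

end

section \<open>The linear term of the local process\<close>

context centred_array begin

text \<open>
  \<open>Q n\<close> is the asymptotically normal variable of the theorem. \<open>D n t\<close> is the noise in the
  increment of \<open>H_emp\<close> from \<open>x0\<close> to \<open>x0 + eps n * t\<close>, on the scale \<open>(eps n)\<^sup>2\<close> of the quadratic
  drift.
\<close>

definition "sing n = singular_part x0 (lower_cut n) (upper_cut n)"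
definition "Q n \<omega> = emp n (sing n) \<omega> / eps n"
definition "incr n t y = ikern y (x0 + eps n * t) - ikern y x0"
definition "D n t \<omega> = emp n (incr n t) \<omega> / (eps n)\<^sup>2"

lemma sing_measurable [measurable]: "sing n \<in> borel_measurable borel"
  unfolding sing_def by measurable

lemma abs_sing_le: "\<bar>sing n y\<bar> \<le> sqrt x0 / sqrt (lower_cut n)"
  unfolding sing_def by (rule abs_singular_part_le[OF x0 lower_cut_pos])

lemma Q_measurable: "n \<ge> 1 \<Longrightarrow> Q n \<in> borel_measurable M"
  unfolding Q_def using emp_measurable[OF _ sing_measurable] by simp

lemma incr_measurable: "0 \<le> x0 + eps n * t \<Longrightarrow> incr n t \<in> borel_measurable borel"
  unfolding incr_def using x0 by (intro borel_measurable_diff borel_measurable_ikern) auto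

lemma abs_incr_le:
  assumes "0 \<le> x0 + eps n * t" shows "\<bar>incr n t y\<bar> \<le> 3 * (x0 + eps n * t) + 3 * x0"
  unfolding incr_def using abs_ikern_le[OF assms, of y] abs_ikern_le[of x0 y] x0 by linarith

lemma D_measurable: "n \<ge> 1 \<Longrightarrow> 0 \<le> x0 + eps n * t \<Longrightarrow> D n t \<in> borel_measurable M"
  unfolding D_def using emp_measurable[OF _ incr_measurable] by simp

lemma sing_second_moment_tendsto:
  "(\<lambda>n. (\<integral>y. (sing n y)\<^sup>2 \<partial>mu n) / ln n) \<longlonglongrightarrow> 2 / pi\<^sup>2 * x0 * gx"
proof -
  obtain C where C: "C \<ge> 1" "\<forall>\<^sub>F n in sequentially. local_mass (mu n) x0 C (eps n)"
      using eventually_local_mass by blast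
  have "(\<lambda>n. 4 / pi\<^sup>2 * x0 * (recip n / ln n)) \<longlonglongrightarrow> 4 / pi\<^sup>2 * x0 * (gx / 2)"
    by (intro tendsto_mult_left recip_tendsto)
  moreover have "\<forall>\<^sub>F n in sequentially. 4 / pi\<^sup>2 * x0 * (recip n / ln n) = (\<integral>y. (sing n y)\<^sup>2 \<partial>mu n) / ln n"
    using C(2) by eventually_elim (simp add: sing_def recip_def local_mass.singular_part_square[OF _
        lower_cut_pos])
  ultimately have "(\<lambda>n. (\<integral>y. (sing n y)\<^sup>2 \<partial>mu n) / ln n) \<longlonglongrightarrow> 4 / pi\<^sup>2 * x0 * (gx / 2)"
    by (rule Lim_transform_eventually)
  then show ?thesis by (simp add: mult.assoc)
qed

text \<open>
  The variance \<open>2 / \<pi>\<^sup>2 * x0 * gx\<close> arises as \<open>4 / \<pi>\<^sup>2 * x0\<close>, from the squared singular part, times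
  \<open>gx / 2\<close>, from \<open>recip_tendsto\<close>; the norming is \<open>1 / (n * (eps n)\<^sup>2) = 1 / ln n\<close>.
\<close>

lemma char_Q_tendsto:
  "(\<lambda>n. char (distr M borel (Q n)) t) \<longlonglongrightarrow> complex_of_real (exp (- (t\<^sup>2 * (2 / pi\<^sup>2 * x0 * gx) / 2)))"
proof -
  have Qe: "Q n = (\<lambda>\<omega>. 1 / eps n * emp n (sing n) \<omega>)" for n by (simp add: Q_def fun_eq_iff)
  show ?thesis unfolding Qe
  proof (rule char_emp_tendsto[where b = "\<lambda>n. sqrt x0 / sqrt (lower_cut n)"])
    show "(\<lambda>n. 1 / eps n * (sqrt x0 / sqrt (lower_cut n)) / n) \<longlonglongrightarrow> 0"
      unfolding eps_def
      by (rule cut_limit[of "\<lambda>a b n. 1 / sqrt (ln (real n) / real n) * (sqrt x0 / sqrt a) / n"]) real_asymp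
    obtain C where C: "C \<ge> 1" "\<forall>\<^sub>F n in sequentially. local_mass (mu n) x0 C (eps n)"
        using eventually_local_mass by blast
    define s2 where "s2 n = (\<integral>y. (sing n y)\<^sup>2 \<partial>mu n) / ln n" for n
    have s2: "s2 \<longlonglongrightarrow> 2 / pi\<^sup>2 * x0 * gx" unfolding s2_def[abs_def] by (rule sing_second_moment_tendsto)
    define m2 where "m2 n = (\<integral>y. sing n y \<partial>mu n)\<^sup>2 / ln n" for n
    have "m2 \<longlonglongrightarrow> 0"
    proof (rule Lim_null_comparison)
      show "\<forall>\<^sub>F n in sequentially. norm (m2 n) \<le> s2 n * (C * (upper_cut n + eps n))"
        using C(2) eventually_ge3 cut_order
      proof eventually_elim
        case (elim n)
        have "(\<integral>y. sing n y \<partial>mu n)\<^sup>2 / ln n \<le> (\<integral>y. (sing n y)\<^sup>2 \<partial>mu n) * (C * (upper_cut n + eps n)) / ln n"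
          unfolding sing_def using elim ln_ge_1[of n]
          by (intro divide_right_mono local_mass.singular_part_mean_square[OF _ lower_cut_pos]) auto
        then show ?case using ln_ge_1[OF elim(2)] by (simp add: m2_def s2_def)
      qed
      have "(\<lambda>n. s2 n * (C * (upper_cut n + eps n))) \<longlonglongrightarrow> 2 / pi\<^sup>2 * x0 * gx * (C * (0 + 0))"
        by (intro tendsto_intros s2 upper_cut_tendsto_0 eps_tendsto_0)
      then show "(\<lambda>n. s2 n * (C * (upper_cut n + eps n))) \<longlonglongrightarrow> 0" by simp
    qed
    from tendsto_diff[OF s2 this] have "(\<lambda>n. s2 n - m2 n) \<longlonglongrightarrow> 2 / pi\<^sup>2 * x0 * gx" by simp
    moreover have "\<forall>\<^sub>F n in sequentially. s2 n - m2 n = (1 / eps n)\<^sup>2 / n * ((\<integral>y. (sing n y)\<^sup>2 \<partial>mu n) - (\<integral>y.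
        sing n y \<partial>mu n)\<^sup>2)"
      using eventually_ge3
    proof eventually_elim
      case (elim n)
      have "(1 / eps n)\<^sup>2 / n = 1 / ln n" using n_eps_sq[of n] elim by (simp add: power_divide mult.commute)
      then show ?case by (simp add: s2_def m2_def diff_divide_distrib)
    qed
    ultimately show "(\<lambda>n. (1 / eps n)\<^sup>2 / n * ((\<integral>y. (sing n y)\<^sup>2 \<partial>mu n) - (\<integral>y. sing n y \<partial>mu n)\<^sup>2)) \<longlonglongrightarrow> 2 / pi\<^sup>2 *
        x0 * gx"
      by (rule Lim_transform_eventually)
  qed (use abs_sing_le eps_nonneg in auto)
qed

lemma Q_tight:
  assumes "0 < p"
  shows "\<exists>L>0. \<forall>\<^sub>F n in sequentially. holds_up_to p (\<lambda>\<omega>. \<bar>Q n \<omega>\<bar> \<le> L)"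
proof -
  define V where "V = 2 / pi\<^sup>2 * x0 * gx + 1"
  have V: "0 < V" using x0 g_pos by (auto simp: V_def intro!: add_nonneg_pos)
  have VV: "2 / pi\<^sup>2 * x0 * gx < V" by (simp add: V_def)
  define L where "L = sqrt (V / p)"
  have L: "0 < L" "L\<^sup>2 = V / p" using V assms by (auto simp: L_def)
  have "\<forall>\<^sub>F n in sequentially. holds_up_to p (\<lambda>\<omega>. \<bar>Q n \<omega>\<bar> \<le> L)"
    using order_tendstoD(2)[OF sing_second_moment_tendsto VV] eventually_ge3
  proof (eventually_elim)
    case (elim n)
    have n: "n \<ge> 1" "0 < eps n" using elim eps_pos[of n] by auto
    define E where "E = {\<omega> \<in> space M. \<bar>emp n (sing n) \<omega>\<bar> \<ge> L * eps n}"
    note ch = emp_chebyshev[OF n(1) sing_measurable[of n] abs_sing_le[of n], of "L * eps n", folded E_def]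
    have "prob E \<le> (\<integral>y. (sing n y)\<^sup>2 \<partial>mu n) / (n * (L * eps n)\<^sup>2)" using ch(2) L n by simp
    also have "n * (L * eps n)\<^sup>2 = ln n * L\<^sup>2" using n_eps_sq[OF n(1)] by (simp add: power_mult_distrib mult_ac)
    also have "(\<integral>y. (sing n y)\<^sup>2 \<partial>mu n) / (ln n * L\<^sup>2) = (\<integral>y. (sing n y)\<^sup>2 \<partial>mu n) / ln n / L\<^sup>2" by simp
    also have "\<dots> \<le> V / L\<^sup>2" using elim by (intro divide_right_mono) (auto simp: V_def)
    also have "\<dots> = p" using L V assms by simp
    finally have "prob E \<le> p" .
    moreover have "\<bar>Q n \<omega>\<bar> \<le> L" if "\<omega> \<in> space M - E" for \<omega>
      using that n by (auto simp: E_def Q_def abs_divide pos_divide_le_eq)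
    ultimately show ?case using ch(1) L n by (intro bexI[of _ E]) auto
  qed
  with L show ?thesis by blast
qed

lemma eps_mult_tendsto_0: "(\<lambda>n. eps n * c) \<longlonglongrightarrow> 0"
  using tendsto_mult_right[OF eps_tendsto_0, of c] by simp

lemma eventually_eps_mult_less: "0 < d \<Longrightarrow> \<forall>\<^sub>F n in sequentially. eps n * c < d"
  by (rule order_tendstoD(2)[OF eps_mult_tendsto_0])

text \<open>
  Chebyshev's inequality and \<open>singular_error_second_moment\<close> with \<open>h = eps n * \<bar>t\<bar>\<close>. The function
  \<open>f\<close> in the proof is the bound divided by \<open>(eps n)\<^sup>2 * ln n\<close>, the order of the second moment of
  the singular part; each of its four terms vanishes by the choice of the cuts.
\<close>

lemma D_minus_tQ_pointwise:
  assumes k: "0 < k" and p: "0 < p"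
  shows "\<forall>\<^sub>F n in sequentially. holds_up_to p (\<lambda>\<omega>. \<bar>D n t \<omega> - t * Q n \<omega>\<bar> \<le> k)"
proof -
  obtain C where C: "C \<ge> 1" "\<forall>\<^sub>F n in sequentially. local_mass (mu n) x0 C (eps n)"
      using eventually_local_mass by blast
  define err where "err n y = incr n t y - eps n * t * sing n y" for n y
  define f where "f e a b l = 2 * t\<^sup>2 * (1 / l) + 16 * x0 * t\<^sup>2 * (1 / (b * l)) +
      32 * x0 * C * \<bar>t\<bar> * (a / (e * l)) +
      8 * (x0 + 1)\<^sup>2 / x0 * C * t\<^sup>2 * t\<^sup>2 * ((e / a)\<^sup>2 * (ln (b / a) + 2) / l)" for e a b l :: real
  have "(\<lambda>n. f (eps n) (lower_cut n) (upper_cut n) (ln n)) \<longlonglongrightarrow> 0"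
    unfolding eps_def
  proof (rule cut_limit[of "\<lambda>a b n. f (sqrt (ln (real n) / real n)) a b (ln n)"])
    have "(\<lambda>n. 1 / ln (real n)) \<longlonglongrightarrow> 0" "(\<lambda>n. 1 / (1 / sqrt (ln (real n)) * ln n)) \<longlonglongrightarrow> 0"
      "(\<lambda>n. ln (real n) / sqrt n / (sqrt (ln (real n) / n) * ln n)) \<longlonglongrightarrow> 0"
      "(\<lambda>n. (sqrt (ln (real n) / n) / (ln (real n) / sqrt n))\<^sup>2 * (ln (1 / sqrt (ln (real n)) / (ln (real n) /
          sqrt n)) + 2) / ln n) \<longlonglongrightarrow> 0"
      by real_asymp+
    then have "(\<lambda>n. f (sqrt (ln (real n) / real n)) (ln (real n) / sqrt n) (1 / sqrt (ln (real n))) (ln n)) \<longlonglongrightarrow>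
        2 * t\<^sup>2 * 0 + 16 * x0 * t\<^sup>2 * 0 + 32 * x0 * C * \<bar>t\<bar> * 0 + 8 * (x0 + 1)\<^sup>2 / x0 * C * t\<^sup>2 * t\<^sup>2 * 0"
      unfolding f_def by (intro tendsto_add tendsto_mult_left)
    then show "(\<lambda>n. f (sqrt (ln (real n) / real n)) (ln (real n) / sqrt n) (1 / sqrt (ln (real n))) (ln n)) \<longlonglongrightarrow>
        0" by simp
  qed
  moreover have "0 < p * k\<^sup>2" using k p by simp
  ultimately have "\<forall>\<^sub>F n in sequentially. f (eps n) (lower_cut n) (upper_cut n) (ln n) < p * k\<^sup>2"
      by (rule order_tendstoD(2))
  moreover have "\<forall>\<^sub>F n in sequentially. eps n * \<bar>t\<bar> < x0" using x0 by (rule eventually_eps_mult_less)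
  ultimately show ?thesis using C(2) eventually_ge3 cut_order eps_le_lower_cut[of 1] eps_le_lower_cut[of "2 *
      \<bar>t\<bar>"]
  proof eventually_elim
    case (elim n)
    have n: "n \<ge> 1" "0 < eps n" using elim eps_pos[of n] by auto
    have l0: "0 < ln (real n)" using ln_ge_1[OF elim(4)] by simp
    interpret D: local_mass "mu n" x0 C "eps n" by fact
    have et: "\<bar>eps n * t\<bar> = eps n * \<bar>t\<bar>" using n by (simp add: abs_mult)
    have pos: "0 \<le> x0 + eps n * t" using elim(2) et by linarith
    note [measurable] = incr_measurable[OF pos]
    define b where "b = (3 * (x0 + eps n * t) + 3 * x0) + eps n * \<bar>t\<bar> * (sqrt x0 / sqrt (lower_cut n))"
    have ib: "\<bar>incr n t y\<bar> \<le> 3 * (x0 + eps n * t) + 3 * x0" for y by (rule abs_incr_le[OF pos])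
    have sb: "\<bar>eps n * t * sing n y\<bar> \<le> eps n * \<bar>t\<bar> * (sqrt x0 / sqrt (lower_cut n))" for y
      unfolding abs_mult[of "eps n * t"] et using n by (intro mult_left_mono abs_sing_le) auto
    have eb: "\<bar>err n y\<bar> \<le> b" for y unfolding err_def b_def using ib[of y] sb[of y] by linarith
    have em: "err n \<in> borel_measurable borel" unfolding err_def[abs_def] by measurable
    have emp_err: "emp n (err n) \<omega> = emp n (incr n t) \<omega> - eps n * t * emp n (sing n) \<omega>" for \<omega>
    proof -
      have "emp n (err n) \<omega> = emp n (incr n t) \<omega> - emp n (\<lambda>y. eps n * t * sing n y) \<omega>"
        unfolding err_def[abs_def]
        by (rule emp_diff[OF n(1) integrable_mu[OF n(1) _ ib] integrable_mu[OF n(1) _ sb]]) measurable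
      then show ?thesis unfolding emp_cmult .
    qed
    have DQ: "D n t \<omega> - t * Q n \<omega> = emp n (err n) \<omega> / (eps n)\<^sup>2" for \<omega>
      unfolding D_def Q_def emp_err using n by (simp add: field_simps power2_eq_square)
    define E where "E = {\<omega> \<in> space M. \<bar>emp n (err n) \<omega>\<bar> \<ge> k * (eps n)\<^sup>2}"
    have "0 < k * (eps n)\<^sup>2" using k n by simp
    note ch = emp_chebyshev[OF n(1) em eb this, folded E_def]
    have v: "(\<integral>y. (err n y)\<^sup>2 \<partial>mu n) \<le> (eps n)\<^sup>2 * ln n * f (eps n) (lower_cut n) (upper_cut n) (ln n)"
    proof (cases "t = 0")
      case True
      then have "err n y = 0" for y by (simp add: err_def incr_def)
      then show ?thesis using True l0 by (simp add: f_def)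
    next
      case False
      have "(\<integral>y. (err n y)\<^sup>2 \<partial>mu n) \<le> 2 * (eps n * \<bar>t\<bar>)\<^sup>2 + 16 * x0 * (eps n * \<bar>t\<bar>)\<^sup>2 / upper_cut n
         + 32 * x0 * C * (eps n * \<bar>t\<bar>) * lower_cut n
         + 8 * (x0 + 1)\<^sup>2 / x0 * C * (eps n * \<bar>t\<bar>)\<^sup>2 * (eps n * \<bar>t\<bar> / lower_cut n)\<^sup>2 * (ln (upper_cut n /
             lower_cut n) + 2)"
        unfolding err_def incr_def sing_def
        by (rule D.singular_error_second_moment[OF et]) (use elim n False upper_cut_le_1 in \<open>auto simp:
            mult_ac\<close>)
      also have "\<dots> = (eps n)\<^sup>2 * ln n * f (eps n) (lower_cut n) (upper_cut n) (ln n)"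
      proof -
        have e: "32 * x0 * C * (eps n * \<bar>t\<bar>) * lower_cut n = (eps n)\<^sup>2 * ln n * (32 * x0 * C * \<bar>t\<bar> * (lower_cut
            n / (eps n * ln n)))"
          using n l0 by (simp add: power2_eq_square)
        have e': "2 * (eps n * \<bar>t\<bar>)\<^sup>2 = (eps n)\<^sup>2 * ln n * (2 * t\<^sup>2 * (1 / ln n))"
          "16 * x0 * (eps n * \<bar>t\<bar>)\<^sup>2 / upper_cut n = (eps n)\<^sup>2 * ln n * (16 * x0 * t\<^sup>2 * (1 / (upper_cut n * ln
              n)))"
          using l0 by (simp_all add: power_mult_distrib)
        have e'': "8 * (x0 + 1)\<^sup>2 / x0 * C * (eps n * \<bar>t\<bar>)\<^sup>2 * (eps n * \<bar>t\<bar> / lower_cut n)\<^sup>2 * w =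
          (eps n)\<^sup>2 * ln n * (8 * (x0 + 1)\<^sup>2 / x0 * C * t\<^sup>2 * t\<^sup>2 * ((eps n / lower_cut n)\<^sup>2 * w / ln n))" for w
          using l0 by (simp add: power_mult_distrib power_divide)
        show ?thesis unfolding e e' e'' f_def by (simp only: distrib_left)
      qed
      finally show ?thesis .
    qed
    have "prob E \<le> (\<integral>y. (err n y)\<^sup>2 \<partial>mu n) / (n * (k * (eps n)\<^sup>2)\<^sup>2)" by (rule ch(2))
    also have "n * (k * (eps n)\<^sup>2)\<^sup>2 = (n * (eps n)\<^sup>2) * (eps n)\<^sup>2 * k\<^sup>2" by (simp add: power2_eq_square)
    also have "\<dots> = (eps n)\<^sup>2 * ln n * k\<^sup>2" using n_eps_sq[OF n(1)] by simp
    also have "(\<integral>y. (err n y)\<^sup>2 \<partial>mu n) / ((eps n)\<^sup>2 * ln n * k\<^sup>2) \<le>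
       ((eps n)\<^sup>2 * ln n * (p * k\<^sup>2)) / ((eps n)\<^sup>2 * ln n * k\<^sup>2)"
      using elim(1) n l0 k by (intro divide_right_mono order_trans[OF v] mult_left_mono) auto
    also have "\<dots> = p" using n l0 k by simp
    finally have "prob E \<le> p" .
    moreover have "\<bar>D n t \<omega> - t * Q n \<omega>\<bar> \<le> k" if "\<omega> \<in> space M - E" for \<omega>
      unfolding DQ using that n by (auto simp: E_def abs_divide pos_divide_le_eq)
    ultimately show ?case using ch(1) by (intro bexI[of _ E]) auto
  qed
qed

lemma D_diff_eq:
  assumes n: "n \<ge> 1" and s: "0 \<le> x0 + eps n * s" and t: "0 \<le> x0 + eps n * t"
  shows "D n t \<omega> - D n s \<omega> = emp n (\<lambda>y. ikern y (x0 + eps n * t) - ikern y (x0 + eps n * s)) \<omega> / (eps n)\<^sup>2"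
proof -
  have "emp n (\<lambda>y. incr n t y - incr n s y) \<omega> = emp n (incr n t) \<omega> - emp n (incr n s) \<omega>"
    by (rule emp_diff[OF n]; rule integrable_mu[OF n incr_measurable abs_incr_le]; fact)
  then show ?thesis unfolding D_def incr_def by (simp add: diff_divide_distrib)
qed

lemma D_0 [simp]: "D n 0 \<omega> = 0"
  by (simp add: D_def incr_def emp_def)

lemma abs_ikern_rescaled_diff_le:
  assumes n: "n \<ge> 1" and s: "0 \<le> x0 + eps n * s" and st: "s \<le> t" and t: "x0 + eps n * t \<le> 2 * x0"
  shows "\<bar>ikern y (x0 + eps n * t) - ikern y (x0 + eps n * s)\<bar> \<le>
      eps n * (t - s) + 2 * sqrt (2 * x0) * sqrt (eps n * (t - s))"
proof -
  have le: "x0 + eps n * s \<le> x0 + eps n * t" using st eps_nonneg by (simp add: mult_left_mono)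
  have "\<bar>ikern y (x0 + eps n * t) - ikern y (x0 + eps n * s)\<bar> \<le> (x0 + eps n * t - (x0 + eps n * s))
      + 2 * sqrt (2 * x0) * sqrt_gap (x0 + eps n * s) (x0 + eps n * t) y"
    by (rule abs_ikern_diff_le[OF s le t])
  also have "sqrt_gap (x0 + eps n * s) (x0 + eps n * t) y \<le> sqrt (x0 + eps n * t - (x0 + eps n * s))"
    by (rule sqrt_gap_le_sqrt[OF le])
  finally show ?thesis using x0 by (simp add: right_diff_distrib mult_left_mono)
qed

lemma D_continuous:
  assumes n: "n \<ge> 1" and S: "\<And>t. t \<in> S \<Longrightarrow> 0 \<le> x0 + eps n * t \<and> x0 + eps n * t \<le> 2 * x0"
  shows "continuous_on S (\<lambda>t. D n t \<omega>)"
  unfolding continuous_on_def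
proof
  fix t assume t: "t \<in> S"
  define w where "w s = 2 * (eps n * \<bar>s - t\<bar> + 2 * sqrt (2 * x0) * sqrt (eps n * \<bar>s - t\<bar>)) / (eps n)\<^sup>2" for s
  have bd: "\<bar>D n s \<omega> - D n t \<omega>\<bar> \<le> w s" if s: "s \<in> S" for s
  proof -
    have "\<bar>ikern y (x0 + eps n * s) - ikern y (x0 + eps n * t)\<bar> \<le>
        eps n * \<bar>s - t\<bar> + 2 * sqrt (2 * x0) * sqrt (eps n * \<bar>s - t\<bar>)" for y
    proof (cases "s \<le> t")
      case True
      then show ?thesis using abs_ikern_rescaled_diff_le[OF n, of s t y] S[OF s] S[OF t]
          by (simp add: abs_minus_commute)
    next
      case False
      then show ?thesis using abs_ikern_rescaled_diff_le[OF n, of t s y] S[OF s] S[OF t] by simp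
    qed
    then have "\<bar>emp n (\<lambda>y. ikern y (x0 + eps n * s) - ikern y (x0 + eps n * t)) \<omega>\<bar> \<le>
        2 * (eps n * \<bar>s - t\<bar> + 2 * sqrt (2 * x0) * sqrt (eps n * \<bar>s - t\<bar>))" by (rule abs_emp_le[OF n])
    then show ?thesis
      using D_diff_eq[OF n, of t s \<omega>] S[OF s] S[OF t] by (simp add: w_def abs_divide divide_right_mono)
  qed
  have "((\<lambda>s. w s) \<longlongrightarrow> 2 * (eps n * \<bar>t - t\<bar> + 2 * sqrt (2 * x0) * sqrt (eps n * \<bar>t - t\<bar>)) / (eps n)\<^sup>2) (at t
      within S)"
  proof (cases "eps n = 0")
    case False
    then show ?thesis unfolding w_def by (intro tendsto_intros) simp
  qed (simp add: w_def)
  then have "(w \<longlongrightarrow> 0) (at t within S)" by simp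
  then have "((\<lambda>s. D n s \<omega> - D n t \<omega>) \<longlongrightarrow> 0) (at t within S)"
    by (rule Lim_null_comparison[rotated]) (use bd in \<open>auto simp: eventually_at_topological\<close>)
  then show "((\<lambda>t. D n t \<omega>) \<longlongrightarrow> D n t \<omega>) (at t within S)" by (rule LIM_zero_cancel)
qed

end

section \<open>Uniform control of the local process\<close>

context centred_array begin

text \<open>
  Over \<open>\<bar>t\<bar> \<le> R\<close> the kernel increments have second moment of order
  \<open>R * eps n * (eps n * \<bar>t - s\<bar>) * ln n\<close>, and \<open>n * (eps n)\<^sup>2 = ln n\<close> turns the resulting variance
  of \<open>D\<close> into \<open>R * \<bar>t - s\<bar>\<close>. So \<open>D\<close> has increments of the size of those of Brownian motion, for
  which second moments do not suffice in chaining, but fourth moments do.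
\<close>

lemma D_increment_fourth_moment:
  "\<exists>C>0. \<exists>\<delta>>0. \<delta> \<le> x0 / 2 \<and> (\<forall>\<^sub>F n in sequentially. \<forall>R\<ge>1. R * eps n \<le> \<delta> \<longrightarrow> (\<forall>s t. \<bar>s\<bar> \<le> R \<longrightarrow> \<bar>t\<bar> \<le> R \<longrightarrow>
     integrable M (\<lambda>\<omega>. (D n t \<omega> - D n s \<omega>) ^ 4) \<and> expectation (\<lambda>\<omega>. (D n t \<omega> - D n s \<omega>) ^ 4) \<le>
         C * R\<^sup>2 * (t - s)\<^sup>2))"
proof -
  obtain C where C: "C \<ge> 1" "\<forall>\<^sub>F n in sequentially. local_mass (mu n) x0 C (eps n)"
      using eventually_local_mass by blast
  define \<delta> where "\<delta> = min (1/2) (x0 / 2)"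
  have d: "0 < \<delta>" "2 * \<delta> \<le> 1" "2 * \<delta> \<le> x0" using x0 by (auto simp: \<delta>_def)
  define K2 where "K2 = 1 + 2 * sqrt (2 * x0)"
  define K3 where "K3 = 800 * (1 + x0) * C"
  have K: "0 < K2" "0 < K3" using x0 C by (auto simp: K2_def K3_def intro: add_pos_nonneg)
  define C' where "C' = 4 * K2\<^sup>2 * K3 + 3 * K3\<^sup>2"
  have "\<forall>\<^sub>F n in sequentially. \<forall>R\<ge>1. R * eps n \<le> \<delta> \<longrightarrow> (\<forall>s t. \<bar>s\<bar> \<le> R \<longrightarrow> \<bar>t\<bar> \<le> R \<longrightarrow>
     integrable M (\<lambda>\<omega>. (D n t \<omega> - D n s \<omega>) ^ 4) \<and> expectation (\<lambda>\<omega>. (D n t \<omega> - D n s \<omega>) ^ 4) \<le>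
         C' * R\<^sup>2 * (t - s)\<^sup>2)"
    using C(2) eventually_ge3
  proof eventually_elim
    case (elim n)
    interpret L: local_mass "mu n" x0 C "eps n" by (rule elim(1))
    have n: "n \<ge> 1" "0 < eps n" "eps n < 1" using elim eps_pos[of n] eps_less_1[of n] by auto
    have l1: "1 \<le> ln (real n)" using ln_ge_1[OF elim(2)] .
    have main: "integrable M (\<lambda>\<omega>. (D n t \<omega> - D n s \<omega>) ^ 4) \<and> expectation (\<lambda>\<omega>. (D n t \<omega> - D n s \<omega>) ^ 4) \<le>
        C' * R\<^sup>2 * (t - s)\<^sup>2"
      if R: "1 \<le> R" "R * eps n \<le> \<delta>" and s: "\<bar>s\<bar> \<le> R" and t: "\<bar>t\<bar> \<le> R" and st: "s < t" for R s t
    proof -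
      define \<tau> where "\<tau> = t - s"
      define A where "A = R * eps n"
      have tau: "0 < \<tau>" using st by (simp add: \<tau>_def)
      have es: "\<bar>eps n * s\<bar> \<le> A" "\<bar>eps n * t\<bar> \<le> A"
        unfolding abs_mult A_def using s t n by (simp_all add: mult.commute mult_right_mono)
      have A: "eps n \<le> A" "2 * A \<le> 1" "2 * A \<le> x0" using R n d by (auto simp: A_def)
      have pos: "0 \<le> x0 + eps n * s" "0 \<le> x0 + eps n * t" "x0 + eps n * t \<le> 2 * x0" using es A
          by (auto simp: abs_le_iff)
      have lt: "x0 + eps n * s < x0 + eps n * t" using st n by simp
      define h where "h y = ikern y (x0 + eps n * t) - ikern y (x0 + eps n * s)" for y
      have hm: "h \<in> borel_measurable borel" unfolding h_def using pos
          by (intro borel_measurable_diff borel_measurable_ikern)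
      have et1: "eps n * \<tau> \<le> 1" using es A by (auto simp: \<tau>_def right_diff_distrib abs_le_iff)
      define b where "b = K2 * sqrt (eps n * \<tau>)"
      have hb: "\<bar>h y\<bar> \<le> b" for y
      proof -
        have "\<bar>h y\<bar> \<le> eps n * \<tau> + 2 * sqrt (2 * x0) * sqrt (eps n * \<tau>)"
          unfolding h_def \<tau>_def using abs_ikern_rescaled_diff_le[OF n(1) pos(1) less_imp_le[OF st] pos(3)] .
        moreover have "eps n * \<tau> \<le> sqrt (eps n * \<tau>)"
          using et1 n tau mult_left_le[of "sqrt (eps n * \<tau>)" "sqrt (eps n * \<tau>)"] by simp
        ultimately show ?thesis by (simp add: b_def K2_def algebra_simps)
      qed
      note mom = emp_moments[OF n(1) hm hb]
      define v where "v = (\<integral>y. (h y)\<^sup>2 \<partial>mu n)"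
      have v0: "0 \<le> v" by (simp add: v_def)
      have "v \<le> 400 * (1 + x0) * C * A * (x0 + eps n * t - (x0 + eps n * s)) * (1 + ln (1 / eps n))"
        unfolding v_def h_def by (rule L.ikern_increment_second_moment) (use es A lt in auto)
      also have "\<dots> \<le> 400 * (1 + x0) * C * A * (x0 + eps n * t - (x0 + eps n * s)) * (2 * ln n)"
        using ln_inverse_eps_le[OF elim(2)] C x0 lt A n by (intro mult_left_mono) auto
      also have "\<dots> = K3 * (R * \<tau>) * (eps n)\<^sup>2 * ln n"
          by (simp add: K3_def A_def \<tau>_def power2_eq_square algebra_simps)
      also have "\<dots> = K3 * (R * \<tau>) * n * (eps n) ^ 4" unfolding n_eps_sq[OF n(1), symmetric]
          by (simp add: power2_eq_square power4_eq_xxxx)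
      finally have v: "v \<le> K3 * (R * \<tau>) * n * (eps n) ^ 4" .
      have D4: "(D n t \<omega> - D n s \<omega>) ^ 4 = emp n h \<omega> ^ 4 / (eps n) ^ 8" for \<omega>
        unfolding D_diff_eq[OF n(1) pos(1,2)] h_def[symmetric] by (simp add: power_divide flip: power_mult)
      have e1: "1 \<le> (real n)\<^sup>2 * (eps n) ^ 3"
      proof -
        have "1 * 1 \<le> ln (real n) * ln n" using l1 by (intro mult_mono) auto
        then have "1 \<le> (real n)\<^sup>2 * (eps n) ^ 4" unfolding n_eps_sq[OF n(1), symmetric]
            by (simp add: power2_eq_square power4_eq_xxxx mult_ac)
        also have "\<dots> \<le> (real n)\<^sup>2 * (eps n) ^ 3" using n by (intro mult_left_mono power_decreasing) auto
        finally show ?thesis .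
      qed
      have "expectation (\<lambda>\<omega>. (D n t \<omega> - D n s \<omega>) ^ 4) = expectation (\<lambda>\<omega>. emp n h \<omega> ^ 4) / (eps n) ^ 8"
          unfolding D4 by simp
      also have "\<dots> \<le> (4 * b\<^sup>2 * v / n ^ 3 + 3 * v\<^sup>2 / n\<^sup>2) / (eps n) ^ 8"
        using mom(3) n by (intro divide_right_mono) (auto simp: v_def)
      also have "\<dots> \<le> (4 * b\<^sup>2 * (K3 * (R * \<tau>) * n * (eps n) ^ 4) / n ^ 3 +
          3 * (K3 * (R * \<tau>) * n * (eps n) ^ 4)\<^sup>2 / n\<^sup>2) / (eps n) ^ 8"
        using v v0 n by (intro divide_right_mono add_mono mult_left_mono power_mono) auto
      also have "\<dots> = 4 * K2\<^sup>2 * K3 * R * \<tau>\<^sup>2 * (1 / ((real n)\<^sup>2 * (eps n) ^ 3)) + 3 * K3\<^sup>2 * R\<^sup>2 * \<tau>\<^sup>2"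
      proof -
        have "b\<^sup>2 = K2\<^sup>2 * (eps n * \<tau>)" using n tau by (simp add: b_def power_mult_distrib)
        then show ?thesis using n by (simp add: field_simps power2_eq_square power3_eq_cube power4_eq_xxxx
            eval_nat_numeral)
      qed
      also have "\<dots> \<le> 4 * K2\<^sup>2 * K3 * R\<^sup>2 * \<tau>\<^sup>2 * 1 + 3 * K3\<^sup>2 * R\<^sup>2 * \<tau>\<^sup>2"
        using e1 n R K tau by (intro add_right_mono mult_mono mult_left_mono mult_right_mono) (auto simp:
            power2_eq_square divide_le_eq)
      also have "\<dots> = C' * R\<^sup>2 * (t - s)\<^sup>2" by (simp add: C'_def \<tau>_def algebra_simps)
      finally show ?thesis unfolding D4 using mom(1)[of 4] by simp
    qed
    show ?case
    proof (intro allI impI)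
      fix R s t :: real assume R: "1 \<le> R" "R * eps n \<le> \<delta>" and s: "\<bar>s\<bar> \<le> R" and t: "\<bar>t\<bar> \<le> R"
      have sym: "(D n t \<omega> - D n s \<omega>) ^ 4 = (D n s \<omega> - D n t \<omega>) ^ 4" for \<omega>
          by (simp add: power4_eq_xxxx algebra_simps)
      consider "s < t" | "s = t" | "t < s" by linarith
      then show "integrable M (\<lambda>\<omega>. (D n t \<omega> - D n s \<omega>) ^ 4) \<and> expectation (\<lambda>\<omega>. (D n t \<omega> - D n s \<omega>) ^ 4) \<le>
          C' * R\<^sup>2 * (t - s)\<^sup>2"
      proof cases
        case 1 then show ?thesis by (rule main[OF R s t])
      next
        case 3 then show ?thesis unfolding sym power2_commute[of t s] by (rule main[OF R t s])
      qed simp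
    qed
  qed
  moreover have "0 < C'" using K by (auto simp: C'_def intro!: add_pos_pos)
  ultimately show ?thesis using d by (intro exI[of _ C'] conjI exI[of _ \<delta>]) auto
qed

lemma D_maximal:
  "\<exists>C>0. \<exists>\<delta>>0. \<delta> \<le> x0 / 2 \<and> (\<forall>\<^sub>F n in sequentially. \<forall>R a L u. 1 \<le> R \<longrightarrow> R * eps n \<le> \<delta> \<longrightarrow> 0 < L \<longrightarrow> - R \<le> a \<longrightarrow>
      a + L \<le> R \<longrightarrow> 0 < u \<longrightarrow>
     (holds_up_to (C * R\<^sup>2 * L\<^sup>2 / u ^ 4) (\<lambda>\<omega>. \<forall>t\<in>{a..a+L}. \<bar>D n t \<omega> - D n a \<omega>\<bar> \<le> u)))"
proof -
  obtain C \<delta> where C: "C > 0" "\<delta> > 0" "\<delta> \<le> x0 / 2" and ev: "\<forall>\<^sub>F n in sequentially. \<forall>R\<ge>1. R * eps n \<le> \<delta> \<longrightarrow>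
      (\<forall>s t. \<bar>s\<bar> \<le> R \<longrightarrow> \<bar>t\<bar> \<le> R \<longrightarrow>
     integrable M (\<lambda>\<omega>. (D n t \<omega> - D n s \<omega>) ^ 4) \<and> expectation (\<lambda>\<omega>. (D n t \<omega> - D n s \<omega>) ^ 4) \<le>
         C * R\<^sup>2 * (t - s)\<^sup>2)"
    using D_increment_fourth_moment by blast
  have "\<forall>\<^sub>F n in sequentially. \<forall>R a L u. 1 \<le> R \<longrightarrow> R * eps n \<le> \<delta> \<longrightarrow> 0 < L \<longrightarrow> - R \<le> a \<longrightarrow> a + L \<le> R \<longrightarrow> 0 < u \<longrightarrow>
     (holds_up_to ((10 ^ 5 * C) * R\<^sup>2 * L\<^sup>2 / u ^ 4) (\<lambda>\<omega>. \<forall>t\<in>{a..a+L}. \<bar>D n t \<omega> - D n a \<omega>\<bar> \<le> u))"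
    using ev eventually_ge_at_top[of 1]
  proof eventually_elim
    case (elim n)
    show ?case
    proof (intro allI impI)
      fix R a L u :: real
      assume R: "1 \<le> R" "R * eps n \<le> \<delta>" and L: "0 < L" and a: "- R \<le> a" "a + L \<le> R" and u: "0 < u"
      have range: "\<bar>t\<bar> \<le> R" if "t \<in> {a..a+L}" for t using that a by auto
      have pos: "0 \<le> x0 + eps n * t \<and> x0 + eps n * t \<le> 2 * x0" if "t \<in> {a..a+L}" for t
      proof -
        have "\<bar>eps n * t\<bar> \<le> eps n * R" unfolding abs_mult using range[OF that] eps_nonneg[of n]
            by (simp add: mult_left_mono)
        then have "\<bar>eps n * t\<bar> \<le> x0 / 2" using R C by (simp add: mult.commute)
        then show ?thesis using x0 by (auto simp: abs_le_iff)
      qed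
      have "holds_up_to (10 ^ 5 * (C * R\<^sup>2) * L\<^sup>2 / u ^ 4) (\<lambda>\<omega>. \<forall>t\<in>{a..a+L}. \<bar>D n t \<omega> - D n a \<omega>\<bar> \<le> u)"
      proof (rule chaining_maximal_inequality[OF L _ u])
        show "D n t \<in> borel_measurable M" if "t \<in> {a..a+L}" for t
            using D_measurable[OF elim(2)] pos[OF that] by simp
        show "continuous_on {a..a+L} (\<lambda>t. D n t \<omega>)" for \<omega> by (rule D_continuous[OF elim(2) pos])
        fix s t assume st: "s \<in> {a..a+L}" "t \<in> {a..a+L}"
        show "integrable M (\<lambda>\<omega>. (D n t \<omega> - D n s \<omega>) ^ 4)" "expectation (\<lambda>\<omega>. (D n t \<omega> - D n s \<omega>) ^ 4) \<le>
            C * R\<^sup>2 * (t - s)\<^sup>2"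
          using elim(1) R range[OF st(1)] range[OF st(2)] by blast+
      qed (use C in auto)
      then show "holds_up_to ((10 ^ 5 * C) * R\<^sup>2 * L\<^sup>2 / u ^ 4) (\<lambda>\<omega>. \<forall>t\<in>{a..a+L}. \<bar>D n t \<omega> - D n a \<omega>\<bar> \<le> u)"
        by (simp add: mult_ac)
    qed
  qed
  then show ?thesis using C by (intro exI[of _ "10 ^ 5 * C"] conjI exI[of _ \<delta>]) auto
qed

text \<open>
  Pointwise closeness at \<open>m\<close> grid points, and the maximal inequality on the \<open>m\<close> intervals between
  them. The latter fails on each interval with probability of order \<open>1 / m\<^sup>2\<close>, so the union bound
  is of order \<open>1 / m\<close>. The number \<open>m\<close> is fixed before \<open>n\<close> tends to infinity.
\<close>

lemma D_close_to_linear: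
  assumes K: "1 \<le> K" and \<eta>: "0 < \<eta>" and p: "0 < p"
  shows "\<forall>\<^sub>F n in sequentially. holds_up_to p (\<lambda>\<omega>. \<forall>t. \<bar>t\<bar> \<le> K \<longrightarrow> \<bar>D n t \<omega> - t * Q n \<omega>\<bar> \<le> \<eta>)"
proof -
  obtain C \<delta> where C: "C > 0" "\<delta> > 0" and ev: "\<forall>\<^sub>F n in sequentially. \<forall>R a L u. 1 \<le> R \<longrightarrow> R * eps n \<le> \<delta> \<longrightarrow>
      0 < L \<longrightarrow> - R \<le> a \<longrightarrow> a + L \<le> R \<longrightarrow> 0 < u \<longrightarrow>
     (holds_up_to (C * R\<^sup>2 * L\<^sup>2 / u ^ 4) (\<lambda>\<omega>. \<forall>t\<in>{a..a+L}. \<bar>D n t \<omega> - D n a \<omega>\<bar> \<le> u))"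
    using D_maximal by blast
  obtain B where B: "B > 0" "\<forall>\<^sub>F n in sequentially. holds_up_to (p/3) (\<lambda>\<omega>. \<bar>Q n \<omega>\<bar> \<le> B)"
    using Q_tight[of "p/3"] p by auto
  define c where "c = C * K\<^sup>2 * (2 * K)\<^sup>2 / (\<eta> / 3) ^ 4"
  obtain m :: nat where m: "m > 0" "c / m \<le> p / 3" "2 * K / m * B \<le> \<eta> / 3"
  proof -
    obtain m :: nat where "real m > max (c / (p / 3)) (max (2 * K * B / (\<eta> / 3)) 1)"
        using reals_Archimedean2 by blast
    then have "0 < real m" "c < real m * (p / 3)" "2 * K * B < real m * (\<eta> / 3)" using p \<eta>
        by (auto simp: field_simps)
    then show ?thesis by (intro that[of m]) (auto simp: field_simps)
  qed
  define l where "l = 2 * K / m"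
  have l: "0 < l" "m * l = 2 * K" using K m by (auto simp: l_def)
  define tt where "tt j = - K + j * l" for j :: nat
  have "\<forall>\<^sub>F n in sequentially. \<forall>j\<in>{..<m}. holds_up_to (p / (3 * m)) (\<lambda>\<omega>. \<bar>D n (tt j) \<omega> - tt j * Q n \<omega>\<bar> \<le> \<eta> / 3)"
    using \<eta> p m by (intro eventually_ball_finite ballI D_minus_tQ_pointwise) auto
  then show ?thesis using ev B(2) eventually_eps_mult_less[OF C(2), of K]
  proof eventually_elim
    case (elim n)
    have r: "tt j \<ge> - K" "tt j + l \<le> K" if "j < m" for j
    proof -
      have "(real j + 1) * l \<le> real m * l" using that l by (intro mult_right_mono) auto
      then show "tt j \<ge> - K" "tt j + l \<le> K" using l by (auto simp: tt_def algebra_simps)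
    qed
    have ch: "holds_up_to (C * K\<^sup>2 * l\<^sup>2 / (\<eta> / 3) ^ 4) (\<lambda>\<omega>. \<forall>t\<in>{tt j..tt j +
        l}. \<bar>D n t \<omega> - D n (tt j) \<omega>\<bar> \<le> \<eta> / 3)"
      if "j < m" for j
      by (rule elim(2)[rule_format]) (use K elim(4) l r[OF that] \<eta> in \<open>auto simp: mult.commute\<close>)
    have "holds_up_to (\<Sum>j\<in>{..<m}. p / (3 * m) + C * K\<^sup>2 * l\<^sup>2 / (\<eta> / 3) ^ 4) (\<lambda>\<omega>. \<forall>j\<in>{..<m}.
        \<bar>D n (tt j) \<omega> - tt j * Q n \<omega>\<bar> \<le> \<eta> / 3 \<and> (\<forall>t\<in>{tt j..tt j + l}. \<bar>D n t \<omega> - D n (tt j) \<omega>\<bar> \<le> \<eta> / 3))"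
      by (intro holds_up_to_finite_ball holds_up_to_conj) (use elim(1) ch in auto)
    moreover have "(\<Sum>j\<in>{..<m}. p / (3 * m) + C * K\<^sup>2 * l\<^sup>2 / (\<eta> / 3) ^ 4) \<le> p / 3 + p / 3"
    proof -
      have "(\<Sum>j\<in>{..<m}. p / (3 * m) + C * K\<^sup>2 * l\<^sup>2 / (\<eta> / 3) ^ 4) =
          m * (p / (3 * m)) + m * (C * K\<^sup>2 * l\<^sup>2 / (\<eta> / 3) ^ 4)"
        by (simp add: distrib_left)
      also have "m * (p / (3 * m)) = p / 3" using m by simp
      also have "m * (C * K\<^sup>2 * l\<^sup>2 / (\<eta> / 3) ^ 4) = c / m" using m
          by (simp add: l_def c_def power_divide power2_eq_square)
      finally show ?thesis using m by simp
    qed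
    ultimately have "holds_up_to (p / 3 + p / 3) (\<lambda>\<omega>. \<forall>j\<in>{..<m}.
        \<bar>D n (tt j) \<omega> - tt j * Q n \<omega>\<bar> \<le> \<eta> / 3 \<and> (\<forall>t\<in>{tt j..tt j + l}. \<bar>D n t \<omega> - D n (tt j) \<omega>\<bar> \<le> \<eta> / 3))"
      by (meson order_trans)
    from holds_up_to_conj[OF this elim(3)] obtain E where E: "E \<in> events" "prob E \<le> p / 3 + p / 3 + p / 3"
      and Es: "\<And>\<omega> j. \<omega> \<in> space M - E \<Longrightarrow> j < m \<Longrightarrow> \<bar>D n (tt j) \<omega> - tt j * Q n \<omega>\<bar> \<le> \<eta> / 3"
        "\<And>\<omega> j t. \<omega> \<in> space M - E \<Longrightarrow> j < m \<Longrightarrow> t \<in> {tt j..tt j + l} \<Longrightarrow> \<bar>D n t \<omega> - D n (tt j) \<omega>\<bar> \<le> \<eta> / 3"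
        "\<And>\<omega>. \<omega> \<in> space M - E \<Longrightarrow> \<bar>Q n \<omega>\<bar> \<le> B" by blast
    have "\<bar>D n t \<omega> - t * Q n \<omega>\<bar> \<le> \<eta>" if w: "\<omega> \<in> space M - E" and t: "\<bar>t\<bar> \<le> K" for \<omega> t
    proof -
      define j where "j = min (nat \<lfloor>(t + K) / l\<rfloor>) (m - 1)"
      have t0: "0 \<le> (t + K) / l" using t l by auto
      have jm: "j < m" using m by (auto simp: j_def min_def)
      have "real j \<le> (t + K) / l" using t0 by (simp add: j_def min_def) linarith
      moreover have "(t + K) / l \<le> real j + 1"
      proof (cases "nat \<lfloor>(t + K) / l\<rfloor> \<le> m - 1")
        case True
        then show ?thesis using t0 by (simp add: j_def min_def)
      next
        case False
        then have "real j + 1 = m" using m by (simp add: j_def min_def of_nat_diff)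
        moreover have "(t + K) / l \<le> m" using t l by (simp add: pos_divide_le_eq)
        ultimately show ?thesis by simp
      qed
      ultimately have tj: "t \<in> {tt j..tt j + l}" using l by (simp add: tt_def field_simps)
      have "\<bar>(t - tt j) * Q n \<omega>\<bar> \<le> l * B" unfolding abs_mult using tj Es(3)[OF w] l by (intro mult_mono) auto
      also have "\<dots> \<le> \<eta> / 3" using m by (simp add: l_def)
      finally have "\<bar>t * Q n \<omega> - tt j * Q n \<omega>\<bar> \<le> \<eta> / 3" by (simp add: left_diff_distrib)
      then show ?thesis using Es(1)[OF w jm] Es(2)[OF w jm tj] by linarith
    qed
    with E show ?case by (intro bexI[of _ E]) auto
  qed
qed

text \<open>
  Dyadic blocks. For \<open>\<bar>t\<bar> \<le> 2 ^ Suc j * K\<close> the maximal inequality has \<open>(2 ^ j * K) ^ 4\<close> in the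
  numerator, and the allowed deviation \<open>c * (2 ^ j * K)\<^sup>2\<close> contributes its fourth power
  \<open>(2 ^ j * K) ^ 8\<close> to the denominator. So the failure probabilities are summable in \<open>j\<close>, and
  their sum is small for large \<open>K\<close>, uniformly in the number of blocks.
\<close>

lemma D_below_quadratic:
  "\<exists>\<delta>>0. \<delta> \<le> x0 / 2 \<and> (\<forall>c>0. \<forall>p>0. \<exists>K0\<ge>1. \<forall>K\<ge>K0. \<forall>\<^sub>F n in sequentially. holds_up_to p (\<lambda>\<omega>. \<forall>t. K \<le> \<bar>t\<bar> \<longrightarrow>
      \<bar>t\<bar> * eps n \<le> \<delta> \<longrightarrow> \<bar>D n t \<omega>\<bar> \<le> c * t\<^sup>2))"
proof -
  obtain C \<delta> where C: "C > 0" "\<delta> > 0" "\<delta> \<le> x0 / 2" and ev: "\<forall>\<^sub>F n in sequentially. \<forall>R a L u. 1 \<le> R \<longrightarrow>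
      R * eps n \<le> \<delta> \<longrightarrow> 0 < L \<longrightarrow> - R \<le> a \<longrightarrow> a + L \<le> R \<longrightarrow> 0 < u \<longrightarrow>
     (holds_up_to (C * R\<^sup>2 * L\<^sup>2 / u ^ 4) (\<lambda>\<omega>. \<forall>t\<in>{a..a+L}. \<bar>D n t \<omega> - D n a \<omega>\<bar> \<le> u))"
    using D_maximal by blast
  have main: "\<exists>K0\<ge>1. \<forall>K\<ge>K0. \<forall>\<^sub>F n in sequentially. holds_up_to p (\<lambda>\<omega>. \<forall>t. K \<le> \<bar>t\<bar> \<longrightarrow> \<bar>t\<bar> * eps n \<le> \<delta> / 2 \<longrightarrow>
      \<bar>D n t \<omega>\<bar> \<le> c * t\<^sup>2)" if c: "0 < c" and p: "0 < p" for c p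
  proof -
    define K0 where "K0 = max 1 (2048 * C / (c ^ 4 * p))"
    show ?thesis
    proof (intro exI[of _ K0] conjI allI impI)
      fix K assume K: "K0 \<le> K"
      have K1: "1 \<le> K" "2048 * C / (c ^ 4 * p) \<le> K" using K by (auto simp: K0_def)
      have Kp: "2048 * C / (c ^ 4 * K ^ 4) \<le> p"
      proof -
        have "2048 * C / (c ^ 4 * p) \<le> K ^ 4" using K1 power_increasing[of 1 4 K] by simp
        then show ?thesis using c p K1 by (simp add: field_simps)
      qed
      show "\<forall>\<^sub>F n in sequentially. holds_up_to p (\<lambda>\<omega>. \<forall>t. K \<le> \<bar>t\<bar> \<longrightarrow> \<bar>t\<bar> * eps n \<le> \<delta> / 2 \<longrightarrow> \<bar>D n t \<omega>\<bar> \<le> c * t\<^sup>2)"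
        using ev eventually_ge_at_top[of 2]
      proof eventually_elim
        case (elim n)
        have en: "0 < eps n" using eps_pos elim by simp
        obtain N :: nat where N: "\<delta> / (eps n * K) < 2 ^ N" using real_arch_pow[of 2 "\<delta> / (eps n * K)"] by auto
        define J where "J = {j \<in> {..<N}. 2 ^ Suc j * K * eps n \<le> \<delta>}"
        define r where "r j = 2 ^ Suc j * K" for j :: nat
        define u where "u j = c * (2 ^ j * K)\<^sup>2 / 2" for j :: nat
        have r1: "1 \<le> r j" for j
        proof -
          have "1 * 1 \<le> 2 ^ Suc j * K" using K1 by (intro mult_mono) (auto simp: one_le_power simp del:
              power_Suc)
          then show ?thesis by (simp add: r_def)
        qed
        have ch: "holds_up_to (1024 * C / (c ^ 4 * K ^ 4) * (1/16) ^ j) (\<lambda>\<omega>. \<forall>t\<in>{- r j..r j}. \<bar>D n t \<omega> - D n (-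
            r j) \<omega>\<bar> \<le> u j)"
          if j: "j \<in> J" for j
        proof -
          have "r j * eps n \<le> \<delta>" using j by (simp add: J_def r_def)
          moreover have "0 < u j" using c K1 by (simp add: u_def)
          ultimately have "holds_up_to (C * (r j)\<^sup>2 * (2 * r j)\<^sup>2 / u j ^ 4) (\<lambda>\<omega>. \<forall>t\<in>{- r j..- r j +
              2 * r j}. \<bar>D n t \<omega> - D n (- r j) \<omega>\<bar> \<le> u j)"
            by (intro elim(1)[rule_format]) (use r1[of j] in auto)
          moreover have "C * (r j)\<^sup>2 * (2 * r j)\<^sup>2 / u j ^ 4 = 1024 * C / (c ^ 4 * K ^ 4) * (1/16) ^ j"
          proof -
            have "(16::real) ^ j = (2 ^ 4) ^ j" by simp
            also have "\<dots> = (2 ^ j) ^ 4" by (simp only: power_mult[symmetric] mult.commute[of 4 j])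
            finally have "(16::real) ^ j = (2 ^ j) ^ 4" .
            moreover have "(2::real) ^ j > 0" by simp
            ultimately show ?thesis using c K1
              by (simp add: r_def u_def power_divide power_mult_distrib field_simps eval_nat_numeral)
          qed
          ultimately show ?thesis by simp
        qed
        have "holds_up_to (\<Sum>j\<in>J. 1024 * C / (c ^ 4 * K ^ 4) * (1/16) ^ j) (\<lambda>\<omega>. \<forall>j\<in>J. \<forall>t\<in>{- r j..r j}. \<bar>D n t \<omega>
            - D n (- r j) \<omega>\<bar> \<le> u j)"
          by (rule holds_up_to_finite_ball) (use ch in \<open>auto simp: J_def\<close>)
        then obtain E where E: "E \<in> events" "prob E \<le> (\<Sum>j\<in>J. 1024 * C / (c ^ 4 * K ^ 4) * (1/16) ^ j)"
          and Es: "\<And>\<omega> j t. \<omega> \<in> space M - E \<Longrightarrow> j \<in> J \<Longrightarrow> t \<in> {- r j..r j} \<Longrightarrow> \<bar>D n t \<omega> - D n (- r j) \<omega>\<bar> \<le> u j"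
              by blast
        have "prob E \<le> p"
        proof -
          have "(\<Sum>j\<in>J. (1/16::real) ^ j) \<le> (\<Sum>j<N. (1/16) ^ j)" by (rule sum_mono2) (auto simp: J_def)
          also have "\<dots> \<le> 2"
          proof -
            have "(\<Sum>j<N. (1/16::real) ^ j) \<le> (\<Sum>j. (1/16) ^ j)"
                by (rule sum_le_suminf) (auto intro: summable_geometric)
            also have "\<dots> = 1 / (1 - 1/16)" by (rule suminf_geometric) simp
            finally show ?thesis by simp
          qed
          finally have "1024 * C / (c ^ 4 * K ^ 4) * (\<Sum>j\<in>J. (1/16::real) ^ j) \<le> 1024 * C / (c ^ 4 * K ^ 4) * 2"
            using C c K1 by (intro mult_left_mono) auto
          then show ?thesis using E(2) Kp by (simp add: sum_distrib_left)
        qed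
        moreover have "\<bar>D n t \<omega>\<bar> \<le> c * t\<^sup>2" if w: "\<omega> \<in> space M - E" and t: "K \<le> \<bar>t\<bar>" "\<bar>t\<bar> * eps n \<le>
            \<delta> / 2" for \<omega> t
        proof -
          have tN: "\<bar>t\<bar> < 2 ^ N * K"
          proof -
            have "\<bar>t\<bar> * eps n < \<delta>" using t C by linarith
            then have "\<bar>t\<bar> < \<delta> / eps n" using en by (simp add: pos_less_divide_eq)
            also have "\<dots> \<le> 2 ^ N * K" using N en K1 by (simp add: field_simps)
            finally show ?thesis .
          qed
          define i where "i = (LEAST i. \<bar>t\<bar> < 2 ^ i * K)"
          have i1: "\<bar>t\<bar> < 2 ^ i * K" unfolding i_def by (rule LeastI[of _ N]) (rule tN)
          have iN: "i \<le> N" unfolding i_def by (rule Least_le) (rule tN)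
          have "i \<noteq> 0" using i1 t by (cases i) auto
          then obtain j where j: "i = Suc j" by (cases i) auto
          have i2: "2 ^ j * K \<le> \<bar>t\<bar>" using not_less_Least[of j "\<lambda>i. \<bar>t\<bar> < 2 ^ i * K"] j
              by (auto simp: i_def not_less)
          have "2 ^ Suc j * K * eps n = 2 * ((2 ^ j * K) * eps n)" by simp
          also have "\<dots> \<le> 2 * (\<bar>t\<bar> * eps n)" using i2 en by (intro mult_left_mono mult_right_mono) auto
          also have "\<dots> \<le> \<delta>" using t by simp
          finally have jJ: "j \<in> J" using iN j by (simp add: J_def)
          have "\<bar>t\<bar> \<le> r j" using i1 j by (simp add: r_def)
          then have "t \<in> {- r j..r j}" "0 \<in> {- r j..r j}" using r1[of j] by auto
          from Es[OF w jJ this(1)] Es[OF w jJ this(2)] have "\<bar>D n t \<omega>\<bar> \<le> 2 * u j" by simp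
          also have "\<dots> = c * (2 ^ j * K)\<^sup>2" by (simp add: u_def)
          also have "\<dots> \<le> c * \<bar>t\<bar>\<^sup>2" using i2 c K1 by (intro mult_left_mono power_mono) auto
          finally show ?thesis by simp
        qed
        ultimately show ?case using E by (intro bexI[of _ E]) auto
      qed
    qed (simp add: K0_def)
  qed
  show ?thesis using C main by (intro exI[of _ "\<delta> / 2"] conjI) auto
qed

end

section \<open>Growth away from the point\<close>

lemma convex_on_ray:
  assumes f: "convex_on UNIV f" and d: "0 < \<delta>" "\<delta> \<le> \<bar>x - x0\<bar>"
    and r: "f x0 + \<delta> * c + \<gamma> * \<delta> \<le> f (x0 + \<delta>)" and l: "f x0 - \<delta> * c + \<gamma> * \<delta> \<le> f (x0 - \<delta>)"
  shows "f x0 + c * (x - x0) + \<gamma> * \<bar>x - x0\<bar> \<le> f (x::real)"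
proof -
  define s where "s = \<delta> / \<bar>x - x0\<bar>"
  have s: "0 < s" "s \<le> 1" "s * \<bar>x - x0\<bar> = \<delta>" using d by (auto simp: s_def)
  have "f ((1 - s) *\<^sub>R x0 + s *\<^sub>R x) \<le> (1 - s) * f x0 + s * f x"
    using convex_onD[OF f, of s x0 x] s by simp
  moreover have "(1 - s) *\<^sub>R x0 + s *\<^sub>R x = x0 + s * (x - x0)" by (simp add: algebra_simps)
  moreover have "f x0 + s * (x - x0) * c + \<gamma> * \<delta> \<le> f (x0 + s * (x - x0))"
  proof (cases "x0 \<le> x")
    case True then show ?thesis using r s by simp
  next
    case False
    then have "s * (x - x0) = - \<delta>" using s(3) by (simp add: abs_if algebra_simps)
    then show ?thesis using l by simp
  qed
  ultimately have "s * (c * (x - x0) + \<gamma> * \<bar>x - x0\<bar>) \<le> s * (f x - f x0)" using s(3)[symmetric]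
      by (simp add: algebra_simps)
  then show ?thesis using s by simp
qed

context centred_array begin

abbreviation "He n \<omega> \<equiv> H_emp n (obs n \<omega>)"

lemma He_sum: "n \<ge> 1 \<Longrightarrow> 0 \<le> x \<Longrightarrow> He n \<omega> x = (\<Sum>i\<in>{1..n}. ikern (obs n \<omega> i) x) / n"
  by (rule H_emp_eq)

lemma He_eq: "n \<ge> 1 \<Longrightarrow> 0 \<le> x \<Longrightarrow> He n \<omega> x = H n x + emp n (\<lambda>y. ikern y x) \<omega>"
  by (simp add: He_sum emp_def H_of_eq[OF Gn] mu_def)

lemma sum_div_mono: "(\<And>i. i \<in> {1..n} \<Longrightarrow> f i \<le> g i) \<Longrightarrow> (\<Sum>i\<in>{1..n}. f i) / n \<le> (\<Sum>i\<in>{1..n}. g i) / (real n)"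
  by (intro divide_right_mono sum_mono) auto

lemma He_le:
  assumes "n \<ge> 1" "0 \<le> x" shows "He n \<omega> x \<le> x"
proof -
  have "He n \<omega> x \<le> (\<Sum>i\<in>{1..n}. x) / n" unfolding He_sum[OF assms] using ikern_le[OF assms(2)]
      by (intro sum_div_mono)
  then show ?thesis using assms by simp
qed

lemma He_lower:
  assumes "n \<ge> 1" "0 \<le> x" shows "- 3 * x \<le> He n \<omega> x"
proof -
  have "(\<Sum>i\<in>{1..n}. - 3 * x) / n \<le> He n \<omega> x" unfolding He_sum[OF assms]
  proof (rule sum_div_mono)
    fix i show "- 3 * x \<le> ikern (obs n \<omega> i) x" using abs_ikern_le[OF assms(2), of "obs n \<omega> i"] by linarith
  qed
  then show ?thesis using assms by simp
qed

lemma He_minus_id_antimono: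
  assumes "n \<ge> 1" "0 \<le> x" "x \<le> x'" shows "He n \<omega> x' - (x' - x) \<le> He n \<omega> x"
proof -
  have "He n \<omega> x' \<le> (\<Sum>i\<in>{1..n}. ikern (obs n \<omega> i) x + (x' - x)) / n"
    unfolding He_sum[OF assms(1) order_trans[OF assms(2,3)]]
  proof (rule sum_div_mono)
    fix i show "ikern (obs n \<omega> i) x' \<le> ikern (obs n \<omega> i) x + (x' - x)"
      using ikern_minus_id_antimono[OF assms(2,3), of "obs n \<omega> i"] by linarith
  qed
  also have "\<dots> = He n \<omega> x + (x' - x)" using assms by (simp add: He_sum sum.distrib add_divide_distrib)
  finally show ?thesis by simp
qed

text \<open>
  Observations up to \<open>B\<close> contribute at least \<open>x - 3/2 * B\<close> to the average, the others at least
  \<open>- 3 * x\<close>. So the primitive grows almost with slope 1 when few observations exceed \<open>B\<close>.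
\<close>

lemma He_far_lower:
  assumes n: "n \<ge> 1" and B: "0 \<le> B" "B \<le> x"
  shows "x - 3/2 * B - 4 * x * ((\<Sum>i\<in>{1..n}. indicator {B<..} (obs n \<omega> i)) / n) \<le> He n \<omega> x"
proof -
  have "(\<Sum>i\<in>{1..n}. (x - 3/2 * B) - 4 * x * indicator {B<..} (obs n \<omega> i)) / n \<le> He n \<omega> x"
    unfolding He_sum[OF n order_trans[OF B]]
  proof (rule sum_div_mono)
    fix i
    show "(x - 3/2 * B) - 4 * x * indicator {B<..} (obs n \<omega> i) \<le> ikern (obs n \<omega> i) x"
      using ikern_ge[of "obs n \<omega> i" B x] abs_ikern_le[of x "obs n \<omega> i"] B
          by (cases "obs n \<omega> i \<le> B") (auto simp: abs_le_iff)
  qed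
  then show ?thesis using n by (simp add: sum_subtractf sum_distrib_left[symmetric] diff_divide_distrib)
qed

text \<open>
  Hypothesis \<open>c'\<close> for the limit \<open>Hinf\<close> at the two points \<open>x0 + \<delta>\<close> and \<open>x0 - \<delta>\<close>. The quadratic
  drift \<open>fx / 2 * \<delta>\<^sup>2\<close> leaves room for the errors.
\<close>

lemma Hinf_slope:
  "\<exists>\<delta>0>0. \<forall>\<delta>. 0 < \<delta> \<longrightarrow> \<delta> < \<delta>0 \<longrightarrow> (\<forall>\<^sub>F n in sequentially.
     sp.Hinf x0 + \<delta> * cen n + (fx / 4 * \<delta>) * \<delta> \<le> sp.Hinf (x0 + \<delta>) \<and>
         sp.Hinf x0 - \<delta> * cen n + (fx / 4 * \<delta>) * \<delta> \<le> sp.Hinf (x0 - \<delta>))"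
proof -
  obtain \<delta>q C where d: "\<delta>q > 0" "C \<ge> 0" and ev: "\<forall>\<^sub>F n in sequentially. \<forall>\<beta>. \<bar>\<beta>\<bar> < \<delta>q \<longrightarrow>
    \<bar>H n (x0 + \<beta>) - H n x0 - \<beta> * cen n - 1/2 * \<beta>\<^sup>2 * fx\<bar> \<le> fx / 8 * \<beta>\<^sup>2 + C * (eps n)\<^sup>2"
    using quadratic_bound[of "fx / 8"] f_pos by auto
  show ?thesis
  proof (intro exI[of _ "min \<delta>q x0"] conjI allI impI)
    fix \<delta> assume dd: "0 < \<delta>" "\<delta> < min \<delta>q x0"
    define k where "k = fx * \<delta>\<^sup>2 / 32"
    have k: "0 < k" using f_pos dd by (simp add: k_def)
    have h: "\<forall>\<^sub>F n in sequentially. \<bar>H n x - sp.Hinf x\<bar> < k" if "0 \<le> x" for x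
      using tendstoD[OF H_tendsto[OF that] k] by (simp add: dist_real_def)
    have "(\<lambda>n. C * (eps n)\<^sup>2) \<longlonglongrightarrow> C * 0\<^sup>2" by (intro tendsto_intros eps_tendsto_0)
    then have "\<forall>\<^sub>F n in sequentially. C * (eps n)\<^sup>2 < k" using k by (intro order_tendstoD(2)) auto
    moreover have "\<forall>\<^sub>F n in sequentially. \<bar>H n x0 - sp.Hinf x0\<bar> < k" "\<forall>\<^sub>F n in sequentially. \<bar>H n (x0 +
        \<delta>) - sp.Hinf (x0 + \<delta>)\<bar> < k"
        "\<forall>\<^sub>F n in sequentially. \<bar>H n (x0 - \<delta>) - sp.Hinf (x0 - \<delta>)\<bar> < k" using x0 dd by (auto intro!: h)
    ultimately show "\<forall>\<^sub>F n in sequentially. sp.Hinf x0 + \<delta> * cen n + (fx / 4 * \<delta>) * \<delta> \<le> sp.Hinf (x0 + \<delta>)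
        \<and> sp.Hinf x0 - \<delta> * cen n + (fx / 4 * \<delta>) * \<delta> \<le> sp.Hinf (x0 - \<delta>)"
      using ev
    proof eventually_elim
      case (elim n)
      define w where "w = fx * \<delta>\<^sup>2"
      have w: "1/2 * \<delta>\<^sup>2 * fx = w / 2" "fx / 8 * \<delta>\<^sup>2 = w / 8" "(fx / 4 * \<delta>) * \<delta> = w / 4" "k = w / 32"
        by (simp_all add: w_def k_def power2_eq_square)
      have "\<bar>H n (x0 + \<delta>) - H n x0 - \<delta> * cen n - w / 2\<bar> \<le> w / 8 + C * (eps n)\<^sup>2"
        using elim(5)[rule_format, of \<delta>] dd unfolding w by simp
      moreover have "\<bar>H n (x0 - \<delta>) - H n x0 + \<delta> * cen n - w / 2\<bar> \<le> w / 8 + C * (eps n)\<^sup>2"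
        using elim(5)[rule_format, of "- \<delta>"] dd unfolding power2_minus w by simp
      ultimately show ?case using elim(1-4) unfolding w by linarith
    qed
  qed (use d x0 in auto)
qed

text \<open>
  \<open>Hinf\<close> is convex, so what \<open>Hinf_slope\<close> says at distance \<open>\<delta>\<close> propagates linearly to all larger
  distances. Up to the bound \<open>B1\<close>, \<open>He\<close> is compared with \<open>Hinf\<close> on a finite grid by the law of
  large numbers, and between grid points by \<open>He_minus_id_antimono\<close>. Beyond \<open>B1\<close> the slope of \<open>He\<close>
  is close to 1 by \<open>He_far_lower\<close>, whereas \<open>cen n\<close> is bounded away from 1 because \<open>Hinf\<close> has slope
  at most 1.
\<close>

lemma He_linear_growth:
  "\<exists>\<delta>0>0. \<forall>\<delta>. 0 < \<delta> \<longrightarrow> \<delta> < \<delta>0 \<longrightarrow> (\<forall>p>0. \<forall>\<^sub>F n in sequentially. holds_up_to p (\<lambda>\<omega>. \<forall>x\<ge>0. \<delta> \<le> \<bar>x - x0\<bar> \<longrightarrow>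
      He n \<omega> x0 + cen n * (x - x0) + fx / 8 * \<delta> * \<bar>x - x0\<bar> \<le> He n \<omega> x))"
proof -
  obtain \<delta>0 where d0: "\<delta>0 > 0" and slope: "\<And>\<delta>. 0 < \<delta> \<Longrightarrow> \<delta> < \<delta>0 \<Longrightarrow> (\<forall>\<^sub>F n in sequentially.
     sp.Hinf x0 + \<delta> * cen n + (fx / 4 * \<delta>) * \<delta> \<le> sp.Hinf (x0 + \<delta>) \<and>
         sp.Hinf x0 - \<delta> * cen n + (fx / 4 * \<delta>) * \<delta> \<le> sp.Hinf (x0 - \<delta>))"
    using Hinf_slope by blast
  show ?thesis
  proof (intro exI[of _ \<delta>0] conjI allI impI)
    fix \<delta> p :: real assume d: "0 < \<delta>" "\<delta> < \<delta>0" and p: "0 < p"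
    define \<gamma> where "\<gamma> = fx / 4 * \<delta>"
    have g: "0 < \<gamma>" using f_pos d by (simp add: \<gamma>_def)
    (* Mesh of the grid and accuracy at its points: three errors of this size are less than half of
       the growth \<gamma> * \<delta>. *)
    define \<theta> where "\<theta> = \<gamma> * \<delta> / 8"
    have th: "0 < \<theta>" using g d by (simp add: \<theta>_def)
    have "(sp.GY \<longlongrightarrow> 1) at_top" unfolding sp.GY_def by (rule sp.Y.cdf_lim_at_top_prob)
    then have "\<forall>\<^sub>F b in at_top. 1 - \<gamma> / 64 < sp.GY b" by (rule order_tendstoD(1)) (use g in simp)
    then obtain B where B: "0 \<le> B" "1 - \<gamma> / 64 < sp.GY B"
      using eventually_conj[OF _ eventually_ge_at_top[of "0::real"]] eventually_happens'
          trivial_limit_at_top_linorder by (metis (mono_tags, lifting))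
    (* Beyond B1 the loss 3/2 * B in He_far_lower is a fraction of \<gamma> * (x - x0). *)
    define B1 where "B1 = max B (6 * B / \<gamma> + 2 * x0)"
    obtain N :: nat where N: "B1 < N * \<theta>" using reals_Archimedean3[OF th] by auto
    define X where "X = insert x0 ((\<lambda>k. real k * \<theta>) ` {..N})"
    have X: "finite X" "\<And>x. x \<in> X \<Longrightarrow> 0 \<le> x" using x0 th by (auto simp: X_def)
    define q where "q = p / (2 * (real (card X) + 1))"
    have q: "0 < q" "card X * q \<le> p / 2" using p by (auto simp: q_def field_simps)
    have "\<forall>\<^sub>F n in sequentially. \<forall>x\<in>X. \<bar>H n x - sp.Hinf x\<bar> < \<theta> / 2"
      using X tendstoD[OF H_tendsto, of _ "\<theta> / 2"] th
          by (intro eventually_ball_finite) (auto simp: dist_real_def)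
    moreover have "\<forall>\<^sub>F n in sequentially. \<forall>x\<in>X. (3 * x)\<^sup>2 / (n * (\<theta> / 2)\<^sup>2) < q"
    proof (intro eventually_ball_finite X ballI)
      fix x
      have "(\<lambda>n. (3 * x)\<^sup>2 / (\<theta> / 2)\<^sup>2 * (1 / real n)) \<longlonglongrightarrow> (3 * x)\<^sup>2 / (\<theta> / 2)\<^sup>2 * 0"
          by (intro tendsto_intros lim_1_over_n)
      then show "\<forall>\<^sub>F n in sequentially. (3 * x)\<^sup>2 / (n * (\<theta> / 2)\<^sup>2) < q" using q
          by (intro order_tendstoD(2)[of _ 0]) (auto simp: mult.commute)
    qed
    moreover have "\<forall>\<^sub>F n in sequentially. 1 - \<gamma> / 32 < Gn n B"
        using order_tendstoD(1)[OF cdf_tendsto, of "1 - \<gamma> / 32" B] B g by simp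
    moreover have "\<forall>\<^sub>F n in sequentially. 1 / (n * (\<gamma> / 32)\<^sup>2) < p / 2"
    proof -
      have "(\<lambda>n. 1 / (\<gamma> / 32)\<^sup>2 * (1 / real n)) \<longlonglongrightarrow> 1 / (\<gamma> / 32)\<^sup>2 * 0" by (intro tendsto_intros lim_1_over_n)
      then show ?thesis using p by (intro order_tendstoD(2)[of _ 0]) (auto simp: mult.commute)
    qed
    ultimately show "\<forall>\<^sub>F n in sequentially. holds_up_to p (\<lambda>\<omega>. \<forall>x\<ge>0. \<delta> \<le> \<bar>x - x0\<bar> \<longrightarrow>
        He n \<omega> x0 + cen n * (x - x0) + fx / 8 * \<delta> * \<bar>x - x0\<bar> \<le> He n \<omega> x)"
      using slope[OF d] eventually_ge_at_top[of 1]
    proof eventually_elim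
      case (elim n)
      note n = elim(6)
      interpret Dn: real_distribution "mu n" by (rule real_distribution_mu[OF n])
      have grid: "holds_up_to q (\<lambda>\<omega>. \<bar>He n \<omega> x - sp.Hinf x\<bar> \<le> \<theta>)" if x: "x \<in> X" for x
      proof -
        note m = borel_measurable_ikern[OF X(2)[OF x]]
        have "0 < \<theta> / 2" using th by simp
        note ch = emp_chebyshev[OF n m abs_ikern_le[OF X(2)[OF x]] this]
        have "(\<integral>y. (ikern y x)\<^sup>2 \<partial>mu n) \<le> (\<integral>y. (3 * x)\<^sup>2 \<partial>mu n)"
        proof (rule integral_mono)
          show le: "(ikern y x)\<^sup>2 \<le> (3 * x)\<^sup>2" for y
            using abs_ikern_le[OF X(2)[OF x], of y] by (metis abs_ge_zero power2_abs power_mono)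
          show "integrable (mu n) (\<lambda>y. (ikern y x)\<^sup>2)"
            by (rule integrable_mu[OF n, of _ "(3 * x)\<^sup>2"]) (use m le in auto)
        qed simp
        also have "\<dots> = (3 * x)\<^sup>2" using Dn.prob_space by simp
        finally have "(\<integral>y. (ikern y x)\<^sup>2 \<partial>mu n) / (n * (\<theta> / 2)\<^sup>2) \<le> (3 * x)\<^sup>2 / (n * (\<theta> / 2)\<^sup>2)"
            by (intro divide_right_mono) auto
        then have "prob {\<omega> \<in> space M. \<theta> / 2 \<le> \<bar>emp n (\<lambda>y. ikern y x) \<omega>\<bar>} \<le> q" using ch(2) elim(2) x
            by (meson less_imp_le order_trans)
        moreover have "\<bar>He n \<omega> x - sp.Hinf x\<bar> \<le> \<theta>" if "\<bar>emp n (\<lambda>y. ikern y x) \<omega>\<bar> < \<theta> / 2" for \<omega>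
          using that elim(1)[rule_format, OF x] He_eq[OF n X(2)[OF x], of \<omega>] by linarith
        ultimately show ?thesis using ch(1) by (intro bexI[of _ "{\<omega> \<in> space M. \<theta> / 2 \<le>
            \<bar>emp n (\<lambda>y. ikern y x) \<omega>\<bar>}"]) (auto simp: not_le)
      qed
      have tail: "holds_up_to (p / 2) (\<lambda>\<omega>. (\<Sum>i\<in>{1..n}. indicator {B<..} (obs n \<omega> i)) / n \<le> \<gamma> / 16)"
      proof -
        have "0 < \<gamma> / 32" using g by simp
        note ch = emp_chebyshev[OF n borel_measurable_indicator[of "{B<..}"] _ this, of 1]
        have "(\<integral>y. (indicat_real {B<..} y)\<^sup>2 \<partial>mu n) \<le> 1"
        proof -
          have "(indicat_real {B<..} y)\<^sup>2 = indicat_real {B<..} y" for y by (simp add: indicator_def)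
          then show ?thesis by simp
        qed
        then have "(\<integral>y. (indicat_real {B<..} y)\<^sup>2 \<partial>mu n) / (n * (\<gamma> / 32)\<^sup>2) \<le> 1 / (n * (\<gamma> / 32)\<^sup>2)"
            by (intro divide_right_mono) auto
        then have pr: "prob {\<omega> \<in> space M. \<gamma> / 32 \<le> \<bar>emp n (indicat_real {B<..}) \<omega>\<bar>} \<le> p / 2"
            using ch(2) elim(4) by (auto simp: indicator_def)
        have cm: "measure (mu n) {B<..} \<le> \<gamma> / 32"
        proof -
          have "measure (mu n) {..B} = Gn n B" using cdf_interval_measure_df[OF Gn[OF n]]
              by (simp add: cdf_def mu_def fun_eq_iff)
          moreover have "measure (mu n) {B<..} = 1 - measure (mu n) {..B}"
            using Dn.prob_compl[of "{..B}"] by (simp add: Compl_eq_Diff_UNIV[symmetric])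
          ultimately show ?thesis using elim(3) by simp
        qed
        have em: "emp n (indicat_real {B<..}) \<omega> = (\<Sum>i\<in>{1..n}. indicator {B<..} (obs n \<omega> i)) / n - measure (mu
            n) {B<..}" for \<omega>
          by (simp add: emp_def)
        have "(\<Sum>i\<in>{1..n}. indicator {B<..} (obs n \<omega> i)) / n \<le> \<gamma> / 16" if "\<bar>emp n (indicat_real {B<..}) \<omega>\<bar> < \<gamma> /
            32" for \<omega>
          using that cm unfolding em by linarith
        then show ?thesis using pr ch(1)
          by (intro bexI[of _ "{\<omega> \<in> space M. \<gamma> / 32 \<le> \<bar>emp n (indicat_real {B<..}) \<omega>\<bar>}"]) (auto simp: not_le
              indicator_def)
      qed
      have "holds_up_to ((\<Sum>x\<in>X. q) + p / 2) (\<lambda>\<omega>. (\<forall>x\<in>X. \<bar>He n \<omega> x - sp.Hinf x\<bar> \<le> \<theta>) \<and>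
          (\<Sum>i\<in>{1..n}. indicator {B<..} (obs n \<omega> i)) / n \<le> \<gamma> / 16)"
        by (intro holds_up_to_conj holds_up_to_finite_ball X tail grid)
      then obtain E where E: "E \<in> events" "prob E \<le> (\<Sum>x\<in>X. q) + p / 2"
        and Es: "\<And>\<omega> x. \<omega> \<in> space M - E \<Longrightarrow> x \<in> X \<Longrightarrow> \<bar>He n \<omega> x - sp.Hinf x\<bar> \<le> \<theta>"
          "\<And>\<omega>. \<omega> \<in> space M - E \<Longrightarrow> (\<Sum>i\<in>{1..n}. indicator {B<..} (obs n \<omega> i)) / n \<le> \<gamma> / 16" by blast
      have Ep: "prob E \<le> p" using E(2) q by simp
      have conv: "sp.Hinf x0 + cen n * (x - x0) + \<gamma> * \<bar>x - x0\<bar> \<le> sp.Hinf x" if "\<delta> \<le> \<bar>x - x0\<bar>" for x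
        by (rule convex_on_ray[OF sp.Hinf_convex d(1) that]) (use elim(5) in \<open>auto simp: \<gamma>_def\<close>)
      have cen1: "cen n + \<gamma> \<le> 1"
      proof -
        have "\<delta> * (cen n + \<gamma>) \<le> \<delta> * 1" using elim(5) sp.Hinf_lipschitz[of x0 "x0 + \<delta>"] d
            by (simp add: \<gamma>_def algebra_simps)
        then show ?thesis using d by simp
      qed
      have "He n \<omega> x0 + cen n * (x - x0) + \<gamma> / 2 * \<bar>x - x0\<bar> \<le> He n \<omega> x"
        if w: "\<omega> \<in> space M - E" and x: "0 \<le> x" "\<delta> \<le> \<bar>x - x0\<bar>" for \<omega> x
      proof (cases "x \<le> B1")
        case True
        define k where "k = nat \<lceil>x / \<theta>\<rceil>"
        have k1: "x \<le> k * \<theta>" "k * \<theta> \<le> x + \<theta>"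
        proof -
          have "x / \<theta> \<le> k" "real k \<le> x / \<theta> + 1" using x th by (auto simp: k_def)
          then show "x \<le> k * \<theta>" "k * \<theta> \<le> x + \<theta>" using th by (auto simp: field_simps)
        qed
        have "x / \<theta> \<le> N" using True N th by (simp add: pos_divide_le_eq)
        then have "k \<le> N" by (simp add: k_def ceiling_le_iff nat_le_iff)
        then have kX: "k * \<theta> \<in> X" "x0 \<in> X" by (auto simp: X_def)
        have "sp.Hinf x - 2 * \<theta> \<le> He n \<omega> x"
          using He_minus_id_antimono[OF n x(1) k1(1), of \<omega>] Es(1)[OF w kX(1)] k1 sp.Hinf_mono[OF k1(1)]
              by linarith
        moreover have "He n \<omega> x0 \<le> sp.Hinf x0 + \<theta>" using Es(1)[OF w kX(2)] by linarith
        moreover have "3 * \<theta> \<le> \<gamma> / 2 * \<bar>x - x0\<bar>"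
        proof -
          have "\<gamma> / 2 * \<delta> \<le> \<gamma> / 2 * \<bar>x - x0\<bar>" using g x by (intro mult_left_mono) auto
          moreover have "3 * \<theta> \<le> \<gamma> / 2 * \<delta>" using g d by (simp add: \<theta>_def)
          ultimately show ?thesis by linarith
        qed
        ultimately show ?thesis using conv[OF x(2)] by linarith
      next
        case False
        then have xB: "B \<le> x" "6 * B / \<gamma> + 2 * x0 \<le> x" by (auto simp: B1_def)
        then have xx: "x0 \<le> x" using x0 B g by (auto intro: order_trans[of _ "6 * B / \<gamma> +
            2 * x0"] simp: add_increasing)
        have "4 * x * ((\<Sum>i\<in>{1..n}. indicator {B<..} (obs n \<omega> i)) / n) \<le> 4 * x * (\<gamma> / 16)"
          using Es(2)[OF w] x by (intro mult_left_mono) auto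
        then have lo: "x - 3/2 * B - x * \<gamma> / 4 \<le> He n \<omega> x" using He_far_lower[OF n B(1) xB(1), of \<omega>]
            by (simp only: times_divide_eq_right)
        have up: "He n \<omega> x0 \<le> x0" using He_le[OF n] x0 by simp
        have "(cen n + \<gamma> / 2) * (x - x0) \<le> (1 - \<gamma> / 2) * (x - x0)" using cen1 xx by (intro mult_right_mono) auto
        then have "cen n * (x - x0) + \<gamma> / 2 * (x - x0) \<le> x - x0 - (\<gamma> * x / 2 - \<gamma> * x0 / 2)"
            by (simp add: field_simps)
        moreover have "3/2 * B + \<gamma> * x0 / 2 \<le> x * \<gamma> / 4"
        proof -
          have "\<gamma> * (6 * B / \<gamma> + 2 * x0) \<le> \<gamma> * x" using xB(2) g by (intro mult_left_mono) auto
          moreover have "\<gamma> * (6 * B / \<gamma> + 2 * x0) = 6 * B + 2 * (\<gamma> * x0)" using g by (simp add: distrib_left)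
          ultimately show ?thesis by (simp add: mult.commute)
        qed
        moreover have abs: "\<bar>x - x0\<bar> = x - x0" using xx by simp
        ultimately show ?thesis using lo up unfolding abs mult.commute[of x \<gamma>] by linarith
      qed
      then show ?case using E(1) Ep by (intro bexI[of _ E]) (auto simp: \<gamma>_def)
    qed
  qed (rule d0)
qed

end

section \<open>Localization and weak convergence\<close>

context centred_array begin

text \<open>
  The line with slope \<open>cen n + eps n * Q n \<omega>\<close> almost supports \<open>He\<close> at \<open>x0\<close>. For \<open>\<bar>t\<bar> \<le> K\<close> both the
  noise and the drift are under control up to \<open>\<eta>\<close>, and the drift is nonnegative. For
  \<open>K \<le> \<bar>t\<bar> \<le> \<delta> / eps n\<close> the drift is at least \<open>3/8 * fx * t\<^sup>2 - Cq\<close> and exceeds the noise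
  \<open>fx / 8 * t\<^sup>2\<close> and the linear term \<open>L * \<bar>t\<bar>\<close> once \<open>K\<close> is large. At distances above \<open>\<delta>\<close> the
  linear growth of \<open>He_linear_growth\<close> exceeds \<open>eps n * L\<close>.
\<close>

lemma He_support_line:
  assumes \<eta>: "0 < \<eta>" and p: "0 < p" and \<kappa>: "0 < \<kappa>"
  shows "\<forall>\<^sub>F n in sequentially. \<exists>E\<in>events. prob E \<le> p \<and> (\<forall>\<omega>\<in>space M - E.
    (\<forall>x\<ge>0. He n \<omega> x0 - 2 * \<eta> * (eps n)\<^sup>2 + (cen n + eps n * Q n \<omega>) * (x - x0) \<le> He n \<omega> x) \<and>
    (\<forall>t. \<bar>t\<bar> \<le> \<kappa> \<longrightarrow> He n \<omega> (x0 + eps n * t) \<le>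
       He n \<omega> x0 + (cen n + eps n * Q n \<omega>) * (eps n * t) + (2 * \<eta> + 1/2 * t\<^sup>2 * fx) * (eps n)\<^sup>2))"
proof -
  have p4: "0 < p / 4" using p by simp
  obtain L where L: "0 < L" and evL: "\<forall>\<^sub>F n in sequentially. holds_up_to (p / 4) (\<lambda>\<omega>. \<bar>Q n \<omega>\<bar> \<le> L)"
    using Q_tight[OF p4] by blast
  have f8: "0 < fx / 8" using f_pos by simp
  obtain \<delta>q Cq where q: "\<delta>q > 0" "Cq \<ge> 0" and evq: "\<forall>\<^sub>F n in sequentially. \<forall>\<beta>. \<bar>\<beta>\<bar> < \<delta>q \<longrightarrow>
    \<bar>H n (x0 + \<beta>) - H n x0 - \<beta> * cen n - 1/2 * \<beta>\<^sup>2 * fx\<bar> \<le> fx / 8 * \<beta>\<^sup>2 + Cq * (eps n)\<^sup>2"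
    using quadratic_bound[OF f8] by blast
  obtain \<delta>m where dm: "\<delta>m > 0" "\<delta>m \<le> x0 / 2" and evm: "\<And>c p. 0 < c \<Longrightarrow> 0 < p \<Longrightarrow>
      \<exists>K0\<ge>1. \<forall>K\<ge>K0. \<forall>\<^sub>F n in sequentially. holds_up_to p (\<lambda>\<omega>. \<forall>t. K \<le> \<bar>t\<bar> \<longrightarrow> \<bar>t\<bar> * eps n \<le> \<delta>m \<longrightarrow>
      \<bar>D n t \<omega>\<bar> \<le> c * t\<^sup>2)"
    using D_below_quadratic by blast
  obtain K0 where K0: "K0 \<ge> 1" and evK: "\<And>K. K \<ge> K0 \<Longrightarrow> \<forall>\<^sub>F n in sequentially. holds_up_to (p / 4) (\<lambda>\<omega>. \<forall>t. K \<le>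
      \<bar>t\<bar> \<longrightarrow> \<bar>t\<bar> * eps n \<le> \<delta>m \<longrightarrow> \<bar>D n t \<omega>\<bar> \<le> fx / 8 * t\<^sup>2)"
    using evm[OF f8 p4] by blast
  obtain \<delta>f where df: "\<delta>f > 0" and evf: "\<And>\<delta> p. 0 < \<delta> \<Longrightarrow> \<delta> < \<delta>f \<Longrightarrow> 0 < p \<Longrightarrow>
      \<forall>\<^sub>F n in sequentially. holds_up_to p (\<lambda>\<omega>. \<forall>x\<ge>0. \<delta> \<le> \<bar>x - x0\<bar> \<longrightarrow>
      He n \<omega> x0 + cen n * (x - x0) + fx / 8 * \<delta> * \<bar>x - x0\<bar> \<le> He n \<omega> x)"
    using He_linear_growth by blast
  define \<delta> where "\<delta> = min \<delta>m (min (\<delta>q / 2) (\<delta>f / 2))"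
  have d: "0 < \<delta>" "\<delta> \<le> \<delta>m" "\<delta> < \<delta>q" "\<delta> < \<delta>f" using dm q df by (auto simp: \<delta>_def)
  (* Beyond the last of these bounds fx / 4 * t\<^sup>2 exceeds both Cq and the linear term. *)
  define K where "K = max (max K0 \<kappa>) (4 * (Cq + L) / fx)"
  have K: "K0 \<le> K" "\<kappa> \<le> K" "4 * (Cq + L) / fx \<le> K" "1 \<le> K" using K0 by (auto simp: K_def)
  have evl: "\<forall>\<^sub>F n in sequentially. holds_up_to (p / 4) (\<lambda>\<omega>. \<forall>t. \<bar>t\<bar> \<le> K \<longrightarrow> \<bar>D n t \<omega> - t * Q n \<omega>\<bar> \<le> \<eta>)"
    by (rule D_close_to_linear[OF K(4) \<eta> p4])
  have evb: "\<forall>\<^sub>F n in sequentially. \<forall>t\<in>{-K..K}. \<bar>(H n (x0 + eps n * t) - H n x0 - cen n * eps n * t) / (eps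
      n)\<^sup>2 - 1/2 * t\<^sup>2 * fx\<bar> < \<eta>"
    using b'[of "{-K..K}"] \<eta> by (auto simp: uniform_limit_iff dist_real_def)
  show ?thesis using evL evq evK[OF K(1)] evf[OF d(1,4) p4] evl evb eventually_ge_at_top[of 2]
    eventually_eps_mult_less[OF x0, of K] eventually_eps_mult_less[of "fx / 8 * \<delta>" L, OF mult_pos_pos[OF f8
        d(1)]]
  proof eventually_elim
    case (elim n)
    have n: "n \<ge> 1" "0 < eps n" using elim eps_pos[of n] by auto
    from holds_up_to_conj[OF elim(1) holds_up_to_conj[OF elim(3) holds_up_to_conj[OF elim(4) elim(5)]]]
    obtain E where E: "E \<in> events" "prob E \<le> p / 4 + (p / 4 + (p / 4 + p / 4))"
      and Es: "\<And>\<omega>. \<omega> \<in> space M - E \<Longrightarrow> \<bar>Q n \<omega>\<bar> \<le> L"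
       "\<And>\<omega> t. \<omega> \<in> space M - E \<Longrightarrow> K \<le> \<bar>t\<bar> \<Longrightarrow> \<bar>t\<bar> * eps n \<le> \<delta>m \<Longrightarrow> \<bar>D n t \<omega>\<bar> \<le> fx / 8 * t\<^sup>2"
       "\<And>\<omega> x. \<omega> \<in> space M - E \<Longrightarrow> 0 \<le> x \<Longrightarrow> \<delta> \<le> \<bar>x - x0\<bar> \<Longrightarrow> He n \<omega> x0 + cen n * (x - x0) +
           fx / 8 * \<delta> * \<bar>x - x0\<bar> \<le> He n \<omega> x"
       "\<And>\<omega> t. \<omega> \<in> space M - E \<Longrightarrow> \<bar>t\<bar> \<le> K \<Longrightarrow> \<bar>D n t \<omega> - t * Q n \<omega>\<bar> \<le> \<eta>" by blast
    define Bt where "Bt t = (H n (x0 + eps n * t) - H n x0 - cen n * eps n * t) / (eps n)\<^sup>2" for t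
    have loc: "He n \<omega> (x0 + eps n * t) = He n \<omega> x0 + cen n * (eps n * t) + (D n t \<omega> +
        Bt t) * (eps n)\<^sup>2" if t: "0 \<le> x0 + eps n * t" for \<omega> t
    proof -
      have "emp n (incr n t) \<omega> = emp n (\<lambda>y. ikern y (x0 + eps n * t)) \<omega> - emp n (\<lambda>y. ikern y x0) \<omega>"
        unfolding incr_def
        by (rule emp_diff[OF n(1)]; rule integrable_mu[OF n(1) borel_measurable_ikern abs_ikern_le]) (use t x0
            in auto)
      moreover have "D n t \<omega> * (eps n)\<^sup>2 = emp n (incr n t) \<omega>" using n by (simp add: D_def)
      moreover have "Bt t * (eps n)\<^sup>2 = H n (x0 + eps n * t) - H n x0 - cen n * (eps n * t)" using n
          by (simp add: Bt_def)
      ultimately show ?thesis using He_eq[OF n(1) t, of \<omega>] He_eq[OF n(1), of x0 \<omega>] x0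
          unfolding distrib_right by linarith
    qed
    have Bloc: "\<bar>Bt t - 1/2 * t\<^sup>2 * fx\<bar> \<le> \<eta>" if "\<bar>t\<bar> \<le> K" for t
      using elim(6)[rule_format, of t] that by (force simp: Bt_def abs_le_iff)
    have pos: "0 \<le> x0 + eps n * t" if "\<bar>t\<bar> \<le> K" for t
    proof -
      have "\<bar>eps n * t\<bar> \<le> eps n * K" unfolding abs_mult using that n by (simp add: mult_left_mono)
      then show ?thesis using elim(8) by linarith
    qed
    have line: "(cen n + eps n * Q n \<omega>) * (eps n * t) = cen n * (eps n * t) + (t * Q n \<omega>) * (eps n)\<^sup>2" for \<omega> t
      by (simp add: power2_eq_square algebra_simps)
    have lower: "He n \<omega> x0 - 2 * \<eta> * (eps n)\<^sup>2 + (cen n + eps n * Q n \<omega>) * (x - x0) \<le> He n \<omega> x"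
      if w: "\<omega> \<in> space M - E" and x: "0 \<le> x" for \<omega> x
    proof -
      define t where "t = (x - x0) / eps n"
      have xt: "x = x0 + eps n * t" using n by (simp add: t_def)
      have pt: "0 \<le> x0 + eps n * t" using x xt by simp
      have near: ?thesis if "t * Q n \<omega> - 2 * \<eta> \<le> D n t \<omega> + Bt t"
      proof -
        have "(t * Q n \<omega> - 2 * \<eta>) * (eps n)\<^sup>2 \<le> (D n t \<omega> + Bt t) * (eps n)\<^sup>2" using that
            by (intro mult_right_mono) auto
        then show ?thesis unfolding xt loc[OF pt] using line[of \<omega> t] by (simp add: left_diff_distrib)
      qed
      consider "\<bar>t\<bar> \<le> K" | "K \<le> \<bar>t\<bar>" "\<bar>t\<bar> * eps n \<le> \<delta>" | "\<delta> \<le> \<bar>t\<bar> * eps n" by linarith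
      then show ?thesis
      proof cases
        case 1
        have "0 \<le> 1/2 * t\<^sup>2 * fx" using f_pos by simp
        then show ?thesis using Bloc[OF 1] Es(4)[OF w 1] by (intro near) linarith
      next
        case 2
        have "\<bar>eps n * t\<bar> < \<delta>q" unfolding abs_mult using 2 d n by (simp add: mult.commute)
        then have "\<bar>H n (x0 + eps n * t) - H n x0 - eps n * t * cen n - 1/2 * (eps n * t)\<^sup>2 * fx\<bar> \<le>
            fx / 8 * (eps n * t)\<^sup>2 + Cq * (eps n)\<^sup>2"
          using elim(2) by blast
        moreover have "H n (x0 + eps n * t) - H n x0 - eps n * t * cen n = Bt t * (eps n)\<^sup>2" using n
            by (simp add: Bt_def mult_ac)
        ultimately have "(3/8 * fx * t\<^sup>2 - Cq) * (eps n)\<^sup>2 \<le> Bt t * (eps n)\<^sup>2"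
            by (simp add: abs_le_iff power_mult_distrib algebra_simps)
        then have B: "3/8 * fx * t\<^sup>2 - Cq \<le> Bt t" using n by simp
        have Dm: "\<bar>D n t \<omega>\<bar> \<le> fx / 8 * t\<^sup>2" using Es(2)[OF w 2(1)] 2 d by linarith
        have "\<bar>t * Q n \<omega>\<bar> \<le> \<bar>t\<bar> * L" unfolding abs_mult using Es(1)[OF w] by (intro mult_left_mono) auto
        moreover have "Cq + \<bar>t\<bar> * L \<le> fx / 4 * t\<^sup>2"
        proof -
          have "Cq \<le> \<bar>t\<bar> * Cq" using 2 K q mult_right_mono[of 1 "\<bar>t\<bar>" Cq] by simp
          then have "Cq + \<bar>t\<bar> * L \<le> \<bar>t\<bar> * (Cq + L)" by (simp add: algebra_simps)
          also have "\<dots> \<le> \<bar>t\<bar> * (fx / 4 * \<bar>t\<bar>)"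
          proof (intro mult_left_mono)
            have "4 * (Cq + L) / fx \<le> \<bar>t\<bar>" using K 2 by linarith
            then show "Cq + L \<le> fx / 4 * \<bar>t\<bar>" using f_pos by (simp add: pos_divide_le_eq mult.commute)
          qed simp
          also have "\<dots> = fx / 4 * t\<^sup>2" by (simp add: power2_eq_square abs_mult[symmetric] mult.left_commute)
          finally show ?thesis .
        qed
        moreover have "3/8 * fx * t\<^sup>2 = fx / 4 * t\<^sup>2 + fx / 8 * t\<^sup>2" by (simp add: algebra_simps)
        ultimately show ?thesis using B Dm \<eta> by (intro near) linarith
      next
        case 3
        have "\<delta> \<le> \<bar>x - x0\<bar>" using 3 n by (simp add: xt abs_mult mult.commute)
        note far = Es(3)[OF w x this]
        have "eps n * \<bar>Q n \<omega>\<bar> \<le> eps n * L" using Es(1)[OF w] n by (intro mult_left_mono) auto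
        then have "\<bar>eps n * Q n \<omega>\<bar> \<le> fx / 8 * \<delta>" using elim(9) abs_mult[of "eps n" "Q n \<omega>"] n by linarith
        then have "\<bar>eps n * Q n \<omega> * (x - x0)\<bar> \<le> fx / 8 * \<delta> * \<bar>x - x0\<bar>"
            unfolding abs_mult[of "eps n * Q n \<omega>"] by (intro mult_right_mono) auto
        moreover have "0 \<le> 2 * \<eta> * (eps n)\<^sup>2" using \<eta> by simp
        ultimately show ?thesis using far unfolding distrib_right by linarith
      qed
    qed
    have upper: "He n \<omega> (x0 + eps n * t) \<le> He n \<omega> x0 + (cen n + eps n * Q n \<omega>) * (eps n * t) + (2 * \<eta> +
        1/2 * t\<^sup>2 * fx) * (eps n)\<^sup>2"
      if w: "\<omega> \<in> space M - E" and t: "\<bar>t\<bar> \<le> \<kappa>" for \<omega> t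
    proof -
      have tK: "\<bar>t\<bar> \<le> K" using t K by simp
      have "D n t \<omega> + Bt t \<le> t * Q n \<omega> + (2 * \<eta> + 1/2 * t\<^sup>2 * fx)" using Bloc[OF tK] Es(4)[OF w tK] by linarith
      then have "(D n t \<omega> + Bt t) * (eps n)\<^sup>2 \<le> (t * Q n \<omega> + (2 * \<eta> + 1/2 * t\<^sup>2 * fx)) * (eps n)\<^sup>2"
          by (intro mult_right_mono) auto
      then have "(D n t \<omega> + Bt t) * (eps n)\<^sup>2 \<le> (t * Q n \<omega>) * (eps n)\<^sup>2 + (2 * \<eta> + 1/2 * t\<^sup>2 * fx) * (eps n)\<^sup>2"
        by (simp only: distrib_right[of "t * Q n \<omega>"])
      then show ?thesis unfolding loc[OF pos[OF tK]] line by linarith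
    qed
    show ?case using E lower upper by (intro bexI[of _ E]) auto
  qed
qed

definition "scaled_error n \<omega> = (F_check n (obs n \<omega>) x0 - cen n) / eps n"

text \<open>
  \<open>right_deriv_gcm_localized\<close> at distance \<open>eps n * \<kappa>\<close>. The drift makes the gap between \<open>He\<close> and
  the line of order \<open>\<kappa>\<^sup>2 * (eps n)\<^sup>2\<close>, hence the error in the slope of order \<open>\<kappa> * eps n\<close>;
  therefore \<open>\<kappa>\<close> is chosen small first, and \<open>\<eta>\<close> small compared with \<open>\<kappa>\<close>.
\<close>

lemma scaled_error_close_Q:
  assumes d: "0 < d" and p: "0 < p"
  shows "\<forall>\<^sub>F n in sequentially. holds_up_to p (\<lambda>\<omega>. \<bar>scaled_error n \<omega> - Q n \<omega>\<bar> \<le> d)"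
proof -
  (* These values make the bound of right_deriv_gcm_localized equal to d * eps n. *)
  define \<kappa> where "\<kappa> = d / (2 * fx)"
  define \<eta> where "\<eta> = \<kappa> * d / 8"
  have k: "0 < \<kappa>" "0 < \<eta>" using d f_pos by (auto simp: \<kappa>_def \<eta>_def)
  show ?thesis using He_support_line[OF k(2) p k(1)] eventually_ge_at_top[of 2] eventually_eps_mult_less[OF x0,
      of \<kappa>]
  proof eventually_elim
    case (elim n)
    have n: "0 < eps n" using eps_pos elim by simp
    from elim(1) obtain E where E: "E \<in> events" "prob E \<le> p" and
      lower: "\<And>\<omega> x. \<omega> \<in> space M - E \<Longrightarrow> 0 \<le> x \<Longrightarrow> He n \<omega> x0 - 2 * \<eta> * (eps n)\<^sup>2 + (cen n +
          eps n * Q n \<omega>) * (x - x0) \<le> He n \<omega> x" and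
      upper: "\<And>\<omega> t. \<omega> \<in> space M - E \<Longrightarrow> \<bar>t\<bar> \<le> \<kappa> \<Longrightarrow> He n \<omega> (x0 + eps n * t) \<le>
       He n \<omega> x0 + (cen n + eps n * Q n \<omega>) * (eps n * t) + (2 * \<eta> + 1/2 * t\<^sup>2 * fx) * (eps n)\<^sup>2" by blast
    have "\<bar>scaled_error n \<omega> - Q n \<omega>\<bar> \<le> d" if w: "\<omega> \<in> space M - E" for \<omega>
    proof -
      define s where "s = cen n + eps n * Q n \<omega>"
      define \<zeta> where "\<zeta> = (2 * \<eta> + 1/2 * \<kappa>\<^sup>2 * fx) * (eps n)\<^sup>2"
      have "\<bar>right_deriv (gcm {0..} (He n \<omega>)) x0 - s\<bar> \<le> 2 * \<zeta> / (eps n * \<kappa>)"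
      proof (rule right_deriv_gcm_localized[OF x0])
        show "0 < eps n * \<kappa>" "eps n * \<kappa> \<le> x0" using n k elim(3) by auto
        fix y :: real assume "0 \<le> y"
        have "2 * \<eta> * (eps n)\<^sup>2 \<le> \<zeta>" unfolding \<zeta>_def using f_pos by (intro mult_right_mono) auto
        then show "He n \<omega> x0 - \<zeta> + s * (y - x0) \<le> He n \<omega> y" using lower[OF w \<open>0 \<le> y\<close>] by (simp add: s_def)
      next
        show "He n \<omega> (x0 + eps n * \<kappa>) \<le> He n \<omega> x0 + s * (eps n * \<kappa>) + \<zeta>"
          using upper[OF w, of \<kappa>] k by (simp add: s_def \<zeta>_def)
        show "He n \<omega> (x0 - eps n * \<kappa>) \<le> He n \<omega> x0 - s * (eps n * \<kappa>) + \<zeta>"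
          using upper[OF w, of "- \<kappa>"] k by (simp add: s_def \<zeta>_def)
      qed
      also have "2 * \<zeta> / (eps n * \<kappa>) = d * eps n"
      proof -
        have "2 * \<eta> + 1/2 * \<kappa>\<^sup>2 * fx = \<kappa> * d / 2" using f_pos
            by (simp add: \<eta>_def \<kappa>_def power2_eq_square field_simps)
        then have "\<zeta> = \<kappa> * d / 2 * (eps n)\<^sup>2" by (simp add: \<zeta>_def)
        then show ?thesis using n k unfolding power2_eq_square by (simp only:) (simp add: field_simps)
      qed
      finally have "\<bar>F_check n (obs n \<omega>) x0 - s\<bar> \<le> d * eps n" by (simp add: F_check_def)
      moreover have "scaled_error n \<omega> - Q n \<omega> = (F_check n (obs n \<omega>) x0 - s) / eps n" using n
          by (simp add: scaled_error_def s_def field_simps)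
      ultimately show ?thesis using n by (simp add: abs_divide pos_divide_le_eq)
    qed
    with E show ?case by (intro bexI[of _ E]) auto
  qed
qed

lemma scaled_error_measurable: "scaled_error n \<in> borel_measurable M"
proof (cases "n \<ge> 1")
  case True
  have "(\<lambda>\<omega>. right_deriv (gcm {0..} (He n \<omega>)) x0) \<in> borel_measurable M"
  proof (rule measurable_right_deriv_gcm[OF x0, where c = "- 3"])
    show "continuous_on {0..} (He n \<omega>)" for \<omega>
    proof -
      have "continuous_on {0..} (\<lambda>x. (\<Sum>i\<in>{1..n}. ikern (obs n \<omega> i) x) / n)"
        using continuous_on_ikern True by (intro continuous_intros) auto
      then show ?thesis using He_sum[OF True] by (subst continuous_on_cong[OF refl]) auto
    qed
    show "- 3 * y \<le> He n \<omega> y" if "0 \<le> y" for \<omega> y by (rule He_lower[OF True that])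
    show "(\<lambda>\<omega>. He n \<omega> y) \<in> borel_measurable M" if "0 \<le> y" for y
      using measurable_compose[OF obs_measurable[OF True] borel_measurable_ikern[OF that]]
          unfolding He_sum[OF True that]
      by (intro borel_measurable_divide borel_measurable_sum) auto
  qed
  then show ?thesis unfolding scaled_error_def F_check_def by simp
next
  case False
  then have "scaled_error n = (\<lambda>_. 0)" by (auto simp: scaled_error_def eps_def)
  then show ?thesis by simp
qed

theorem scaled_error_weakly_converges:
  assumes N: "prob_space N" and W: "distributed N lborel W (\<lambda>w. ennreal (normal_density 0 (sqrt (2 / pi\<^sup>2 * x0
      * gx)) w))"
  shows "weak_conv_m (\<lambda>n. distr M borel (scaled_error n)) (distr N borel W)"
proof (rule levy_continuity)
  have Wm: "W \<in> borel_measurable N" using distributed_measurable[OF W] by simp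
  show "real_distribution (distr M borel (scaled_error n))" for n
      by (rule real_distribution_distr[OF scaled_error_measurable])
  show "real_distribution (distr N borel W)" using prob_space.real_distribution_distr[OF N Wm] .
  have Qm: "Q n \<in> borel_measurable M" for n
  proof (cases "n \<ge> 1")
    case False
    then have "Q n = (\<lambda>_. 0)" by (auto simp: Q_def eps_def)
    then show ?thesis by simp
  qed (rule Q_measurable)
  fix t
  have close: "(\<lambda>n. prob {\<omega> \<in> space M. \<bar>scaled_error n \<omega> - Q n \<omega>\<bar> > d}) \<longlonglongrightarrow> 0" if d: "0 < d" for d
  proof (rule LIMSEQ_I)
    fix e :: real assume e: "0 < e"
    have "\<forall>\<^sub>F n in sequentially. norm (prob {\<omega> \<in> space M. \<bar>scaled_error n \<omega> - Q n \<omega>\<bar> > d} - 0) < e"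
      using scaled_error_close_Q[OF d half_gt_zero[OF e]]
    proof eventually_elim
      case (elim n)
      then obtain E where E: "E \<in> events" "prob E \<le> e / 2" "\<forall>\<omega>\<in>space M - E. \<bar>scaled_error n \<omega> - Q n \<omega>\<bar> \<le> d"
          by auto
      have "prob {\<omega> \<in> space M. \<bar>scaled_error n \<omega> - Q n \<omega>\<bar> > d} \<le> prob E"
        using E by (intro finite_measure_mono) (auto simp: not_le[symmetric])
      then show ?case using E(2) e by simp
    qed
    then show "\<exists>no. \<forall>n\<ge>no. norm (prob {\<omega> \<in> space M. \<bar>scaled_error n \<omega> - Q n \<omega>\<bar> > d} - 0) < e"
        by (simp add: eventually_sequentially)
  qed
  have s: "0 < 2 / pi\<^sup>2 * x0 * gx" using x0 g_pos by simp
  have "char (distr N borel W) t = complex_of_real (exp (- (t\<^sup>2 * (2 / pi\<^sup>2 * x0 * gx) / 2)))"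
    using char_normal_distribution[OF N W] s by simp
  with tendsto_add[OF char_diff_tendsto_0[OF scaled_error_measurable Qm close, of t] char_Q_tendsto[of t]]
  show "(\<lambda>n. char (distr M borel (scaled_error n)) t) \<longlonglongrightarrow> char (distr N borel W) t" by simp
qed

end

theorem corollary2p2:
  fixes P :: "'p measure" and X :: "'p \<Rightarrow> real ^ 3" and \<rho> :: "real \<Rightarrow> real"
    and G f g :: "real \<Rightarrow> real"
    and Gn :: "nat \<Rightarrow> real \<Rightarrow> real"
    and M :: "'m measure" and T :: "nat \<Rightarrow> 'm \<Rightarrow> real" and Y :: "nat \<Rightarrow> 'm \<Rightarrow> nat \<Rightarrow> real"
    and N :: "'w measure" and W :: "'w \<Rightarrow> real"
    and x0 :: real and Fhat :: "nat \<Rightarrow> real \<Rightarrow> real" and \<Lambda> :: "nat \<Rightarrow> 'm \<Rightarrow> real"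
  assumes "prob_space P"
    and rho_nonneg: "\<And>z. z \<ge> 0 \<Longrightarrow> \<rho> z \<ge> 0"
    and X: "distributed P lborel X (\<lambda>x. ennreal (\<rho> ((x $ 1)\<^sup>2 + (x $ 2)\<^sup>2 + (x $ 3)\<^sup>2)))"
    and G: "G = cdf (distr P borel (\<lambda>\<omega>. (X \<omega> $ 1)\<^sup>2 + (X \<omega> $ 2)\<^sup>2))"
    and g: "g = proj_density \<rho>" and f: "f = radial_density \<rho>"
    and Gn: "\<And>n. n \<ge> 1 \<Longrightarrow> is_df_nonneg (Gn n)"
    and "prob_space M"
    and T_indep: "prob_space.indep_vars M (\<lambda>_. borel) T {1..}"
    and T_unif: "\<And>i. i \<ge> 1 \<Longrightarrow> distr M borel (T i) = uniform_measure lborel {0<..<1}"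
    and Y: "\<And>n \<omega> i. Y n \<omega> i = quantile (Gn n) (T i \<omega>)"
    and x0: "x0 > 0" and g_pos: "g x0 > 0" and f_pos: "f x0 > 0"
    and Fhat: "Fhat = (\<lambda>n. F_of (Gn n)) \<or> Fhat = (\<lambda>n. F_tilde (Gn n))"
    and a: "(\<lambda>n. SUP t. \<bar>Gn n t - G t\<bar>) \<in> O(eps)"
    and b': "\<And>K. compact K \<Longrightarrow>
      uniform_limit K
        (\<lambda>n t. (H_of (Gn n) (x0 + eps n * t) - H_of (Gn n) x0 - Fhat n x0 * eps n * t) / (eps n)\<^sup>2)
        (\<lambda>t. 1/2 * t\<^sup>2 * f x0) sequentially"
    and c': "\<And>e. e > 0 \<Longrightarrow>
      \<exists>\<delta>>0. \<exists>r \<in> o[at 0](\<lambda>\<beta>::real. \<beta>\<^sup>2). \<exists>s \<in> O(\<lambda>n. (eps n)\<^sup>2).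
        \<forall>\<^sub>F n in sequentially. \<forall>\<beta>. \<bar>\<beta>\<bar> < \<delta> \<longrightarrow>
          \<bar>H_of (Gn n) (x0 + \<beta>) - H_of (Gn n) x0 - \<beta> * Fhat n x0 - 1/2 * \<beta>\<^sup>2 * f x0\<bar>
            \<le> e * \<beta>\<^sup>2 + r \<beta> + s n"
    and Lambda: "\<And>n \<omega>. \<Lambda> n \<omega> = (F_check n (Y n \<omega>) x0 - Fhat n x0) / eps n"
    and "prob_space N"
    and W: "distributed N lborel W
      (\<lambda>w. ennreal (normal_density 0 (sqrt (2 / pi\<^sup>2 * x0 * g x0)) w))"
  shows "(\<forall>n\<ge>1. \<Lambda> n \<in> borel_measurable M)
    \<and> weak_conv_m (\<lambda>n. distr M borel (\<Lambda> n)) (distr N borel W)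
    \<and> distr N borel W
        = distr N borel (\<lambda>\<omega>. right_deriv (gcm UNIV (\<lambda>t. t * W \<omega> + 1/2 * t\<^sup>2 * f x0)) 0)"
proof -
  have fx0: "0 \<le> f x0" using f_pos by simp
  interpret sp: spherical P X \<rho>
    by (rule spherical.intro[OF assms(1) rho_nonneg X])
  have G': "sp.GY = G" unfolding sp.GY_def sp.Y2_def G ..
  interpret uniform_array M T Gn
    using assms(8) Gn T_indep T_unif by (intro uniform_array.intro uniform_array_axioms.intro)
  interpret centred_array P X \<rho> M T Gn x0 "\<lambda>n. Fhat n x0"
    by unfold_locales (use x0 g_pos f_pos a b' c' in \<open>simp_all add: g f G'\<close>)
  have YY: "Y n \<omega> = obs n \<omega>" for n \<omega> by (rule ext) (simp add: Y obs_def)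
  have L: "\<Lambda> = scaled_error" by (intro ext) (simp add: Lambda scaled_error_def YY)
  have "weak_conv_m (\<lambda>n. distr M borel (\<Lambda> n)) (distr N borel W)"
    unfolding L by (rule scaled_error_weakly_converges[OF \<open>prob_space N\<close>]) (use W in \<open>simp add: g\<close>)
  moreover have "distr N borel W = distr N borel (\<lambda>\<omega>. right_deriv (gcm UNIV (\<lambda>t. t * W \<omega> +
      1/2 * t\<^sup>2 * f x0)) 0)"
    by (simp only: right_deriv_gcm_quadratic[OF fx0])
  ultimately show ?thesis using scaled_error_measurable by (simp add: L)
qed

end
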